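(* Let $p$ be a prime, $c>1$ a constant, $\alpha_n=\frac{c\log n}{n}$, and for each $n$ with $\alpha_n\le 1/2$ let $\beta_n\in[\alpha_n,1-\alpha_n]$ and let $\Gamma(n)\in G(n,\beta_n)$ be an Erdős–Rényi random graph. Then for every finite abelian $p$-group $H$, $\lim_{n\to\infty}\mathbb{P}(S_{\Gamma(n),p}\cong H)=\frac{\#\{\text{symmetric, bilinear, perfect }\phi:H\times H\to\mathbb{C}^*\}}{|H|\,|\mathrm{Aut}(H)|}\prod_{i=1}^{\infty}(1-p^{1-2i})$.
   Context: $G(n,q)$ denotes the Erdős–Rényi random graph on $n$ vertices in which each edge is included independently with probability $q$. For a graph $\Gamma$, $S_\Gamma$ is its sandpile group (Jacobian), i.e. the cokernel of its reduced Laplacian (finite iff $\Gamma$ is connected), and $S_{\Gamma,p}$ is the Sylow $p$-subgroup of $S_\Gamma$ (its subgroup of elements of $p$-power order). *)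

theory Defs
  imports
    "HOL-Algebra.Algebra"
    "HOL-Analysis.Analysis"
    "HOL-Probability.Probability"
    "Jordan_Normal_Form.Matrix"
    "Jordan_Normal_Form.Determinant"
begin

text \<open>A simple graph on the vertex set \<open>{0..<n}\<close> is given by \<open>n\<close> together with its edge set,
  a set of two-element subsets of \<open>{0..<n}\<close>.\<close>

definition vertex_pairs :: "nat \<Rightarrow> nat set set" where
  "vertex_pairs n = {e. e \<subseteq> {0..<n} \<and> card e = 2}"

definition erdos_renyi :: "nat \<Rightarrow> real \<Rightarrow> nat set set pmf" where
  "erdos_renyi n q =
     map_pmf (\<lambda>present. {e \<in> vertex_pairs n. present e})
       (Pi_pmf (vertex_pairs n) False (\<lambda>_. bernoulli_pmf q))"

definition vertex_degree :: "nat set set \<Rightarrow> nat \<Rightarrow> nat" where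
  "vertex_degree E v = card {e \<in> E. v \<in> e}"

definition laplacian :: "nat \<Rightarrow> nat set set \<Rightarrow> int mat" where
  "laplacian n E = mat n n (\<lambda>(i, j).
     if i = j then int (vertex_degree E i) else if {i, j} \<in> E then - 1 else 0)"

text \<open>The row and column of vertex \<open>0\<close> are deleted. The cokernel is, up to isomorphism,
  independent of the deleted vertex, also for disconnected graphs.\<close>

definition reduced_laplacian :: "nat \<Rightarrow> nat set set \<Rightarrow> int mat" where
  "reduced_laplacian n E = mat_delete (laplacian n E) 0 0"

definition cokernel :: "int mat \<Rightarrow> int vec set monoid" where
  "cokernel A =
     monoid_vec TYPE(int) (dim_row A) Mod ((\<lambda>x. A *\<^sub>v x) ` carrier_vec (dim_col A))"

definition sandpile_group :: "nat \<Rightarrow> nat set set \<Rightarrow> int vec set monoid" where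
  "sandpile_group n E = cokernel (reduced_laplacian n E)"

text \<open>Elements of infinite order have \<open>ord = 0\<close>, so they are excluded for \<open>p > 0\<close>.\<close>

definition sylow_part :: "nat \<Rightarrow> ('a, 'b) monoid_scheme \<Rightarrow> ('a, 'b) monoid_scheme" where
  "sylow_part p G = G\<lparr>carrier := {x \<in> carrier G. \<exists>k::nat. group.ord G x = p ^ k}\<rparr>"

definition finite_abelian_p_group :: "nat \<Rightarrow> ('a, 'b) monoid_scheme \<Rightarrow> bool" where
  "finite_abelian_p_group p H \<longleftrightarrow>
     comm_group H \<and> finite (carrier H) \<and> (\<exists>k. Coset.order H = p ^ k)"

definition complex_units :: "complex monoid" where
  "complex_units = \<lparr>carrier = UNIV - {0}, monoid.mult = (*), one = 1\<rparr>"

text \<open>Maps out of \<open>H\<close> and \<open>H \<times> H\<close> are taken extensional on the carrier,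
  so that each map is counted exactly once.\<close>

definition dual_group :: "('a, 'b) monoid_scheme \<Rightarrow> ('a \<Rightarrow> complex) monoid" where
  "dual_group H =
     \<lparr>carrier = hom H complex_units \<inter> extensional (carrier H),
      monoid.mult = (\<lambda>f g. \<lambda>x\<in>carrier H. f x * g x),
      one = (\<lambda>x\<in>carrier H. 1)\<rparr>"

definition symmetric_pairing :: "('a, 'b) monoid_scheme \<Rightarrow> ('a \<times> 'a \<Rightarrow> complex) \<Rightarrow> bool" where
  "symmetric_pairing H \<phi> \<longleftrightarrow> (\<forall>x\<in>carrier H. \<forall>y\<in>carrier H. \<phi> (x, y) = \<phi> (y, x))"

definition bilinear_pairing :: "('a, 'b) monoid_scheme \<Rightarrow> ('a \<times> 'a \<Rightarrow> complex) \<Rightarrow> bool" where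
  "bilinear_pairing H \<phi> \<longleftrightarrow>
     (\<forall>x\<in>carrier H. (\<lambda>y. \<phi> (x, y)) \<in> hom H complex_units) \<and>
     (\<forall>y\<in>carrier H. (\<lambda>x. \<phi> (x, y)) \<in> hom H complex_units)"

definition perfect_pairing :: "('a, 'b) monoid_scheme \<Rightarrow> ('a \<times> 'a \<Rightarrow> complex) \<Rightarrow> bool" where
  "perfect_pairing H \<phi> \<longleftrightarrow>
     (\<lambda>x. \<lambda>y\<in>carrier H. \<phi> (x, y)) \<in> iso H (dual_group H) \<and>
     (\<lambda>y. \<lambda>x\<in>carrier H. \<phi> (x, y)) \<in> iso H (dual_group H)"

definition sym_perfect_pairings :: "('a, 'b) monoid_scheme \<Rightarrow> ('a \<times> 'a \<Rightarrow> complex) set" where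
  "sym_perfect_pairings H =
     {\<phi> \<in> carrier H \<times> carrier H \<rightarrow>\<^sub>E carrier complex_units.
        symmetric_pairing H \<phi> \<and> bilinear_pairing H \<phi> \<and> perfect_pairing H \<phi>}"

end

theory Submission
  imports Defs "HOL-Real_Asymp.Real_Asymp"
begin

text \<open>
  The limit law is computed by the method of moments. Fourier analysis on a finite abelian group \<open>G\<close> turns
  the expected number of surjections from the sandpile group onto \<open>G\<close> into a sum over maps from the vertices
  to \<open>G \<times> G\<close> (the second factor standing for the dual), weighted by the exponential of minus an energy. As \<open>c > 1\<close>, only maps whose image is
  a maximal set of mutually orthogonal vectors survive; these sets are the graphs of alternating maps, so the moment
  tends to the number of alternating forms on \<open>G\<close>.

  Alternating Bonferroni sums of the moments of \<open>G \<times> (Z/p)^i\<close> isolate the event that the cokernel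
  modulo \<open>p^k\<close> has rank exactly \<open>r\<close>. On this event finitely many groups remain, and since surjections do not
  increase the order, their probabilities are determined by the moments through a triangular system. Up to a constant,
  the same moments arise from uniformly random symmetric \<open>r \<times> r\<close> matrices modulo \<open>p^k\<close> divisible by \<open>p\<close>: there,
  congruence by the coordinate matrix of a generating tuple reduces every surjection to a standard one, and
  the matrices with a given cokernel are counted by the perfect symmetric pairings on it.

  Finally, a singular reduced Laplacian forces about \<open>p^K\<close> surjections onto \<open>Z/p^K\<close> for all \<open>K\<close>, whereas the
  expected number of these tends to \<open>1\<close>; so the Laplacian is nonsingular with probability tending to one, and then the
  cokernel modulo a high power of \<open>p\<close> is the Sylow part.
\<close>

section \<open>Weighted sums over vertex labellings\<close>

text \<open>The threshold c > 1 enters at one place. By Parseval, a label outside a maximal clique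
  of size g has total distance at least g to it, so in a nearly uniform labelling each stray vertex
  costs a factor close to n^(-c), against n choices of its position. Averaging over an edge gives
  the rate q(1-q) rather than q, hence the symmetric range of \<beta>. The moments of (Z/p)^i grow
  like p^(i(i-1)/2), which makes a direct inversion over all groups delicate. Fixing the rank first
  avoids this: the Bonferroni coefficients have size about p^(-i(i+1)/2), so a series with geometric
  decay remains, and Euler's identities turn its sum into the product in the limit. The number of
  model matrices with a given cokernel is never evaluated in closed form. The number
  \<open>theta\<close> of invertible matrices of a certain shape modulo p occurs both there and in
  the count of perfect pairings, and it cancels.\<close>

lemma sum_PiE_prod_const:
  fixes h :: "'w \<Rightarrow> real"
  assumes "finite W"
  shows "(\<Sum>w\<in>{..<n::nat} \<rightarrow>\<^sub>E W. \<Prod>i<n. h (w i)) = (\<Sum>x\<in>W. h x) ^ n"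
  using prod_sum_PiE[of "{..<n}" "\<lambda>_. W" "\<lambda>_. h"] assms by simp

lemma prod_if_const:
  "(\<Prod>i<n. if P i then z else 1) = (z :: 'a :: comm_monoid_mult) ^ card {i. i < (n::nat) \<and> P i}" using prod.inter_filter[of "{..<n}" "\<lambda>_. z" P] by simp

text \<open>Without the terms in \<open>a\<close> the left side equals \<open>g\<close> at
  \<open>b = 0\<close> and has derivative \<open>- \<delta>\<close> there, so a small
  \<open>b\<close> brings it below \<open>g\<close>; then \<open>a\<close> is taken large and
  finally \<open>\<mu>\<close> small. The expression is the base of the exponential-moment bound for
  labellings that underuse one of \<open>g\<close> labels.\<close>

lemma chernoff_constants:
  fixes \<delta> :: real and g N :: nat
  assumes "0 < \<delta>" "g \<ge> 1" "N \<ge> 1"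
  obtains a b \<mu> :: real where "a > 0" "b > 0" "\<mu> > 0"
    "exp (a * \<mu>) * exp (b * (1 - \<delta>) / g) * (real g - 1 + exp (- b) + N * exp (- a)) < g"
proof -
  define f where "f = (\<lambda>b. exp (b * ((1 - \<delta>) / g)) * (real g - 1 + exp (- b)))"
  have "(f has_real_derivative ((1 - \<delta>) / g) * g - 1) (at 0)" unfolding f_def by (auto intro!: derivative_eq_intros)
  moreover have "((1 - \<delta>) / g) * g - 1 < 0" using assms by simp
  ultimately obtain d where d: "d > 0" "\<And>h. 0 < h \<Longrightarrow> h < d \<Longrightarrow> f (0 + h) < f 0" using DERIV_neg_dec_right[of f _ 0] by blast
  define b where "b = d / 2"
  have b: "b > 0" "f b < g" using d(2)[of b] d(1) by (auto simp: b_def f_def)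
  define E where "E = exp (b * ((1 - \<delta>) / g))"
  have "((\<lambda>a. E * (real g - 1 + exp (- b) + N * exp (- a))) \<longlongrightarrow> E * (real g - 1 + exp (- b) + N * 0)) at_top" by (intro tendsto_intros) real_asymp
  moreover have "E * (real g - 1 + exp (- b) + N * 0) < g" using b by (simp add: f_def E_def)
  ultimately have "eventually (\<lambda>a. E * (real g - 1 + exp (- b) + N * exp (- a)) < g) at_top" by (rule order_tendstoD(2))
  then have "eventually (\<lambda>a. E * (real g - 1 + exp (- b) + N * exp (- a)) < g \<and> a > 0) at_top" using eventually_gt_at_top[of "0::real"] by eventually_elim auto
  then obtain a :: real where a: "E * (real g - 1 + exp (- b) + N * exp (- a)) < g" "a > 0" using eventually_happens'[OF trivial_limit_at_top_linorder] by blast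
  define R where "R = E * (real g - 1 + exp (- b) + N * exp (- a))"
  have R: "0 < R" "R < g"
  proof -
    have "real g - 1 \<ge> 0" "N * exp (- a) \<ge> 0" using assms by auto
    then have "real g - 1 + exp (- b) + N * exp (- a) > 0" using exp_gt_zero[of "- b"] by linarith
    then show "0 < R" by (simp add: R_def E_def)
    show "R < g" using a by (simp add: R_def)
  qed
  \<comment> \<open>Half of the logarithmic gap between \<open>R\<close> and \<open>g\<close>, so
    that \<open>exp (a * \<mu>)\<close> uses up only part of it.\<close>
  define \<mu> where "\<mu> = ln (g / R) / (2 * a)"
  have L: "ln (g / R) > 0" using R by simp
  have "exp (a * \<mu>) * R < exp (ln (g / R)) * R" using R a L by (intro mult_strict_right_mono) (simp_all only: exp_less_cancel_iff, simp_all add: \<mu>_def)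
  also have "\<dots> = g" using R by simp
  finally have "exp (a * \<mu>) * exp (b * (1 - \<delta>) / g) * (real g - 1 + exp (- b) + N * exp (- a)) < g" by (simp add: R_def E_def mult.assoc)
  moreover have "\<mu> > 0" using L a by (simp add: \<mu>_def)
  ultimately show ?thesis using that a b by blast
qed

text \<open>The sum runs over ordered pairs; for symmetric \<open>D\<close> with zero diagonal,
  halving it counts every edge of the complete graph once.\<close>

definition energy :: "('w \<Rightarrow> 'w \<Rightarrow> real) \<Rightarrow> nat \<Rightarrow> (nat \<Rightarrow> 'w) \<Rightarrow> real" where
  "energy D n w = (\<Sum>i<n. \<Sum>j<n. D (w i) (w j)) / 2"

text \<open>\<open>clique_out\<close> is the quantitative core: a label outside a clique of full
  size is on average at distance at least 1 from its \<open>g\<close> members. In the intended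
  instance \<open>clique_energy_kdist\<close> this comes from Parseval.\<close>

locale clique_energy =
  fixes W :: "'w set" and D :: "'w \<Rightarrow> 'w \<Rightarrow> real" and g :: nat
  assumes finite_W: "finite W"
    and g_pos: "g \<ge> 1"
    and g_le: "g \<le> card W"
    and D_nonneg: "\<And>s t. s \<in> W \<Longrightarrow> t \<in> W \<Longrightarrow> 0 \<le> D s t"
    and D_sym: "\<And>s t. s \<in> W \<Longrightarrow> t \<in> W \<Longrightarrow> D s t = D t s"
    and D_diag: "\<And>s. s \<in> W \<Longrightarrow> D s s = 0"
    and clique_card: "\<And>S. S \<subseteq> W \<Longrightarrow> (\<forall>s\<in>S. \<forall>t\<in>S. D s t = 0) \<Longrightarrow> card S \<le> g"
    and clique_out: "\<And>S w. S \<subseteq> W \<Longrightarrow> (\<forall>s\<in>S. \<forall>t\<in>S. D s t = 0) \<Longrightarrow> card S = g \<Longrightarrow>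
      w \<in> W - S \<Longrightarrow> real g \<le> (\<Sum>s\<in>S. D w s)"
begin

definition max_clique :: "'w set \<Rightarrow> bool" where
  "max_clique S \<longleftrightarrow> S \<subseteq> W \<and> (\<forall>s\<in>S. \<forall>t\<in>S. D s t = 0) \<and> card S = g"

text \<open>Cross pairs between disjoint index sets occur in both orders, which compensates the
  factor one half in \<open>energy\<close>.\<close>

lemma energy_ge:
  assumes "w \<in> {..<n} \<rightarrow>\<^sub>E W" "A \<subseteq> {..<n}" "B \<subseteq> {..<n}" "A \<inter> B = {}"
  shows "(\<Sum>i\<in>A. \<Sum>j\<in>B. D (w i) (w j)) \<le> energy D n w"
proof -
  have fin: "finite A" "finite B" using assms finite_subset by blast+
  have w: "w i \<in> W" if "i < n" for i using assms that by auto
  have "2 * (\<Sum>i\<in>A. \<Sum>j\<in>B. D (w i) (w j))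
     = (\<Sum>(i,j)\<in>A\<times>B. D (w i) (w j)) + (\<Sum>(j,i)\<in>B\<times>A. D (w j) (w i))"
  proof -
    have "(\<Sum>i\<in>A. \<Sum>j\<in>B. D (w i) (w j)) = (\<Sum>j\<in>B. \<Sum>i\<in>A. D (w j) (w i))"
      by (subst sum.swap) (intro sum.cong refl D_sym w; use assms in auto)
    then show ?thesis by (simp add: sum.cartesian_product)
  qed
  also have "\<dots> = (\<Sum>(i,j)\<in>A\<times>B \<union> B\<times>A. D (w i) (w j))" by (subst sum.union_disjoint) (use assms fin in auto)
  also have "\<dots> \<le> (\<Sum>(i,j)\<in>{..<n}\<times>{..<n}. D (w i) (w j))" by (intro sum_mono2) (use assms w in \<open>auto intro!: D_nonneg\<close>)
  also have "\<dots> = 2 * energy D n w" by (simp add: energy_def sum.cartesian_product)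
  finally show ?thesis by simp
qed

lemma energy_nonneg: "w \<in> {..<n} \<rightarrow>\<^sub>E W \<Longrightarrow> 0 \<le> energy D n w" using energy_ge[of w n "{}" "{}"] by simp

text \<open>Call a label frequent if it occurs at least \<open>\<epsilon> * n\<close> times. Either
  two frequent labels are at positive distance (quadratic energy), or some \<open>g\<close> labels
  catch all but \<open>\<mu> * n\<close> indices while one of them is underused (Chernoff), or the
  frequent labels form a maximal clique that is used almost evenly and there are stray indices, each
  costing a factor \<open>y\<close>. The subtracted product removes the labellings without stray
  indices.\<close>

lemma weight_le:
  fixes \<delta> \<epsilon> \<kappa> a b \<mu> q :: real
  assumes w: "w \<in> {..<n} \<rightarrow>\<^sub>E W" and n: "n \<ge> 1" and bad: "\<not> max_clique (w ` {..<n})"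
    and q: "q \<ge> 0"
    and \<epsilon>: "\<epsilon> > 0" "card W * \<epsilon> \<le> \<mu>" "\<epsilon> \<le> (1 - \<delta>) / g" and \<delta>: "\<delta> < 1"
    and ab: "a > 0" "b > 0"
    and \<kappa>: "\<kappa> \<ge> 0" "\<And>s t. s \<in> W \<Longrightarrow> t \<in> W \<Longrightarrow> D s t \<noteq> 0 \<Longrightarrow> \<kappa> \<le> D s t"
  defines "y \<equiv> exp (- (q * (1 - \<delta>) * n))"
  shows "exp (- q * energy D n w) \<le>
     exp (- q * \<kappa> * (\<epsilon> * n)\<^sup>2)
   + (\<Sum>T\<in>{T. T \<subseteq> W \<and> card T = g}. \<Sum>t\<in>T.
         exp (a * \<mu> + b * (1 - \<delta>) / g) ^ n * (\<Prod>i<n. if w i = t then exp (-b) else if w i \<in> T then 1 else exp (-a)))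
   + (\<Sum>S\<in>{S. S \<subseteq> W \<and> card S = g}. (\<Prod>i<n. if w i \<in> S then 1 else y) - (\<Prod>i<n. if w i \<in> S then 1 else 0))"
   (is "_ \<le> ?t1 + (\<Sum>T\<in>?\<T>. \<Sum>t\<in>T. ?h T t) + (\<Sum>S\<in>?\<T>. ?k S)")
proof -
  define N where "N = (\<lambda>s. card {i. i < n \<and> w i = s})"
  define outs where "outs = (\<lambda>T. card {i. i < n \<and> w i \<notin> T})"
  have fT: "finite ?\<T>" using finite_W by simp
  have wW: "w i \<in> W" if "i < n" for i using w that by auto
  have y: "0 \<le> y" "y \<le> 1" using q \<delta> by (auto simp: y_def)
  have h0: "?h T t \<ge> 0" for T t by (intro mult_nonneg_nonneg prod_nonneg) auto
  have kform: "?k S = y ^ outs S - 0 ^ outs S" for S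
  proof -
    have "(\<Prod>i<n. if w i \<in> S then 1 else z) = z ^ outs S" for z :: real
    proof -
      have "(\<Prod>i<n. if w i \<in> S then 1 else z) = (\<Prod>i<n. if w i \<notin> S then z else 1)" by (intro prod.cong) auto
      then show ?thesis unfolding prod_if_const outs_def .
    qed
    then show ?thesis by simp
  qed
  have k0: "?k S \<ge> 0" for S unfolding kform using y by (cases "outs S = 0") auto
  have hsum0: "(\<Sum>T\<in>?\<T>. \<Sum>t\<in>T. ?h T t) \<ge> 0" by (intro sum_nonneg h0)
  have ksum0: "(\<Sum>S\<in>?\<T>. ?k S) \<ge> 0" by (intro sum_nonneg k0)
  have le1: "exp (- q * energy D n w) \<le> 1" using q energy_nonneg[OF w] by simp
  define S where "S = {s\<in>W. \<epsilon> * n \<le> N s}"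
  have SW: "S \<subseteq> W" by (auto simp: S_def)
  have finS: "finite S" using SW finite_W finite_subset by blast
  show ?thesis
  proof (cases "\<forall>s\<in>S. \<forall>t\<in>S. D s t = 0")
    case False
    then obtain s t where st: "s \<in> S" "t \<in> S" "D s t \<noteq> 0" by blast
    then have stW: "s \<in> W" "t \<in> W" using SW by auto
    have "s \<noteq> t" using D_diag st stW by auto
    then have "(\<Sum>i\<in>{i. i < n \<and> w i = s}. \<Sum>j\<in>{j. j < n \<and> w j = t}. D (w i) (w j)) \<le> energy D n w" by (intro energy_ge w) auto
    moreover have "(\<Sum>i\<in>{i. i < n \<and> w i = s}. \<Sum>j\<in>{j. j < n \<and> w j = t}. D (w i) (w j))
        = (\<Sum>i\<in>{i. i < n \<and> w i = s}. \<Sum>j\<in>{j. j < n \<and> w j = t}. D s t)" by (intro sum.cong) auto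
    moreover have "\<dots> = real (N s) * (real (N t) * D s t)" by (simp add: N_def)
    moreover have "\<kappa> * (\<epsilon> * n)\<^sup>2 \<le> real (N s) * (real (N t) * D s t)"
    proof -
      have "(\<epsilon> * n) * ((\<epsilon> * n) * \<kappa>) \<le> real (N s) * (real (N t) * D s t)"
        using st stW \<epsilon> \<kappa> by (intro mult_mono mult_nonneg_nonneg D_nonneg) (auto simp: S_def)
      then show ?thesis by (simp add: power2_eq_square algebra_simps)
    qed
    ultimately have "\<kappa> * (\<epsilon> * n)\<^sup>2 \<le> energy D n w" by linarith
    then have "q * (\<kappa> * (\<epsilon> * n)\<^sup>2) \<le> q * energy D n w" using q by (rule mult_left_mono)
    then have "exp (- q * energy D n w) \<le> ?t1" by (simp add: mult.assoc)
    then show ?thesis using hsum0 ksum0 by linarith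
  next
    case True
    have cS: "card S \<le> g" by (rule clique_card[OF SW True])
    have outS: "real (outs S) \<le> \<mu> * n"
    proof -
      have "{i. i < n \<and> w i \<notin> S} = (\<Union>s\<in>W - S. {i. i < n \<and> w i = s})" using wW by auto
      then have "outs S \<le> (\<Sum>s\<in>W - S. N s)" unfolding outs_def N_def using finite_W by (auto intro: card_UN_le)
      then have "real (outs S) \<le> (\<Sum>s\<in>W - S. real (N s))" by (metis of_nat_le_iff of_nat_sum)
      also have "\<dots> \<le> (\<Sum>s\<in>W - S. \<epsilon> * n)" by (intro sum_mono) (auto simp: S_def)
      also have "\<dots> \<le> (\<Sum>s\<in>W. \<epsilon> * n)" using \<epsilon> finite_W by (intro sum_mono2) auto
      also have "\<dots> = card W * \<epsilon> * n" by simp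
      also have "\<dots> \<le> \<mu> * n" using \<epsilon> by (intro mult_right_mono) auto
      finally show ?thesis .
    qed
    show ?thesis
    proof (cases "card S = g \<and> (\<forall>s\<in>S. (1 - \<delta>) * n / g \<le> N s)")
      case False
      \<comment> \<open>Either \<open>S\<close> already has \<open>g\<close> labels and one of them
        is underused, or \<open>S\<close> is padded to \<open>g\<close> labels by infrequent ones,
        each of which is underused. Only the size of \<open>T\<close> matters from here on.\<close>
      obtain T t where T: "S \<subseteq> T" "T \<subseteq> W" "card T = g" "t \<in> T" "N t \<le> (1 - \<delta>) * n / g"
      proof (cases "card S = g")
        case True
        then show ?thesis using that[of S] False SW by force
      next
        case False
        then have "card S < g" using cS by simp
        moreover have "g - card S \<le> card (W - S)" using g_le SW finS by (simp add: card_Diff_subset)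
        then obtain U where U: "U \<subseteq> W - S" "card U = g - card S" "finite U" by (rule obtain_subset_with_card_n)
        ultimately have "U \<noteq> {}" by auto
        then obtain t where t: "t \<in> U" by auto
        have "card (S \<union> U) = g" using U finS \<open>card S < g\<close> by (subst card_Un_disjoint) auto
        moreover have "N t \<le> (1 - \<delta>) * n / g"
        proof -
          have "N t \<le> \<epsilon> * n" using U t by (auto simp: S_def)
          also have "\<dots> \<le> (1 - \<delta>) / g * n" using \<epsilon> by (intro mult_right_mono) auto
          finally show ?thesis by simp
        qed
        ultimately show ?thesis using that[of "S \<union> U" t] U SW t by auto
      qed
      have "outs T \<le> outs S" unfolding outs_def using T by (intro card_mono) auto
      then have outT: "real (outs T) \<le> \<mu> * n" using outS by linarith
      have "(\<Prod>i<n. if w i = t then exp (-b) else if w i \<in> T then 1 else exp (-a))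
        = (\<Prod>i<n. (if w i = t then exp (-b) else 1) * (if w i \<notin> T then exp (-a) else 1))" using T by (intro prod.cong) auto
      also have "\<dots> = exp (-b) ^ N t * exp (-a) ^ outs T" unfolding prod.distrib N_def outs_def prod_if_const ..
      also have "\<dots> = exp (- (b * N t + a * outs T))" by (simp add: exp_of_nat_mult[symmetric] exp_add[symmetric] algebra_simps)
      finally have "?h T t = exp (n * (a * \<mu> + b * (1 - \<delta>) / g) - (b * N t + a * outs T))" by (simp add: exp_of_nat_mult[symmetric] flip: exp_add)
      moreover have "b * N t \<le> n * (b * (1 - \<delta>) / g)" using mult_left_mono[OF T(5), of b] ab by (simp add: algebra_simps)
      moreover have "a * outs T \<le> n * (a * \<mu>)" using mult_left_mono[OF outT, of a] ab by (simp add: algebra_simps)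
      \<comment> \<open>The prefactor outweighs the two penalties exactly under the bounds on
        \<open>N t\<close> and \<open>outs T\<close>, so this summand alone dominates any
        weight.\<close>
      ultimately have "1 \<le> ?h T t" by (simp add: algebra_simps)
      also have "?h T t \<le> (\<Sum>t\<in>T. ?h T t)" using T finite_subset[OF T(2) finite_W] by (intro member_le_sum h0) auto
      also have "\<dots> \<le> (\<Sum>T\<in>?\<T>. \<Sum>t\<in>T. ?h T t)"
        using T fT by (intro member_le_sum[where f="\<lambda>T. \<Sum>t\<in>T. ?h T t"] sum_nonneg h0) auto
      finally show ?thesis using le1 ksum0 exp_ge_zero[of "- q * \<kappa> * (\<epsilon> * n)\<^sup>2"] by linarith
    next
      case good: True
      \<comment> \<open>All labels of the clique occur, so a labelling whose image is not a maximal
        clique has to leave \<open>S\<close> somewhere.\<close>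
      have "S \<subseteq> w ` {..<n}"
      proof
        fix s assume s: "s \<in> S"
        have "0 < \<epsilon> * n" using \<epsilon> n by simp
        also have "\<dots> \<le> N s" using s by (auto simp: S_def)
        finally have "{i. i < n \<and> w i = s} \<noteq> {}" unfolding N_def by (auto simp del: Collect_empty_eq)
        then show "s \<in> w ` {..<n}" by auto
      qed
      moreover have "max_clique S" using good True SW by (simp add: max_clique_def)
      ultimately have "\<not> w ` {..<n} \<subseteq> S" using bad by (metis subset_antisym)
      then have "{i. i < n \<and> w i \<notin> S} \<noteq> {}" by auto
      then have m1: "outs S \<noteq> 0" unfolding outs_def by (simp add: card_eq_0_iff)
      have "real (outs S) * ((1 - \<delta>) * n) \<le> (\<Sum>i\<in>{i. i < n \<and> w i \<notin> S}. \<Sum>j\<in>{j. j < n \<and> w j \<in> S}. D (w i) (w j))"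
      proof -
        have "(1 - \<delta>) * n \<le> (\<Sum>j\<in>{j. j < n \<and> w j \<in> S}. D (w i) (w j))" if i: "i < n" "w i \<notin> S" for i
        proof -
          \<comment> \<open>Every clique label occurs at least \<open>(1 - \<delta>) * n / g\<close>
            times, and the distances from \<open>w i\<close> to the clique add up to at least
            \<open>g\<close>.\<close>
          have "(1 - \<delta>) * n = (1 - \<delta>) * n / g * g" using g_pos by simp
          also have "\<dots> \<le> (1 - \<delta>) * n / g * (\<Sum>s\<in>S. D (w i) s)" using \<delta> i wW good True by (intro mult_left_mono clique_out[OF SW]) auto
          also have "\<dots> \<le> (\<Sum>s\<in>S. N s * D (w i) s)" unfolding sum_distrib_left using good wW i SW by (intro sum_mono mult_right_mono D_nonneg) auto
          also have "\<dots> = (\<Sum>s\<in>S. \<Sum>j\<in>{j. j < n \<and> w j = s}. D (w i) (w j))" by (simp add: N_def)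
          also have "\<dots> = (\<Sum>j\<in>{j. j < n \<and> w j \<in> S}. D (w i) (w j))"
          proof -
            have "{j. j < n \<and> w j = s} = {j \<in> {j. j < n \<and> w j \<in> S}. w j = s}" if "s \<in> S" for s using that by auto
            then show ?thesis using sum.group[of "{j. j < n \<and> w j \<in> S}" S w "\<lambda>j. D (w i) (w j)"] finS by (simp add: image_subset_iff)
          qed
          finally show ?thesis .
        qed
        then have "(\<Sum>i\<in>{i. i < n \<and> w i \<notin> S}. (1 - \<delta>) * n) \<le> (\<Sum>i\<in>{i. i < n \<and> w i \<notin> S}. \<Sum>j\<in>{j. j < n \<and> w j \<in> S}. D (w i) (w j))"
          by (intro sum_mono) auto
        then show ?thesis by (simp add: outs_def)
      qed
      also have "\<dots> \<le> energy D n w" by (intro energy_ge w) auto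
      finally have "q * (real (outs S) * ((1 - \<delta>) * n)) \<le> q * energy D n w" using q by (rule mult_left_mono)
      then have "exp (- q * energy D n w) \<le> y ^ outs S" by (simp add: y_def exp_of_nat_mult[symmetric] algebra_simps)
      also have "\<dots> = ?k S" unfolding kform using m1 by simp
      also have "\<dots> \<le> (\<Sum>S\<in>?\<T>. ?k S)" using fT SW good by (intro member_le_sum[where f="?k"] k0) auto
      finally show ?thesis using hsum0 exp_ge_zero[of "- q * \<kappa> * (\<epsilon> * n)\<^sup>2"] by linarith
    qed
  qed
qed

lemma exists_kappa: "\<exists>\<kappa>>0. \<forall>s\<in>W. \<forall>t\<in>W. D s t \<noteq> 0 \<longrightarrow> \<kappa> \<le> D s t"
proof -
  define V where "V = insert 1 ((\<lambda>(s,t). D s t) ` (W \<times> W) - {0})"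
  have V: "finite V" "V \<noteq> {}" "\<forall>v\<in>V. v > 0" using finite_W D_nonneg by (auto simp: V_def less_le)
  have "Min V > 0" using V by auto
  moreover have "Min V \<le> D s t" if "s \<in> W" "t \<in> W" "D s t \<noteq> 0" for s t using V that by (intro Min_le) (auto simp: V_def)
  ultimately show ?thesis by blast
qed

text \<open>The three terms of \<open>weight_le\<close> are summed over all labellings, where
  products over indices become n-th powers. Relative to \<open>g ^ n\<close> they are
  superexponentially small, geometric, and of order n^(1 - (c+1)/2).\<close>

theorem bad_weight_tendsto_0:
  fixes q :: "nat \<Rightarrow> real" and c :: real
  assumes c: "c > 1" and q: "eventually (\<lambda>n. c * ln n \<le> real n * q n) sequentially"
  shows "(\<lambda>n. (\<Sum>w | w \<in> {..<n} \<rightarrow>\<^sub>E W \<and> \<not> max_clique (w ` {..<n}). exp (- q n * energy D n w)) / real g ^ n)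
     \<longlonglongrightarrow> 0"
proof -
  \<comment> \<open>Chosen so that \<open>(1 - \<delta>) * c = (c + 1) / 2 > 1\<close>: the loss
    from uneven use of the clique still leaves an exponent above 1.\<close>
  define \<delta> where "\<delta> = (c - 1) / (2 * c)"
  have \<delta>: "0 < \<delta>" "\<delta> < 1" "(1 - \<delta>) * c = (c + 1) / 2" using c by (auto simp: \<delta>_def field_simps)
  have cW: "card W \<ge> 1" using g_pos g_le by linarith
  obtain a b \<mu> :: real where ab: "a > 0" "b > 0" "\<mu> > 0"
    and R: "exp (a * \<mu>) * exp (b * (1 - \<delta>) / g) * (real g - 1 + exp (- b) + card W * exp (- a)) < g" using chernoff_constants[OF \<delta>(1) g_pos cW] by blast
  define \<epsilon> where "\<epsilon> = min (\<mu> / card W) ((1 - \<delta>) / g)"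
  have \<epsilon>: "\<epsilon> > 0" "card W * \<epsilon> \<le> \<mu>" "\<epsilon> \<le> (1 - \<delta>) / g"
  proof -
    show "\<epsilon> > 0" using ab \<delta> g_pos cW by (auto simp: \<epsilon>_def)
    have "card W * \<epsilon> \<le> card W * (\<mu> / card W)" by (intro mult_left_mono) (auto simp: \<epsilon>_def)
    then show "card W * \<epsilon> \<le> \<mu>" using cW by simp
  qed (simp add: \<epsilon>_def)
  obtain \<kappa> where \<kappa>: "\<kappa> > 0" "\<And>s t. s \<in> W \<Longrightarrow> t \<in> W \<Longrightarrow> D s t \<noteq> 0 \<Longrightarrow> \<kappa> \<le> D s t"
    using exists_kappa by blast
  let ?\<T> = "{T. T \<subseteq> W \<and> card T = g}"
  define y where "y = (\<lambda>n. exp (- (q n * (1 - \<delta>) * n)))"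
  define r where "r = exp (a * \<mu> + b * (1 - \<delta>) / g) * (real g - 1 + exp (- b) + card W * exp (- a)) / g"
  define t1 where "t1 = (\<lambda>n. (card W) ^ n * exp (- q n * \<kappa> * (\<epsilon> * n)\<^sup>2))"
  define t3 where "t3 = (\<lambda>n. (1 + card W * y n) ^ n - 1)"
  define bound where "bound = (\<lambda>n. t1 n + card ?\<T> * g * r ^ n + card ?\<T> * t3 n)"
  have fT: "finite ?\<T>" using finite_W by simp
  have bnd: "eventually (\<lambda>n. norm ((\<Sum>w | w \<in> {..<n} \<rightarrow>\<^sub>E W \<and> \<not> max_clique (w ` {..<n}). exp (- q n * energy D n w)) / real g ^ n) \<le> bound n) sequentially"
    using q eventually_ge_at_top[of 1]
  proof eventually_elim
    case (elim n)
    have "c * ln n \<ge> 0" using elim c by simp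
    then have "real n * q n \<ge> 0" using elim by linarith
    then have qn: "q n \<ge> 0" using elim by (simp add: zero_le_mult_iff)
    let ?A = "{..<n} \<rightarrow>\<^sub>E W"
    have finA: "finite ?A" using finite_W by (intro finite_PiE) auto
    let ?h = "\<lambda>w T t. exp (a * \<mu> + b * (1 - \<delta>) / g) ^ n * (\<Prod>i<n. if w i = t then exp (-b) else if w i \<in> T then 1 else exp (-a))"
    let ?k = "\<lambda>w S. (\<Prod>i<n. if w i \<in> S then 1 else y n) - (\<Prod>i<n. if w i \<in> S then 1 else 0)"
    have y: "0 \<le> y n" "y n \<le> 1" using qn \<delta> by (auto simp: y_def)
    have k0: "?k w S \<ge> 0" for w S using y by (subst diff_ge_0_iff_ge, intro prod_mono) auto
    have "(\<Sum>w | w \<in> ?A \<and> \<not> max_clique (w ` {..<n}). exp (- q n * energy D n w))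
      \<le> (\<Sum>w | w \<in> ?A \<and> \<not> max_clique (w ` {..<n}). exp (- q n * \<kappa> * (\<epsilon> * n)\<^sup>2)
           + (\<Sum>T\<in>?\<T>. \<Sum>t\<in>T. ?h w T t) + (\<Sum>S\<in>?\<T>. ?k w S))" unfolding y_def
      by (intro sum_mono weight_le[OF _ elim(2) _ qn \<epsilon> \<delta>(2) ab(1,2) less_imp_le[OF \<kappa>(1)] \<kappa>(2)]) auto
    also have "\<dots> \<le> (\<Sum>w\<in>?A. exp (- q n * \<kappa> * (\<epsilon> * n)\<^sup>2)
           + (\<Sum>T\<in>?\<T>. \<Sum>t\<in>T. ?h w T t) + (\<Sum>S\<in>?\<T>. ?k w S))"
      using finA by (intro sum_mono2 add_nonneg_nonneg sum_nonneg k0 mult_nonneg_nonneg prod_nonneg) auto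
    also have "\<dots> = (\<Sum>w\<in>?A. exp (- q n * \<kappa> * (\<epsilon> * n)\<^sup>2))
           + (\<Sum>w\<in>?A. \<Sum>T\<in>?\<T>. \<Sum>t\<in>T. ?h w T t) + (\<Sum>w\<in>?A. \<Sum>S\<in>?\<T>. ?k w S)" by (simp only: sum.distrib)
    also have "(\<Sum>w\<in>?A. exp (- q n * \<kappa> * (\<epsilon> * n)\<^sup>2)) = t1 n" by (simp add: t1_def card_PiE)
    also have "(\<Sum>w\<in>?A. \<Sum>T\<in>?\<T>. \<Sum>t\<in>T. ?h w T t) = (\<Sum>T\<in>?\<T>. \<Sum>t\<in>T. \<Sum>w\<in>?A. ?h w T t)"
      by (subst sum.swap, rule sum.cong[OF refl], subst sum.swap, rule refl)
    also have "\<dots> \<le> (\<Sum>T\<in>?\<T>. \<Sum>t\<in>T. r ^ n * real g ^ n)"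
    proof (intro sum_mono)
      fix T t assume T: "T \<in> ?\<T>" and t: "t \<in> T"
      have finT: "finite T" using T finite_W finite_subset by blast
      let ?f = "\<lambda>x. if x = t then exp (-b) else if x \<in> T then 1 else exp (-a)"
      have "(\<Sum>x\<in>W. ?f x) = (\<Sum>x\<in>T. ?f x) + (\<Sum>x\<in>W - T. ?f x)" by (subst add.commute, rule sum.subset_diff) (use T finite_W in auto)
      also have "(\<Sum>x\<in>T. ?f x) = exp (-b) + (\<Sum>x\<in>T - {t}. ?f x)" using t finT by (simp add: sum.remove)
      also have "(\<Sum>x\<in>T - {t}. ?f x) = (\<Sum>x\<in>T - {t}. 1)" by (intro sum.cong) auto
      also have "\<dots> = real g - 1" using t T finT g_pos by (simp add: card_Diff_singleton)
      also have "(\<Sum>x\<in>W - T. ?f x) = (\<Sum>x\<in>W - T. exp (-a))" using t by (intro sum.cong) auto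
      also have "\<dots> \<le> card W * exp (-a)" using finite_W by (simp add: card_mono)
      finally have le: "(\<Sum>x\<in>W. ?f x) \<le> real g - 1 + exp (- b) + card W * exp (- a)" by simp
      have "(\<Sum>w\<in>?A. ?h w T t) = (exp (a * \<mu> + b * (1 - \<delta>) / g) * (\<Sum>x\<in>W. ?f x)) ^ n"
        by (simp only: sum_distrib_left[symmetric] power_mult_distrib sum_PiE_prod_const[OF finite_W, of ?f n])
      also have "\<dots> \<le> (exp (a * \<mu> + b * (1 - \<delta>) / g) * (real g - 1 + exp (- b) + card W * exp (- a))) ^ n"
        by (intro power_mono mult_left_mono le mult_nonneg_nonneg sum_nonneg) auto
      also have "\<dots> = r ^ n * real g ^ n" using g_pos by (simp add: r_def flip: power_mult_distrib)
      finally show "(\<Sum>w\<in>?A. ?h w T t) \<le> r ^ n * real g ^ n" .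
    qed
    also have "(\<Sum>T\<in>?\<T>. \<Sum>t\<in>T. r ^ n * real g ^ n) = card ?\<T> * g * r ^ n * real g ^ n" by simp
    also have "(\<Sum>w\<in>?A. \<Sum>S\<in>?\<T>. ?k w S) = (\<Sum>S\<in>?\<T>. \<Sum>w\<in>?A. ?k w S)" by (rule sum.swap)
    also have "\<dots> \<le> (\<Sum>S\<in>?\<T>. t3 n * real g ^ n)"
    proof (intro sum_mono)
      fix S assume S: "S \<in> ?\<T>"
      have finS: "finite S" using S finite_W finite_subset by blast
      have "(\<Sum>x\<in>W. if x \<in> S then 1 else z) = real g + (\<Sum>x\<in>W - S. z)" for z :: real
      proof -
        have "(\<Sum>x\<in>W. if x \<in> S then 1 else z) = (\<Sum>x\<in>S. if x \<in> S then 1 else z) + (\<Sum>x\<in>W - S. if x \<in> S then 1 else z)"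
          by (subst add.commute, rule sum.subset_diff) (use S finite_W in auto)
        then show ?thesis using S by simp
      qed
      then have eq: "(\<Sum>x\<in>W. if x \<in> S then 1 else z) = real g + card (W - S) * z" for z :: real by simp
      have "(\<Sum>w\<in>?A. ?k w S) = (real g + card (W - S) * y n) ^ n - real g ^ n"
        unfolding sum_subtractf sum_PiE_prod_const[OF finite_W, of "\<lambda>x. if x \<in> S then 1 else y n" n]
          sum_PiE_prod_const[OF finite_W, of "\<lambda>x. if x \<in> S then 1 else 0" n] eq by simp
      also have "(real g + card (W - S) * y n) ^ n \<le> (real g * (1 + card W * y n)) ^ n"
      proof (intro power_mono)
        have "card (W - S) * y n \<le> card W * y n" using finite_W y by (intro mult_right_mono) (auto intro: card_mono)
        also have "\<dots> \<le> g * (card W * y n)" using g_pos y mult_right_mono[of 1 "real g" "card W * y n"] by simp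
        finally show "real g + card (W - S) * y n \<le> real g * (1 + card W * y n)" by (simp add: algebra_simps)
      qed (use y in auto)
      finally show "(\<Sum>w\<in>?A. ?k w S) \<le> t3 n * real g ^ n" by (simp add: t3_def power_mult_distrib right_diff_distrib mult.commute[of _ "real g ^ n"])
    qed
    also have "(\<Sum>S\<in>?\<T>. t3 n * real g ^ n) = card ?\<T> * t3 n * real g ^ n" by simp
    finally have main: "(\<Sum>w | w \<in> ?A \<and> \<not> max_clique (w ` {..<n}). exp (- q n * energy D n w))
       \<le> t1 n + card ?\<T> * g * r ^ n * real g ^ n + card ?\<T> * t3 n * real g ^ n" by simp
    have gn: "real g ^ n > 0" using g_pos by simp
    \<comment> \<open>The first term is small even before division by \<open>g ^ n\<close>, so it
      may be enlarged to share the common factor.\<close>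
    have "t1 n \<le> t1 n * real g ^ n" using g_pos mult_left_mono[of 1 "real g ^ n" "t1 n"] by (simp add: t1_def)
    with main have "(\<Sum>w | w \<in> ?A \<and> \<not> max_clique (w ` {..<n}). exp (- q n * energy D n w)) \<le> bound n * real g ^ n"
      by (simp add: bound_def algebra_simps)
    then have "(\<Sum>w | w \<in> ?A \<and> \<not> max_clique (w ` {..<n}). exp (- q n * energy D n w)) / real g ^ n \<le> bound n" using gn by (simp add: pos_divide_le_eq)
    moreover have "(\<Sum>w | w \<in> ?A \<and> \<not> max_clique (w ` {..<n}). exp (- q n * energy D n w)) / real g ^ n \<ge> 0"
      by (intro divide_nonneg_nonneg sum_nonneg) auto
    ultimately show ?case by simp
  qed
  have lim1: "t1 \<longlonglongrightarrow> 0"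
  proof (rule tendsto_sandwich[OF _ _ tendsto_const])
    define K where "K = \<kappa> * \<epsilon>\<^sup>2 * c"
    define L where "L = ln (card W)"
    have K: "K > 0" using \<kappa> \<epsilon> c by (simp add: K_def)
    show "(\<lambda>n. exp (real n * (L - K * ln n))) \<longlonglongrightarrow> 0" using K by real_asymp
    show "eventually (\<lambda>n. t1 n \<le> exp (real n * (L - K * ln n))) sequentially" using q
    proof eventually_elim
      case (elim n)
      have "\<kappa> * \<epsilon>\<^sup>2 * n * (c * ln n) \<le> \<kappa> * \<epsilon>\<^sup>2 * n * (n * q n)"
        using \<kappa> \<epsilon> elim by (intro mult_left_mono) auto
      then have "exp (- q n * \<kappa> * (\<epsilon> * n)\<^sup>2) \<le> exp (- (n * (K * ln n)))" by (simp add: K_def power2_eq_square algebra_simps)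
      moreover have "real (card W) ^ n = exp (n * L)" using cW by (simp add: L_def exp_of_nat_mult)
      ultimately have "t1 n \<le> exp (n * L) * exp (- (n * (K * ln n)))" by (simp add: t1_def)
      then show ?case by (simp add: exp_add[symmetric] algebra_simps)
    qed
  qed (simp add: t1_def)
  have lim2: "(\<lambda>n. r ^ n) \<longlonglongrightarrow> 0"
  proof (rule LIMSEQ_power_zero)
    have "real g - 1 \<ge> 0" using g_pos by simp
    then have "r \<ge> 0" unfolding r_def by (intro divide_nonneg_nonneg mult_nonneg_nonneg add_nonneg_nonneg) auto
    moreover have "r < 1" using R g_pos by (simp add: r_def exp_add)
    ultimately show "norm r < 1" by simp
  qed
  have lim3: "t3 \<longlonglongrightarrow> 0"
  proof (rule tendsto_sandwich[OF _ _ tendsto_const])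
    define B where "B = real (card W)"
    define s where "s = (c + 1) / 2"
    have s: "s > 1" using c by (simp add: s_def)
    have "(\<lambda>n. real n * exp (- (s * ln n))) \<longlonglongrightarrow> 0" using s by real_asymp
    then have "(\<lambda>n. exp (B * (real n * exp (- (s * ln n)))) - 1) \<longlonglongrightarrow> exp (B * 0) - 1" by (intro tendsto_intros)
    then show "(\<lambda>n. exp (B * (real n * exp (- (s * ln n)))) - 1) \<longlonglongrightarrow> 0" by simp
    show "eventually (\<lambda>n. t3 n \<le> exp (B * (real n * exp (- (s * ln n)))) - 1) sequentially" using q
    proof eventually_elim
      case (elim n)
      have "s * ln n = (1 - \<delta>) * (c * ln n)" by (simp add: s_def \<delta>(3)[symmetric] mult.assoc)
      also have "\<dots> \<le> (1 - \<delta>) * (n * q n)" using elim \<delta> by (intro mult_left_mono) auto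
      finally have yn: "y n \<le> exp (- (s * ln n))" by (simp add: y_def algebra_simps)
      have "(1 + B * y n) ^ n \<le> exp (B * y n) ^ n" by (intro power_mono) (auto simp: B_def y_def intro!: add_nonneg_nonneg exp_ge_add_one_self)
      also have "\<dots> = exp (B * (n * y n))" by (simp add: exp_of_nat_mult[symmetric] algebra_simps)
      also have "\<dots> \<le> exp (B * (n * exp (- (s * ln n))))" using yn by (simp add: B_def mult_left_mono)
      finally show ?case by (simp add: t3_def B_def)
    qed
    show "eventually (\<lambda>n. 0 \<le> t3 n) sequentially" by (intro always_eventually allI) (simp add: t3_def y_def one_le_power)
  qed
  have "bound \<longlonglongrightarrow> 0 + real (card ?\<T> * g) * 0 + real (card ?\<T>) * 0" unfolding bound_def by (intro tendsto_intros lim1 lim2 lim3)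
  then have "bound \<longlonglongrightarrow> 0" by simp
  then show ?thesis by (rule Lim_null_comparison[OF bnd])
qed

end

section \<open>A q-series for alternating Bonferroni sums\<close>

text \<open>The Newton interpolation coefficients, at the nodes 1, p, p^2, ..., of the function that
  is 1 at 1 and 0 at all other powers of p. At \<open>x = p ^ d\<close> the product
  \<open>\<Prod>j<i. x - p ^ j\<close> is the number of surjections from (Z/p)^d onto
  (Z/p)^i.\<close>

definition bonferroni_coeff :: "nat \<Rightarrow> nat \<Rightarrow> real" where
  "bonferroni_coeff p i = (-1) ^ i / (\<Prod>j=1..i. real p ^ j - 1)"

lemma prod_pow_minus_one_pos:
  assumes "p > (1::nat)"
  shows "(\<Prod>j=1..i. real p ^ j - 1) > 0" using assms by (intro prod_pos) auto

text \<open>The partial sum is a polynomial of degree \<open>I\<close> that interpolates 0 at p,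
  ..., p^I; this fixes it up to the leading coefficient.\<close>

lemma bonferroni_sum:
  fixes x :: real
  assumes "p > (1::nat)"
  shows "(\<Sum>i\<le>I. bonferroni_coeff p i * (\<Prod>j<i. x - real p ^ j))
     = bonferroni_coeff p I * (\<Prod>j=1..I. x - real p ^ j)"
proof (induction I)
  case (Suc I)
  define P where "P = (\<Prod>j=1..I. real p ^ j - 1)"
  define A where "A = (\<Prod>j=1..I. x - real p ^ j)"
  have P: "P \<noteq> 0" "real p ^ Suc I - 1 \<noteq> 0" using prod_pow_minus_one_pos[OF assms, of I] assms one_less_power[of "real p" "Suc I", OF _ zero_less_Suc]
    by (simp_all add: P_def less_imp_neq[THEN not_sym] del: power_Suc prod_zero_iff)
  have *: "(\<Prod>j<Suc I. x - real p ^ j) = (x - 1) * A"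
    unfolding A_def by (subst prod.lessThan_Suc_shift) (simp add: prod.shift_bounds_Suc_ivl lessThan_atLeast0 atLeastLessThanSuc_atLeastAtMost prod.atLeast_Suc_atMost_Suc_shift prod.atLeast1_atMost_eq)
  have "(\<Sum>i\<le>Suc I. bonferroni_coeff p i * (\<Prod>j<i. x - real p ^ j))
     = (-1)^I / P * A - (-1)^I / (P * (real p ^ Suc I - 1)) * ((x - 1) * A)"
    using Suc.IH * by (simp add: bonferroni_coeff_def P_def A_def del: prod.lessThan_Suc power_Suc) simp
  also have "\<dots> = - ((-1)^I / (P * (real p ^ Suc I - 1))) * (A * (x - real p ^ Suc I))"
    using P by (simp add: divide_simps del: power_Suc) (simp add: algebra_simps del: power_Suc)
  also have "\<dots> = bonferroni_coeff p (Suc I) * (\<Prod>j=1..Suc I. x - real p ^ j)" by (simp add: bonferroni_coeff_def P_def A_def del: power_Suc) simp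
  finally show ?case .
qed (simp add: bonferroni_coeff_def)

lemma prod_pow_diff_nonneg:
  assumes "p > (1::nat)" "d \<ge> 1"
  shows "(\<Prod>j=1..I. real p ^ d - real p ^ j) \<ge> 0"
proof (cases "d \<le> I")
  case True
  then have "d \<in> {1..I}" using assms by auto
  then have "(\<Prod>j=1..I. real p ^ d - real p ^ j) = 0" by (intro prod_zero bexI[of _ d]) auto
  then show ?thesis by (simp only: order_refl)
next
  case False
  then show ?thesis by (intro prod_nonneg) (use assms in \<open>auto intro!: power_increasing\<close>)
qed

text \<open>For \<open>d > 0\<close> the truncated sum is \<open>(-1) ^ I\<close> times a
  nonnegative quotient, and for \<open>d = 0\<close> it is exactly 1. Truncations therefore
  alternate around the indicator.\<close>

lemma bonferroni_bounds:
  assumes "p > (1::nat)"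
  shows "even I \<Longrightarrow> of_bool (d = 0) \<le> (\<Sum>i\<le>I. bonferroni_coeff p i * (\<Prod>j<i. real p ^ d - real p ^ j))"
    and "odd I \<Longrightarrow> (\<Sum>i\<le>I. bonferroni_coeff p i * (\<Prod>j<i. real p ^ d - real p ^ j)) \<le> of_bool (d = 0)"
proof -
  let ?P = "\<Prod>j=1..I. real p ^ j - 1"
  have P: "?P > 0" by (rule prod_pow_minus_one_pos[OF assms])
  have eq: "(\<Sum>i\<le>I. bonferroni_coeff p i * (\<Prod>j<i. real p ^ d - real p ^ j))
    = (-1)^I * ((\<Prod>j=1..I. real p ^ d - real p ^ j) / ?P)" unfolding bonferroni_sum[OF assms] by (simp add: bonferroni_coeff_def)
  have d0: "(\<Prod>j=1..I. real p ^ d - real p ^ j) = (-1)^I * ?P" if "d = 0"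
  proof -
    have "(\<Prod>j=1..I. real p ^ d - real p ^ j) = (\<Prod>j=1..I. (-1) * (real p ^ j - 1))" using that by (intro prod.cong) auto
    also have "\<dots> = (-1)^I * ?P" by (subst prod.distrib) simp
    finally show ?thesis .
  qed
  have d1: "(\<Prod>j=1..I. real p ^ d - real p ^ j) / ?P \<ge> 0" if "d \<noteq> 0" using prod_pow_diff_nonneg[OF assms, of d I] P that by auto
  have e0: "(-1)^I * ((\<Prod>j=1..I. real p ^ d - real p ^ j) / ?P) = 1" if "d = 0" unfolding d0[OF that] using P by (simp del: prod_zero_iff flip: power_mult_distrib)
  show "even I \<Longrightarrow> of_bool (d = 0) \<le> (\<Sum>i\<le>I. bonferroni_coeff p i * (\<Prod>j<i. real p ^ d - real p ^ j))"
    using e0 d1 unfolding eq by (cases "d = 0") (simp, simp)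
  show "odd I \<Longrightarrow> (\<Sum>i\<le>I. bonferroni_coeff p i * (\<Prod>j<i. real p ^ d - real p ^ j)) \<le> of_bool (d = 0)"
    using e0 d1 unfolding eq by (cases "d = 0") (simp, simp)
qed

text \<open>\<open>\<Prod>j<i. p ^ j\<close> is the number of alternating forms on (Z/p)^i, that is,
  the limiting moment; the right side shows that its product with the coefficient decays like
  p^(-i).\<close>

lemma bonferroni_coeff_term:
  assumes "p > (1::nat)"
  shows "bonferroni_coeff p i * (\<Prod>j<i. real p ^ j)
     = (- inverse (real p)) ^ i / (\<Prod>j=1..i. 1 - inverse (real p) ^ j)"
proof (induction i)
  case (Suc i)
  have nz: "real p ^ Suc i - 1 \<noteq> 0" "1 - inverse (real p) ^ Suc i \<noteq> 0"
    using assms one_less_power[of "real p" "Suc i", OF _ zero_less_Suc] power_Suc_less_one[of "inverse (real p)" i]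
    by (simp_all add: inverse_less_1_iff less_imp_neq[THEN not_sym] less_imp_neq del: power_Suc)
  have "bonferroni_coeff p (Suc i) * (\<Prod>j<Suc i. real p ^ j) =
     bonferroni_coeff p i * (\<Prod>j<i. real p ^ j) * (- (real p ^ i) / (real p ^ Suc i - 1))" by (simp add: bonferroni_coeff_def del: power_Suc) simp
  also have "- (real p ^ i) / (real p ^ Suc i - 1) = - inverse (real p) / (1 - inverse (real p) ^ Suc i)" using assms nz by (simp add: divide_simps)
  finally show ?case unfolding Suc.IH by (simp del: power_Suc) simp
qed (simp add: bonferroni_coeff_def)

text \<open>The power series \<open>f\<close> with coefficients \<open>c\<close> satisfies
  \<open>f (x * z) = (1 - z) * f z\<close>. Iterating from \<open>z = - x\<close> pushes the
  argument to 0, where \<open>f\<close> is continuous with value 1.\<close>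

lemma euler_q_series:
  fixes x :: real
  assumes x: "0 < x" "x < 1"
  defines "c \<equiv> \<lambda>i. 1 / (\<Prod>j=1..i. 1 - x ^ j)"
  shows "(\<lambda>i. c i * (-x) ^ i) sums inverse (prodinf (\<lambda>j. 1 + x ^ Suc j))"
    and "convergent_prod (\<lambda>j. 1 + x ^ Suc j)"
proof -
  define f where "f = (\<lambda>z. suminf (\<lambda>i. c i * z ^ i))"
  have cpos: "c i > 0" for i unfolding c_def using x by (auto intro!: prod_pos simp: power_less_one_iff)
  have crec: "c (Suc i) * (1 - x ^ Suc i) = c i" for i
  proof -
    have "1 - x ^ Suc i \<noteq> 0" using power_Suc_less_one[OF x(1,2), of i] by (simp del: power_Suc)
    then show ?thesis by (simp add: c_def del: power_Suc)
  qed
  have summ: "summable (\<lambda>i. c i * z ^ i)" if z: "\<bar>z\<bar> < 1" for z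
  proof -
    obtain r where r: "\<bar>z\<bar> < r" "r < 1" using z dense by blast
    have "(\<lambda>n. \<bar>z\<bar> / (1 - x ^ Suc n)) \<longlonglongrightarrow> \<bar>z\<bar> / (1 - 0)"
      by (intro tendsto_intros LIMSEQ_Suc[OF LIMSEQ_power_zero]) (use x in auto)
    then have "eventually (\<lambda>n. \<bar>z\<bar> / (1 - x ^ Suc n) < r) sequentially" using r(1) by (intro order_tendstoD(2)) auto
    then obtain N where N: "\<And>n. n \<ge> N \<Longrightarrow> \<bar>z\<bar> / (1 - x ^ Suc n) < r" unfolding eventually_sequentially by blast
    have step: "norm (c (Suc n) * z ^ Suc n) = (\<bar>z\<bar> / (1 - x ^ Suc n)) * norm (c n * z ^ n)" for n
    proof -
      have "1 - x ^ Suc n > 0" using power_Suc_less_one[OF x(1,2), of n] by (simp del: power_Suc)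
      then show ?thesis unfolding crec[of n, symmetric] by (simp add: abs_mult del: power_Suc) (simp add: abs_mult)
    qed
    show ?thesis by (rule summable_ratio_test[of r N])
         (use r in simp, simp only: step, intro mult_right_mono norm_ge_zero less_imp_le[OF N], simp)
  qed
  have fx: "f (x * z) = (1 - z) * f z" if z: "\<bar>z\<bar> < 1" for z
  proof -
    have xz: "\<bar>x * z\<bar> < 1"
    proof -
      have "x * \<bar>z\<bar> \<le> 1 * \<bar>z\<bar>" using x by (intro mult_right_mono) auto
      then show ?thesis using z x by (simp add: abs_mult)
    qed
    have "f z - f (x * z) = suminf (\<lambda>i. c i * z ^ i - c i * (x * z) ^ i)" unfolding f_def by (rule suminf_diff[OF summ[OF z] summ[OF xz]])
    also have "\<dots> = suminf (\<lambda>i. c (Suc i) * z ^ Suc i - c (Suc i) * (x * z) ^ Suc i)"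
      using suminf_split_head[OF summable_diff[OF summ[OF z] summ[OF xz]]] by simp
    also have "\<dots> = suminf (\<lambda>i. z * (c i * z ^ i))"
    proof (rule suminf_cong)
      fix i
      have "c (Suc i) * z ^ Suc i - c (Suc i) * (x * z) ^ Suc i = (c (Suc i) * (1 - x ^ Suc i)) * z ^ Suc i" by (simp add: power_mult_distrib algebra_simps)
      then show "c (Suc i) * z ^ Suc i - c (Suc i) * (x * z) ^ Suc i = z * (c i * z ^ i)" unfolding crec by simp
    qed
    also have "\<dots> = z * f z" unfolding f_def by (rule suminf_mult[OF summ[OF z]])
    finally show ?thesis by (simp add: algebra_simps)
  qed
  have fN: "f (- x) * (\<Prod>j<N. 1 + x ^ Suc j) = f (- (x ^ Suc N))" for N
  proof (induction N)
    case (Suc N)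
    have "\<bar>- (x ^ Suc N)\<bar> < 1" using power_Suc_less_one[OF x(1,2), of N] x by simp
    from fx[OF this] have "f (- (x ^ Suc (Suc N))) = (1 + x ^ Suc N) * f (- (x ^ Suc N))" by simp
    then show ?case using Suc.IH by (simp add: algebra_simps)
  qed simp
  have "isCont f 0" unfolding f_def by (rule isCont_powser[where K="1/2"]) (use summ[of "1/2"] in auto)
  moreover have "(\<lambda>N. - (x ^ Suc N)) \<longlonglongrightarrow> 0" using tendsto_minus[OF LIMSEQ_Suc[OF LIMSEQ_power_zero[of x]]] x by simp
  ultimately have "(\<lambda>N. f (- (x ^ Suc N))) \<longlonglongrightarrow> f 0" by (rule isCont_tendsto_compose)
  moreover have "f 0 = 1" unfolding f_def powser_zero by (simp add: c_def)
  ultimately have lim: "(\<lambda>N. f (- x) * (\<Prod>j<N. 1 + x ^ Suc j)) \<longlonglongrightarrow> 1" using fN by simp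
  show conv: "convergent_prod (\<lambda>j. 1 + x ^ Suc j)"
  proof -
    have "summable (\<lambda>j. x ^ Suc j)" using x by (intro summable_mult summable_geometric | simp)+
    then show ?thesis using x by (intro abs_convergent_prod_imp_convergent_prod) (simp add: abs_convergent_prod_conv_summable)
  qed
  have "(\<lambda>N. \<Prod>j\<le>N. 1 + x ^ Suc j) \<longlonglongrightarrow> prodinf (\<lambda>j. 1 + x ^ Suc j)" by (rule convergent_prod_LIMSEQ[OF conv])
  then have "(\<lambda>N. \<Prod>j<N. 1 + x ^ Suc j) \<longlonglongrightarrow> prodinf (\<lambda>j. 1 + x ^ Suc j)"
    by (subst (asm) lessThan_Suc_atMost[symmetric], subst (asm) filterlim_sequentially_Suc)
  from tendsto_mult_left[OF this, of "f (- x)"] lim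
  have "f (- x) * prodinf (\<lambda>j. 1 + x ^ Suc j) = 1" by (rule LIMSEQ_unique)
  then have "f (- x) = inverse (prodinf (\<lambda>j. 1 + x ^ Suc j))" by (metis inverse_unique mult.commute)
  then show "(\<lambda>i. c i * (-x) ^ i) sums inverse (prodinf (\<lambda>j. 1 + x ^ Suc j))"
    using summ[of "-x"] x unfolding f_def by (metis abs_minus_cancel abs_of_pos summable_sums)
qed

text \<open>Euler: partitions into distinct parts are equinumerous with partitions into odd parts.\<close>

lemma prodinf_odd_eq:
  fixes x :: real
  assumes x: "0 < x" "x < 1"
  shows "prodinf (\<lambda>i. 1 - x ^ (2 * i + 1)) = inverse (prodinf (\<lambda>j. 1 + x ^ Suc j))"
proof -
  define A where "A = (\<lambda>N::nat. \<Prod>j<N. 1 + x ^ Suc j)"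
  define Od where "Od = (\<lambda>N::nat. \<Prod>j<N. 1 - x ^ (2 * j + 1))"
  define P where "P = (\<lambda>N::nat. \<Prod>j<N. 1 - x ^ Suc j)"
  have geo: "summable (\<lambda>j. x ^ Suc j)" using x by (intro summable_mult summable_geometric | simp)+
  have cP: "convergent_prod (\<lambda>j. 1 - x ^ Suc j)" using geo x by (intro abs_convergent_prod_imp_convergent_prod) (simp add: abs_convergent_prod_conv_summable)
  have cO: "convergent_prod (\<lambda>j. 1 - x ^ (2 * j + 1))"
  proof -
    have "summable (\<lambda>j. x ^ (2 * j + 1))"
      by (rule summable_comparison_test[OF _ geo]) (use x in \<open>auto intro!: exI[of _ 0] power_decreasing mult_left_mono\<close>)
    then show ?thesis using x by (intro abs_convergent_prod_imp_convergent_prod) (simp add: abs_convergent_prod_conv_summable)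
  qed
  have L: "(\<lambda>N. \<Prod>j<N. u j) \<longlonglongrightarrow> prodinf u" if "convergent_prod u" for u :: "nat \<Rightarrow> real" using convergent_prod_LIMSEQ[OF that]
    by (subst (asm) lessThan_Suc_atMost[symmetric], subst (asm) filterlim_sequentially_Suc)
  have lP: "P \<longlonglongrightarrow> prodinf (\<lambda>j. 1 - x ^ Suc j)" unfolding P_def by (rule L[OF cP])
  have x1: "x ^ Suc j < 1" for j by (rule power_Suc_less_one[OF x])
  have nz: "prodinf (\<lambda>j. 1 - x ^ Suc j) \<noteq> 0" using x1 by (intro prodinf_nonzero[OF cP]) (metis diff_gt_0_iff_gt less_irrefl)
  have Ppos: "P N > 0" for N unfolding P_def using x1 by (intro prod_pos) (simp del: power_Suc)
  \<comment> \<open>\<open>P (2 * N)\<close> splits into odd and even exponents, and the even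
    factors split as \<open>1 - x^(2j) = (1 + x^j) * (1 - x^j)\<close>.\<close>
  have id: "Od N * A N = P (2 * N) / P N" for N
  proof -
    have "Od N * A N * P N = P (2 * N)"
    proof (induction N)
      case (Suc N)
      have "Od (Suc N) * A (Suc N) * P (Suc N)
         = (Od N * A N * P N) * ((1 - x ^ (2 * N + 1)) * ((1 + x ^ Suc N) * (1 - x ^ Suc N)))" by (simp add: Od_def A_def P_def del: power_Suc)
      also have "(1 + x ^ Suc N) * (1 - x ^ Suc N) = 1 - x ^ Suc (2 * N + 1)" by (simp add: algebra_simps power_mult power2_eq_square power_mult_distrib)
      also have "(Od N * A N * P N) * ((1 - x ^ (2 * N + 1)) * (1 - x ^ Suc (2 * N + 1))) = P (2 * Suc N)" unfolding Suc.IH by (simp add: P_def del: power_Suc)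
      finally show ?case .
    qed (simp add: Od_def A_def P_def)
    then show ?thesis using Ppos[of N] by (simp add: field_simps)
  qed
  have "(\<lambda>N. P (2 * N)) \<longlonglongrightarrow> prodinf (\<lambda>j. 1 - x ^ Suc j)"
    using LIMSEQ_subseq_LIMSEQ[OF lP, of "\<lambda>N. 2 * N"] by (simp add: strict_mono_def o_def)
  from tendsto_divide[OF this lP nz] have "(\<lambda>N. Od N * A N) \<longlonglongrightarrow> 1" using nz by (simp add: id)
  moreover have "(\<lambda>N. Od N * A N) \<longlonglongrightarrow> prodinf (\<lambda>i. 1 - x ^ (2 * i + 1)) * prodinf (\<lambda>j. 1 + x ^ Suc j)"
    unfolding Od_def A_def by (intro tendsto_mult L cO euler_q_series(2) x)
  ultimately have "prodinf (\<lambda>i. 1 - x ^ (2 * i + 1)) * prodinf (\<lambda>j. 1 + x ^ Suc j) = 1" using LIMSEQ_unique by blast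
  then show ?thesis by (metis inverse_unique mult.commute)
qed

lemma bonferroni_series:
  assumes "p > (1::nat)"
  shows "(\<lambda>i. bonferroni_coeff p i * (\<Prod>j<i. real p ^ j)) sums
     prodinf (\<lambda>i. 1 - real p powi (1 - 2 * int (Suc i)))"
proof -
  define x where "x = inverse (real p)"
  have x: "0 < x" "x < 1" using assms by (auto simp: x_def inverse_less_1_iff)
  have "real p powi (1 - 2 * int (Suc i)) = x ^ (2 * i + 1)" for i
  proof -
    have "1 - 2 * int (Suc i) = - int (2 * i + 1)" by simp
    then show ?thesis unfolding x_def by (simp only: power_int_minus power_int_of_nat power_inverse)
  qed
  then show ?thesis using euler_q_series(1)[OF x] prodinf_odd_eq[OF x] by (simp add: bonferroni_coeff_term[OF assms] x_def[symmetric])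
qed

section \<open>Products of cyclic groups and their characters\<close>

text \<open>Concrete representatives of the finite abelian groups, with tuples of canonical residues
  as elements. A modulus 0 would give a factor of integers, which \<open>pos_list\<close>
  excludes.\<close>

definition cyc_prod :: "nat list \<Rightarrow> (nat \<Rightarrow> int) monoid" where
  "cyc_prod ds = product_group {..<length ds} (\<lambda>l. integer_mod_group (ds ! l))"

abbreviation "cyc ds \<equiv> carrier (cyc_prod ds)"

abbreviation "cyc_one ds \<equiv> \<one>\<^bsub>cyc_prod ds\<^esub>"

abbreviation pows :: "nat \<Rightarrow> nat list \<Rightarrow> nat list" where
  "pows p es \<equiv> map (\<lambda>e. p ^ e) es"

definition pos_list :: "nat list \<Rightarrow> bool" where
  "pos_list ds \<longleftrightarrow> (\<forall>l<length ds. ds ! l > 0)"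

lemma cyc_prod_group: "comm_group (cyc_prod ds)" unfolding cyc_prod_def by (rule group.group_comm_groupI)
     (auto simp: add.commute intro!: product_group restrict_ext)

lemma cyc_prod_carrier:
  "pos_list ds \<Longrightarrow> cyc ds = (\<Pi>\<^sub>E l\<in>{..<length ds}. {0..<int (ds ! l)})"
  by (auto simp: cyc_prod_def carrier_integer_mod_group pos_list_def intro!: PiE_cong)

lemma cyc_prod_one: "cyc_one ds = (\<lambda>l\<in>{..<length ds}. 0)" by (simp add: cyc_prod_def)

lemma cyc_prod_mult: "x \<otimes>\<^bsub>cyc_prod ds\<^esub> y = (\<lambda>l\<in>{..<length ds}. (x l + y l) mod int (ds ! l))" by (simp add: cyc_prod_def)

lemma cyc_prod_finite: "pos_list ds \<Longrightarrow> finite (cyc ds)" by (simp add: cyc_prod_carrier finite_PiE)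

definition cyc_order :: "nat list \<Rightarrow> nat" where "cyc_order ds = (\<Prod>l<length ds. ds ! l)"

lemma cyc_prod_card: "pos_list ds \<Longrightarrow> card (cyc ds) = cyc_order ds" by (simp add: cyc_prod_carrier card_PiE cyc_order_def)

lemma cyc_order_pos: "pos_list ds \<Longrightarrow> cyc_order ds > 0" by (auto simp: cyc_order_def pos_list_def intro!: prod_pos)

lemma cyc_prod_reduce:
  "pos_list ds \<Longrightarrow> (\<lambda>l\<in>{..<length ds}. x l mod int (ds ! l)) \<in> cyc ds" by (auto simp: cyc_prod_carrier pos_list_def)

lemma cyc_prod_eqI:
  assumes "pos_list ds" "x \<in> cyc ds" "y \<in> cyc ds"
    "\<And>l. l < length ds \<Longrightarrow> int (ds ! l) dvd x l - y l"
  shows "x = y"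
proof (rule PiE_ext)
  show "x \<in> (\<Pi>\<^sub>E l\<in>{..<length ds}. {0..<int (ds ! l)})" "y \<in> (\<Pi>\<^sub>E l\<in>{..<length ds}. {0..<int (ds ! l)})"
    using assms by (simp_all add: cyc_prod_carrier)
  fix l assume l: "l \<in> {..<length ds}"
  have "x l mod int (ds ! l) = y l mod int (ds ! l)" using assms(4)[of l] l by (simp add: mod_eq_dvd_iff)
  moreover have "x l \<in> {0..<int (ds ! l)}" "y l \<in> {0..<int (ds ! l)}" using assms l by (auto simp: cyc_prod_carrier)
  ultimately show "x l = y l" by simp
qed

text \<open>Identifies the group with its own dual. The arguments are arbitrary integer tuples, so
  that sums and differences can be formed before reduction; \<open>chi_cong\<close> shows that only
  residues matter.\<close>

definition chi :: "nat list \<Rightarrow> (nat \<Rightarrow> int) \<Rightarrow> (nat \<Rightarrow> int) \<Rightarrow> complex" where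
  "chi ds x y = cis (2 * pi * (\<Sum>l<length ds. of_int (x l * y l) / of_nat (ds ! l)))"

lemma norm_chi [simp]: "norm (chi ds x y) = 1" by (simp add: chi_def)

lemma chi_nonzero [simp]: "chi ds x y \<noteq> 0" using norm_chi[of ds x y] by fastforce

lemma chi_sym: "chi ds x y = chi ds y x" by (simp add: chi_def mult.commute)

lemma chi_add: "chi ds (\<lambda>l. x l + x' l) y = chi ds x y * chi ds x' y" by (simp add: chi_def cis_mult sum.distrib add_divide_distrib distrib_right distrib_left)

lemma chi_zero [simp]: "chi ds (\<lambda>l. 0) y = 1" by (simp add: chi_def)

lemma chi_minus: "chi ds (\<lambda>l. - x l) y = cnj (chi ds x y)" by (simp add: chi_def cis_cnj sum_negf)

lemma chi_diff: "chi ds (\<lambda>l. x l - x' l) y = chi ds x y * cnj (chi ds x' y)" using chi_add[of ds x "\<lambda>l. - x' l" y] by (simp add: chi_minus)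

lemma chi_add_right: "chi ds x (\<lambda>l. y l + y' l) = chi ds x y * chi ds x y'" by (metis chi_add chi_sym)

lemma chi_diff_right: "chi ds x (\<lambda>l. y l - y' l) = chi ds x y * cnj (chi ds x y')" by (metis chi_diff chi_sym)

lemma chi_sum_right: "finite A \<Longrightarrow> chi ds x (\<lambda>l. \<Sum>i\<in>A. y i l) = (\<Prod>i\<in>A. chi ds x (y i))"
proof (induction A rule: finite_induct)
  case empty
  then show ?case using chi_sym[of ds x "\<lambda>l. 0"] by simp
qed (simp add: chi_add_right)

lemma cnj_chi_mult [simp]: "chi ds x y * cnj (chi ds x y) = 1" "cnj (chi ds x y) * chi ds x y = 1"
  by (simp_all add: complex_norm_square[symmetric] mult.commute[of "cnj _"])

lemma chi_cong_zero:
  assumes "pos_list ds" "\<And>l. l < length ds \<Longrightarrow> int (ds ! l) dvd x l * y l"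
  shows "chi ds x y = 1"
proof -
  have "(\<Sum>l<length ds. of_int (x l * y l) / of_nat (ds ! l) :: real) = of_int (\<Sum>l<length ds. (x l * y l) div int (ds ! l))" unfolding of_int_sum
  proof (rule sum.cong[OF refl])
    fix l assume "l \<in> {..<length ds}"
    with assms have "int (ds ! l) dvd x l * y l" "ds ! l > 0" by (auto simp: pos_list_def)
    then show "of_int (x l * y l) / of_nat (ds ! l) = (of_int ((x l * y l) div int (ds ! l)) :: real)" by (simp add: real_of_int_div)
  qed
  then show ?thesis unfolding chi_def by (simp only: cis_multiple_2pi Ints_of_int)
qed

lemma chi_cong:
  assumes "pos_list ds" "\<And>l. l < length ds \<Longrightarrow> int (ds ! l) dvd x l - x' l"
  shows "chi ds x y = chi ds x' y"
proof -
  have "chi ds (\<lambda>l. x l - x' l) y = 1" using assms by (intro chi_cong_zero) auto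
  then have "chi ds x y * cnj (chi ds x' y) = 1" by (simp add: chi_diff)
  moreover have "chi ds x y = (chi ds x y * cnj (chi ds x' y)) * chi ds x' y" by (simp add: mult.assoc)
  ultimately show ?thesis by simp
qed

lemma chi_cong_right:
  assumes "pos_list ds" "\<And>l. l < length ds \<Longrightarrow> int (ds ! l) dvd y l - y' l"
  shows "chi ds x y = chi ds x y'" using chi_cong[OF assms] by (metis chi_sym)

lemma cis_frac_eq_1_iff:
  assumes "d > (0::nat)"
  shows "cis (2 * pi * (of_int y / of_nat d)) = 1 \<longleftrightarrow> int d dvd y"
proof
  assume "cis (2 * pi * (of_int y / of_nat d)) = 1"
  then have "cos (2 * pi * (of_int y / of_nat d)) = 1" by (metis cis.simps(1) one_complex.simps(1))
  then obtain k :: int where "2 * pi * (of_int y / of_nat d) = of_int k * 2 * pi" by (auto simp: cos_one_2pi_int)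
  then have "of_int y = (of_int k * of_nat d :: real)" using assms by (simp add: field_simps)
  then have "y = k * int d" by (metis of_int_eq_iff of_int_mult of_int_of_nat_eq)
  then show "int d dvd y" by simp
next
  assume "int d dvd y"
  then obtain k where "y = int d * k" by (elim dvdE)
  then show "cis (2 * pi * (of_int y / of_nat d)) = 1" using assms by (simp add: cis_multiple_2pi)
qed

lemma sum_cis_frac:
  assumes "d > (0::nat)"
  shows "(\<Sum>x\<in>{0..<int d}. cis (2 * pi * (of_int (x * y) / of_nat d))) = (if int d dvd y then of_nat d else 0)"
proof -
  let ?z = "cis (2 * pi * (of_int y / of_nat d))"
  have "(\<Sum>x\<in>{0..<int d}. cis (2 * pi * (of_int (x * y) / of_nat d)))
      = (\<Sum>k<d. cis (2 * pi * (of_int (int k * y) / of_nat d)))" by (rule sum.reindex_bij_witness[of _ int nat]) auto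
  also have "\<dots> = (\<Sum>k<d. ?z ^ k)" by (intro sum.cong refl) (simp add: Complex.DeMoivre algebra_simps)
  also have "\<dots> = (if int d dvd y then of_nat d else 0)"
  proof (cases "int d dvd y")
    case True
    then show ?thesis using cis_frac_eq_1_iff[OF assms, of y] by simp
  next
    case False
    then have "?z \<noteq> 1" using cis_frac_eq_1_iff[OF assms, of y] by simp
    moreover have "?z ^ d = 1" using assms by (simp add: Complex.DeMoivre cis_multiple_2pi)
    ultimately show ?thesis using False by (simp add: geometric_sum)
  qed
  finally show ?thesis .
qed

lemma cis_sum: "finite A \<Longrightarrow> cis (\<Sum>a\<in>A. f a) = (\<Prod>a\<in>A. cis (f a))" by (induction A rule: finite_induct) (auto simp: cis_mult[symmetric])

text \<open>The condition is divisibility rather than equality with zero, because \<open>y\<close>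
  is usually an unreduced sum or difference.\<close>

lemma chi_orthogonal:
  assumes "pos_list ds"
  shows "(\<Sum>x\<in>cyc ds. chi ds x y)
     = (if \<forall>l<length ds. int (ds ! l) dvd y l then of_nat (cyc_order ds) else 0)"
proof -
  have "(\<Sum>x\<in>cyc ds. chi ds x y)
     = (\<Sum>x\<in>cyc ds. \<Prod>l<length ds. cis (2 * pi * (of_int (x l * y l) / of_nat (ds ! l))))"
    by (intro sum.cong refl) (simp add: chi_def sum_distrib_left cis_sum)
  also have "\<dots> = (\<Prod>l<length ds. \<Sum>x\<in>{0..<int (ds ! l)}. cis (2 * pi * (of_int (x * y l) / of_nat (ds ! l))))"
    unfolding cyc_prod_carrier[OF assms] by (rule prod_sum_PiE[symmetric]) auto
  also have "\<dots> = (\<Prod>l<length ds. if int (ds ! l) dvd y l then of_nat (ds ! l) else 0)"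
    using assms by (intro prod.cong refl sum_cis_frac) (auto simp: pos_list_def)
  also have "\<dots> = (if \<forall>l<length ds. int (ds ! l) dvd y l then of_nat (cyc_order ds) else 0)" by (auto simp: cyc_order_def intro!: prod_zero)
  finally show ?thesis .
qed

section \<open>The quadratic form on G x G and the size of its cliques\<close>

type_synonym wvec = "(nat \<Rightarrow> int) \<times> (nat \<Rightarrow> int)"

text \<open>The quadratic form \<open>chi ds c f\<close> on pairs \<open>(c, f)\<close>, evaluated
  at the difference of two points. Hence \<open>kdist\<close> vanishes exactly when the difference
  is isotropic.\<close>

definition kern :: "nat list \<Rightarrow> wvec \<Rightarrow> wvec \<Rightarrow> complex" where
  "kern ds w v = chi ds (\<lambda>l. fst w l - fst v l) (\<lambda>l. snd w l - snd v l)"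

definition wspace :: "nat list \<Rightarrow> wvec set" where
  "wspace ds = cyc ds \<times> cyc ds"

definition kdist :: "nat list \<Rightarrow> wvec \<Rightarrow> wvec \<Rightarrow> real" where
  "kdist ds w v = 1 - Re (kern ds w v)"

lemma norm_kern [simp]: "norm (kern ds w v) = 1" by (simp add: kern_def)

lemma kern_sym: "kern ds w v = kern ds v w" unfolding kern_def chi_def by (simp add: algebra_simps)

lemma kdist_eq_0_iff: "kdist ds w v = 0 \<longleftrightarrow> kern ds w v = 1"
proof
  assume "kdist ds w v = 0"
  then have "Re (kern ds w v) = 1" by (simp add: kdist_def)
  moreover have "(Re (kern ds w v))\<^sup>2 + (Im (kern ds w v))\<^sup>2 = 1" using norm_kern[of ds w v] by (simp add: cmod_def)
  ultimately show "kern ds w v = 1" by (simp add: complex_eq_iff)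
qed (simp add: kdist_def)

lemma kern_expand:
  "kern ds (c,f) (c',f') = chi ds c f * cnj (chi ds c f') * cnj (chi ds c' f) * chi ds c' f'" by (simp add: kern_def chi_diff chi_diff_right algebra_simps)

lemma wspace_finite: "pos_list ds \<Longrightarrow> finite (wspace ds)" by (simp add: wspace_def cyc_prod_finite)

text \<open>The functions \<open>\<lambda>w. kern ds w s\<close> are orthogonal for distinct
  \<open>s\<close>: in the product of one with the conjugate of another the part quadratic in
  \<open>w\<close> cancels, and a character of \<open>w\<close> remains.\<close>

lemma kern_parseval:
  assumes ds: "pos_list ds" and S: "S \<subseteq> wspace ds"
  shows "(\<Sum>w\<in>wspace ds. (norm (\<Sum>s\<in>S. kern ds w s))\<^sup>2) = (real (cyc_order ds))\<^sup>2 * card S"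
proof -
  let ?G = "cyc ds" let ?g = "of_nat (cyc_order ds) :: complex"
  have finS: "finite S" using S wspace_finite[OF ds] finite_subset by blast
  have key: "(\<Sum>w\<in>wspace ds. kern ds w s * cnj (kern ds w t)) = (if s = t then ?g\<^sup>2 else 0)"
    if st: "s \<in> S" "t \<in> S" for s t
  proof -
    obtain c f where s: "s = (c,f)" by (cases s)
    obtain c' f' where t: "t = (c',f')" by (cases t)
    have mem: "c \<in> ?G" "f \<in> ?G" "c' \<in> ?G" "f' \<in> ?G" using st S s t by (auto simp: wspace_def)
    have "kern ds (x,y) s * cnj (kern ds (x,y) t)
        = (chi ds c f * cnj (chi ds c' f')) * (chi ds x (\<lambda>l. f' l - f l) * chi ds y (\<lambda>l. c' l - c l))" for x y
    proof -
      have "kern ds (x,y) s * cnj (kern ds (x,y) t) =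
        (chi ds x y * cnj (chi ds x y)) * ((chi ds c f * cnj (chi ds c' f')) * ((chi ds x f' * cnj (chi ds x f)) * (chi ds c' y * cnj (chi ds c y))))"
        unfolding s t kern_expand by (simp add: algebra_simps)
      then show ?thesis by (simp add: chi_diff_right chi_sym[of ds y])
    qed
    note ker = this
    have "(\<Sum>w\<in>wspace ds. kern ds w s * cnj (kern ds w t))
        = (\<Sum>x\<in>?G. \<Sum>y\<in>?G. kern ds (x,y) s * cnj (kern ds (x,y) t))" by (simp add: wspace_def sum.cartesian_product case_prod_unfold)
    also have "\<dots> =
       (chi ds c f * cnj (chi ds c' f')) * ((\<Sum>x\<in>?G. chi ds x (\<lambda>l. f' l - f l)) * (\<Sum>y\<in>?G. chi ds y (\<lambda>l. c' l - c l)))"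
      unfolding ker by (simp only: sum_product) (simp only: sum_distrib_left)
    also have "\<dots> = (if s = t then ?g\<^sup>2 else 0)"
    proof (cases "s = t")
      case True
      then show ?thesis using s t by (simp add: chi_orthogonal[OF ds] power2_eq_square)
    next
      case False
      have "(\<forall>l<length ds. int (ds ! l) dvd f' l - f l) \<Longrightarrow> f' = f" "(\<forall>l<length ds. int (ds ! l) dvd c' l - c l) \<Longrightarrow> c' = c"
        using cyc_prod_eqI[OF ds] mem by blast+
      then show ?thesis using False s t by (auto simp: chi_orthogonal[OF ds])
    qed
    finally show ?thesis .
  qed
  have "of_real (\<Sum>w\<in>wspace ds. (norm (\<Sum>s\<in>S. kern ds w s))\<^sup>2)
      = (\<Sum>w\<in>wspace ds. (\<Sum>s\<in>S. kern ds w s) * cnj (\<Sum>s\<in>S. kern ds w s))" by (simp only: of_real_sum complex_norm_square[symmetric])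
  also have "\<dots> = (\<Sum>w\<in>wspace ds. \<Sum>s\<in>S. \<Sum>t\<in>S. kern ds w s * cnj (kern ds w t))" by (simp add: sum_product)
  also have "\<dots> = (\<Sum>s\<in>S. \<Sum>t\<in>S. \<Sum>w\<in>wspace ds. kern ds w s * cnj (kern ds w t))" by (subst sum.swap, rule sum.cong[OF refl], rule sum.swap)
  also have "\<dots> = (\<Sum>s\<in>S. \<Sum>t\<in>S. if s = t then ?g\<^sup>2 else 0)" by (intro sum.cong refl key)
  also have "\<dots> = of_real ((real (cyc_order ds))\<^sup>2 * card S)" using finS by simp
  finally show ?thesis by (simp only: of_real_eq_iff)
qed

text \<open>For a clique \<open>S\<close> the sum of \<open>kern ds w s\<close> over
  \<open>s\<close> in \<open>S\<close> is \<open>card S\<close> at every \<open>w\<close> in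
  \<open>S\<close>, so Parseval gives \<open>card S ^ 3 \<le> ?g ^ 2 * card S\<close>. In the case
  of equality nothing is left for \<open>w\<close> outside \<open>S\<close>: the sum vanishes there,
  and its real part gives the total distance \<open>?g\<close>.\<close>

lemma clique_energy_kdist:
  assumes ds: "pos_list ds"
  shows "clique_energy (wspace ds) (kdist ds) (cyc_order ds)"
proof
  let ?g = "cyc_order ds"
  show g1: "1 \<le> ?g" using cyc_order_pos[OF ds] by simp
  show "finite (wspace ds)" by (rule wspace_finite[OF ds])
  show "?g \<le> card (wspace ds)" by (simp add: wspace_def card_cartesian_product cyc_prod_card[OF ds])
  show "0 \<le> kdist ds s t" for s t using complex_Re_le_cmod[of "kern ds s t"] by (simp add: kdist_def)
  show "kdist ds s t = kdist ds t s" for s t by (simp add: kdist_def kern_sym)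
  show "kdist ds s s = 0" for s by (simp add: kdist_def kern_def)
  have le: "(card S :: real) ^ 3 + (\<Sum>w\<in>wspace ds - S. (norm (\<Sum>s\<in>S. kern ds w s))\<^sup>2) = (real ?g)\<^sup>2 * card S"
    if S: "S \<subseteq> wspace ds" "\<forall>s\<in>S. \<forall>t\<in>S. kdist ds s t = 0" for S
  proof -
    have "(\<Sum>w\<in>S. (norm (\<Sum>s\<in>S. kern ds w s))\<^sup>2) = (\<Sum>w\<in>S. (real (card S))\<^sup>2)"
      using S by (intro sum.cong refl) (simp add: kdist_eq_0_iff)
    also have "\<dots> = (card S :: real) ^ 3" by (simp add: power3_eq_cube power2_eq_square)
    finally show ?thesis using kern_parseval[OF ds S(1)] sum.subset_diff[OF S(1) wspace_finite[OF ds], of "\<lambda>w. (norm (\<Sum>s\<in>S. kern ds w s))\<^sup>2"] by simp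
  qed
  show "card S \<le> ?g" if S: "S \<subseteq> wspace ds" "\<forall>s\<in>S. \<forall>t\<in>S. kdist ds s t = 0" for S
  proof (cases "card S = 0")
    case False
    have "0 \<le> (\<Sum>w\<in>wspace ds - S. (norm (\<Sum>s\<in>S. kern ds w s))\<^sup>2)" by (intro sum_nonneg) auto
    then have "(card S :: real)\<^sup>2 * card S \<le> (real ?g)\<^sup>2 * card S" using le[OF S] by (simp add: power3_eq_cube power2_eq_square)
    then have "(card S :: real)\<^sup>2 \<le> (real ?g)\<^sup>2" using False by simp
    then have "real (card S) \<le> real ?g" by (rule power2_le_imp_le) simp
    then show ?thesis by simp
  qed simp
  show "real ?g \<le> (\<Sum>s\<in>S. kdist ds w s)"
    if S: "S \<subseteq> wspace ds" "\<forall>s\<in>S. \<forall>t\<in>S. kdist ds s t = 0" "card S = ?g" "w \<in> wspace ds - S" for S w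
  proof -
    have "(\<Sum>w\<in>wspace ds - S. (norm (\<Sum>s\<in>S. kern ds w s))\<^sup>2) = 0" using le[OF S(1,2)] S(3) by (simp add: power3_eq_cube power2_eq_square)
    then have "(norm (\<Sum>s\<in>S. kern ds w s))\<^sup>2 = 0" using S wspace_finite[OF ds] by (subst (asm) sum_nonneg_eq_0_iff) auto
    then have "Re (\<Sum>s\<in>S. kern ds w s) = 0" by simp
    then show ?thesis using S(3) by (simp add: kdist_def sum_subtractf)
  qed
qed

section \<open>The moments of the sandpile group\<close>

lemma sum_Pow_prod:
  fixes f g :: "'a \<Rightarrow> 'b :: comm_semiring_1"
  assumes "finite A"
  shows "(\<Sum>B\<in>Pow A. \<Prod>a\<in>A. if a \<in> B then f a else g a) = (\<Prod>a\<in>A. f a + g a)" using assms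
proof (induction A rule: finite_induct)
  case (insert x A)
  have inj: "inj_on (insert x) (Pow A)" using insert by (auto simp: inj_on_def)
  have dis: "Pow A \<inter> insert x ` Pow A = {}" using insert by auto
  have 1: "(\<Sum>B\<in>Pow A. \<Prod>a\<in>insert x A. if a \<in> B then f a else g a)
     = g x * (\<Sum>B\<in>Pow A. \<Prod>a\<in>A. if a \<in> B then f a else g a)" unfolding sum_distrib_left using insert by (intro sum.cong refl) auto
  have 2: "(\<Sum>B\<in>insert x ` Pow A. \<Prod>a\<in>insert x A. if a \<in> B then f a else g a)
     = f x * (\<Sum>B\<in>Pow A. \<Prod>a\<in>A. if a \<in> B then f a else g a)" unfolding sum_distrib_left sum.reindex[OF inj] o_def
  proof (intro sum.cong refl)
    fix B assume "B \<in> Pow A"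
    have "(\<Prod>a\<in>A. if a \<in> insert x B then f a else g a) = (\<Prod>a\<in>A. if a \<in> B then f a else g a)" using insert by (intro prod.cong) auto
    then show "(\<Prod>a\<in>insert x A. if a \<in> insert x B then f a else g a) = f x * (\<Prod>a\<in>A. if a \<in> B then f a else g a)" using insert by simp
  qed
  show ?case unfolding Pow_insert using insert dis
    by (subst sum.union_disjoint) (simp_all only: finite_Pow_iff finite_imageI 1 2 insert.IH prod.insert, simp add: algebra_simps)
qed simp

section \<open>Sums over random edge sets\<close>

lemma finite_vertex_pairs: "finite (vertex_pairs n)" by (rule finite_subset[of _ "Pow {0..<n}"]) (auto simp: vertex_pairs_def)

lemma erdos_renyi_expectation:
  fixes f :: "nat set set \<Rightarrow> real"
  assumes q: "0 \<le> q" "q \<le> 1"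
  shows "measure_pmf.expectation (erdos_renyi n q) f
     = (\<Sum>E\<in>Pow (vertex_pairs n). (\<Prod>e\<in>vertex_pairs n. if e \<in> E then q else 1 - q) * f E)"
proof -
  let ?V = "vertex_pairs n"
  let ?B = "PiE_dflt ?V False (\<lambda>_. UNIV :: bool set)"
  let ?g = "\<lambda>h. {e \<in> ?V. h e}"
  note fin = finite_vertex_pairs[of n]
  have "measure_pmf.expectation (erdos_renyi n q) f
      = measure_pmf.expectation (Pi_pmf ?V False (\<lambda>_. bernoulli_pmf q)) (\<lambda>h. f (?g h))" by (simp add: erdos_renyi_def)
  also have "\<dots> = (\<Sum>h\<in>?B. f (?g h) * pmf (Pi_pmf ?V False (\<lambda>_. bernoulli_pmf q)) h)"
  proof (rule integral_measure_pmf_real)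
    show "finite ?B" using fin by (intro finite_PiE_dflt) auto
    fix h assume "h \<in> set_pmf (Pi_pmf ?V False (\<lambda>_. bernoulli_pmf q))"
    then show "h \<in> ?B" using set_Pi_pmf_subset[OF fin, of False] by (auto simp: PiE_dflt_def)
  qed
  also have "\<dots> = (\<Sum>h\<in>?B. (\<Prod>e\<in>?V. if e \<in> ?g h then q else 1 - q) * f (?g h))"
  proof (intro sum.cong refl)
    fix h assume h: "h \<in> ?B"
    have "pmf (Pi_pmf ?V False (\<lambda>_. bernoulli_pmf q)) h = (\<Prod>e\<in>?V. pmf (bernoulli_pmf q) (h e))" using h by (intro pmf_Pi' fin) (auto simp: PiE_dflt_def)
    also have "\<dots> = (\<Prod>e\<in>?V. if e \<in> ?g h then q else 1 - q)"
    proof (intro prod.cong refl)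
      fix e assume "e \<in> ?V"
      then show "pmf (bernoulli_pmf q) (h e) = (if e \<in> ?g h then q else 1 - q)" using q by (cases "h e") auto
    qed
    finally show "f (?g h) * pmf (Pi_pmf ?V False (\<lambda>_. bernoulli_pmf q)) h = (\<Prod>e\<in>?V. if e \<in> ?g h then q else 1 - q) * f (?g h)" by simp
  qed
  also have "\<dots> = (\<Sum>E\<in>Pow ?V. (\<Prod>e\<in>?V. if e \<in> E then q else 1 - q) * f E)"
    by (rule sum.reindex_bij_witness[of _ "\<lambda>E e. e \<in> E" ?g]) (auto simp: PiE_dflt_def)
  finally show ?thesis .
qed

lemma vertex_pairsE:
  assumes "e \<in> vertex_pairs n"
  obtains i j where "i < j" "j < n" "e = {i, j}" "Min e = i" "Max e = j"
proof -
  from assms obtain a b where ab: "e = {a, b}" "a \<noteq> b" "a < n" "b < n" by (auto simp: vertex_pairs_def card_2_iff)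
  show ?thesis
  proof (cases "a < b")
    case True then show ?thesis using that[of a b] ab by auto
  next
    case False then show ?thesis using that[of b a] ab by (auto simp: insert_commute)
  qed
qed

text \<open>Lets sums over ordered adjacent pairs be rewritten as sums over edges, with
  \<open>Min\<close> and \<open>Max\<close> naming the endpoints.\<close>

lemma ordered_edges:
  assumes E: "E \<subseteq> vertex_pairs n"
  shows "{(j, i). j < n \<and> i < n \<and> {i, j} \<in> E} = (\<lambda>e. (Max e, Min e)) ` E \<union> (\<lambda>e. (Min e, Max e)) ` E"
    and "(\<lambda>e. (Max e, Min e)) ` E \<inter> (\<lambda>e. (Min e, Max e)) ` E = {}"
    and "inj_on (\<lambda>e. (Max e, Min e)) E" "inj_on (\<lambda>e. (Min e, Max e)) E"
proof -
  have e: "Min e < Max e \<and> Max e < n \<and> e = {Min e, Max e}" if "e \<in> E" for e using E that by (auto elim!: vertex_pairsE[of e n])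
  have "(j, i) \<in> (\<lambda>e. (Max e, Min e)) ` E \<union> (\<lambda>e. (Min e, Max e)) ` E" if ij: "{i, j} \<in> E" for i j
  proof -
    have "i \<noteq> j" using e[OF ij] by auto
    then show ?thesis by (cases "i < j") (use ij in \<open>force simp: image_iff intro!: bexI[of _ "{i,j}"]\<close>)+
  qed
  moreover have "{Min e, Max e} \<in> E" "{Max e, Min e} \<in> E" "Min e < n" "Max e < n" if "e \<in> E" for e using e[OF that] that by (simp_all add: insert_commute)
  ultimately show "{(j, i). j < n \<and> i < n \<and> {i, j} \<in> E} = (\<lambda>e. (Max e, Min e)) ` E \<union> (\<lambda>e. (Min e, Max e)) ` E" by auto
  show "(\<lambda>e. (Max e, Min e)) ` E \<inter> (\<lambda>e. (Min e, Max e)) ` E = {}"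
  proof (intro equals0I)
    fix x assume "x \<in> (\<lambda>e. (Max e, Min e)) ` E \<inter> (\<lambda>e. (Min e, Max e)) ` E"
    then obtain a b where "a \<in> E" "b \<in> E" "x = (Max a, Min a)" "x = (Min b, Max b)" by blast
    with e[of a] e[of b] show False by simp
  qed
  show "inj_on (\<lambda>e. (Max e, Min e)) E" "inj_on (\<lambda>e. (Min e, Max e)) E"
  proof -
    have "a = b" if "a \<in> E" "b \<in> E" "Min a = Min b" "Max a = Max b" for a b using e[of a] e[of b] that by simp
    then show "inj_on (\<lambda>e. (Max e, Min e)) E" "inj_on (\<lambda>e. (Min e, Max e)) E" by (simp_all add: inj_on_def)
  qed
qed

lemma prod_adjacent:
  fixes h :: "nat \<Rightarrow> nat \<Rightarrow> 'a :: comm_monoid_mult"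
  assumes E: "E \<subseteq> vertex_pairs n"
  shows "(\<Prod>j<n. \<Prod>i | i < n \<and> {i, j} \<in> E. h i j) = (\<Prod>e\<in>E. h (Min e) (Max e) * h (Max e) (Min e))"
proof -
  have fin: "finite E" using E finite_vertex_pairs finite_subset by blast
  have "(\<Prod>j<n. \<Prod>i | i < n \<and> {i, j} \<in> E. h i j)
     = (\<Prod>(j,i)\<in>(SIGMA j:{..<n}. {i. i < n \<and> {i, j} \<in> E}). h i j)" by (rule prod.Sigma) auto
  also have "(SIGMA j:{..<n}. {i. i < n \<and> {i, j} \<in> E}) = {(j, i). j < n \<and> i < n \<and> {i, j} \<in> E}" by auto
  also have "(\<Prod>(j,i)\<in>\<dots>. h i j) = (\<Prod>e\<in>E. h (Min e) (Max e) * h (Max e) (Min e))" unfolding ordered_edges(1)[OF E] using ordered_edges(2-)[OF E] fin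
    by (subst prod.union_disjoint) (auto simp: prod.reindex prod.distrib)
  finally show ?thesis .
qed

lemma energy_eq_sum_pairs:
  assumes "\<And>i j. i < n \<Longrightarrow> j < n \<Longrightarrow> D (w i) (w j) = D (w j) (w i)" "\<And>i. i < n \<Longrightarrow> D (w i) (w i) = 0"
  shows "energy D n w = (\<Sum>e\<in>vertex_pairs n. D (w (Min e)) (w (Max e)))"
proof -
  let ?E = "vertex_pairs n"
  note fin = finite_vertex_pairs[of n]
  have "(\<Sum>j<n. \<Sum>i<n. D (w j) (w i)) = (\<Sum>(j,i)\<in>{..<n}\<times>{..<n}. D (w j) (w i))" by (simp add: sum.cartesian_product)
  also have "\<dots> = (\<Sum>(j,i)\<in>{(j, i). j < n \<and> i < n \<and> {i, j} \<in> ?E}. D (w j) (w i))"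
    by (rule sum.mono_neutral_right) (auto simp: vertex_pairs_def card_insert_if assms(2) split: if_splits)
  also have "\<dots> = (\<Sum>e\<in>?E. D (w (Max e)) (w (Min e)) + D (w (Min e)) (w (Max e)))"
    unfolding ordered_edges(1)[OF order_refl] using ordered_edges(2-)[OF order_refl, of n] fin by (subst sum.union_disjoint) (auto simp: sum.reindex sum.distrib)
  also have "\<dots> = (\<Sum>e\<in>?E. 2 * D (w (Min e)) (w (Max e)))"
  proof (intro sum.cong refl)
    fix e assume "e \<in> ?E"
    then obtain i j where "i < j" "j < n" "Min e = i" "Max e = j" by (elim vertex_pairsE)
    then show "D (w (Max e)) (w (Min e)) + D (w (Min e)) (w (Max e)) = 2 * D (w (Min e)) (w (Max e))" using assms(1)[of i j] by simp
  qed
  finally show ?thesis by (simp add: energy_def sum_distrib_left[symmetric])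
qed

lemma PiE_pin_iff:
  assumes "n \<ge> (1::nat)" "z \<in> T"
  shows "w \<in> (\<Pi>\<^sub>E j\<in>{..<n}. if j = 0 then {z} else T) \<longleftrightarrow> w \<in> {..<n} \<rightarrow>\<^sub>E T \<and> w 0 = z"
proof -
  have "(\<forall>i<n. w i \<in> (if i = 0 then {z} else T)) \<longleftrightarrow> (\<forall>i<n. w i \<in> T) \<and> w 0 = z" (is "?L \<longleftrightarrow> ?R")
  proof
    assume L: ?L
    have "w 0 = z" using L[rule_format, of 0] assms by simp
    moreover have "w i \<in> T" if "i < n" for i using L[rule_format, OF that] assms by (cases "i = 0") simp_all
    ultimately show ?R by blast
  next
    assume ?R
    then show ?L by simp
  qed
  then show ?thesis unfolding PiE_iff Ball_def lessThan_iff by blast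
qed

section \<open>Harmonic labellings and their Fourier expansion\<close>

definition pinned :: "nat list \<Rightarrow> nat \<Rightarrow> (nat \<Rightarrow> nat \<Rightarrow> int) set" where
  "pinned ds n = (\<Pi>\<^sub>E j\<in>{..<n}. if j = 0 then {cyc_one ds} else cyc ds)"

lemma one_in_carrier: "cyc_one ds \<in> cyc ds" by (rule monoid.one_closed[OF group.is_monoid[OF comm_group.axioms(2)[OF cyc_prod_group]]])

lemma pinned_iff:
  "n \<ge> 1 \<Longrightarrow> F \<in> pinned ds n \<longleftrightarrow> F \<in> {..<n} \<rightarrow>\<^sub>E cyc ds \<and> F 0 = cyc_one ds"
  unfolding pinned_def by (rule PiE_pin_iff) (auto simp: one_in_carrier)

text \<open>Vertex 0 carries the identity in \<open>pinned\<close> and no equation here, which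
  mirrors the deletion of its row and column. The generating harmonic labellings are the surjections
  from the sandpile group, see \<open>card_epis_mcok_sandpile\<close>.\<close>

definition harmonic :: "nat list \<Rightarrow> nat \<Rightarrow> nat set set \<Rightarrow> (nat \<Rightarrow> nat \<Rightarrow> int) \<Rightarrow> bool" where
  "harmonic ds n E F \<longleftrightarrow>
     (\<forall>j\<in>{1..<n}. \<forall>l<length ds. int (ds ! l) dvd (\<Sum>i | i < n \<and> {i, j} \<in> E. F j l - F i l))"

definition generating :: "nat list \<Rightarrow> nat \<Rightarrow> (nat \<Rightarrow> nat \<Rightarrow> int) \<Rightarrow> bool" where
  "generating ds n F \<longleftrightarrow> generate (cyc_prod ds) (F ` {..<n}) = cyc ds"

definition harmonic_surj :: "nat list \<Rightarrow> nat \<Rightarrow> nat set set \<Rightarrow> (nat \<Rightarrow> nat \<Rightarrow> int) set" where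
  "harmonic_surj ds n E = {F \<in> pinned ds n. generating ds n F \<and> harmonic ds n E F}"

lemma finite_pinned: "pos_list ds \<Longrightarrow> finite (pinned ds n)" unfolding pinned_def by (intro finite_PiE) (auto simp: cyc_prod_finite)

text \<open>The equation at vertex \<open>j\<close> is detected by a character sum over
  \<open>C j\<close>. An edge collects a factor from each of its ends, and the product of
  \<open>chi\<close> of \<open>C i\<close> with \<open>F i - F j\<close> and of \<open>C j\<close>
  with \<open>F j - F i\<close> is the kernel of the two points. Fixing \<open>C 0\<close> drops the
  equation at vertex 0, hence the exponent \<open>n - 1\<close>.\<close>

lemma harmonic_fourier:
  assumes ds: "pos_list ds" and n: "n \<ge> 1" and E: "E \<subseteq> vertex_pairs n"
  shows "(\<Sum>C\<in>pinned ds n. \<Prod>e\<in>E. kern ds (C (Min e), F (Min e)) (C (Max e), F (Max e)))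
     = of_bool (harmonic ds n E F) * of_nat (cyc_order ds) ^ (n - 1)"
proof -
  let ?Y = "\<lambda>j l. \<Sum>i | i < n \<and> {i, j} \<in> E. F j l - F i l"
  let ?B = "\<lambda>j. if j = 0 then {cyc_one ds} else cyc ds"
  have "(\<Prod>e\<in>E. kern ds (C (Min e), F (Min e)) (C (Max e), F (Max e))) = (\<Prod>j<n. chi ds (C j) (?Y j))" for C
  proof -
    have "(\<Prod>j<n. chi ds (C j) (?Y j)) = (\<Prod>j<n. \<Prod>i | i < n \<and> {i, j} \<in> E. chi ds (C j) (\<lambda>l. F j l - F i l))"
      by (intro prod.cong refl chi_sum_right) auto
    also have "\<dots> = (\<Prod>e\<in>E. chi ds (C (Max e)) (\<lambda>l. F (Max e) l - F (Min e) l) * chi ds (C (Min e)) (\<lambda>l. F (Min e) l - F (Max e) l))"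
      by (rule prod_adjacent[OF E])
    also have "\<dots> = (\<Prod>e\<in>E. kern ds (C (Min e), F (Min e)) (C (Max e), F (Max e)))" by (intro prod.cong refl) (simp add: kern_expand chi_diff_right)
    finally show ?thesis by simp
  qed
  then have "(\<Sum>C\<in>pinned ds n. \<Prod>e\<in>E. kern ds (C (Min e), F (Min e)) (C (Max e), F (Max e)))
      = (\<Sum>C\<in>pinned ds n. \<Prod>j<n. chi ds (C j) (?Y j))" by simp
  also have "\<dots> = (\<Prod>j<n. \<Sum>c\<in>?B j. chi ds c (?Y j))" unfolding pinned_def by (rule prod_sum_PiE[symmetric]) (auto simp: cyc_prod_finite[OF ds])
  also have "\<dots> = (\<Prod>j\<in>insert 0 {1..<n}. \<Sum>c\<in>?B j. chi ds c (?Y j))" using n by (intro prod.cong) auto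
  also have "\<dots> = chi ds (cyc_one ds) (?Y 0) * (\<Prod>j\<in>{1..<n}. \<Sum>c\<in>cyc ds. chi ds c (?Y j))" by (subst prod.insert) auto
  also have "chi ds (cyc_one ds) (?Y 0) = 1" by (rule chi_cong_zero[OF ds]) (simp add: cyc_prod_one)
  also have "(\<Prod>j\<in>{1..<n}. \<Sum>c\<in>cyc ds. chi ds c (?Y j))
      = (\<Prod>j\<in>{1..<n}. if \<forall>l<length ds. int (ds ! l) dvd ?Y j l then of_nat (cyc_order ds) else 0)" by (simp only: chi_orthogonal[OF ds])
  also have "\<dots> = of_bool (harmonic ds n E F) * of_nat (cyc_order ds) ^ (n - 1)" by (cases "harmonic ds n E F") (auto simp: harmonic_def intro!: prod_zero)
  finally show ?thesis by simp
qed

definition edge_weight :: "nat list \<Rightarrow> real \<Rightarrow> nat \<Rightarrow> (nat \<Rightarrow> wvec) \<Rightarrow> complex" where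
  "edge_weight ds q n w = (\<Prod>e\<in>vertex_pairs n. of_real (1 - q) + of_real q * kern ds (w (Min e)) (w (Max e)))"

definition wpinned :: "nat list \<Rightarrow> nat \<Rightarrow> (nat \<Rightarrow> wvec) set" where
  "wpinned ds n = {w \<in> {..<n} \<rightarrow>\<^sub>E wspace ds. w 0 = (cyc_one ds, cyc_one ds)}"

text \<open>Edges are independent, so averaging replaces the factor 1 (absent) or
  \<open>kern\<close> (present) of each pair by \<open>1 - q + q * kern\<close>.\<close>

lemma expected_harmonic_surj:
  assumes ds: "pos_list ds" and n: "n \<ge> 1" and q: "0 \<le> q" "q \<le> 1"
  shows "of_real (measure_pmf.expectation (erdos_renyi n q) (\<lambda>E. real (card (harmonic_surj ds n E))) * real (cyc_order ds) ^ (n - 1))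
    = (\<Sum>w | w \<in> wpinned ds n \<and> generating ds n (snd \<circ> w). edge_weight ds q n w)"
proof -
  let ?V = "vertex_pairs n" and ?P = "pinned ds n"
  let ?k = "\<lambda>C F e. kern ds (C (Min e), F (Min e)) (C (Max e), F (Max e))"
  let ?pr = "\<lambda>E. \<Prod>e\<in>?V. if e \<in> E then q else 1 - q"
  let ?G = "{F \<in> ?P. generating ds n F}"
  have finP: "finite ?P" by (rule finite_pinned[OF ds])
  have gen: "generating ds n F \<longleftrightarrow> generating ds n F'" if "\<And>i. i < n \<Longrightarrow> F i = F' i" for F F'
    using that by (simp add: generating_def cong: image_cong_simp)
  have cardH: "(of_nat (card (harmonic_surj ds n E)) :: complex) = (\<Sum>F\<in>?G. of_bool (harmonic ds n E F))" for E
  proof -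
    have "harmonic_surj ds n E = {F \<in> ?G. harmonic ds n E F}" by (auto simp: harmonic_surj_def)
    then show ?thesis using finP by (simp add: of_bool_def sum.If_cases Int_def)
  qed
  have "of_real (measure_pmf.expectation (erdos_renyi n q) (\<lambda>E. real (card (harmonic_surj ds n E))) * real (cyc_order ds) ^ (n - 1))
    = (\<Sum>E\<in>Pow ?V. of_real (?pr E) * ((\<Sum>F\<in>?G. of_bool (harmonic ds n E F) * of_nat (cyc_order ds) ^ (n - 1)) :: complex))"
    by (simp add: erdos_renyi_expectation[OF q] cardH sum_distrib_right mult.assoc)
  also have "\<dots> = (\<Sum>E\<in>Pow ?V. of_real (?pr E) * (\<Sum>F\<in>?G. \<Sum>C\<in>?P. \<Prod>e\<in>E. ?k C F e))"
    using harmonic_fourier[OF ds n] by (intro sum.cong refl) (simp add: Pow_iff)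
  also have "\<dots> = (\<Sum>E\<in>Pow ?V. \<Sum>F\<in>?G. \<Sum>C\<in>?P. \<Prod>e\<in>?V. if e \<in> E then of_real q * ?k C F e else of_real (1 - q))"
    unfolding sum_distrib_left
  proof (intro sum.cong refl)
    fix E F C assume E: "E \<in> Pow ?V"
    have "(\<Prod>e\<in>E. ?k C F e) = (\<Prod>e\<in>?V. if e \<in> E then ?k C F e else 1)" using E finite_vertex_pairs[of n] by (simp add: prod.If_cases Int_absorb1)
    then show "of_real (?pr E) * (\<Prod>e\<in>E. ?k C F e) = (\<Prod>e\<in>?V. if e \<in> E then of_real q * ?k C F e else of_real (1 - q))"
      by (simp add: of_real_prod prod.distrib[symmetric]) (intro prod.cong; auto)
  qed
  also have "\<dots> = (\<Sum>F\<in>?G. \<Sum>C\<in>?P. \<Sum>E\<in>Pow ?V. \<Prod>e\<in>?V. if e \<in> E then of_real q * ?k C F e else of_real (1 - q))"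
    by (subst sum.swap, rule sum.cong[OF refl], rule sum.swap)
  also have "\<dots> = (\<Sum>F\<in>?G. \<Sum>C\<in>?P. \<Prod>e\<in>?V. of_real q * ?k C F e + of_real (1 - q))" by (intro sum.cong refl sum_Pow_prod finite_vertex_pairs)
  also have "\<dots> = (\<Sum>(F,C)\<in>?G \<times> ?P. \<Prod>e\<in>?V. of_real q * ?k C F e + of_real (1 - q))" by (rule sum.cartesian_product)
  also have "\<dots> = (\<Sum>w | w \<in> wpinned ds n \<and> generating ds n (snd \<circ> w). edge_weight ds q n w)"
  proof (rule sum.reindex_bij_witness[of _ "\<lambda>w. (\<lambda>i\<in>{..<n}. snd (w i), \<lambda>i\<in>{..<n}. fst (w i))" "\<lambda>(F,C). \<lambda>i\<in>{..<n}. (C i, F i)"])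
    fix a assume a: "a \<in> ?G \<times> ?P"
    obtain F C where FC: "a = (F, C)" by (cases a)
    have F: "F \<in> ?P" "C \<in> ?P" "generating ds n F" using a FC by auto
    have mem: "F i \<in> cyc ds" "C i \<in> cyc ds" if "i < n" for i using F(1,2) that unfolding pinned_iff[OF n] by blast+
    have z: "F 0 = cyc_one ds" "C 0 = cyc_one ds" using F(1,2) by (simp_all add: pinned_iff[OF n])
    have ext: "restrict F {..<n} = F" "restrict C {..<n} = C" using F(1,2) unfolding pinned_iff[OF n] by (blast intro: PiE_restrict)+
    let ?w = "\<lambda>i\<in>{..<n}. (C i, F i)"
    show "(\<lambda>w. (\<lambda>i\<in>{..<n}. snd (w i), \<lambda>i\<in>{..<n}. fst (w i))) ((\<lambda>(F,C). \<lambda>i\<in>{..<n}. (C i, F i)) a) = a"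
      using ext unfolding FC by (simp cong: restrict_cong)
    have "generating ds n (snd \<circ> ?w)" using F gen[of F "snd \<circ> ?w"] by simp
    then show "(\<lambda>(F,C). \<lambda>i\<in>{..<n}. (C i, F i)) a \<in> {w. w \<in> wpinned ds n \<and> generating ds n (snd \<circ> w)}"
      using n mem z unfolding FC by (simp add: wpinned_def wspace_def)
    show "edge_weight ds q n ((\<lambda>(F,C). \<lambda>i\<in>{..<n}. (C i, F i)) a)
        = (case a of (F, C) \<Rightarrow> \<Prod>e\<in>?V. of_real q * ?k C F e + of_real (1 - q))" unfolding FC edge_weight_def prod.case
    proof (intro prod.cong refl)
      fix e assume "e \<in> ?V"
      then obtain i j where "i < j" "j < n" "Min e = i" "Max e = j" by (elim vertex_pairsE)
      then show "of_real (1 - q) + of_real q * kern ds (?w (Min e)) (?w (Max e)) = of_real q * ?k C F e + of_real (1 - q)" by (simp add: add.commute)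
    qed
  next
    fix w assume w: "w \<in> {w. w \<in> wpinned ds n \<and> generating ds n (snd \<circ> w)}"
    have w1: "w \<in> {..<n} \<rightarrow>\<^sub>E wspace ds" and w0: "w 0 = (cyc_one ds, cyc_one ds)" using w by (auto simp: wpinned_def)
    have wm: "fst (w i) \<in> cyc ds" "snd (w i) \<in> cyc ds" if "i < n" for i using PiE_mem[OF w1, of i] that by (auto simp: wspace_def)
    show "(\<lambda>(F,C). \<lambda>i\<in>{..<n}. (C i, F i)) ((\<lambda>w. (\<lambda>i\<in>{..<n}. snd (w i), \<lambda>i\<in>{..<n}. fst (w i))) w) = w"
      using PiE_restrict[OF w1] by (simp cong: restrict_cong)
    have "generating ds n (\<lambda>i\<in>{..<n}. snd (w i))" using w gen[of "snd \<circ> w" "\<lambda>i\<in>{..<n}. snd (w i)"] by simp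
    then show "(\<lambda>i\<in>{..<n}. snd (w i), \<lambda>i\<in>{..<n}. fst (w i)) \<in> ?G \<times> ?P" using wm w0 n by (simp add: pinned_iff[OF n])
  qed
  finally show ?thesis .
qed

text \<open>The squared norm is exactly \<open>1 - 2 * q * (1 - q) * (1 - Re k)\<close>. This is why
  \<open>q\<close> and \<open>1 - q\<close> enter symmetrically and \<open>q * (1 - q)\<close> is
  the effective rate.\<close>

lemma norm_bernoulli_factor_le:
  fixes k :: complex
  assumes "norm k = 1" "0 \<le> q" "q \<le> 1"
  shows "norm (of_real (1 - q) + of_real q * k) \<le> exp (- (q * (1 - q)) * (1 - Re k))"
proof -
  have k: "(Re k)\<^sup>2 + (Im k)\<^sup>2 = 1" using assms(1) by (simp add: cmod_def)
  have "(norm (of_real (1 - q) + of_real q * k))\<^sup>2 = (1 - q + q * Re k)\<^sup>2 + (q * Im k)\<^sup>2" by (simp add: cmod_power2)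
  also have "\<dots> = (1 - q)\<^sup>2 + 2 * (1 - q) * q * Re k + q\<^sup>2 * ((Re k)\<^sup>2 + (Im k)\<^sup>2)" by (simp add: power2_eq_square algebra_simps)
  also have "\<dots> = 1 + (- 2 * (q * (1 - q)) * (1 - Re k))" unfolding k by (simp add: power2_eq_square algebra_simps)
  also have "\<dots> \<le> exp (- 2 * (q * (1 - q)) * (1 - Re k))" by (rule exp_ge_add_one_self)
  also have "\<dots> = (exp (- (q * (1 - q)) * (1 - Re k)))\<^sup>2" by (simp add: power2_eq_square exp_add[symmetric])
  finally show ?thesis by (rule power2_le_imp_le) simp
qed

lemma norm_edge_weight_le:
  assumes "0 \<le> q" "q \<le> 1"
  shows "norm (edge_weight ds q n w) \<le> exp (- (q * (1 - q)) * energy (kdist ds) n w)"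
proof -
  have "norm (edge_weight ds q n w) = (\<Prod>e\<in>vertex_pairs n. norm (of_real (1 - q) + of_real q * kern ds (w (Min e)) (w (Max e))))"
    by (simp add: edge_weight_def prod_norm)
  also have "\<dots> \<le> (\<Prod>e\<in>vertex_pairs n. exp (- (q * (1 - q)) * kdist ds (w (Min e)) (w (Max e))))"
    unfolding kdist_def using assms by (intro prod_mono conjI norm_ge_zero norm_bernoulli_factor_le) auto
  also have "\<dots> = exp (\<Sum>e\<in>vertex_pairs n. - (q * (1 - q)) * kdist ds (w (Min e)) (w (Max e)))" by (rule exp_sum[symmetric]) (rule finite_vertex_pairs)
  also have "\<dots> = exp (- (q * (1 - q)) * energy (kdist ds) n w)"
  proof -
    have "energy (kdist ds) n w = (\<Sum>e\<in>vertex_pairs n. kdist ds (w (Min e)) (w (Max e)))"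
    proof (rule energy_eq_sum_pairs)
      show "kdist ds (w i) (w j) = kdist ds (w j) (w i)" for i j unfolding kdist_def by (subst kern_sym) (rule refl)
      show "kdist ds (w i) (w i) = 0" for i by (simp add: kdist_def kern_def)
    qed
    then show ?thesis by (simp only: sum_distrib_left)
  qed
  finally show ?thesis .
qed

section \<open>Maximal cliques as graphs of alternating maps\<close>

definition reduce :: "nat list \<Rightarrow> (nat \<Rightarrow> int) \<Rightarrow> (nat \<Rightarrow> int)" where
  "reduce ds x = (\<lambda>l\<in>{..<length ds}. x l mod int (ds ! l))"

lemma reduce_carrier: "pos_list ds \<Longrightarrow> reduce ds x \<in> cyc ds" unfolding reduce_def by (rule cyc_prod_reduce)

lemma reduce_id: "pos_list ds \<Longrightarrow> x \<in> cyc ds \<Longrightarrow> reduce ds x = x"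
  by (rule cyc_prod_eqI) (auto simp: reduce_carrier, simp add: reduce_def minus_mod_eq_div_mult[symmetric] mod_eq_dvd_iff[symmetric])

lemma reduce_cong: "(\<And>l. l < length ds \<Longrightarrow> int (ds ! l) dvd x l - y l) \<Longrightarrow> reduce ds x = reduce ds y"
  unfolding reduce_def by (rule restrict_ext) (simp add: mod_eq_dvd_iff)

lemma reduce_mult: "reduce ds x \<otimes>\<^bsub>cyc_prod ds\<^esub> reduce ds y = reduce ds (\<lambda>l. x l + y l)"
  unfolding cyc_prod_mult reduce_def by (rule restrict_ext) (simp add: mod_add_eq)

lemma chi_reduce: "pos_list ds \<Longrightarrow> chi ds (reduce ds x) y = chi ds x y" by (rule chi_cong) (auto simp: reduce_def mod_eq_dvd_iff[symmetric])

lemma chi_reduce_right: "pos_list ds \<Longrightarrow> chi ds x (reduce ds y) = chi ds x y" by (rule chi_cong_right) (auto simp: reduce_def mod_eq_dvd_iff[symmetric])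

lemma one_eq_reduce: "cyc_one ds = reduce ds (\<lambda>l. 0)" by (simp add: cyc_prod_one reduce_def)

lemma chi_one: "pos_list ds \<Longrightarrow> chi ds (cyc_one ds) y = 1" "pos_list ds \<Longrightarrow> chi ds y (cyc_one ds) = 1"
  by (simp_all add: one_eq_reduce chi_reduce chi_sym[of ds y])

lemma chi_single:
  assumes "i < length ds"
  shows "chi ds x (\<lambda>l. of_bool (l = i)) = cis (2 * pi * (of_int (x i) / of_nat (ds ! i)))"
proof -
  have "(\<Sum>l<length ds. of_int (x l * of_bool (l = i)) / of_nat (ds ! l) :: real) = (\<Sum>l<length ds. if l = i then of_int (x l) / of_nat (ds ! l) else 0)"
    by (intro sum.cong) auto
  also have "\<dots> = of_int (x i) / of_nat (ds ! i)" using assms by simp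
  finally show ?thesis by (simp add: chi_def)
qed

definition is_clique :: "nat list \<Rightarrow> wvec set \<Rightarrow> bool" where
  "is_clique ds S \<longleftrightarrow> S \<subseteq> wspace ds \<and> (\<forall>s\<in>S. \<forall>t\<in>S. kern ds s t = 1) \<and> card S = cyc_order ds"

abbreviation wzero :: "nat list \<Rightarrow> wvec" where
  "wzero ds \<equiv> (cyc_one ds, cyc_one ds)"

definition wred :: "nat list \<Rightarrow> (nat \<Rightarrow> int) \<Rightarrow> (nat \<Rightarrow> int) \<Rightarrow> wvec" where
  "wred ds c f = (reduce ds c, reduce ds f)"

text \<open>With the zero vector in \<open>S\<close>, isotropy of all differences splits into
  isotropy of each member and vanishing of the polar form on each pair.\<close>

lemma clique_relations:
  assumes ds: "pos_list ds" and S: "is_clique ds S" "wzero ds \<in> S" and s: "(c, f) \<in> S" "(c', f') \<in> S"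
  shows "chi ds c f = 1" "chi ds c f' * chi ds c' f = 1"
proof -
  have 1: "chi ds c f = 1" if "(c, f) \<in> S" for c f
  proof -
    have "kern ds (c, f) (wzero ds) = 1" using S that by (auto simp: is_clique_def)
    then show ?thesis by (simp add: kern_expand chi_one[OF ds])
  qed
  show "chi ds c f = 1" by (rule 1[OF s(1)])
  have "kern ds (c, f) (c', f') = 1" using S s by (auto simp: is_clique_def)
  then have "cnj (chi ds c f' * chi ds c' f) = 1" by (simp add: kern_expand 1[OF s(1)] 1[OF s(2)])
  then show "chi ds c f' * chi ds c' f = 1" by (metis complex_cnj_cnj complex_cnj_one)
qed

text \<open>By the relations the sum is at distance zero from all of \<open>S\<close>, so adjoining
  it gives a clique again; as \<open>S\<close> already has the largest possible size, the sum lies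
  in \<open>S\<close>. Maximal cliques through zero are therefore closed under addition.\<close>

lemma clique_add:
  assumes ds: "pos_list ds" and S: "is_clique ds S" "wzero ds \<in> S"
    and s: "wred ds c f \<in> S" "wred ds c' f' \<in> S"
  shows "wred ds (\<lambda>l. c l + c' l) (\<lambda>l. f l + f' l) \<in> S"
proof -
  let ?u = "wred ds (\<lambda>l. c l + c' l) (\<lambda>l. f l + f' l)"
  have fin: "finite S" using S(1) wspace_finite[OF ds] finite_subset by (auto simp: is_clique_def)
  have r: "chi ds c f = 1" "chi ds c' f' = 1" "chi ds c f' * chi ds c' f = 1" using clique_relations[OF ds S s(1)[unfolded wred_def] s(2)[unfolded wred_def]]
      clique_relations(1)[OF ds S s(2)[unfolded wred_def] s(2)[unfolded wred_def]] by (simp_all add: chi_reduce[OF ds] chi_reduce_right[OF ds])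
  have ux: "kern ds ?u x = 1" if x: "x \<in> S" for x
  proof -
    obtain a b where ab: "x = (a, b)" by (cases x)
    have ab1: "chi ds a b = 1" "chi ds c b * chi ds a f = 1" "chi ds c' b * chi ds a f' = 1"
      using clique_relations[OF ds S s(1)[unfolded wred_def], of a b] clique_relations[OF ds S s(2)[unfolded wred_def], of a b]
        clique_relations(1)[OF ds S, of a b a b] x ab by (simp_all add: chi_reduce[OF ds] chi_reduce_right[OF ds])
    have "kern ds ?u x = (chi ds c f * (chi ds c f' * chi ds c' f) * chi ds c' f') *
       cnj ((chi ds c b * chi ds a f) * (chi ds c' b * chi ds a f')) * chi ds a b"
      unfolding ab wred_def kern_expand chi_reduce[OF ds] chi_reduce_right[OF ds] chi_add chi_add_right by (simp add: algebra_simps)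
    then show ?thesis by (simp add: r ab1)
  qed
  have uu: "kern ds ?u ?u = 1" by (simp add: kern_def)
  have "?u \<in> wspace ds" by (simp add: wspace_def wred_def reduce_carrier[OF ds])
  then have "insert ?u S \<subseteq> wspace ds" using S(1) by (auto simp: is_clique_def)
  moreover have "\<forall>s\<in>insert ?u S. \<forall>t\<in>insert ?u S. kdist ds s t = 0"
  proof -
    have "kern ds x ?u = 1" if "x \<in> S" for x using ux[OF that] by (subst kern_sym)
    then show ?thesis using S(1) ux uu by (simp add: is_clique_def kdist_eq_0_iff)
  qed
  ultimately have "card (insert ?u S) \<le> cyc_order ds" by (rule clique_energy.clique_card[OF clique_energy_kdist[OF ds]])
  moreover have "card (insert ?u S) = Suc (cyc_order ds)" if "?u \<notin> S" using that S(1) fin by (simp add: is_clique_def)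
  ultimately show ?thesis by fastforce
qed

lemma clique_sum:
  assumes ds: "pos_list ds" and S: "is_clique ds S" "wzero ds \<in> S"
    and "finite A" and s: "\<And>j. j \<in> A \<Longrightarrow> wred ds (c j) (f j) \<in> S"
  shows "wred ds (\<lambda>l. \<Sum>j\<in>A. int (k j) * c j l) (\<lambda>l. \<Sum>j\<in>A. int (k j) * f j l) \<in> S" using assms(4) s
proof (induction A rule: finite_induct)
  case empty
  then show ?case using S(2) by (simp add: wred_def one_eq_reduce)
next
  case (insert a A)
  have "wred ds (\<lambda>l. int m * c a l) (\<lambda>l. int m * f a l) \<in> S" for m
  proof (induction m)
    case 0
    then show ?case using S(2) by (simp add: wred_def one_eq_reduce)
  next
    case (Suc m)
    from clique_add[OF ds S this insert.prems[of a]] show ?case by (simp add: algebra_simps)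
  qed
  from clique_add[OF ds S this[of "k a"] insert.IH] insert show ?case by simp
qed

definition alt_pairs :: "nat list \<Rightarrow> (nat \<times> nat) set" where
  "alt_pairs ds = {(i, j). i < j \<and> j < length ds}"

text \<open>The order of the exterior square of the group, which is also the number of alternating
  forms on it.\<close>

definition alt_count :: "nat list \<Rightarrow> nat" where
  "alt_count ds = (\<Prod>(i,j)\<in>alt_pairs ds. gcd (ds ! i) (ds ! j))"

definition alt_forms :: "nat list \<Rightarrow> (nat \<times> nat \<Rightarrow> int) set" where
  "alt_forms ds = (\<Pi>\<^sub>E (i,j)\<in>alt_pairs ds. {0..<int (gcd (ds ! i) (ds ! j))})"

definition skew :: "(nat \<times> nat \<Rightarrow> int) \<Rightarrow> nat \<Rightarrow> nat \<Rightarrow> int" where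
  "skew A i j = (if i < j then A (i, j) else if j < i then - A (j, i) else 0)"

text \<open>The homomorphisms from Z/d_j to Z/d_i form a cyclic group of order gcd(d_i, d_j),
  generated by multiplication by d_i / gcd(d_i, d_j). \<open>A\<close> lists the coordinates above
  the diagonal, and \<open>skew\<close> fills in the others.\<close>

definition alt_map :: "nat list \<Rightarrow> (nat \<times> nat \<Rightarrow> int) \<Rightarrow> (nat \<Rightarrow> int) \<Rightarrow> nat \<Rightarrow> int" where
  "alt_map ds A f i = (\<Sum>j<length ds. skew A i j * int (ds ! i div gcd (ds ! i) (ds ! j)) * f j)"

definition alt_graph :: "nat list \<Rightarrow> (nat \<times> nat \<Rightarrow> int) \<Rightarrow> wvec set" where
  "alt_graph ds A = (\<lambda>f. (reduce ds (alt_map ds A f), f)) ` cyc ds"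

text \<open>Surjectivity of \<open>snd\<close> is what \<open>generating\<close> amounts to on a
  maximal clique, see \<open>clique_generating_iff\<close>.\<close>

definition good_cliques :: "nat list \<Rightarrow> wvec set set" where
  "good_cliques ds = {S. is_clique ds S \<and> wzero ds \<in> S \<and> snd ` S = cyc ds}"

lemma finite_alt_pairs: "finite (alt_pairs ds)" by (rule finite_subset[of _ "{..<length ds} \<times> {..<length ds}"]) (auto simp: alt_pairs_def)

lemma card_alt_forms: "card (alt_forms ds) = alt_count ds" by (simp add: alt_forms_def alt_count_def card_PiE[OF finite_alt_pairs] case_prod_unfold)

text \<open>Swapping the summation indices shows that the exponent, as a real number, is its own
  negative. It is thus exactly 0 and not merely half an integer, which also settles even
  moduli.\<close>

lemma alt_map_isotropic:
  assumes ds: "pos_list ds"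
  shows "chi ds (alt_map ds A f) f = 1"
proof -
  let ?n = "length ds"
  define tot :: real where "tot = (\<Sum>i<?n. \<Sum>j<?n. of_int (skew A i j * f j * f i) / of_nat (gcd (ds ! i) (ds ! j)))"
  have "(\<Sum>i<?n. of_int (alt_map ds A f i * f i) / of_nat (ds ! i) :: real) = tot"
    unfolding tot_def alt_map_def of_int_mult of_int_sum sum_distrib_right sum_divide_distrib
  proof (intro sum.cong refl)
    fix i j assume "i \<in> {..<?n}" "j \<in> {..<?n}"
    then have d: "ds ! i > 0" "gcd (ds ! i) (ds ! j) > 0" using ds by (auto simp: pos_list_def)
    then have "real (ds ! i div gcd (ds ! i) (ds ! j)) = real (ds ! i) / real (gcd (ds ! i) (ds ! j))" by (simp add: real_of_nat_div)
    then show "of_int (skew A i j) * of_int (int (ds ! i div gcd (ds ! i) (ds ! j))) * of_int (f j) * of_int (f i) / of_nat (ds ! i)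
       = (of_int (skew A i j) * of_int (f j) * of_int (f i) / of_nat (gcd (ds ! i) (ds ! j)) :: real)" using d by (simp add: field_simps)
  qed
  moreover have "tot = - tot"
  proof -
    have "tot = (\<Sum>j<?n. \<Sum>i<?n. of_int (skew A i j * f j * f i) / of_nat (gcd (ds ! i) (ds ! j)))" unfolding tot_def by (rule sum.swap)
    also have "\<dots> = - tot" unfolding tot_def sum_negf[symmetric]
    proof (intro sum.cong refl)
      fix i j
      have "skew A j i * f i * f j = - (skew A i j * f j * f i)" by (simp add: skew_def)
      then show "of_int (skew A j i * f i * f j) / of_nat (gcd (ds ! j) (ds ! i)) = (- (of_int (skew A i j * f j * f i) / of_nat (gcd (ds ! i) (ds ! j))) :: real)"
        by (simp add: gcd.commute)
    qed
    finally show ?thesis .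
  qed
  ultimately show ?thesis by (simp add: chi_def)
qed

lemma alt_graph_good:
  assumes ds: "pos_list ds"
  shows "alt_graph ds A \<in> good_cliques ds"
proof -
  let ?G = "cyc ds"
  have lin: "alt_map ds A f i - alt_map ds A f' i = alt_map ds A (\<lambda>l. f l - f' l) i" for f f' i by (simp add: alt_map_def sum_subtractf algebra_simps)
  have "kern ds (reduce ds (alt_map ds A f), f) (reduce ds (alt_map ds A f'), f') = 1" for f f'
  proof -
    have "kern ds (reduce ds (alt_map ds A f), f) (reduce ds (alt_map ds A f'), f') = kern ds (alt_map ds A f, f) (alt_map ds A f', f')"
      by (simp add: kern_expand chi_reduce[OF ds])
    also have "\<dots> = 1" using alt_map_isotropic[OF ds, of A "\<lambda>l. f l - f' l"] by (simp add: kern_def lin)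
    finally show ?thesis .
  qed
  moreover have "card (alt_graph ds A) = cyc_order ds" unfolding alt_graph_def by (subst card_image) (auto simp: inj_on_def cyc_prod_card[OF ds])
  moreover have "wzero ds \<in> alt_graph ds A"
  proof -
    have "reduce ds (alt_map ds A (cyc_one ds)) = cyc_one ds" unfolding one_eq_reduce by (rule reduce_cong) (auto simp: alt_map_def reduce_def intro!: dvd_sum)
    moreover have "cyc_one ds \<in> ?G" unfolding one_eq_reduce by (rule reduce_carrier[OF ds])
    ultimately show ?thesis unfolding alt_graph_def by (auto simp: image_iff intro!: bexI[of _ "(cyc_one ds)"])
  qed
  moreover have "alt_graph ds A \<subseteq> wspace ds" by (auto simp: alt_graph_def wspace_def reduce_carrier[OF ds])
  moreover have "snd ` alt_graph ds A = ?G" by (auto simp: alt_graph_def image_iff)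
  ultimately show ?thesis by (auto simp: good_cliques_def is_clique_def alt_graph_def)
qed

lemma alt_map_single:
  assumes "j < length ds"
  shows "alt_map ds A (\<lambda>l. of_bool (l = j)) i = skew A i j * int (ds ! i div gcd (ds ! i) (ds ! j))"
proof -
  have "alt_map ds A (\<lambda>l. of_bool (l = j)) i = (\<Sum>l<length ds. if l = j then skew A i l * int (ds ! i div gcd (ds ! i) (ds ! l)) else 0)"
    unfolding alt_map_def by (intro sum.cong) auto
  then show ?thesis using assms by simp
qed

lemma alt_map_cong_arg:
  assumes "\<And>l. l < length ds \<Longrightarrow> int (ds ! l) dvd f l - f' l" "i < length ds"
  shows "int (ds ! i) dvd alt_map ds A f i - alt_map ds A f' i"
proof -
  have "alt_map ds A f i - alt_map ds A f' i = (\<Sum>j<length ds. skew A i j * int (ds ! i div gcd (ds ! i) (ds ! j)) * (f j - f' j))"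
    by (simp add: alt_map_def sum_subtractf algebra_simps)
  also have "int (ds ! i) dvd \<dots>"
  proof (intro dvd_sum)
    fix j assume "j \<in> {..<length ds}"
    then have "int (ds ! j) dvd f j - f' j" using assms by simp
    then have "int (ds ! i div gcd (ds ! i) (ds ! j)) * int (gcd (ds ! i) (ds ! j)) dvd int (ds ! i div gcd (ds ! i) (ds ! j)) * (f j - f' j)"
      by (intro mult_dvd_mono dvd_refl) (metis dvd_trans gcd_dvd2 of_nat_dvd_iff)
    moreover have "int (ds ! i div gcd (ds ! i) (ds ! j)) * int (gcd (ds ! i) (ds ! j)) = int (ds ! i)" by (metis dvd_div_mult_self gcd_dvd1 of_nat_mult)
    ultimately show "int (ds ! i) dvd skew A i j * int (ds ! i div gcd (ds ! i) (ds ! j)) * (f j - f' j)" by (simp add: mult.assoc)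
  qed
  finally show ?thesis .
qed

lemma alt_graph_inj:
  assumes ds: "pos_list ds" and A: "A \<in> alt_forms ds" "B \<in> alt_forms ds" and eq: "alt_graph ds A = alt_graph ds B"
  shows "A = B"
proof (rule PiE_ext[OF A[unfolded alt_forms_def]])
  fix x assume x: "x \<in> alt_pairs ds"
  then obtain i j where ij: "x = (i, j)" "i < j" "j < length ds" by (auto simp: alt_pairs_def)
  let ?g = "gcd (ds ! i) (ds ! j)" and ?e = "reduce ds (\<lambda>l. of_bool (l = j))"
  have d: "ds ! i > 0" "?g > 0" using ds ij by (auto simp: pos_list_def)
  have "(reduce ds (alt_map ds A ?e), ?e) \<in> alt_graph ds A" unfolding alt_graph_def by (rule imageI[OF reduce_carrier[OF ds]])
  then have "(reduce ds (alt_map ds A ?e), ?e) \<in> alt_graph ds B" by (simp only: eq)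
  then have "reduce ds (alt_map ds A ?e) = reduce ds (alt_map ds B ?e)" by (auto simp: alt_graph_def)
  moreover have "reduce ds (alt_map ds C ?e) = reduce ds (alt_map ds C (\<lambda>l. of_bool (l = j)))" for C
    by (intro reduce_cong alt_map_cong_arg) (auto simp: reduce_def mod_eq_dvd_iff[symmetric])
  ultimately have "reduce ds (alt_map ds A (\<lambda>l. of_bool (l = j))) i = reduce ds (alt_map ds B (\<lambda>l. of_bool (l = j))) i" by simp
  then have *: "(A x * int (ds ! i div ?g)) mod int (ds ! i) = (B x * int (ds ! i div ?g)) mod int (ds ! i)" using ij by (simp add: reduce_def alt_map_single skew_def)
  \<comment> \<open>A coordinate below the gcd times \<open>ds ! i div ?g\<close> stays below
    \<open>ds ! i\<close>, so its residue determines it.\<close>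
  have "(C x * int (ds ! i div ?g)) mod int (ds ! i) = C x * int (ds ! i div ?g)" if "C \<in> alt_forms ds" for C
  proof (rule mod_pos_pos_trivial)
    have C: "0 \<le> C x" "C x < int ?g" using PiE_mem[OF that[unfolded alt_forms_def] x] ij by auto
    show "0 \<le> C x * int (ds ! i div ?g)" using C by simp
    have "C x * int (ds ! i div ?g) < int ?g * int (ds ! i div ?g)" using C d by (intro mult_strict_right_mono) (auto simp: div_greater_zero_iff gcd_le1_nat)
    also have "\<dots> = int (ds ! i)" by (metis dvd_mult_div_cancel gcd_dvd1 of_nat_mult)
    finally show "C x * int (ds ! i div ?g) < int (ds ! i)" .
  qed
  with * A have "A x * int (ds ! i div ?g) = B x * int (ds ! i div ?g)" by simp
  moreover have "ds ! i div ?g > 0" using d by (simp add: div_greater_zero_iff gcd_le1_nat)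
  ultimately show "A x = B x" by simp
qed

text \<open>The members of \<open>S\<close> above the unit tuples give the columns of a matrix;
  isotropy forces its diagonal to vanish and orthogonality makes it skew. The graph of the resulting
  map lies in \<open>S\<close> because \<open>S\<close> is closed under sums, and the sizes
  agree.\<close>

lemma alt_graph_surj:
  assumes ds: "pos_list ds" and S: "S \<in> good_cliques ds"
  shows "\<exists>A\<in>alt_forms ds. alt_graph ds A = S"
proof -
  let ?n = "length ds"
  let ?\<delta> = "\<lambda>j l. of_bool (l = j) :: int"
  have cl: "is_clique ds S" "wzero ds \<in> S" and sur: "snd ` S = cyc ds" using S by (auto simp: good_cliques_def)
  have "\<forall>j. \<exists>c. (c, reduce ds (?\<delta> j)) \<in> S"
  proof
    fix j have "reduce ds (?\<delta> j) \<in> snd ` S" unfolding sur by (rule reduce_carrier[OF ds])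
    then show "\<exists>c. (c, reduce ds (?\<delta> j)) \<in> S" by auto
  qed
  then obtain c where c: "\<And>j. (c j, reduce ds (?\<delta> j)) \<in> S" by metis
  have cG: "c j \<in> cyc ds" for j using c[of j] cl(1) by (auto simp: is_clique_def wspace_def)
  have crange: "0 \<le> c j i" "c j i < int (ds ! i)" if "i < ?n" for i j using cG[of j] that by (auto simp: cyc_prod_carrier[OF ds] PiE_iff)
  have pos: "ds ! i > 0" if "i < ?n" for i using ds that by (auto simp: pos_list_def)
  have diag: "c j j = 0" if j: "j < ?n" for j
  proof -
    have "chi ds (c j) (?\<delta> j) = 1" using clique_relations(1)[OF ds cl c c] by (simp add: chi_reduce_right[OF ds])
    then have "int (ds ! j) dvd c j j" unfolding chi_single[OF j] cis_frac_eq_1_iff[OF pos[OF j]] .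
    then show ?thesis using crange[OF j, of j] by (metis dvd_imp_le_int linorder_not_le abs_of_nonneg of_nat_0_le_iff)
  qed
  \<comment> \<open>Vanishing of the polar form: \<open>c i j / ds ! j + c j i / ds ! i\<close> is
    an integer. Here the denominators are cleared.\<close>
  have rel: "int (ds ! i * ds ! j) dvd c i j * int (ds ! i) + c j i * int (ds ! j)" if ij: "i < ?n" "j < ?n" for i j
  proof -
    have "chi ds (c i) (?\<delta> j) * chi ds (c j) (?\<delta> i) = 1" using clique_relations(2)[OF ds cl c c] by (simp add: chi_reduce_right[OF ds])
    then have "cis (2 * pi * (of_int (c i j) / of_nat (ds ! j) + of_int (c j i) / of_nat (ds ! i))) = 1"
      by (simp add: chi_single[OF ij(1)] chi_single[OF ij(2)] cis_mult distrib_left)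
    moreover have "of_int (c i j) / of_nat (ds ! j) + of_int (c j i) / of_nat (ds ! i) =
       (of_int (c i j * int (ds ! i) + c j i * int (ds ! j)) / of_nat (ds ! i * ds ! j) :: real)" using pos[OF ij(1)] pos[OF ij(2)] by (simp add: field_simps)
    ultimately have "cis (2 * pi * (of_int (c i j * int (ds ! i) + c j i * int (ds ! j)) / of_nat (ds ! i * ds ! j))) = 1" by (simp only:)
    then show ?thesis by (rule cis_frac_eq_1_iff[THEN iffD1, rotated]) (use pos[OF ij(1)] pos[OF ij(2)] in simp)
  qed
  define A where "A = (\<lambda>(i,j)\<in>alt_pairs ds. c j i div int (ds ! i div gcd (ds ! i) (ds ! j)))"
  \<comment> \<open>By the relation \<open>c j i * ds ! j\<close> is a multiple of
    \<open>ds ! i\<close>; dividing by the gcd leaves coprime cofactors.\<close>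
  have dv: "int (ds ! i div gcd (ds ! i) (ds ! j)) dvd c j i" if ij: "i < ?n" "j < ?n" for i j
  proof -
    let ?g = "gcd (ds ! i) (ds ! j)"
    have "int (ds ! i) dvd c i j * int (ds ! i) + c j i * int (ds ! j)" using rel[OF ij] by (metis dvd_mult_left of_nat_mult)
    then have "int (ds ! i) dvd c j i * int (ds ! j)" by (simp add: dvd_add_right_iff)
    then have "int (ds ! i div ?g) * int ?g dvd c j i * (int (ds ! j div ?g) * int ?g)" by (metis dvd_div_mult_self gcd_dvd1 gcd_dvd2 of_nat_mult)
    then have "int (ds ! i div ?g) dvd c j i * int (ds ! j div ?g)" using pos[OF ij(1)] by (simp add: mult.assoc[symmetric])
    moreover have "coprime (int (ds ! i div ?g)) (int (ds ! j div ?g))" using pos[OF ij(1)] by (simp add: div_gcd_coprime)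
    ultimately show ?thesis by (simp add: coprime_dvd_mult_left_iff)
  qed
  have Aform: "A \<in> alt_forms ds" unfolding alt_forms_def
  proof (rule PiE_I)
    fix x assume "x \<in> alt_pairs ds"
    then obtain i j where ij: "x = (i, j)" "i < j" "j < ?n" by (auto simp: alt_pairs_def)
    let ?g = "gcd (ds ! i) (ds ! j)"
    have i: "i < ?n" using ij by simp
    have m: "ds ! i div ?g > 0" using pos[OF i] by (simp add: div_greater_zero_iff gcd_le1_nat)
    have "c j i div int (ds ! i div ?g) < int ?g"
    proof -
      have "c j i < int ?g * int (ds ! i div ?g)" using crange[OF i, of j] by (metis dvd_mult_div_cancel gcd_dvd1 of_nat_mult)
      moreover obtain k where "c j i = int (ds ! i div ?g) * k" using dv[OF i ij(3)] by (elim dvdE)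
      ultimately show ?thesis using m by (simp add: mult.commute[of "int ?g"] mult_less_cancel_left_pos)
    qed
    moreover have "0 \<le> c j i div int (ds ! i div ?g)" using crange[OF i, of j] by (simp add: pos_imp_zdiv_nonneg_iff m)
    ultimately show "A x \<in> (case x of (i, j) \<Rightarrow> {0..<int (gcd (ds ! i) (ds ! j))})" using \<open>x \<in> alt_pairs ds\<close> ij by (simp add: A_def)
  qed (auto simp: A_def)
  have cmap: "int (ds ! i) dvd skew A i j * int (ds ! i div gcd (ds ! i) (ds ! j)) - c j i" if ij: "i < ?n" "j < ?n" for i j
  proof (cases i j rule: linorder_cases)
    case less
    then have "skew A i j * int (ds ! i div gcd (ds ! i) (ds ! j)) = c j i" using dv[OF ij] ij by (simp add: skew_def A_def alt_pairs_def)
    then show ?thesis by simp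
  next
    case equal
    then show ?thesis using diag ij by (simp add: skew_def)
  next
    \<comment> \<open>Only entries above the diagonal are stored, so the relation has to supply the
      sign and the change of scale from \<open>ds ! j div ?g\<close> to
      \<open>ds ! i div ?g\<close>.\<close>
    case greater
    let ?g = "gcd (ds ! j) (ds ! i)"
    define a where "a = c i j div int (ds ! j div ?g)"
    have a: "c i j = a * int (ds ! j div ?g)" using dv[OF ij(2,1)] by (simp add: a_def)
    obtain k where k: "c i j * int (ds ! i) + c j i * int (ds ! j) = int (ds ! i * ds ! j) * k" using rel[OF ij] by (elim dvdE)
    have "c i j * int (ds ! i) = a * int (ds ! i div ?g) * int (ds ! j)"
    proof -
      have "(ds ! j div ?g) * ds ! i = (ds ! i div ?g) * ds ! j"
        using dvd_div_mult[OF gcd_dvd1[of "ds ! j" "ds ! i"], of "ds ! i"] dvd_div_mult[OF gcd_dvd2[of "ds ! j" "ds ! i"], of "ds ! j"] by (metis mult.commute)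
      then have "int (ds ! j div ?g) * int (ds ! i) = int (ds ! i div ?g) * int (ds ! j)" by (metis of_nat_mult)
      then show ?thesis unfolding a by (simp add: mult.assoc)
    qed
    with k have "(a * int (ds ! i div ?g) + c j i) * int (ds ! j) = (int (ds ! i) * k) * int (ds ! j)" by (simp add: algebra_simps)
    then have "a * int (ds ! i div ?g) + c j i = int (ds ! i) * k" using pos[OF ij(2)] by simp
    then have "int (ds ! i) dvd a * int (ds ! i div ?g) + c j i" by simp
    moreover have "skew A i j * int (ds ! i div gcd (ds ! i) (ds ! j)) - c j i = - (a * int (ds ! i div ?g) + c j i)"
      using greater ij by (simp add: skew_def A_def alt_pairs_def a_def gcd.commute)
    ultimately show ?thesis by (simp only: dvd_minus_iff)
  qed
  have "alt_graph ds A \<subseteq> S"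
  proof
    fix s assume "s \<in> alt_graph ds A"
    then obtain f where f: "f \<in> cyc ds" "s = (reduce ds (alt_map ds A f), f)" by (auto simp: alt_graph_def)
    have fpos: "0 \<le> f j" if "j < ?n" for j using f that by (auto simp: cyc_prod_carrier[OF ds] PiE_iff)
    have "wred ds (c j) (?\<delta> j) \<in> S" for j using c[of j] cG[of j] by (simp add: wred_def reduce_id[OF ds])
    then have "wred ds (\<lambda>l. \<Sum>j<?n. int (nat (f j)) * c j l) (\<lambda>l. \<Sum>j<?n. int (nat (f j)) * ?\<delta> j l) \<in> S"
      by (intro clique_sum[OF ds cl]) auto
    moreover have "reduce ds (\<lambda>l. \<Sum>j<?n. int (nat (f j)) * ?\<delta> j l) = f"
    proof -
      have "(\<Sum>j<?n. int (nat (f j)) * ?\<delta> j l) = f l" if "l < ?n" for l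
      proof -
        have "(\<Sum>j<?n. int (nat (f j)) * ?\<delta> j l) = (\<Sum>j<?n. if j = l then f j else 0)" by (intro sum.cong) (auto simp: fpos)
        then show ?thesis using that by simp
      qed
      then have "reduce ds (\<lambda>l. \<Sum>j<?n. int (nat (f j)) * ?\<delta> j l) = reduce ds f" by (intro reduce_cong) simp
      then show ?thesis using f(1) by (simp add: reduce_id[OF ds])
    qed
    moreover have "reduce ds (\<lambda>l. \<Sum>j<?n. int (nat (f j)) * c j l) = reduce ds (alt_map ds A f)"
    proof (rule reduce_cong)
      fix i assume i: "i < ?n"
      have "(\<Sum>j<?n. int (nat (f j)) * c j i) - alt_map ds A f i
        = (\<Sum>j<?n. - (f j * (skew A i j * int (ds ! i div gcd (ds ! i) (ds ! j)) - c j i)))"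
        unfolding alt_map_def sum_subtractf[symmetric] by (intro sum.cong) (auto simp: fpos algebra_simps)
      also have "int (ds ! i) dvd \<dots>" using cmap[OF i] by (intro dvd_sum) (simp add: dvd_mult)
      finally show "int (ds ! i) dvd (\<Sum>j<?n. int (nat (f j)) * c j i) - alt_map ds A f i" .
    qed
    ultimately show "s \<in> S" using f by (simp add: wred_def)
  qed
  moreover have "finite S" "card S = card (alt_graph ds A)" using cl(1) wspace_finite[OF ds] alt_graph_good[OF ds, of A]
    by (auto simp: is_clique_def good_cliques_def intro: finite_subset)
  ultimately have "alt_graph ds A = S" by (simp add: card_subset_eq)
  then show ?thesis using Aform by blast
qed

lemma card_good_cliques: "pos_list ds \<Longrightarrow> card (good_cliques ds) = alt_count ds"
proof -
  assume ds: "pos_list ds"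
  have "bij_betw (alt_graph ds) (alt_forms ds) (good_cliques ds)" unfolding bij_betw_def
  proof
    show "inj_on (alt_graph ds) (alt_forms ds)" using alt_graph_inj[OF ds] by (intro inj_onI)
    show "alt_graph ds ` alt_forms ds = good_cliques ds" using alt_graph_good[OF ds] alt_graph_surj[OF ds] by blast
  qed
  then show ?thesis using bij_betw_same_card card_alt_forms by metis
qed

section \<open>The limit of the moments\<close>

lemma is_clique_iff:
  assumes ds: "pos_list ds"
  shows "clique_energy.max_clique (wspace ds) (kdist ds) (cyc_order ds) S \<longleftrightarrow> is_clique ds S"
  unfolding clique_energy.max_clique_def[OF clique_energy_kdist[OF ds]] is_clique_def kdist_eq_0_iff ..

lemma edge_weight_clique:
  assumes "is_clique ds (w ` {..<n})"
  shows "edge_weight ds q n w = 1" unfolding edge_weight_def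
proof (rule prod.neutral, rule ballI)
  fix e assume "e \<in> vertex_pairs n"
  then obtain i j where "i < j" "j < n" "Min e = i" "Max e = j" by (elim vertex_pairsE)
  then have "kern ds (w (Min e)) (w (Max e)) = 1" using assms by (simp add: is_clique_def)
  then show "of_real (1 - q) + of_real q * kern ds (w (Min e)) (w (Max e)) = 1" by simp
qed

text \<open>The second projection of a maximal clique through zero is closed under addition, hence a
  subgroup by finiteness; it generates the group only if it is the whole group.\<close>

lemma clique_generating_iff:
  assumes ds: "pos_list ds" and S: "is_clique ds (w ` {..<n})" and z: "wzero ds \<in> w ` {..<n}"
  shows "generating ds n (snd \<circ> w) \<longleftrightarrow> snd ` (w ` {..<n}) = cyc ds"
proof
  interpret G: comm_group "cyc_prod ds" by (rule cyc_prod_group)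
  let ?S = "w ` {..<n}" let ?K = "snd ` ?S"
  have SW: "?S \<subseteq> wspace ds" using S by (simp add: is_clique_def)
  then have KG: "?K \<subseteq> cyc ds" by (auto simp: wspace_def)
  {
    assume "?K = cyc ds"
    moreover have "?K \<subseteq> generate (cyc_prod ds) ?K" by (auto intro: generate.incl)
    moreover have "generate (cyc_prod ds) ?K \<subseteq> cyc ds" by (rule G.generate_incl[OF KG])
    ultimately show "generating ds n (snd \<circ> w)" by (auto simp: generating_def image_comp)
  }
  assume gen: "generating ds n (snd \<circ> w)"
  have closed: "x \<otimes>\<^bsub>cyc_prod ds\<^esub> y \<in> ?K" if xy: "x \<in> ?K" "y \<in> ?K" for x y
  proof -
    obtain s t where st: "s \<in> ?S" "x = snd s" "t \<in> ?S" "y = snd t" using imageE[OF xy(1)] imageE[OF xy(2)] by metis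
    define c c' where "c = fst s" and "c' = fst t"
    have c: "(c, x) \<in> ?S" "(c', y) \<in> ?S" using st by (simp_all add: c_def c'_def)
    then have G: "c \<in> cyc ds" "x \<in> cyc ds" "c' \<in> cyc ds" "y \<in> cyc ds" using SW by (auto simp: wspace_def)
    have red: "wred ds c x \<in> ?S" "wred ds c' y \<in> ?S" using c G by (simp_all add: wred_def reduce_id[OF ds])
    have "reduce ds (\<lambda>l. x l + y l) \<in> ?K" using imageI[OF clique_add[OF ds S z red], of snd] by (simp add: wred_def)
    moreover have "reduce ds (\<lambda>l. x l + y l) = x \<otimes>\<^bsub>cyc_prod ds\<^esub> y" using reduce_mult[of ds x y] G by (simp add: reduce_id[OF ds])
    ultimately show ?thesis by simp
  qed
  have one: "cyc_one ds \<in> ?K" using imageI[OF z, of snd] by simp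
  have finK: "finite ?K" by simp
  \<comment> \<open>Translation by \<open>x\<close> is an injection of the finite set
    \<open>?K\<close> into itself, so it hits the identity.\<close>
  have inv: "inv\<^bsub>cyc_prod ds\<^esub> x \<in> ?K" if x: "x \<in> ?K" for x
  proof -
    have "(\<lambda>y. x \<otimes>\<^bsub>cyc_prod ds\<^esub> y) ` ?K = ?K"
    proof (rule endo_inj_surj[OF finK])
      show "(\<lambda>y. x \<otimes>\<^bsub>cyc_prod ds\<^esub> y) ` ?K \<subseteq> ?K" using closed[OF x] by (rule image_subsetI)
      show "inj_on (\<lambda>y. x \<otimes>\<^bsub>cyc_prod ds\<^esub> y) ?K"
      proof (rule inj_onI)
        fix a b assume "a \<in> ?K" "b \<in> ?K" and eq: "x \<otimes>\<^bsub>cyc_prod ds\<^esub> a = x \<otimes>\<^bsub>cyc_prod ds\<^esub> b"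
        then have "x \<in> cyc ds" "a \<in> cyc ds" "b \<in> cyc ds" using KG x by blast+
        then show "a = b" using eq by simp
      qed
    qed
    then obtain y where y: "y \<in> ?K" "x \<otimes>\<^bsub>cyc_prod ds\<^esub> y = cyc_one ds" using one by (metis (no_types, lifting) imageE)
    have "x \<in> cyc ds" "y \<in> cyc ds" using KG x y(1) by blast+
    then have "inv\<^bsub>cyc_prod ds\<^esub> x = y" using y(2) G.m_comm[of x y] by (intro G.inv_equality) simp_all
    then show ?thesis using y by simp
  qed
  have "x \<in> ?K" if "x \<in> generate (cyc_prod ds) ?K" for x using that by (induction rule: generate.induct) (simp_all only: one inv closed)
  then show "?K = cyc ds" using gen KG by (auto simp: generating_def image_comp)
qed

text \<open>Union bound over the missed label: those labellings that avoid one given label form the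
  fraction ((g-1)/g)^(n-1) of all. The value at 0 is fixed, hence \<open>n - 1\<close>.\<close>

lemma count_surjective_maps:
  fixes S :: "'a set"
  assumes fin: "finite S" and z: "z \<in> S"
  shows "(\<lambda>n. real (card {w \<in> {..<n} \<rightarrow>\<^sub>E S. w 0 = z \<and> w ` {..<n} = S}) / real (card S) ^ (n - 1)) \<longlonglongrightarrow> 1"
proof -
  let ?g = "real (card S)"
  have g: "?g \<ge> 1" using fin z by (metis One_nat_def Suc_leI card_gt_0_iff empty_iff of_nat_1 of_nat_mono)
  define P where "P = (\<lambda>(n::nat) T. {w \<in> {..<n} \<rightarrow>\<^sub>E T. w 0 = z})"
  have cardP: "card (P n T) = card T ^ (n - 1)" if "finite T" "z \<in> T" "n \<ge> 1" for n T
  proof -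
    have "P n T = (\<Pi>\<^sub>E j\<in>{..<n}. if j = 0 then {z} else T)" using PiE_pin_iff[OF that(3,2)] by (auto simp: P_def)
    then have "card (P n T) = (\<Prod>j<n. card (if j = 0 then {z} else T))" by (simp add: card_PiE)
    also have "\<dots> = (\<Prod>j\<in>insert 0 {1..<n}. card (if j = 0 then {z} else T))" using that by (intro prod.cong) auto
    also have "\<dots> = card T ^ (n - 1)" by (subst prod.insert) auto
    finally show ?thesis .
  qed
  have finP: "finite (P n T)" if "finite T" for n T unfolding P_def using that by (intro finite_subset[OF _ finite_PiE[of "{..<n}" "\<lambda>_. T"]]) auto
  let ?A = "\<lambda>n. {w \<in> {..<n} \<rightarrow>\<^sub>E S. w 0 = z \<and> w ` {..<n} = S}"
  have up: "real (card (?A n)) / ?g ^ (n - 1) \<le> 1" if "n \<ge> 1" for n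
  proof -
    have "card (?A n) \<le> card (P n S)" using finP[OF fin] by (intro card_mono) (auto simp: P_def)
    then have "real (card (?A n)) \<le> real (card S ^ (n - 1))" unfolding cardP[OF fin z that] by (rule of_nat_mono)
    then show ?thesis using g by (simp add: divide_le_eq_1)
  qed
  have lo: "1 - ?g * ((?g - 1) / ?g) ^ (n - 1) \<le> real (card (?A n)) / ?g ^ (n - 1)" if n: "n \<ge> 1" for n
  proof -
    have sub: "P n S \<subseteq> ?A n \<union> (\<Union>s\<in>S - {z}. P n (S - {s}))"
    proof
      fix w assume w: "w \<in> P n S"
      show "w \<in> ?A n \<union> (\<Union>s\<in>S - {z}. P n (S - {s}))"
      proof (cases "w ` {..<n} = S")
        case True then show ?thesis using w by (auto simp: P_def)
      next
        case False
        have wS: "w \<in> {..<n} \<rightarrow>\<^sub>E S" and wz: "w 0 = z" using w by (simp_all add: P_def)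
        have "w ` {..<n} \<subseteq> S" using wS by auto
        then obtain s where s: "s \<in> S" "s \<notin> w ` {..<n}" using False by blast
        have "z \<in> w ` {..<n}" using wz n by (intro image_eqI[of _ _ 0]) auto
        then have "s \<noteq> z" using s by blast
        moreover have "w \<in> {..<n} \<rightarrow>\<^sub>E S - {s}"
        proof (rule PiE_I)
          fix i assume i: "i \<in> {..<n}"
          have "w i \<in> w ` {..<n}" using i by (rule imageI)
          then have "w i \<noteq> s" using s(2) by blast
          then show "w i \<in> S - {s}" using PiE_mem[OF wS i] by simp
        qed (use PiE_arb[OF wS] in blast)
        ultimately show ?thesis using s(1) wz by (auto simp: P_def)
      qed
    qed
    have "card (P n S) \<le> card (?A n \<union> (\<Union>s\<in>S - {z}. P n (S - {s})))"
    proof (rule card_mono[OF _ sub])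
      have "finite (?A n)" by (rule finite_subset[OF _ finP[OF fin, of n]]) (auto simp: P_def)
      then show "finite (?A n \<union> (\<Union>s\<in>S - {z}. P n (S - {s})))" using fin finP by simp
    qed
    also have "\<dots> \<le> card (?A n) + card (\<Union>s\<in>S - {z}. P n (S - {s}))" by (rule card_Un_le)
    also have "card (\<Union>s\<in>S - {z}. P n (S - {s})) \<le> (\<Sum>s\<in>S - {z}. card (P n (S - {s})))" using fin by (intro card_UN_le) auto
    also have "\<dots> = (\<Sum>s\<in>S - {z}. (card S - 1) ^ (n - 1))" using fin z n by (intro sum.cong refl) (subst cardP; auto)
    also have "\<dots> \<le> card S * (card S - 1) ^ (n - 1)" using fin by (simp add: card_mono)
    finally have "card S ^ (n - 1) \<le> card (?A n) + card S * (card S - 1) ^ (n - 1)" using cardP[OF fin z n] by simp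
    then have "real (card S ^ (n - 1)) \<le> real (card (?A n) + card S * (card S - 1) ^ (n - 1))" by (rule of_nat_mono)
    then have "?g ^ (n - 1) \<le> real (card (?A n)) + ?g * (?g - 1) ^ (n - 1)" using g by (simp add: of_nat_diff)
    then have "(?g ^ (n - 1) - ?g * (?g - 1) ^ (n - 1)) / ?g ^ (n - 1) \<le> real (card (?A n)) / ?g ^ (n - 1)" using g by (intro divide_right_mono) auto
    moreover have "(?g ^ (n - 1) - ?g * (?g - 1) ^ (n - 1)) / ?g ^ (n - 1) = 1 - ?g * ((?g - 1) / ?g) ^ (n - 1)"
      using g by (subst power_divide) (simp add: diff_divide_distrib)
    ultimately show ?thesis by (simp only:)
  qed
  show ?thesis
  proof (rule tendsto_sandwich)
    have "(\<lambda>n. ((?g - 1) / ?g) ^ n) \<longlonglongrightarrow> 0" using g by (intro LIMSEQ_power_zero) auto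
    then have "(\<lambda>n. ((?g - 1) / ?g) ^ (n - 1)) \<longlonglongrightarrow> 0" by (subst filterlim_sequentially_Suc[symmetric]) simp
    from tendsto_diff[OF tendsto_const tendsto_mult_left[OF this, of ?g], of 1]
    show "(\<lambda>n. 1 - ?g * ((?g - 1) / ?g) ^ (n - 1)) \<longlonglongrightarrow> 1" by simp
    show "eventually (\<lambda>n. 1 - ?g * ((?g - 1) / ?g) ^ (n - 1) \<le> real (card (?A n)) / ?g ^ (n - 1)) sequentially"
      using eventually_ge_at_top[of 1] by eventually_elim (rule lo)
    show "eventually (\<lambda>n. real (card (?A n)) / ?g ^ (n - 1) \<le> 1) sequentially" using eventually_ge_at_top[of 1] by eventually_elim (rule up)
  qed simp
qed

text \<open>Labellings whose image is a maximal clique have edge weight exactly 1, and almost all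
  labellings into a given good clique fill it; all others are bounded by \<open>bad\<close>. Each
  good clique contributes 1 in the limit.\<close>

theorem harmonic_surj_moment:
  fixes q :: "nat \<Rightarrow> real"
  assumes ds: "pos_list ds" and c: "c > 1"
    and q: "eventually (\<lambda>n. c * ln n \<le> real n * (q n * (1 - q n))) sequentially"
    and q01: "eventually (\<lambda>n. 0 \<le> q n \<and> q n \<le> 1) sequentially"
  shows "(\<lambda>n. measure_pmf.expectation (erdos_renyi n (q n)) (\<lambda>E. real (card (harmonic_surj ds n E))))
    \<longlonglongrightarrow> real (alt_count ds)"
proof -
  interpret clique_energy "wspace ds" "kdist ds" "cyc_order ds" by (rule clique_energy_kdist[OF ds])
  let ?g = "real (cyc_order ds)"
  have g: "?g \<ge> 1" using g_pos by simp
  define M where "M = (\<lambda>n. measure_pmf.expectation (erdos_renyi n (q n)) (\<lambda>E. real (card (harmonic_surj ds n E))))"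
  define N where "N = (\<lambda>(n::nat) S. card {w \<in> {..<n} \<rightarrow>\<^sub>E S. w 0 = wzero ds \<and> w ` {..<n} = S})"
  define bad where "bad = (\<lambda>n. (\<Sum>w | w \<in> {..<n} \<rightarrow>\<^sub>E wspace ds \<and> \<not> max_clique (w ` {..<n}).
      exp (- (q n * (1 - q n)) * energy (kdist ds) n w)) / ?g ^ n)"
  have fing: "finite (good_cliques ds)" by (rule finite_subset[of _ "Pow (wspace ds)"]) (auto simp: good_cliques_def is_clique_def finite_W)
  have S: "finite S" "card S = cyc_order ds" "wzero ds \<in> S" "S \<subseteq> wspace ds" if "S \<in> good_cliques ds" for S
    using that finite_subset[OF _ finite_W] by (auto simp: good_cliques_def is_clique_def)
  have "bad \<longlonglongrightarrow> 0" unfolding bad_def by (rule bad_weight_tendsto_0[OF c q])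
  \<comment> \<open>The moment is normalised by \<open>g ^ (n - 1)\<close> and the bad sum by
    \<open>g ^ n\<close>, which costs a factor \<open>g\<close>.\<close>
  then have bad0: "(\<lambda>n. ?g * bad n) \<longlonglongrightarrow> 0" using tendsto_mult_right_zero by blast
  have close: "eventually (\<lambda>n. norm (M n - (\<Sum>S\<in>good_cliques ds. real (N n S) / ?g ^ (n - 1))) \<le> ?g * bad n) sequentially"
    using q01 eventually_ge_at_top[of 1]
  proof eventually_elim
    case (elim n)
    then have n: "n \<ge> 1" and q': "0 \<le> q n" "q n \<le> 1" by auto
    let ?W = "{w. w \<in> wpinned ds n \<and> generating ds n (snd \<circ> w)}"
    let ?B = "{w. w \<in> {..<n} \<rightarrow>\<^sub>E wspace ds \<and> \<not> max_clique (w ` {..<n})}"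
    let ?W1 = "{w \<in> ?W. is_clique ds (w ` {..<n})}" and ?W2 = "{w \<in> ?W. \<not> is_clique ds (w ` {..<n})}"
    have finA: "finite ({..<n} \<rightarrow>\<^sub>E wspace ds)" using finite_W by (intro finite_PiE) auto
    have finW: "finite ?W" by (rule finite_subset[OF _ finA]) (auto simp: wpinned_def)
    have W1: "?W1 = (\<Union>S\<in>good_cliques ds. {w \<in> {..<n} \<rightarrow>\<^sub>E S. w 0 = wzero ds \<and> w ` {..<n} = S})" (is "_ = ?U")
    proof (intro Set.set_eqI iffI)
      fix w assume w: "w \<in> ?W1"
      then have w1: "w \<in> {..<n} \<rightarrow>\<^sub>E wspace ds" "w 0 = wzero ds" "generating ds n (snd \<circ> w)" "is_clique ds (w ` {..<n})"
        by (auto simp: wpinned_def)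
      have z: "wzero ds \<in> w ` {..<n}" using w1(2) n by (intro image_eqI[of _ _ 0]) auto
      have "w ` {..<n} \<in> good_cliques ds" using clique_generating_iff[OF ds w1(4) z] w1(3,4) z by (simp add: good_cliques_def)
      moreover have "w \<in> {..<n} \<rightarrow>\<^sub>E w ` {..<n}" using PiE_arb[OF w1(1)] by (intro PiE_I imageI) auto
      ultimately show "w \<in> ?U" using w1(2) by (intro UN_I[of "w ` {..<n}"]) simp_all
    next
      fix w assume "w \<in> ?U"
      then obtain T where T: "T \<in> good_cliques ds" "w \<in> {..<n} \<rightarrow>\<^sub>E T" "w 0 = wzero ds" "w ` {..<n} = T" by (elim UN_E) simp
      then have T': "is_clique ds (w ` {..<n})" "wzero ds \<in> w ` {..<n}" "snd ` (w ` {..<n}) = cyc ds" by (auto simp: good_cliques_def)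
      have "w \<in> {..<n} \<rightarrow>\<^sub>E wspace ds" using T(2) PiE_mono[of "{..<n}" "\<lambda>_. T" "\<lambda>_. wspace ds"] S(4)[OF T(1)] by blast
      then show "w \<in> ?W1" using clique_generating_iff[OF ds T'(1,2)] T' T(3) by (simp add: wpinned_def)
    qed
    have "card ?W1 = (\<Sum>S\<in>good_cliques ds. N n S)" unfolding W1 N_def
    proof (rule card_UN_disjoint[OF fing])
      show "\<forall>S\<in>good_cliques ds. finite {w \<in> {..<n} \<rightarrow>\<^sub>E S. w 0 = wzero ds \<and> w ` {..<n} = S}"
      proof
        fix T assume "T \<in> good_cliques ds"
        then have "finite ({..<n} \<rightarrow>\<^sub>E T)" using S(1) by (intro finite_PiE) auto
        then show "finite {w \<in> {..<n} \<rightarrow>\<^sub>E T. w 0 = wzero ds \<and> w ` {..<n} = T}" by simp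
      qed
    qed blast
    moreover have "(\<Sum>w\<in>?W. edge_weight ds (q n) n w) = (\<Sum>w\<in>?W1. edge_weight ds (q n) n w) + (\<Sum>w\<in>?W2. edge_weight ds (q n) n w)"
    proof -
      have "(\<Sum>w\<in>?W1 \<union> ?W2. edge_weight ds (q n) n w) = (\<Sum>w\<in>?W1. edge_weight ds (q n) n w) + (\<Sum>w\<in>?W2. edge_weight ds (q n) n w)"
        by (intro sum.union_disjoint finite_subset[OF _ finW]) blast+
      moreover have "?W1 \<union> ?W2 = ?W" by blast
      ultimately show ?thesis by (simp only:)
    qed
    moreover have "(\<Sum>w\<in>?W1. edge_weight ds (q n) n w) = of_nat (card ?W1)" by (simp add: edge_weight_clique)
    moreover have "of_real (M n * ?g ^ (n - 1)) = (\<Sum>w\<in>?W. edge_weight ds (q n) n w)" unfolding M_def by (rule expected_harmonic_surj[OF ds n q'])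
    ultimately have eq: "of_real (M n * ?g ^ (n - 1) - (\<Sum>S\<in>good_cliques ds. real (N n S))) = (\<Sum>w\<in>?W2. edge_weight ds (q n) n w)" by simp
    have "norm (\<Sum>w\<in>?W2. edge_weight ds (q n) n w) \<le> (\<Sum>w\<in>?W2. exp (- (q n * (1 - q n)) * energy (kdist ds) n w))"
      by (rule sum_norm_le) (rule norm_edge_weight_le[OF q'])
    also have "\<dots> \<le> (\<Sum>w\<in>?B. exp (- (q n * (1 - q n)) * energy (kdist ds) n w))"
      by (rule sum_mono2) (use finA in \<open>auto simp: wpinned_def is_clique_iff[OF ds]\<close>)
    also have "\<dots> = bad n * ?g ^ n" using g by (simp add: bad_def)
    finally have "norm (of_real (M n * ?g ^ (n - 1) - (\<Sum>S\<in>good_cliques ds. real (N n S))) :: complex) \<le> bad n * ?g ^ n" unfolding eq .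
    then have 1: "\<bar>M n * ?g ^ (n - 1) - (\<Sum>S\<in>good_cliques ds. real (N n S))\<bar> \<le> bad n * ?g ^ n" by (simp only: norm_of_real)
    have gp: "?g ^ (n - 1) > 0" using g by simp
    have "\<bar>M n - (\<Sum>S\<in>good_cliques ds. real (N n S) / ?g ^ (n - 1))\<bar> * ?g ^ (n - 1)
       = \<bar>(M n - (\<Sum>S\<in>good_cliques ds. real (N n S) / ?g ^ (n - 1))) * ?g ^ (n - 1)\<bar>" using gp by (simp add: abs_mult)
    also have "(M n - (\<Sum>S\<in>good_cliques ds. real (N n S) / ?g ^ (n - 1))) * ?g ^ (n - 1) = M n * ?g ^ (n - 1) - (\<Sum>S\<in>good_cliques ds. real (N n S))"
    proof -
      have "real (N n T) / ?g ^ (n - 1) * ?g ^ (n - 1) = real (N n T)" for T using gp by (metis less_irrefl nonzero_eq_divide_eq)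
      then show ?thesis by (simp only: left_diff_distrib sum_distrib_right)
    qed
    also note 1
    also have "bad n * ?g ^ n = ?g * bad n * ?g ^ (n - 1)" using n by (cases n) auto
    finally have "\<bar>M n - (\<Sum>S\<in>good_cliques ds. real (N n S) / ?g ^ (n - 1))\<bar> \<le> ?g * bad n" using gp by (rule mult_right_le_imp_le)
    then show ?case by simp
  qed
  have "(\<lambda>n. M n - (\<Sum>S\<in>good_cliques ds. real (N n S) / ?g ^ (n - 1))) \<longlonglongrightarrow> 0" by (rule Lim_null_comparison[OF close bad0])
  moreover have "(\<lambda>n. \<Sum>S\<in>good_cliques ds. real (N n S) / ?g ^ (n - 1)) \<longlonglongrightarrow> (\<Sum>S\<in>good_cliques ds. 1)"
  proof (rule tendsto_sum)
    fix T assume "T \<in> good_cliques ds"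
    from count_surjective_maps[OF S(1)[OF this] S(3)[OF this]] S(2)[OF this]
    show "(\<lambda>n. real (N n T) / ?g ^ (n - 1)) \<longlonglongrightarrow> 1" by (simp add: N_def)
  qed
  ultimately have "(\<lambda>n. (M n - (\<Sum>S\<in>good_cliques ds. real (N n S) / ?g ^ (n - 1))) + (\<Sum>S\<in>good_cliques ds. real (N n S) / ?g ^ (n - 1))) \<longlonglongrightarrow> 0 + (\<Sum>S\<in>good_cliques ds. 1)"
    by (rule tendsto_add)
  then show ?thesis using card_good_cliques[OF ds] by (simp add: M_def)
qed

section \<open>Structure of finite abelian p-groups\<close>

lemma cyc_prod_snoc_iso:
  assumes "d > 0" "pos_list ds"
  shows "cyc_prod ds \<times>\<times> integer_mod_group d \<cong> cyc_prod (ds @ [d])"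
proof -
  let ?n = "length ds"
  let ?f = "\<lambda>(x, t). \<lambda>l\<in>{..<Suc ?n}. if l < ?n then x l else t"
  have ds': "pos_list (ds @ [d])" using assms by (auto simp: pos_list_def nth_append less_Suc_eq)
  have ca: "cyc ds = (\<Pi>\<^sub>E l\<in>{..<?n}. {0..<int (ds ! l)})" by (rule cyc_prod_carrier[OF assms(2)])
  have cb: "carrier (cyc_prod (ds @ [d])) = (\<Pi>\<^sub>E l\<in>{..<Suc ?n}. {0..<int ((ds @ [d]) ! l)})" using cyc_prod_carrier[OF ds'] by simp
  have cd: "carrier (integer_mod_group d) = {0..<int d}" using assms(1) by (simp add: carrier_integer_mod_group)
  have mem: "?f (x, t) \<in> carrier (cyc_prod (ds @ [d]))" if "x \<in> cyc ds" "t \<in> {0..<int d}" for x t unfolding cb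
  proof (rule PiE_I)
    fix l assume l: "l \<in> {..<Suc ?n}"
    show "?f (x, t) l \<in> {0..<int ((ds @ [d]) ! l)}"
    proof (cases "l < ?n")
      case True
      then have "x l \<in> {0..<int (ds ! l)}" using that(1) unfolding ca by (simp add: PiE_iff)
      then show ?thesis using True by (simp add: nth_append)
    next
      case False
      then have "l = ?n" using l by simp
      then show ?thesis using that(2) by simp
    qed
  qed simp
  have "?f \<in> hom (cyc_prod ds \<times>\<times> integer_mod_group d) (cyc_prod (ds @ [d]))"
  proof (rule homI)
    fix a b assume ab: "a \<in> carrier (cyc_prod ds \<times>\<times> integer_mod_group d)" "b \<in> carrier (cyc_prod ds \<times>\<times> integer_mod_group d)"
    show "?f a \<in> carrier (cyc_prod (ds @ [d]))" using ab(1) mem by (cases a) (simp add: cd)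
    show "?f (a \<otimes>\<^bsub>cyc_prod ds \<times>\<times> integer_mod_group d\<^esub> b) = ?f a \<otimes>\<^bsub>cyc_prod (ds @ [d])\<^esub> ?f b"
      by (cases a; cases b) (auto simp: cyc_prod_mult fun_eq_iff nth_append less_Suc_eq)
  qed
  moreover have "bij_betw ?f (carrier (cyc_prod ds \<times>\<times> integer_mod_group d)) (carrier (cyc_prod (ds @ [d])))"
  proof (rule bij_betw_byWitness[where f'="\<lambda>z. (\<lambda>l\<in>{..<?n}. z l, z ?n)"])
    show "\<forall>a\<in>carrier (cyc_prod ds \<times>\<times> integer_mod_group d). (\<lambda>l\<in>{..<?n}. ?f a l, ?f a ?n) = a"
    proof
      fix a assume a: "a \<in> carrier (cyc_prod ds \<times>\<times> integer_mod_group d)"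
      obtain x t where xt: "a = (x, t)" by (cases a)
      have "x \<in> extensional {..<?n}" using a unfolding xt by (simp add: ca PiE_iff)
      then show "(\<lambda>l\<in>{..<?n}. ?f a l, ?f a ?n) = a" unfolding xt by (auto simp: fun_eq_iff extensional_def)
    qed
    show "\<forall>z\<in>carrier (cyc_prod (ds @ [d])). ?f (\<lambda>l\<in>{..<?n}. z l, z ?n) = z"
    proof
      fix z assume "z \<in> carrier (cyc_prod (ds @ [d]))"
      then have "z \<in> extensional {..<Suc ?n}" unfolding cb by (simp add: PiE_iff)
      then show "?f (\<lambda>l\<in>{..<?n}. z l, z ?n) = z" by (auto simp: fun_eq_iff extensional_def less_Suc_eq)
    qed
    show "?f ` carrier (cyc_prod ds \<times>\<times> integer_mod_group d) \<subseteq> carrier (cyc_prod (ds @ [d]))" using mem by (auto simp: cd simp del: restrict_apply)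
    show "(\<lambda>z. (\<lambda>l\<in>{..<?n}. z l, z ?n)) ` carrier (cyc_prod (ds @ [d])) \<subseteq> carrier (cyc_prod ds \<times>\<times> integer_mod_group d)"
    proof
      fix a assume "a \<in> (\<lambda>z. (\<lambda>l\<in>{..<?n}. z l, z ?n)) ` carrier (cyc_prod (ds @ [d]))"
      then obtain z where z: "z \<in> carrier (cyc_prod (ds @ [d]))" "a = (\<lambda>l\<in>{..<?n}. z l, z ?n)" by blast
      have zl: "z l \<in> {0..<int ((ds @ [d]) ! l)}" if "l < Suc ?n" for l using z(1) that unfolding cb by (simp add: PiE_iff)
      have "(\<lambda>l\<in>{..<?n}. z l) \<in> cyc ds" unfolding ca
      proof (rule PiE_I)
        fix l assume "l \<in> {..<?n}"
        then show "(\<lambda>l\<in>{..<?n}. z l) l \<in> {0..<int (ds ! l)}" using zl[of l] by (simp add: nth_append)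
      qed simp
      moreover have "z ?n \<in> {0..<int d}" using zl[of ?n] by simp
      ultimately show "a \<in> carrier (cyc_prod ds \<times>\<times> integer_mod_group d)" unfolding z(2) by (simp add: cd)
    qed
  qed
  ultimately show ?thesis unfolding is_iso_def iso_def by blast
qed

context comm_group
begin

lemma subgroup_adjoin:
  assumes K: "subgroup K G" and z: "z \<in> carrier G"
  shows "subgroup {k \<otimes> z [^] j |k j. k \<in> K \<and> j \<in> (UNIV :: int set)} G" (is "subgroup ?M G")
proof -
  have KG: "K \<subseteq> carrier G" by (rule subgroup.subset[OF K])
  show ?thesis
  proof (rule subgroupI)
    show "?M \<subseteq> carrier G" using KG z by auto
    show "?M \<noteq> {}" using subgroup.one_closed[OF K] by auto
    show "inv a \<in> ?M" if "a \<in> ?M" for a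
    proof -
      obtain k and j :: int where a: "k \<in> K" "a = k \<otimes> z [^] j" using \<open>a \<in> ?M\<close> by auto
      then have kG: "k \<in> carrier G" using KG by blast
      have "inv a = inv k \<otimes> z [^] (- j)" using a kG z by (simp add: inv_mult int_pow_neg)
      then show ?thesis using subgroup.m_inv_closed[OF K a(1)] by blast
    qed
    show "a \<otimes> b \<in> ?M" if "a \<in> ?M" "b \<in> ?M" for a b
    proof -
      obtain k k' and j j' :: int where a: "k \<in> K" "a = k \<otimes> z [^] j" "k' \<in> K" "b = k' \<otimes> z [^] j'"
        using \<open>a \<in> ?M\<close> \<open>b \<in> ?M\<close> by auto
      then have kG: "k \<in> carrier G" "k' \<in> carrier G" using KG by auto
      have "a \<otimes> b = (k \<otimes> k') \<otimes> z [^] (j + j')" using a kG z by (simp add: int_pow_mult m_ac)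
      then show ?thesis using subgroup.m_closed[OF K a(1,3)] by blast
    qed
  qed
qed

text \<open>Take \<open>K\<close> of largest order among the subgroups that meet the powers of
  \<open>x\<close> trivially. If \<open>K\<close> and \<open>x\<close> did not span, some
  \<open>y\<close> outside the span \<open>?M\<close> would have its p-th power inside. Correcting
  \<open>y\<close> by a power of \<open>x\<close> puts the p-th power into \<open>K\<close>, and
  adjoining the corrected element enlarges \<open>K\<close> while still avoiding the powers of
  \<open>x\<close>.\<close>

lemma cyclic_complement:
  assumes fin: "finite (carrier G)" and p: "Factorial_Ring.prime p" and x: "x \<in> carrier G"
    and ordx: "ord x = p ^ e" and e: "e \<ge> 1" and expo: "\<And>y. y \<in> carrier G \<Longrightarrow> y [^] (p ^ e) = \<one>"
  shows "\<exists>K. subgroup K G \<and> (\<forall>j::int. x [^] j \<in> K \<longrightarrow> x [^] j = \<one>) \<and>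
      (\<forall>y\<in>carrier G. \<exists>k\<in>K. \<exists>j::int. y = k \<otimes> x [^] j)"
proof -
  let ?C = "\<lambda>K. subgroup K G \<and> (\<forall>j::int. x [^] j \<in> K \<longrightarrow> x [^] j = \<one>)"
  have "?C {\<one>}" using triv_subgroup by simp
  moreover have "\<forall>K. ?C K \<longrightarrow> card K < Suc (card (carrier G))" using fin by (auto intro!: card_mono le_imp_less_Suc dest: subgroup.subset)
  ultimately have "\<exists>K. ?C K \<and> (\<forall>K'. ?C K' \<longrightarrow> card K' \<le> card K)"
    by (rule ex_has_greatest_nat[of ?C "{\<one>}" card "Suc (card (carrier G))"])
  then obtain K where CK: "?C K" and max': "\<forall>K'. ?C K' \<longrightarrow> card K' \<le> card K" by (elim exE conjE) auto
  then have K: "subgroup K G" "\<And>j::int. x [^] j \<in> K \<Longrightarrow> x [^] j = \<one>" by auto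
  note max = max'[rule_format]
  have KG: "K \<subseteq> carrier G" by (rule subgroup.subset[OF K(1)])
  have finK: "finite K" using KG fin finite_subset by blast
  let ?M = "{k \<otimes> x [^] j |k j. k \<in> K \<and> j \<in> (UNIV :: int set)}"
  have M: "subgroup ?M G" by (rule subgroup_adjoin[OF K(1) x])
  have KM: "K \<subseteq> ?M"
  proof
    fix k assume k: "k \<in> K"
    then have "k = k \<otimes> x [^] (0::int)" using KG by auto
    then show "k \<in> ?M" using k by blast
  qed
  have xM: "x [^] (j::int) \<in> ?M" for j
  proof -
    have "x [^] j = \<one> \<otimes> x [^] j" using x by simp
    then show ?thesis using subgroup.one_closed[OF K(1)] by blast
  qed
  have "carrier G \<subseteq> ?M"
  proof (rule ccontr)
    assume "\<not> carrier G \<subseteq> ?M"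
    then obtain y0 where y0: "y0 \<in> carrier G" "y0 \<notin> ?M" by blast
    \<comment> \<open>The first power of \<open>p\<close> that brings \<open>y0\<close> into
      \<open>?M\<close>; the step before it yields \<open>y\<close>.\<close>
    define i where "i = (LEAST i. y0 [^] (p ^ i) \<in> ?M)"
    have ex: "y0 [^] (p ^ e) \<in> ?M" using expo[OF y0(1)] subgroup.one_closed[OF M] by simp
    have i1: "y0 [^] (p ^ i) \<in> ?M" unfolding i_def by (rule LeastI[of _ e]) (rule ex)
    have "i \<noteq> 0" using i1 y0 by (intro notI) simp
    then obtain i' where i': "i = Suc i'" by (cases i) auto
    define y where "y = y0 [^] (p ^ i')"
    have yG: "y \<in> carrier G" using y0 by (simp add: y_def)
    have yM: "y \<notin> ?M" unfolding y_def using not_less_Least[of i' "\<lambda>i. y0 [^] (p ^ i) \<in> ?M"] i' by (simp add: i_def)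
    have "y [^] p = y0 [^] (p ^ i)" using y0 by (simp add: y_def i' nat_pow_pow mult.commute)
    with i1 have "y [^] p \<in> ?M" by simp
    then obtain k and m :: int where km: "k \<in> K" "y [^] p = k \<otimes> x [^] m" by auto
    have kG: "k \<in> carrier G" using km KG by auto
    \<comment> \<open>Raise \<open>y [^] p = k \<otimes> x [^] m\<close> to the power
      \<open>p ^ (e - 1)\<close>: the left side dies because \<open>p ^ e\<close> kills the group,
      so this power of \<open>x\<close> lies in \<open>K\<close>. Its triviality forces
      \<open>p\<close> to divide \<open>m\<close>.\<close>
    have "x [^] (m * int (p ^ (e - 1))) = \<one>"
    proof (rule K(2))
      have pe: "p ^ e = p * p ^ (e - 1)" using e by (cases e) auto
      have "\<one> = (y [^] p) [^] (p ^ (e - 1))" using expo[OF yG] yG by (simp add: nat_pow_pow pe)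
      also have "\<dots> = k [^] (p ^ (e - 1)) \<otimes> (x [^] m) [^] (p ^ (e - 1))" unfolding km(2) using kG x by (intro nat_pow_distrib) auto
      also have "(x [^] m) [^] (p ^ (e - 1)) = x [^] (m * int (p ^ (e - 1)))" using x by (simp add: int_pow_pow flip: int_pow_int)
      finally have "inv (k [^] (p ^ (e - 1))) = x [^] (m * int (p ^ (e - 1)))" using kG x by (intro inv_equality) (simp_all add: m_comm)
      moreover have "inv (k [^] (p ^ (e - 1))) \<in> K" using subgroup.m_inv_closed[OF K(1) subgroup_int_pow_closed[OF K(1) km(1), of "int (p ^ (e - 1))"]]
        by (simp only: int_pow_int)
      ultimately show "x [^] (m * int (p ^ (e - 1))) \<in> K" by simp
    qed
    then have "int (p ^ e) dvd m * int (p ^ (e - 1))" using int_pow_eq_id[OF x] ordx by simp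
    then have "int p * int (p ^ (e - 1)) dvd m * int (p ^ (e - 1))" using e by (cases e) auto
    then have "int p dvd m" using p by (simp add: prime_gt_0_nat)
    then obtain m' where m': "m = int p * m'" by (elim dvdE)
    define z where "z = y \<otimes> x [^] (- m')"
    have zG: "z \<in> carrier G" using yG x by (simp add: z_def)
    have zp: "z [^] (int p) = k"
    proof -
      have "z [^] (int p) = y [^] (int p) \<otimes> (x [^] (- m')) [^] (int p)" unfolding z_def using yG x by (intro int_pow_distrib) auto
      also have "(x [^] (- m')) [^] (int p) = x [^] (- m)" unfolding int_pow_pow[OF x] by (simp add: m' mult.commute)
      also have "y [^] (int p) = k \<otimes> x [^] m" by (simp only: int_pow_int km(2))
      also have "k \<otimes> x [^] m \<otimes> x [^] (- m) = k" using kG x by (simp add: m_assoc int_pow_mult[symmetric])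
      finally show ?thesis .
    qed
    have zM: "z \<notin> ?M"
    proof
      assume "z \<in> ?M"
      then have "z \<otimes> x [^] m' \<in> ?M" by (rule subgroup.m_closed[OF M _ xM])
      moreover have "z \<otimes> x [^] m' = y" using yG x by (simp add: z_def m_assoc int_pow_mult[symmetric])
      ultimately show False using yM by simp
    qed
    let ?K' = "{k \<otimes> z [^] j |k j. k \<in> K \<and> j \<in> (UNIV :: int set)}"
    have K': "subgroup ?K' G" by (rule subgroup_adjoin[OF K(1) zG])
    have "?C ?K'"
    proof (intro conjI allI impI)
      fix t :: int assume "x [^] t \<in> ?K'"
      then obtain k' and j :: int where kj: "k' \<in> K" "x [^] t = k' \<otimes> z [^] j" by auto
      have k'G: "k' \<in> carrier G" using kj KG by auto
      \<comment> \<open>Otherwise Bezout expresses \<open>z\<close> through its powers with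
        exponents \<open>p\<close> and \<open>j\<close>, both in \<open>?M\<close>, against
        \<open>zM\<close>.\<close>
      have "int p dvd j"
      proof (rule ccontr)
        assume "\<not> int p dvd j"
        then have "coprime (int p) j" using p by (intro prime_imp_coprime) auto
        then obtain a b where ab: "a * int p + b * j = 1" using bezout_int[of "int p" j] by (auto simp: coprime_iff_gcd_eq_1)
        have "z [^] j = inv k' \<otimes> x [^] t" using kj k'G zG x by (simp add: m_assoc[symmetric])
        then have zj: "z [^] j \<in> ?M" using subgroup.m_closed[OF M subsetD[OF KM subgroup.m_inv_closed[OF K(1) kj(1)]] xM] by simp
        have zpM: "z [^] (int p) \<in> ?M" unfolding zp by (rule subsetD[OF KM km(1)])
        have "(z [^] (int p)) [^] a \<otimes> (z [^] j) [^] b \<in> ?M" by (rule subgroup.m_closed[OF M subgroup_int_pow_closed[OF M zpM] subgroup_int_pow_closed[OF M zj]])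
        moreover have "(z [^] (int p)) [^] a \<otimes> (z [^] j) [^] b = z [^] (a * int p + b * j)" using zG by (simp add: int_pow_pow int_pow_mult mult.commute)
        ultimately show False using zM ab zG by simp
      qed
      then obtain j' where "j = int p * j'" by (elim dvdE)
      then have "z [^] j = k [^] j'" using zG zp by (simp add: int_pow_pow[symmetric])
      then have "x [^] t \<in> K" using kj subgroup.m_closed[OF K(1) kj(1) subgroup_int_pow_closed[OF K(1) km(1)]] by simp
      then show "x [^] t = \<one>" by (rule K(2))
    qed (rule K')
    then have "card ?K' \<le> card K" by (rule max)
    moreover have "K \<subset> ?K'"
    proof
      show "K \<subseteq> ?K'"
      proof
        fix k assume k: "k \<in> K"
        then have "k = k \<otimes> z [^] (0::int)" using KG by auto
        then show "k \<in> ?K'" using k by blast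
      qed
      have "z = \<one> \<otimes> z [^] (1::int)" using zG by simp
      then have zK': "z \<in> ?K'" using subgroup.one_closed[OF K(1)] by blast
      show "K \<noteq> ?K'"
      proof
        assume eq: "K = ?K'"
        have "z \<in> K" by (subst eq) (rule zK')
        then have "z \<in> ?M" by (rule subsetD[OF KM])
        with zM show False by (rule notE)
      qed
    qed
    ultimately show False using psubset_card_mono[of ?K' K] finite_subset[OF subgroup.subset[OF K'] fin] by simp
  qed
  then show ?thesis using K by blast
qed

lemma complement_iso:
  assumes fin: "finite (carrier G)" and x: "x \<in> carrier G" and d: "ord x = d" "d > 0"
    and K: "subgroup K G" "\<And>j::int. x [^] j \<in> K \<Longrightarrow> x [^] j = \<one>"
      "\<And>y. y \<in> carrier G \<Longrightarrow> \<exists>k\<in>K. \<exists>j::int. y = k \<otimes> x [^] j"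
  shows "G\<lparr>carrier := K\<rparr> \<times>\<times> integer_mod_group d \<cong> G"
proof -
  let ?f = "\<lambda>(k, j::int). k \<otimes> x [^] j"
  let ?D = "G\<lparr>carrier := K\<rparr> \<times>\<times> integer_mod_group d"
  have KG: "K \<subseteq> carrier G" by (rule subgroup.subset[OF K(1)])
  have cd: "carrier ?D = K \<times> {0..<int d}" using d by (simp add: carrier_integer_mod_group)
  have xmod: "x [^] (j mod int d) = x [^] j" for j :: int using int_pow_eq[OF x, of "j mod int d" j] d by (simp add: mod_eq_dvd_iff[symmetric])
  have "?f \<in> hom ?D G"
  proof (rule homI)
    fix a b assume "a \<in> carrier ?D" "b \<in> carrier ?D"
    then obtain k j k' j' where ab: "a = (k, j)" "b = (k', j')" "k \<in> K" "k' \<in> K" unfolding cd by auto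
    then have kG: "k \<in> carrier G" "k' \<in> carrier G" using KG by auto
    show "?f a \<in> carrier G" using ab kG x by simp
    show "?f (a \<otimes>\<^bsub>?D\<^esub> b) = ?f a \<otimes> ?f b" using ab kG x by (simp add: xmod int_pow_mult m_ac)
  qed
  moreover have "bij_betw ?f (carrier ?D) (carrier G)" unfolding bij_betw_def
  proof
    show "inj_on ?f (carrier ?D)"
    proof (rule inj_onI)
      fix a b assume ab: "a \<in> carrier ?D" "b \<in> carrier ?D" "?f a = ?f b"
      then obtain k j k' j' where kj: "a = (k, j)" "b = (k', j')" "k \<in> K" "k' \<in> K" "j \<in> {0..<int d}" "j' \<in> {0..<int d}" unfolding cd by auto
      then have kG: "k \<in> carrier G" "k' \<in> carrier G" using KG by auto
      have eq: "k \<otimes> x [^] j = k' \<otimes> x [^] j'" using ab kj by simp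
      have "x [^] (j - j') = inv k \<otimes> k'"
      proof -
        have "x [^] (j - j') = inv k \<otimes> (k \<otimes> x [^] j) \<otimes> inv (x [^] j')" using kG x by (simp add: int_pow_diff m_assoc[symmetric])
        also have "\<dots> = inv k \<otimes> k'" unfolding eq using kG x by (simp add: m_assoc)
        finally show ?thesis .
      qed
      then have "x [^] (j - j') \<in> K" using subgroup.m_closed[OF K(1) subgroup.m_inv_closed[OF K(1) kj(3)] kj(4)] by simp
      then have one: "x [^] (j - j') = \<one>" by (rule K(2))
      then have "int d dvd j - j'" using int_pow_eq_id[OF x] d by simp
      then have "j mod int d = j' mod int d" by (simp add: mod_eq_dvd_iff)
      then have "j = j'" using kj by simp
      moreover have "k = k'" using eq \<open>j = j'\<close> kG x by simp
      ultimately show "a = b" using kj by simp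
    qed
    show "?f ` carrier ?D = carrier G"
    proof
      show "?f ` carrier ?D \<subseteq> carrier G" using KG x unfolding cd by auto
      show "carrier G \<subseteq> ?f ` carrier ?D"
      proof
        fix y assume "y \<in> carrier G"
        then obtain k and j :: int where kj: "k \<in> K" "y = k \<otimes> x [^] j" using K(3) by blast
        then have "y = ?f (k, j mod int d)" by (simp add: xmod)
        moreover have "(k, j mod int d) \<in> carrier ?D" unfolding cd using kj d by simp
        ultimately show "y \<in> ?f ` carrier ?D" by (rule image_eqI)
      qed
    qed
  qed
  ultimately show ?thesis unfolding is_iso_def iso_def by blast
qed

end

text \<open>Induction on the order: an element of maximal order generates a cyclic factor, since
  that order is the exponent of the group. The exponents in \<open>es\<close> start at 1, so that
  the length of the list is the rank, and are bounded by \<open>k\<close>, so that for fixed rank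
  only finitely many lists occur.\<close>

theorem finite_abelian_p_group_structure:
  fixes U :: "('a,'m) monoid_scheme"
  assumes "comm_group U" "finite (carrier U)" "Factorial_Ring.prime p" "\<And>x. x \<in> carrier U \<Longrightarrow> x [^]\<^bsub>U\<^esub> (p ^ k) = \<one>\<^bsub>U\<^esub>"
  shows "\<exists>es. set es \<subseteq> {1..k} \<and> cyc_prod (pows p es) \<cong> U" using assms
proof (induction "card (carrier U)" arbitrary: U rule: less_induct)
  case less
  interpret U: comm_group U by (rule less.prems(1))
  note p = less.prems(3)
  have p1: "p > 1" using p prime_gt_1_nat by blast
  have ord_pow: "\<exists>f\<le>k. U.ord y = p ^ f" if "y \<in> carrier U" for y
  proof -
    have "U.ord y dvd p ^ k" using less.prems(4)[OF that] U.pow_eq_id[OF that] by simp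
    then show ?thesis using p by (simp add: divides_primepow_nat)
  qed
  obtain x where x: "x \<in> carrier U" "\<And>y. y \<in> carrier U \<Longrightarrow> U.ord y \<le> U.ord x"
  proof -
    have "finite (U.ord ` carrier U)" "U.ord ` carrier U \<noteq> {}" using less.prems(2) U.one_closed by auto
    from Max_in[OF this] obtain x where "x \<in> carrier U" "U.ord x = Max (U.ord ` carrier U)" by auto
    then show ?thesis using that[of x] Max_ge[OF \<open>finite (U.ord ` carrier U)\<close>] by auto
  qed
  obtain e where e: "e \<le> k" "U.ord x = p ^ e" using ord_pow[OF x(1)] by blast
  have expo: "y [^]\<^bsub>U\<^esub> (p ^ e) = \<one>\<^bsub>U\<^esub>" if y: "y \<in> carrier U" for y
  proof -
    obtain f where f: "U.ord y = p ^ f" using ord_pow[OF y] by blast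
    then have "p ^ f \<le> p ^ e" using x(2)[OF y] e by simp
    then have "f \<le> e" using p1 by (rule power_le_imp_le_exp[rotated])
    then have "U.ord y dvd p ^ e" unfolding f by (rule le_imp_power_dvd)
    then show ?thesis using U.pow_eq_id[OF y] by simp
  qed
  show ?case
  proof (cases "e = 0")
    case True
    then have triv: "carrier U = {\<one>\<^bsub>U\<^esub>}" using expo U.one_closed by auto
    have "cyc_prod [] \<cong> U" unfolding is_iso_def iso_def by (auto intro!: exI[of _ "\<lambda>_. \<one>\<^bsub>U\<^esub>"] homI simp: cyc_prod_def bij_betw_def triv)
    then show ?thesis by (intro exI[of _ "[]"]) simp
  next
    case False
    then obtain K where K: "subgroup K U" "\<And>j::int. x [^]\<^bsub>U\<^esub> j \<in> K \<Longrightarrow> x [^]\<^bsub>U\<^esub> j = \<one>\<^bsub>U\<^esub>"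
      "\<And>y. y \<in> carrier U \<Longrightarrow> \<exists>k\<in>K. \<exists>j::int. y = k \<otimes>\<^bsub>U\<^esub> x [^]\<^bsub>U\<^esub> j"
      using U.cyclic_complement[OF less.prems(2) p x(1) e(2) _ expo] by auto
    have KU: "K \<subseteq> carrier U" by (rule subgroup.subset[OF K(1)])
    have "x \<noteq> \<one>\<^bsub>U\<^esub>" using e(2) False p1 by (metis U.ord_id nat_neq_iff one_less_power neq0_conv)
    then have "x \<notin> K" using K(2)[of 1] x(1) by auto
    then have lt: "card K < card (carrier U)" using KU x(1) less.prems(2) by (intro psubset_card_mono) auto
    have "comm_group (U\<lparr>carrier := K\<rparr>)" using KU by (intro group.group_comm_groupI[OF U.subgroup_imp_group[OF K(1)]]) (auto simp: U.m_comm subset_iff)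
    moreover have "finite (carrier (U\<lparr>carrier := K\<rparr>))" using KU less.prems(2) finite_subset by auto
    moreover have "y [^]\<^bsub>U\<lparr>carrier := K\<rparr>\<^esub> (p ^ k) = \<one>\<^bsub>U\<lparr>carrier := K\<rparr>\<^esub>" if "y \<in> carrier (U\<lparr>carrier := K\<rparr>)" for y
      using less.prems(4)[of y] that KU by (auto simp: nat_pow_def)
    ultimately obtain es where es: "set es \<subseteq> {1..k}" "cyc_prod (pows p es) \<cong> U\<lparr>carrier := K\<rparr>"
      using less.hyps[of "U\<lparr>carrier := K\<rparr>"] lt p by auto
    have pos: "pos_list (pows p es)" using p1 by (simp add: pos_list_def)
    interpret E: comm_group "cyc_prod (pows p es)" by (rule cyc_prod_group)
    interpret E': comm_group "cyc_prod (pows p es @ [p ^ e])" by (rule cyc_prod_group)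
    have "cyc_prod (pows p es) \<times>\<times> integer_mod_group (p ^ e) \<cong> cyc_prod (pows p es @ [p ^ e])" using p1 pos by (intro cyc_prod_snoc_iso) auto
    then have "cyc_prod (pows p es @ [p ^ e]) \<cong> cyc_prod (pows p es) \<times>\<times> integer_mod_group (p ^ e)"
      by (rule group.iso_sym[OF DirProd_group[OF E.is_group group_integer_mod_group]])
    also have "cyc_prod (pows p es) \<times>\<times> integer_mod_group (p ^ e) \<cong> U\<lparr>carrier := K\<rparr> \<times>\<times> integer_mod_group (p ^ e)"
      by (rule E.DirProd_iso_trans[OF es(2) iso_refl])
    also have "U\<lparr>carrier := K\<rparr> \<times>\<times> integer_mod_group (p ^ e) \<cong> U" using p1 by (intro U.complement_iso[OF less.prems(2) x(1) e(2) _ K]) auto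
    finally have "cyc_prod (pows p (es @ [e])) \<cong> U" by simp
    moreover have "set (es @ [e]) \<subseteq> {1..k}" using es e False by auto
    ultimately show ?thesis by blast
  qed
qed

section \<open>Counting epimorphisms\<close>

text \<open>Extensional on the domain, so that each surjection is counted exactly once.\<close>

definition epis :: "('a,'m) monoid_scheme \<Rightarrow> ('b,'n) monoid_scheme \<Rightarrow> ('a \<Rightarrow> 'b) set" where
  "epis U G = {h \<in> hom U G. h \<in> extensional (carrier U) \<and> h ` carrier U = carrier G}"

definition homs :: "('a,'m) monoid_scheme \<Rightarrow> ('b,'n) monoid_scheme \<Rightarrow> ('a \<Rightarrow> 'b) set" where
  "homs U G = {h \<in> hom U G. h \<in> extensional (carrier U)}"

lemma epis_subset_homs: "epis U G \<subseteq> homs U G" by (auto simp: epis_def homs_def)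

lemma finite_homs: "finite (carrier U) \<Longrightarrow> finite (carrier G) \<Longrightarrow> finite (homs U G)"
  by (rule finite_subset[OF _ finite_PiE[of "carrier U" "\<lambda>_. carrier G"]]) (auto simp: homs_def hom_def PiE_def)

lemma finite_epis: "finite (carrier U) \<Longrightarrow> finite (carrier G) \<Longrightarrow> finite (epis U G)" using finite_subset[OF epis_subset_homs finite_homs] .

lemma homs_compose:
  assumes "k \<in> homs B G" "f \<in> hom A B" "group A"
  shows "(\<lambda>x\<in>carrier A. k (f x)) \<in> homs A G"
proof -
  interpret A: group A by fact
  show ?thesis using assms(1,2) unfolding homs_def by (auto intro!: homI simp: hom_mult hom_in_carrier)
qed

lemma bij_precompose:
  assumes \<phi>: "\<phi> \<in> iso U Y" and U: "group U" and Y: "group Y"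
  shows "bij_betw (\<lambda>h. \<lambda>x\<in>carrier U. h (\<phi> x)) (homs Y G) (homs U G)"
    and "bij_betw (\<lambda>h. \<lambda>x\<in>carrier U. h (\<phi> x)) (epis Y G) (epis U G)"
proof -
  define \<psi> where "\<psi> = inv_into (carrier U) \<phi>"
  have b: "bij_betw \<phi> (carrier U) (carrier Y)" and h: "\<phi> \<in> hom U Y" using \<phi> by (auto simp: iso_def)
  have \<psi>: "\<psi> \<in> iso Y U" unfolding \<psi>_def by (rule group.iso_set_sym[OF U \<phi>])
  have h': "\<psi> \<in> hom Y U" using \<psi> by (auto simp: iso_def)
  have inv1: "\<psi> (\<phi> x) = x" if "x \<in> carrier U" for x unfolding \<psi>_def by (rule bij_betw_inv_into_left[OF b that])
  have inv2: "\<phi> (\<psi> y) = y" if "y \<in> carrier Y" for y unfolding \<psi>_def by (rule bij_betw_inv_into_right[OF b that])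
  have m: "\<phi> x \<in> carrier Y" if "x \<in> carrier U" for x using hom_in_carrier[OF h that] .
  have m': "\<psi> x \<in> carrier U" if "x \<in> carrier Y" for x using hom_in_carrier[OF h' that] .
  show B1: "bij_betw (\<lambda>h. \<lambda>x\<in>carrier U. h (\<phi> x)) (homs Y G) (homs U G)"
  proof (rule bij_betw_byWitness[where f'="\<lambda>k. \<lambda>y\<in>carrier Y. k (\<psi> y)"])
    show "\<forall>k\<in>homs Y G. (\<lambda>y\<in>carrier Y. (\<lambda>x\<in>carrier U. k (\<phi> x)) (\<psi> y)) = k"
      by (auto simp: homs_def m' inv2 extensional_def fun_eq_iff)
    show "\<forall>k\<in>homs U G. (\<lambda>x\<in>carrier U. (\<lambda>y\<in>carrier Y. k (\<psi> y)) (\<phi> x)) = k"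
      by (auto simp: homs_def m inv1 extensional_def fun_eq_iff)
    show "(\<lambda>h. \<lambda>x\<in>carrier U. h (\<phi> x)) ` homs Y G \<subseteq> homs U G" using homs_compose[OF _ h U] by blast
    show "(\<lambda>k. \<lambda>y\<in>carrier Y. k (\<psi> y)) ` homs U G \<subseteq> homs Y G" using homs_compose[OF _ h' Y] by blast
  qed
  have eq: "(\<lambda>x\<in>carrier U. k (\<phi> x)) ` carrier U = k ` carrier Y" for k
    unfolding bij_betw_imp_surj_on[OF b, symmetric] image_image by (rule image_cong) auto
  have E: "epis U G = {h \<in> homs U G. h ` carrier U = carrier G}" "epis Y G = {h \<in> homs Y G. h ` carrier Y = carrier G}" by (auto simp: homs_def epis_def)
  have "(\<lambda>h. \<lambda>x\<in>carrier U. h (\<phi> x)) ` epis Y G = epis U G"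
  proof
    show "(\<lambda>h. \<lambda>x\<in>carrier U. h (\<phi> x)) ` epis Y G \<subseteq> epis U G"
    proof
      fix h assume "h \<in> (\<lambda>h. \<lambda>x\<in>carrier U. h (\<phi> x)) ` epis Y G"
      then obtain k where "k \<in> epis Y G" "h = (\<lambda>x\<in>carrier U. k (\<phi> x))" by blast
      then show "h \<in> epis U G" using bij_betwE[OF B1] eq[of k] by (simp add: E)
    qed
    show "epis U G \<subseteq> (\<lambda>h. \<lambda>x\<in>carrier U. h (\<phi> x)) ` epis Y G"
    proof
      fix h assume h: "h \<in> epis U G"
      then have "h \<in> (\<lambda>h. \<lambda>x\<in>carrier U. h (\<phi> x)) ` homs Y G" unfolding bij_betw_imp_surj_on[OF B1] by (simp add: E)
      then obtain k where "k \<in> homs Y G" "h = (\<lambda>x\<in>carrier U. k (\<phi> x))" by blast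
      then show "h \<in> (\<lambda>h. \<lambda>x\<in>carrier U. h (\<phi> x)) ` epis Y G" using h eq[of k] by (simp add: E)
    qed
  qed
  then show "bij_betw (\<lambda>h. \<lambda>x\<in>carrier U. h (\<phi> x)) (epis Y G) (epis U G)"
    using inj_on_subset[OF bij_betw_imp_inj_on[OF B1] epis_subset_homs] by (simp add: bij_betw_def)
qed

lemma card_homs_iso: "U \<cong> Y \<Longrightarrow> group U \<Longrightarrow> group Y \<Longrightarrow> card (homs U G) = card (homs Y G)"
  using bij_precompose(1)[of _ U Y G] bij_betw_same_card unfolding is_iso_def by (metis ex_in_conv)

lemma card_epis_iso: "U \<cong> Y \<Longrightarrow> group U \<Longrightarrow> group Y \<Longrightarrow> card (epis U G) = card (epis Y G)"
  using bij_precompose(2)[of _ U Y G] bij_betw_same_card unfolding is_iso_def by (metis ex_in_conv)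

lemma epis_nonempty_card:
  assumes "finite (carrier U)" "epis U G \<noteq> {}"
  shows "card (carrier G) \<le> card (carrier U)" using assms by (auto simp: epis_def) (metis card_image_le)

lemma epis_iso:
  assumes "finite (carrier U)" "h \<in> epis U G" "card (carrier U) = card (carrier G)"
  shows "h \<in> iso U G"
proof -
  have "inj_on h (carrier U)" using assms by (intro eq_card_imp_inj_on) (auto simp: epis_def)
  then show ?thesis using assms by (auto simp: epis_def iso_def bij_betw_def)
qed

lemma epis_self: "finite (carrier G) \<Longrightarrow> epis G G = auto G" by (auto simp: epis_def auto_def Bij_def bij_betw_def intro!: eq_card_imp_inj_on)

context comm_group
begin

lemma quotient_hom:
  assumes N: "subgroup N G"
  shows "comm_group (G Mod N)" "(\<lambda>x. N #> x) \<in> hom G (G Mod N)" "carrier (G Mod N) = (\<lambda>x. N #> x) ` carrier G"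
    and "\<And>x. x \<in> carrier G \<Longrightarrow> N #> x = \<one>\<^bsub>G Mod N\<^esub> \<longleftrightarrow> x \<in> N"
proof -
  interpret N: normal N G by (rule subgroup_imp_normal[OF N])
  show "comm_group (G Mod N)" by (rule abelian_FactGroup[OF N])
  show "(\<lambda>x. N #> x) \<in> hom G (G Mod N)" by (rule N.r_coset_hom_Mod)
  show "carrier (G Mod N) = (\<lambda>x. N #> x) ` carrier G" by (auto simp: FactGroup_def RCOSETS_def)
  show "N #> x = \<one>\<^bsub>G Mod N\<^esub> \<longleftrightarrow> x \<in> N" if "x \<in> carrier G" for x
    using that N coset_join1[OF _ _ N] coset_join2[OF _ N] by (auto simp: FactGroup_def subgroup.subset)
qed

lemma bij_quotient_epis:
  assumes N: "subgroup N G" and K: "group K"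
  shows "bij_betw (\<lambda>k. \<lambda>x\<in>carrier G. k (N #> x)) (epis (G Mod N) K) {h \<in> epis G K. \<forall>x\<in>N. h x = \<one>\<^bsub>K\<^esub>}"
proof (rule bij_betwI')
  note Q = quotient_hom[OF N]
  interpret Q: comm_group "G Mod N" by (rule Q(1))
  interpret K: group K by (rule K)
  have NG: "N \<subseteq> carrier G" by (rule subgroup.subset[OF N])
  have qin: "N #> x \<in> carrier (G Mod N)" if "x \<in> carrier G" for x using that Q(3) by auto
  have qm: "N #> (x \<otimes> y) = (N #> x) \<otimes>\<^bsub>G Mod N\<^esub> (N #> y)" if "x \<in> carrier G" "y \<in> carrier G" for x y
    using hom_mult[OF Q(2)] that by simp
  {
    fix k l assume k: "k \<in> epis (G Mod N) K" "l \<in> epis (G Mod N) K"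
    show "((\<lambda>x\<in>carrier G. k (N #> x)) = (\<lambda>x\<in>carrier G. l (N #> x))) = (k = l)"
    proof
      assume eq: "(\<lambda>x\<in>carrier G. k (N #> x)) = (\<lambda>x\<in>carrier G. l (N #> x))"
      show "k = l"
      proof (rule extensionalityI)
        show "k \<in> extensional (carrier (G Mod N))" "l \<in> extensional (carrier (G Mod N))" using k by (auto simp: epis_def)
        fix C assume "C \<in> carrier (G Mod N)"
        then obtain x where "x \<in> carrier G" "C = N #> x" using Q(3) by auto
        then show "k C = l C" using fun_cong[OF eq, of x] by simp
      qed
    qed simp
  next
    fix k assume k: "k \<in> epis (G Mod N) K"
    then have kh: "k \<in> hom (G Mod N) K" by (simp add: epis_def)
    have "(\<lambda>x\<in>carrier G. k (N #> x)) \<in> hom G K"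
    proof (rule homI)
      fix x y assume xy: "x \<in> carrier G" "y \<in> carrier G"
      show "(\<lambda>x\<in>carrier G. k (N #> x)) x \<in> carrier K" using xy hom_in_carrier[OF kh qin] by simp
      have "k (N #> (x \<otimes> y)) = k (N #> x) \<otimes>\<^bsub>K\<^esub> k (N #> y)" unfolding qm[OF xy] by (rule hom_mult[OF kh qin[OF xy(1)] qin[OF xy(2)]])
      then show "(\<lambda>x\<in>carrier G. k (N #> x)) (x \<otimes> y) = (\<lambda>x\<in>carrier G. k (N #> x)) x \<otimes>\<^bsub>K\<^esub> (\<lambda>x\<in>carrier G. k (N #> x)) y"
        using xy by simp
    qed
    moreover have "(\<lambda>x\<in>carrier G. k (N #> x)) ` carrier G = k ` carrier (G Mod N)" unfolding Q(3) image_image by (rule image_cong) auto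
    moreover have "k (N #> x) = \<one>\<^bsub>K\<^esub>" if "x \<in> N" for x
    proof -
      have "N #> x = \<one>\<^bsub>G Mod N\<^esub>" using Q(4)[of x] that NG by auto
      then show ?thesis using hom_one[OF kh Q.is_group K] by simp
    qed
    ultimately show "(\<lambda>x\<in>carrier G. k (N #> x)) \<in> {h \<in> epis G K. \<forall>x\<in>N. h x = \<one>\<^bsub>K\<^esub>}" using k NG by (auto simp: epis_def)
  next
    fix h assume h: "h \<in> {h \<in> epis G K. \<forall>x\<in>N. h x = \<one>\<^bsub>K\<^esub>}"
    then have hh: "h \<in> hom G K" and h1: "\<And>x. x \<in> N \<Longrightarrow> h x = \<one>\<^bsub>K\<^esub>" and hs: "h ` carrier G = carrier K"
      and he: "h \<in> extensional (carrier G)" by (auto simp: epis_def)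
    interpret H: group_hom G K h by unfold_locales (rule hh)
    have const: "h ` (N #> x) = {h x}" if x: "x \<in> carrier G" for x
    proof -
      have "h (a \<otimes> x) = h x" if "a \<in> N" for a using that x h1[OF that] NG hom_mult[OF hh, of a x] hom_in_carrier[OF hh x] by auto
      moreover have "N \<noteq> {}" using subgroup.one_closed[OF N] by auto
      ultimately show ?thesis unfolding r_coset_def by (auto simp: image_iff)
    qed
    define k where "k = (\<lambda>C\<in>carrier (G Mod N). the_elem (h ` C))"
    have kx: "k (N #> x) = h x" if "x \<in> carrier G" for x using that by (simp add: k_def qin const)
    have "k \<in> hom (G Mod N) K"
    proof (rule homI)
      fix C D assume "C \<in> carrier (G Mod N)" "D \<in> carrier (G Mod N)"
      then obtain x y where xy: "x \<in> carrier G" "C = N #> x" "y \<in> carrier G" "D = N #> y" using Q(3) by auto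
      show "k C \<in> carrier K" using xy kx hom_in_carrier[OF hh] by simp
      have "C \<otimes>\<^bsub>G Mod N\<^esub> D = N #> (x \<otimes> y)" using qm xy by simp
      then show "k (C \<otimes>\<^bsub>G Mod N\<^esub> D) = k C \<otimes>\<^bsub>K\<^esub> k D" using xy kx[of "x \<otimes> y"] by (simp only: kx hom_mult[OF hh] m_closed)
    qed
    moreover have "k ` carrier (G Mod N) = carrier K" unfolding Q(3) image_image hs[symmetric] by (rule image_cong) (auto simp: kx)
    ultimately have "k \<in> epis (G Mod N) K" by (simp add: epis_def k_def)
    moreover have "h = (\<lambda>x\<in>carrier G. k (N #> x))" using he by (intro extensionalityI[of h "carrier G"]) (auto simp: kx)
    ultimately show "\<exists>k\<in>epis (G Mod N) K. h = (\<lambda>x\<in>carrier G. k (N #> x))" by blast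
  }
qed

end

lemma bij_postcompose:
  assumes \<phi>: "\<phi> \<in> iso G G'" and G: "group G" and U: "group U"
  shows "bij_betw (\<lambda>h. \<lambda>x\<in>carrier U. \<phi> (h x)) (epis U G) (epis U G')"
proof -
  define \<psi> where "\<psi> = inv_into (carrier G) \<phi>"
  have b: "bij_betw \<phi> (carrier G) (carrier G')" and h: "\<phi> \<in> hom G G'" using \<phi> by (auto simp: iso_def)
  have \<psi>: "\<psi> \<in> iso G' G" unfolding \<psi>_def by (rule group.iso_set_sym[OF G \<phi>])
  have b': "bij_betw \<psi> (carrier G') (carrier G)" and h': "\<psi> \<in> hom G' G" using \<psi> by (auto simp: iso_def)
  have inv1: "\<psi> (\<phi> x) = x" if "x \<in> carrier G" for x unfolding \<psi>_def by (rule bij_betw_inv_into_left[OF b that])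
  have inv2: "\<phi> (\<psi> y) = y" if "y \<in> carrier G'" for y unfolding \<psi>_def by (rule bij_betw_inv_into_right[OF b that])
  interpret U: group U by (rule U)
  have 1: "(\<lambda>x\<in>carrier U. \<phi> (k x)) \<in> epis U G'" if "k \<in> epis U G" for k
  proof -
    have k: "k \<in> hom U G" "k ` carrier U = carrier G" using that by (auto simp: epis_def)
    have "(\<lambda>x\<in>carrier U. \<phi> (k x)) \<in> hom U G'" using k(1) h by (intro homI) (simp_all add: hom_mult hom_in_carrier)
    moreover have "(\<lambda>x\<in>carrier U. \<phi> (k x)) ` carrier U = \<phi> ` (k ` carrier U)" unfolding image_image by (rule image_cong) auto
    ultimately show ?thesis using bij_betw_imp_surj_on[OF b] k(2) by (simp add: epis_def)
  qed
  have 2: "(\<lambda>x\<in>carrier U. \<psi> (k x)) \<in> epis U G" if "k \<in> epis U G'" for k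
  proof -
    have k: "k \<in> hom U G'" "k ` carrier U = carrier G'" using that by (auto simp: epis_def)
    have "(\<lambda>x\<in>carrier U. \<psi> (k x)) \<in> hom U G" using k(1) h' by (intro homI) (simp_all add: hom_mult hom_in_carrier)
    moreover have "(\<lambda>x\<in>carrier U. \<psi> (k x)) ` carrier U = \<psi> ` (k ` carrier U)" unfolding image_image by (rule image_cong) auto
    ultimately show ?thesis using bij_betw_imp_surj_on[OF b'] k(2) by (simp add: epis_def)
  qed
  have in1: "k x \<in> carrier G" if "k \<in> epis U G" "x \<in> carrier U" for k x using that hom_in_carrier[of k U G x] by (simp add: epis_def)
  have in2: "k x \<in> carrier G'" if "k \<in> epis U G'" "x \<in> carrier U" for k x using that hom_in_carrier[of k U G' x] by (simp add: epis_def)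
  show ?thesis
  proof (rule bij_betw_byWitness[where f'="\<lambda>k. \<lambda>x\<in>carrier U. \<psi> (k x)"])
    show "\<forall>k\<in>epis U G. (\<lambda>x\<in>carrier U. \<psi> ((\<lambda>x\<in>carrier U. \<phi> (k x)) x)) = k"
    proof
      fix k assume k: "k \<in> epis U G"
      show "(\<lambda>x\<in>carrier U. \<psi> ((\<lambda>x\<in>carrier U. \<phi> (k x)) x)) = k"
        using k by (intro extensionalityI[of _ "carrier U"]) (auto simp: inv1 in1 epis_def)
    qed
    show "\<forall>k\<in>epis U G'. (\<lambda>x\<in>carrier U. \<phi> ((\<lambda>x\<in>carrier U. \<psi> (k x)) x)) = k"
    proof
      fix k assume k: "k \<in> epis U G'"
      show "(\<lambda>x\<in>carrier U. \<phi> ((\<lambda>x\<in>carrier U. \<psi> (k x)) x)) = k"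
        using k by (intro extensionalityI[of _ "carrier U"]) (auto simp: inv2 in2 epis_def)
    qed
  qed (use 1 2 in blast)+
qed

lemma card_epis_iso_cod: "G \<cong> G' \<Longrightarrow> group G \<Longrightarrow> group U \<Longrightarrow> card (epis U G) = card (epis U G')"
  using bij_postcompose[of _ G G' U] bij_betw_same_card unfolding is_iso_def by (metis ex_in_conv)

text \<open>For an epimorphism \<open>f\<close> onto \<open>G\<close>, a pair \<open>(f, g)\<close> with \<open>g : U \<rightarrow> Z/p\<close> fails to be jointly surjective exactly
  when its image is the graph of a homomorphism \<open>G \<rightarrow> Z/p\<close>.\<close>

lemma joint_surj_iff:
  assumes U: "comm_group U" and G: "comm_group G" and p: "Factorial_Ring.prime p"
    and f: "f \<in> epis U G" and g: "g \<in> homs U (integer_mod_group p)"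
  shows "(\<lambda>x\<in>carrier U. (f x, g x)) \<in> epis U (G \<times>\<times> integer_mod_group p)
     \<longleftrightarrow> g \<notin> (\<lambda>k. \<lambda>x\<in>carrier U. k (f x)) ` homs G (integer_mod_group p)"
proof -
  let ?P = "integer_mod_group p"
  interpret U: comm_group U by (rule U)
  interpret G: comm_group G by (rule G)
  interpret P: comm_group ?P by simp
  have p1: "p > 1" using p prime_gt_1_nat by blast
  have Pc: "carrier ?P = {0..<int p}" using p1 by (simp add: carrier_integer_mod_group)
  have fh: "f \<in> hom U G" and fs: "f ` carrier U = carrier G" using f by (auto simp: epis_def)
  have fpre: "\<exists>x\<in>carrier U. y = f x" if "y \<in> carrier G" for y using that unfolding fs[symmetric] by blast
  have gh: "g \<in> hom U ?P" and ge: "g \<in> extensional (carrier U)" using g by (auto simp: homs_def)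
  interpret F: group_hom U G f by unfold_locales (rule fh)
  interpret g: group_hom U ?P g by unfold_locales (rule gh)
  have hom: "(\<lambda>x\<in>carrier U. (f x, g x)) \<in> hom U (G \<times>\<times> ?P)"
    using hom_in_carrier[OF gh] by (intro homI) (auto simp: mult_DirProd F.hom_mult g.hom_mult simp del: mult_integer_mod_group)
  show ?thesis
  proof
    assume s: "(\<lambda>x\<in>carrier U. (f x, g x)) \<in> epis U (G \<times>\<times> ?P)"
    show "g \<notin> (\<lambda>k. \<lambda>x\<in>carrier U. k (f x)) ` homs G ?P"
    proof
      assume "g \<in> (\<lambda>k. \<lambda>x\<in>carrier U. k (f x)) ` homs G ?P"
      then obtain k where k: "k \<in> homs G ?P" "g = (\<lambda>x\<in>carrier U. k (f x))" by blast
      have "(\<one>\<^bsub>G\<^esub>, 1) \<in> (\<lambda>x\<in>carrier U. (f x, g x)) ` carrier U" using s p1 by (auto simp: epis_def Pc)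
      then obtain x where x: "x \<in> carrier U" "f x = \<one>\<^bsub>G\<^esub>" "g x = 1" by auto
      then have "g x = k \<one>\<^bsub>G\<^esub>" using k by simp
      also have "\<dots> = 0" using hom_one[OF _ G.is_group P.is_group, of k] k(1) by (simp add: homs_def)
      finally show False using x by simp
    qed
  next
    assume nf: "g \<notin> (\<lambda>k. \<lambda>x\<in>carrier U. k (f x)) ` homs G ?P"
    \<comment> \<open>If \<open>g\<close> were trivial on the kernel of \<open>f\<close>, it would
      factor through \<open>f\<close>.\<close>
    have "\<exists>x\<in>carrier U. f x = \<one>\<^bsub>G\<^esub> \<and> g x \<noteq> 0"
    proof (rule ccontr)
      assume "\<not> ?thesis"
      then have z: "\<And>x. x \<in> carrier U \<Longrightarrow> f x = \<one>\<^bsub>G\<^esub> \<Longrightarrow> g x = \<one>\<^bsub>?P\<^esub>" by auto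
      have eq: "g x = g y" if xy: "x \<in> carrier U" "y \<in> carrier U" "f x = f y" for x y
      proof -
        have "f (x \<otimes>\<^bsub>U\<^esub> inv\<^bsub>U\<^esub> y) = \<one>\<^bsub>G\<^esub>" using xy by simp
        then have "g (x \<otimes>\<^bsub>U\<^esub> inv\<^bsub>U\<^esub> y) = \<one>\<^bsub>?P\<^esub>" using xy by (intro z) auto
        then have "g x \<otimes>\<^bsub>?P\<^esub> inv\<^bsub>?P\<^esub> (g y) = \<one>\<^bsub>?P\<^esub>" using xy by (simp only: g.hom_mult g.hom_inv U.inv_closed)
        then show ?thesis using P.inv_solve_right' P.r_one xy g.hom_closed by (metis P.inv_inv P.inv_closed P.inv_equality)
      qed
      define k where "k = (\<lambda>y\<in>carrier G. g (SOME x. x \<in> carrier U \<and> f x = y))"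
      have kf: "k (f x) = g x" if x: "x \<in> carrier U" for x
      proof -
        define s where "s = (SOME x'. x' \<in> carrier U \<and> f x' = f x)"
        have "\<exists>x'. x' \<in> carrier U \<and> f x' = f x" using x by blast
        then have s: "s \<in> carrier U \<and> f s = f x" unfolding s_def by (rule someI_ex)
        have "k (f x) = g s" using F.hom_closed[OF x] by (simp add: k_def s_def)
        then show ?thesis using eq[of s x] s x by simp
      qed
      have "k \<in> homs G ?P" unfolding homs_def
      proof (safe intro!: homI)
        fix a b assume ab: "a \<in> carrier G" "b \<in> carrier G"
        obtain x y where xy: "x \<in> carrier U" "a = f x" "y \<in> carrier U" "b = f y" using fpre[OF ab(1)] fpre[OF ab(2)] by blast
        show "k a \<in> carrier ?P" using xy kf g.hom_closed by simp
        have "a \<otimes>\<^bsub>G\<^esub> b = f (x \<otimes>\<^bsub>U\<^esub> y)" using xy by simp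
        then show "k (a \<otimes>\<^bsub>G\<^esub> b) = k a \<otimes>\<^bsub>?P\<^esub> k b" using xy by (simp only: kf g.hom_mult U.m_closed)
      qed (auto simp: k_def)
      moreover have "g = (\<lambda>x\<in>carrier U. k (f x))" using ge by (intro extensionalityI[of _ "carrier U"]) (auto simp: kf)
      ultimately show False using nf by blast
    qed
    then obtain x0 where x0: "x0 \<in> carrier U" "f x0 = \<one>\<^bsub>G\<^esub>" "g x0 \<noteq> 0" by blast
    have g0: "0 \<le> g x0" "g x0 < int p" using g.hom_closed[OF x0(1)] by (auto simp: Pc)
    have "coprime (g x0) (int p)"
    proof -
      have "\<not> int p dvd g x0" using g0 x0(3) zdvd_not_zless[of "g x0" "int p"] by simp
      moreover have "Factorial_Ring.prime (int p)" using p by simp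
      ultimately show ?thesis using prime_imp_coprime[of "int p" "g x0"] by (simp add: coprime_commute)
    qed
    then obtain u v where uv: "u * g x0 + v * int p = 1" using bezout_int[of "g x0" "int p"] by (auto simp: coprime_iff_gcd_eq_1)
    have surj: "(y, t) \<in> (\<lambda>x\<in>carrier U. (f x, g x)) ` carrier U" if yt: "y \<in> carrier G" "t \<in> {0..<int p}" for y t
    proof -
      obtain x where x: "x \<in> carrier U" "f x = y" using fpre[OF yt(1)] by blast
      \<comment> \<open>This power of \<open>x0\<close> moves the second coordinate to
        \<open>t\<close> without touching the first; \<open>u\<close> inverts \<open>g x0\<close>
        modulo \<open>p\<close>.\<close>
      define j where "j = nat ((u * (t - g x)) mod int p)"
      let ?z = "x \<otimes>\<^bsub>U\<^esub> x0 [^]\<^bsub>U\<^esub> j"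
      have "f ?z = y" using x x0 yt(1) F.hom_nat_pow[OF x0(1), of j] by simp
      moreover have "g ?z = t"
      proof -
        have "g ?z = (g x + (int j * g x0) mod int p) mod int p" using x x0 g.hom_nat_pow[OF x0(1), of j] g.hom_closed[OF x0(1)] by (simp add: g.hom_mult)
        also have "\<dots> = (g x + int j * g x0) mod int p" by (simp add: mod_simps)
        also have "\<dots> = t mod int p"
        proof -
          define q where "q = (u * (t - g x)) div int p"
          have j: "int j = u * (t - g x) - int p * q" using p1 by (simp add: j_def q_def minus_mult_div_eq_mod)
          have "(g x + int j * g x0) - t = (t - g x) * (u * g x0) - int p * (q * g x0) + g x - t" unfolding j by (simp add: algebra_simps)
          also have "u * g x0 = 1 - v * int p" using uv by simp
          also have "(t - g x) * (1 - v * int p) - int p * (q * g x0) + g x - t = int p * (- (t - g x) * v - q * g x0)" by (simp add: algebra_simps)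
          finally have "(g x + int j * g x0) - t = int p * (- (t - g x) * v - q * g x0)" .
          then show ?thesis by (simp add: mod_eq_dvd_iff)
        qed
        also have "\<dots> = t" using yt by simp
        finally show ?thesis .
      qed
      ultimately show ?thesis using x x0 by (intro image_eqI[of _ _ ?z]) auto
    qed
    have "(\<lambda>x\<in>carrier U. (f x, g x)) ` carrier U = carrier (G \<times>\<times> ?P)"
    proof
      show "(\<lambda>x\<in>carrier U. (f x, g x)) ` carrier U \<subseteq> carrier (G \<times>\<times> ?P)" using hom_in_carrier[OF hom] by blast
      show "carrier (G \<times>\<times> ?P) \<subseteq> (\<lambda>x\<in>carrier U. (f x, g x)) ` carrier U" using surj by (auto simp: Pc)
    qed
    then show "(\<lambda>x\<in>carrier U. (f x, g x)) \<in> epis U (G \<times>\<times> ?P)" using hom by (simp add: epis_def)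
  qed
qed

text \<open>For each surjection \<open>f\<close> the forbidden second components are those factoring
  through \<open>f\<close>. As \<open>f\<close> is onto, there are as many of them as homomorphisms
  from \<open>G\<close>, whichever \<open>f\<close> is taken.\<close>

lemma card_epis_DirProd:
  assumes U: "comm_group U" "finite (carrier U)" and G: "comm_group G" "finite (carrier G)" and p: "Factorial_Ring.prime p"
  defines "P \<equiv> integer_mod_group p"
  shows "real (card (epis U (G \<times>\<times> P))) = real (card (epis U G)) * (real (card (homs U P)) - real (card (homs G P)))"
proof -
  interpret U: comm_group U by (rule U)
  interpret G: comm_group G by (rule G)
  interpret P: comm_group P by (simp add: P_def)
  let ?Q = "\<lambda>f. (\<lambda>k. \<lambda>x\<in>carrier U. k (f x)) ` homs G P"
  have p1: "p > 1" using p prime_gt_1_nat by blast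
  have Pf: "finite (carrier P)" using p1 by (simp add: P_def carrier_integer_mod_group)
  have Q: "?Q f \<subseteq> homs U P" "card (?Q f) = card (homs G P)" if f: "f \<in> epis U G" for f
  proof -
    have fh: "f \<in> hom U G" and fs: "f ` carrier U = carrier G" using f by (auto simp: epis_def)
    show "?Q f \<subseteq> homs U P" using homs_compose[OF _ fh U.is_group] by blast
    have "inj_on (\<lambda>k. \<lambda>x\<in>carrier U. k (f x)) (homs G P)"
    proof (rule inj_onI)
      fix k l assume kl: "k \<in> homs G P" "l \<in> homs G P" "(\<lambda>x\<in>carrier U. k (f x)) = (\<lambda>x\<in>carrier U. l (f x))"
      show "k = l"
      proof (rule extensionalityI)
        show "k \<in> extensional (carrier G)" "l \<in> extensional (carrier G)" using kl by (auto simp: homs_def)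
        fix y assume "y \<in> carrier G"
        then have "y \<in> f ` carrier U" by (simp only: fs)
        then obtain x where "x \<in> carrier U" "y = f x" by blast
        then show "k y = l y" using fun_cong[OF kl(3), of x] by simp
      qed
    qed
    then show "card (?Q f) = card (homs G P)" by (rule card_image)
  qed
  have "bij_betw (\<lambda>(f, g). \<lambda>x\<in>carrier U. (f x, g x)) (SIGMA f:epis U G. homs U P - ?Q f) (epis U (G \<times>\<times> P))"
  proof (rule bij_betw_byWitness[where f'="\<lambda>h. (\<lambda>x\<in>carrier U. fst (h x), \<lambda>x\<in>carrier U. snd (h x))"])
    show "\<forall>a\<in>SIGMA f:epis U G. homs U P - ?Q f.
       (\<lambda>x\<in>carrier U. fst ((case a of (f, g) \<Rightarrow> \<lambda>x\<in>carrier U. (f x, g x)) x), \<lambda>x\<in>carrier U. snd ((case a of (f, g) \<Rightarrow> \<lambda>x\<in>carrier U. (f x, g x)) x)) = a"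
      by (auto simp: epis_def homs_def extensional_def fun_eq_iff)
    show "\<forall>h\<in>epis U (G \<times>\<times> P). (case (\<lambda>x\<in>carrier U. fst (h x), \<lambda>x\<in>carrier U. snd (h x)) of (f, g) \<Rightarrow> \<lambda>x\<in>carrier U. (f x, g x)) = h"
      by (auto simp: epis_def extensional_def fun_eq_iff)
    show "(\<lambda>(f, g). \<lambda>x\<in>carrier U. (f x, g x)) ` (SIGMA f:epis U G. homs U P - ?Q f) \<subseteq> epis U (G \<times>\<times> P)"
      using joint_surj_iff[OF U(1) G(1) p] unfolding P_def by auto
    show "(\<lambda>h. (\<lambda>x\<in>carrier U. fst (h x), \<lambda>x\<in>carrier U. snd (h x))) ` epis U (G \<times>\<times> P) \<subseteq> (SIGMA f:epis U G. homs U P - ?Q f)"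
    proof
      fix a assume "a \<in> (\<lambda>h. (\<lambda>x\<in>carrier U. fst (h x), \<lambda>x\<in>carrier U. snd (h x))) ` epis U (G \<times>\<times> P)"
      then obtain h where h: "h \<in> epis U (G \<times>\<times> P)" "a = (\<lambda>x\<in>carrier U. fst (h x), \<lambda>x\<in>carrier U. snd (h x))" by blast
      let ?f = "\<lambda>x\<in>carrier U. fst (h x)" and ?g = "\<lambda>x\<in>carrier U. snd (h x)"
      have hh: "h \<in> hom U (G \<times>\<times> P)" and he: "h \<in> extensional (carrier U)" and hs: "h ` carrier U = carrier G \<times> carrier P"
        using h(1) by (auto simp: epis_def)
      have hc: "fst (h x) \<in> carrier G" "snd (h x) \<in> carrier P" if "x \<in> carrier U" for x using hom_in_carrier[OF hh that] by auto
      have hm: "fst (h (x \<otimes>\<^bsub>U\<^esub> y)) = fst (h x) \<otimes>\<^bsub>G\<^esub> fst (h y)" "snd (h (x \<otimes>\<^bsub>U\<^esub> y)) = snd (h x) \<otimes>\<^bsub>P\<^esub> snd (h y)"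
        if "x \<in> carrier U" "y \<in> carrier U" for x y using hom_mult[OF hh that] by (auto simp: mult_DirProd' DirProd_def split: prod.splits)
      have "?f ` carrier U = fst ` (h ` carrier U)" unfolding image_image by (rule image_cong) auto
      also have "\<dots> = carrier G" unfolding hs using P.one_closed by auto
      finally have f: "?f \<in> epis U G" unfolding epis_def by (auto intro!: homI simp: hc hm)
      have g: "?g \<in> homs U P" unfolding homs_def by (auto intro!: homI simp: hc hm)
      have "(\<lambda>x\<in>carrier U. (?f x, ?g x)) = h" using he by (auto simp: extensional_def fun_eq_iff)
      then have "?g \<notin> ?Q ?f" using joint_surj_iff[OF U(1) G(1) p f, of ?g] g h(1) unfolding P_def by simp
      then show "a \<in> (SIGMA f:epis U G. homs U P - ?Q f)" using h(2) f g by simp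
    qed
  qed
  from bij_betw_same_card[OF this, symmetric]
  have "card (epis U (G \<times>\<times> P)) = card (SIGMA f:epis U G. homs U P - ?Q f)" .
  also have "\<dots> = (\<Sum>f\<in>epis U G. card (homs U P - ?Q f))" using finite_epis[OF U(2) G(2)] finite_homs[OF U(2) Pf] by (intro card_SigmaI) auto
  finally have "real (card (epis U (G \<times>\<times> P))) = (\<Sum>f\<in>epis U G. real (card (homs U P - ?Q f)))" by simp
  also have "\<dots> = (\<Sum>f\<in>epis U G. real (card (homs U P)) - real (card (homs G P)))"
  proof (rule sum.cong[OF refl])
    fix f assume f: "f \<in> epis U G"
    have "card (homs U P - ?Q f) = card (homs U P) - card (homs G P)" using Q[OF f] finite_subset[OF Q(1)[OF f] finite_homs[OF U(2) Pf]] by (simp add: card_Diff_subset)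
    moreover have "card (homs G P) \<le> card (homs U P)" using card_mono[OF finite_homs[OF U(2) Pf] Q(1)[OF f]] Q(2)[OF f] by simp
    ultimately show "real (card (homs U P - ?Q f)) = real (card (homs U P)) - real (card (homs G P))" by simp
  qed
  finally show ?thesis by simp
qed

section \<open>Surjections from quotients of Z^m as generating tuples\<close>

abbreviation zvec :: "nat \<Rightarrow> int vec monoid" where
  "zvec m \<equiv> monoid_vec TYPE(int) m"

lemma zvec_group: "comm_group (zvec m)" by (rule comm_group_vec)

lemma zvec_pow: "v \<in> carrier_vec m \<Longrightarrow> v [^]\<^bsub>zvec m\<^esub> (k::nat) = int k \<cdot>\<^sub>v v"
proof (induction k)
  case 0
  then show ?case by (intro eq_vecI) (auto simp: monoid_vec_simps)
next
  case (Suc k)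
  then show ?case by (intro eq_vecI) (auto simp: monoid_vec_simps algebra_simps)
qed

lemma zvec_generate: "generate (zvec m) (unit_vec m ` {..<m}) = carrier_vec m"
proof
  interpret Z: comm_group "zvec m" by (rule zvec_group)
  let ?K = "generate (zvec m) (unit_vec m ` {..<m})"
  have sub: "unit_vec m ` {..<m} \<subseteq> carrier (zvec m)" by (auto simp: monoid_vec_simps)
  show "?K \<subseteq> carrier_vec m" using Z.generate_incl[OF sub] by (simp add: monoid_vec_simps)
  have K: "subgroup ?K (zvec m)" by (rule Z.generate_is_subgroup[OF sub])
  have nat: "int k \<cdot>\<^sub>v unit_vec m i \<in> ?K" if "i < m" for k i
  proof (induction k)
    case 0
    have "int 0 \<cdot>\<^sub>v unit_vec m i = \<one>\<^bsub>zvec m\<^esub>" by (intro eq_vecI) (auto simp: monoid_vec_simps)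
    then show ?case using subgroup.one_closed[OF K] by simp
  next
    case (Suc k)
    have "int (Suc k) \<cdot>\<^sub>v unit_vec m i = (int k \<cdot>\<^sub>v unit_vec m i) \<otimes>\<^bsub>zvec m\<^esub> unit_vec m i"
      by (intro eq_vecI) (auto simp: monoid_vec_simps algebra_simps)
    then show ?case using subgroup.m_closed[OF K Suc generate.incl, of "unit_vec m i"] that by simp
  qed
  have smul: "c \<cdot>\<^sub>v unit_vec m i \<in> ?K" if i: "i < m" for c i
  proof (cases "c \<ge> 0")
    case True
    then show ?thesis using nat[OF i, of "nat c"] by simp
  next
    case False
    have "(c \<cdot>\<^sub>v unit_vec m i) \<otimes>\<^bsub>zvec m\<^esub> (int (nat (- c)) \<cdot>\<^sub>v unit_vec m i) = \<one>\<^bsub>zvec m\<^esub>"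
      using False by (intro eq_vecI) (simp_all add: monoid_vec_simps)
    then have "inv\<^bsub>zvec m\<^esub> (int (nat (- c)) \<cdot>\<^sub>v unit_vec m i) = c \<cdot>\<^sub>v unit_vec m i"
      by (rule Z.inv_equality) (simp_all add: monoid_vec_simps)
    then show ?thesis using subgroup.m_inv_closed[OF K nat[OF i, of "nat (- c)"]] by simp
  qed
  show "carrier_vec m \<subseteq> ?K"
  proof
    fix v :: "int vec" assume v: "v \<in> carrier_vec m"
    have "k \<le> m \<Longrightarrow> vec m (\<lambda>i. if i < k then v $ i else 0) \<in> ?K" for k
    proof (induction k)
      case 0
      have "vec m (\<lambda>i. if i < 0 then v $ i else 0) = \<one>\<^bsub>zvec m\<^esub>" by (intro eq_vecI) (auto simp: monoid_vec_simps)
      then show ?case using subgroup.one_closed[OF K] by simp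
    next
      case (Suc k)
      have "vec m (\<lambda>i. if i < Suc k then v $ i else 0) = vec m (\<lambda>i. if i < k then v $ i else 0) \<otimes>\<^bsub>zvec m\<^esub> (v $ k \<cdot>\<^sub>v unit_vec m k)"
        using Suc.prems by (intro eq_vecI) (auto simp: monoid_vec_simps less_Suc_eq)
      then show ?case using subgroup.m_closed[OF K Suc.IH smul[of k "v $ k"]] Suc.prems by simp
    qed
    from this[of m] have "vec m (\<lambda>i. if i < m then v $ i else 0) \<in> ?K" by simp
    moreover have "vec m (\<lambda>i. if i < m then v $ i else 0) = v" using v by (intro eq_vecI) auto
    ultimately show "v \<in> ?K" by simp
  qed
qed

lemma zvec_hom_eqI:
  assumes K: "group K" and h: "h \<in> hom (zvec m) K" "k \<in> hom (zvec m) K"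
    and eq: "\<And>i. i < m \<Longrightarrow> h (unit_vec m i) = k (unit_vec m i)" and v: "v \<in> carrier_vec m"
  shows "h v = k v"
proof -
  interpret Z: comm_group "zvec m" by (rule zvec_group)
  interpret K: group K by (rule K)
  interpret h: group_hom "zvec m" K h by unfold_locales (rule h)
  interpret k: group_hom "zvec m" K k by unfold_locales (rule h)
  have "v \<in> generate (zvec m) (unit_vec m ` {..<m})" using v by (simp only: zvec_generate)
  then have "v \<in> carrier (zvec m) \<and> h v = k v"
  proof (induction rule: generate.induct)
    case (inv x)
    then obtain i where "x = unit_vec m i" "i < m" by auto
    moreover have "x \<in> carrier (zvec m)" using \<open>x = unit_vec m i\<close> by (simp add: monoid_vec_simps)
    ultimately show ?case using eq by simp
  next
    case (incl x)
    then show ?case using eq by (auto simp: monoid_vec_simps)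
  next
    case (eng x y)
    then show ?case by simp
  qed simp
  then show ?thesis by simp
qed

definition lincomb :: "nat list \<Rightarrow> nat \<Rightarrow> (nat \<Rightarrow> nat \<Rightarrow> int) \<Rightarrow> int vec \<Rightarrow> (nat \<Rightarrow> int)" where
  "lincomb ds m F v = reduce ds (\<lambda>l. \<Sum>i<m. v $ i * F i l)"

lemma lincomb_hom:
  assumes "pos_list ds"
  shows "lincomb ds m F \<in> hom (zvec m) (cyc_prod ds)"
proof (rule homI)
  fix v w assume "v \<in> carrier (zvec m)" "w \<in> carrier (zvec m)"
  then have vw: "v \<in> carrier_vec m" "w \<in> carrier_vec m" by (simp_all add: monoid_vec_simps)
  show "lincomb ds m F v \<in> cyc ds" unfolding lincomb_def by (rule reduce_carrier[OF assms])
  have "(\<Sum>i<m. (v + w) $ i * F i l) = (\<Sum>i<m. v $ i * F i l) + (\<Sum>i<m. w $ i * F i l)" for l using vw by (simp add: distrib_right sum.distrib)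
  then show "lincomb ds m F (v \<otimes>\<^bsub>zvec m\<^esub> w) = lincomb ds m F v \<otimes>\<^bsub>cyc_prod ds\<^esub> lincomb ds m F w"
    by (simp add: lincomb_def reduce_mult monoid_vec_simps)
qed

lemma lincomb_unit:
  assumes ds: "pos_list ds" and i: "i < m" and F: "F i \<in> cyc ds"
  shows "lincomb ds m F (unit_vec m i) = F i"
proof -
  have "(\<Sum>j<m. unit_vec m i $ j * F j l) = F i l" for l
  proof -
    have "(\<Sum>j<m. unit_vec m i $ j * F j l) = (\<Sum>j<m. if j = i then F j l else 0)" using i by (intro sum.cong) auto
    then show ?thesis using i by simp
  qed
  then show ?thesis by (simp add: lincomb_def reduce_id[OF ds F])
qed

text \<open>The predicate \<open>Q\<close> is carried along so that conditions on the kernel can be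
  translated together with surjectivity.\<close>

lemma bij_epis_zvec:
  assumes ds: "pos_list ds"
  shows "bij_betw (\<lambda>h. \<lambda>i\<in>{..<m}. h (unit_vec m i)) {h \<in> epis (zvec m) (cyc_prod ds). Q h}
    {F \<in> {..<m} \<rightarrow>\<^sub>E cyc ds. generating ds m F \<and> Q (\<lambda>v\<in>carrier_vec m. lincomb ds m F v)}"
proof -
  interpret Z: comm_group "zvec m" by (rule zvec_group)
  interpret G: comm_group "cyc_prod ds" by (rule cyc_prod_group)
  have cz: "carrier (zvec m) = carrier_vec m" by (simp add: monoid_vec_simps)
  let ?r = "\<lambda>F. \<lambda>v\<in>carrier_vec m. lincomb ds m F v"
  have sub: "unit_vec m ` {..<m} \<subseteq> carrier (zvec m)" by (auto simp: monoid_vec_simps)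
  have img: "h ` carrier_vec m = generate (cyc_prod ds) ((\<lambda>i. h (unit_vec m i)) ` {..<m})" if "h \<in> hom (zvec m) (cyc_prod ds)" for h
  proof -
    interpret h: group_hom "zvec m" "cyc_prod ds" h by unfold_locales (rule that)
    show ?thesis using h.generate_img[OF sub] by (simp add: zvec_generate image_image)
  qed
  have rec: "?r (\<lambda>i\<in>{..<m}. h (unit_vec m i)) = h" if h: "h \<in> epis (zvec m) (cyc_prod ds)" for h
  proof (rule extensionalityI[of _ "carrier_vec m"])
    have hh: "h \<in> hom (zvec m) (cyc_prod ds)" using h by (simp add: epis_def)
    show "h \<in> extensional (carrier_vec m)" using h by (simp add: epis_def cz)
    fix v :: "int vec" assume v: "v \<in> carrier_vec m"
    have "lincomb ds m (\<lambda>i\<in>{..<m}. h (unit_vec m i)) v = h v"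
    proof (rule zvec_hom_eqI[OF G.is_group lincomb_hom[OF ds] hh _ v])
      fix i assume i: "i < m"
      have "h (unit_vec m i) \<in> cyc ds" using hom_in_carrier[OF hh] by (simp add: cz)
      then show "lincomb ds m (\<lambda>i\<in>{..<m}. h (unit_vec m i)) (unit_vec m i) = h (unit_vec m i)"
        using lincomb_unit[OF ds i, of "\<lambda>i\<in>{..<m}. h (unit_vec m i)"] i by simp
    qed
    then show "?r (\<lambda>i\<in>{..<m}. h (unit_vec m i)) v = h v" using v by simp
  qed simp
  show ?thesis
  proof (rule bij_betw_byWitness[where f'="?r"])
    show "\<forall>h\<in>{h \<in> epis (zvec m) (cyc_prod ds). Q h}. ?r (\<lambda>i\<in>{..<m}. h (unit_vec m i)) = h" using rec by blast
    show "\<forall>F\<in>{F \<in> {..<m} \<rightarrow>\<^sub>E cyc ds. generating ds m F \<and> Q (?r F)}. (\<lambda>i\<in>{..<m}. ?r F (unit_vec m i)) = F"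
    proof
      fix F assume "F \<in> {F \<in> {..<m} \<rightarrow>\<^sub>E cyc ds. generating ds m F \<and> Q (?r F)}"
      then have F: "F \<in> {..<m} \<rightarrow>\<^sub>E cyc ds" by simp
      show "(\<lambda>i\<in>{..<m}. ?r F (unit_vec m i)) = F"
      proof (rule extensionalityI[of _ "{..<m}"])
        show "F \<in> extensional {..<m}" using F by (simp add: PiE_iff)
        fix i assume i: "i \<in> {..<m}"
        then show "(\<lambda>i\<in>{..<m}. ?r F (unit_vec m i)) i = F i" using lincomb_unit[OF ds, of i m F] PiE_mem[OF F i] by simp
      qed simp
    qed
    show "(\<lambda>h. \<lambda>i\<in>{..<m}. h (unit_vec m i)) ` {h \<in> epis (zvec m) (cyc_prod ds). Q h}
      \<subseteq> {F \<in> {..<m} \<rightarrow>\<^sub>E cyc ds. generating ds m F \<and> Q (?r F)}"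
    proof
      fix F assume "F \<in> (\<lambda>h. \<lambda>i\<in>{..<m}. h (unit_vec m i)) ` {h \<in> epis (zvec m) (cyc_prod ds). Q h}"
      then obtain h where h: "h \<in> epis (zvec m) (cyc_prod ds)" "Q h" "F = (\<lambda>i\<in>{..<m}. h (unit_vec m i))" by blast
      have hh: "h \<in> hom (zvec m) (cyc_prod ds)" and hs: "h ` carrier_vec m = cyc ds" using h by (auto simp: epis_def cz)
      have "generating ds m F" using img[OF hh] hs unfolding generating_def h(3) by (simp cong: image_cong_simp)
      moreover have "F \<in> {..<m} \<rightarrow>\<^sub>E cyc ds" unfolding h(3) using hom_in_carrier[OF hh] by (simp add: cz)
      moreover have "?r F = h" unfolding h(3) by (rule rec[OF h(1)])
      ultimately show "F \<in> {F \<in> {..<m} \<rightarrow>\<^sub>E cyc ds. generating ds m F \<and> Q (?r F)}" using h(2) by simp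
    qed
    show "?r ` {F \<in> {..<m} \<rightarrow>\<^sub>E cyc ds. generating ds m F \<and> Q (?r F)} \<subseteq> {h \<in> epis (zvec m) (cyc_prod ds). Q h}"
    proof
      fix h assume "h \<in> ?r ` {F \<in> {..<m} \<rightarrow>\<^sub>E cyc ds. generating ds m F \<and> Q (?r F)}"
      then obtain F where F: "F \<in> {..<m} \<rightarrow>\<^sub>E cyc ds" "generating ds m F" "Q (?r F)" "h = ?r F" by blast
      have hom: "?r F \<in> hom (zvec m) (cyc_prod ds)"
      proof (rule homI)
        fix v w assume vw: "v \<in> carrier (zvec m)" "w \<in> carrier (zvec m)"
        show "?r F v \<in> cyc ds" using vw hom_in_carrier[OF lincomb_hom[OF ds, of m F] vw(1)] by (simp add: cz)
        have "v \<otimes>\<^bsub>zvec m\<^esub> w \<in> carrier (zvec m)" using vw by (rule Z.m_closed)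
        then show "?r F (v \<otimes>\<^bsub>zvec m\<^esub> w) = ?r F v \<otimes>\<^bsub>cyc_prod ds\<^esub> ?r F w"
          using vw hom_mult[OF lincomb_hom[OF ds, of m F] vw] unfolding cz by (simp only: restrict_apply' )
      qed
      have "(\<lambda>i. ?r F (unit_vec m i)) ` {..<m} = F ` {..<m}"
      proof (rule image_cong[OF refl])
        fix i assume i: "i \<in> {..<m}"
        then show "?r F (unit_vec m i) = F i" using lincomb_unit[OF ds, of i m F] PiE_mem[OF F(1) i] by simp
      qed
      then have "?r F ` carrier_vec m = cyc ds" unfolding img[OF hom] using F(2) by (simp add: generating_def)
      then show "h \<in> {h \<in> epis (zvec m) (cyc_prod ds). Q h}" using hom F(3,4) by (simp add: epis_def cz)
    qed
  qed
qed

lemma reduce_eq_one_iff: "reduce ds y = cyc_one ds \<longleftrightarrow> (\<forall>l<length ds. int (ds ! l) dvd y l)"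
  by (auto simp: reduce_def cyc_prod_one fun_eq_iff dvd_eq_mod_eq_0)

text \<open>\<open>P\<close> sees a surjection through its pullback to Z^m. It is trivial in
  \<open>card_epis_mcok\<close> and expresses injectivity in
  \<open>card_inj_epis_mcok\<close>.\<close>

lemma card_epis_zvec_quotient:
  assumes ds: "pos_list ds" and N: "subgroup N (zvec m)"
  shows "card {h \<in> epis (zvec m Mod N) (cyc_prod ds). P (\<lambda>v\<in>carrier_vec m. h (N #>\<^bsub>zvec m\<^esub> v))} =
     card {F \<in> {..<m} \<rightarrow>\<^sub>E cyc ds. generating ds m F \<and>
        (\<forall>x\<in>N. lincomb ds m F x = cyc_one ds) \<and> P (\<lambda>v\<in>carrier_vec m. lincomb ds m F v)}"
proof -
  interpret Z: comm_group "zvec m" by (rule zvec_group)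
  interpret G: comm_group "cyc_prod ds" by (rule cyc_prod_group)
  have cz: "carrier (zvec m) = carrier_vec m" by (simp add: monoid_vec_simps)
  let ?f = "\<lambda>k. \<lambda>v\<in>carrier_vec m. k (N #>\<^bsub>zvec m\<^esub> v)"
  have B: "bij_betw ?f (epis (zvec m Mod N) (cyc_prod ds)) {h \<in> epis (zvec m) (cyc_prod ds). \<forall>x\<in>N. h x = cyc_one ds}"
    using Z.bij_quotient_epis[OF N G.is_group] unfolding cz .
  have kill: "(\<forall>x\<in>N. (\<lambda>v\<in>carrier_vec m. lincomb ds m F v) x = cyc_one ds) \<longleftrightarrow> (\<forall>x\<in>N. lincomb ds m F x = cyc_one ds)" for F
    using subgroup.subset[OF N] unfolding cz by auto
  have "card {h \<in> epis (zvec m Mod N) (cyc_prod ds). P (?f h)}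
      = card {h \<in> {h \<in> epis (zvec m) (cyc_prod ds). \<forall>x\<in>N. h x = cyc_one ds}. P h}" by (rule bij_betw_same_card[OF bij_betw_Collect[OF B]]) simp
  also have "\<dots> = card {h \<in> epis (zvec m) (cyc_prod ds). (\<forall>x\<in>N. h x = cyc_one ds) \<and> P h}" by (simp add: conj_assoc)
  also have "\<dots> = card {F \<in> {..<m} \<rightarrow>\<^sub>E cyc ds. generating ds m F \<and>
      ((\<forall>x\<in>N. (\<lambda>v\<in>carrier_vec m. lincomb ds m F v) x = cyc_one ds) \<and> P (\<lambda>v\<in>carrier_vec m. lincomb ds m F v))}"
    by (rule bij_betw_same_card[OF bij_epis_zvec[OF ds]])
  finally show ?thesis by (simp only: kill)
qed

lemma card_incident:
  assumes E: "E \<subseteq> vertex_pairs n" and v: "v < n"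
  shows "vertex_degree E v = card {i. i < n \<and> {i, v} \<in> E}"
proof -
  have "bij_betw (\<lambda>i. {i, v}) {i. i < n \<and> {i, v} \<in> E} {e \<in> E. v \<in> e}" unfolding bij_betw_def
  proof
    show "inj_on (\<lambda>i. {i, v}) {i. i < n \<and> {i, v} \<in> E}" by (auto simp: inj_on_def doubleton_eq_iff)
    show "(\<lambda>i. {i, v}) ` {i. i < n \<and> {i, v} \<in> E} = {e \<in> E. v \<in> e}"
    proof
      show "{e \<in> E. v \<in> e} \<subseteq> (\<lambda>i. {i, v}) ` {i. i < n \<and> {i, v} \<in> E}"
      proof
        fix e assume e: "e \<in> {e \<in> E. v \<in> e}"
        then have "e \<in> vertex_pairs n" using E by auto
        then obtain i j where ij: "i < j" "j < n" "e = {i, j}" by (elim vertex_pairsE)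
        have "v = i \<or> v = j" using e ij(3) by auto
        then show "e \<in> (\<lambda>i. {i, v}) ` {i. i < n \<and> {i, v} \<in> E}"
        proof
          assume "v = i"
          then show ?thesis using e ij by (intro image_eqI[of _ _ j]) (auto simp: insert_commute)
        next
          assume "v = j"
          then show ?thesis using e ij by (intro image_eqI[of _ _ i]) auto
        qed
      qed
    qed auto
  qed
  from bij_betw_same_card[OF this] show ?thesis by (simp add: vertex_degree_def)
qed

lemma reduced_laplacian_carrier: "reduced_laplacian n E \<in> carrier_mat (n - 1) (n - 1)" by (simp add: reduced_laplacian_def laplacian_def mat_delete_def)

text \<open>The reduction matters for moduli equal to 1, where the residue of 1 is 0.\<close>

definition unit_tuple :: "nat list \<Rightarrow> nat \<Rightarrow> nat \<Rightarrow> int" where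
  "unit_tuple ds i = reduce ds (\<lambda>l. of_bool (l = i))"

lemma unit_tuple_carrier: "pos_list ds \<Longrightarrow> unit_tuple ds i \<in> cyc ds" by (simp add: unit_tuple_def reduce_carrier)

lemma lincomb_unit_tuple:
  assumes ds: "pos_list ds" and x: "x \<in> cyc ds"
  shows "lincomb ds (length ds) (unit_tuple ds) (vec (length ds) x) = x"
proof -
  have "lincomb ds (length ds) (unit_tuple ds) (vec (length ds) x) = reduce ds x" unfolding lincomb_def
  proof (rule reduce_cong)
    fix l assume l: "l < length ds"
    have "(\<Sum>i<length ds. vec (length ds) x $ i * unit_tuple ds i l) - x l = (\<Sum>i<length ds. x i * (unit_tuple ds i l - of_bool (l = i)))"
    proof -
      have "(\<Sum>i<length ds. x i * of_bool (l = i)) = x l" using l by (simp add: of_bool_def if_distrib[of "\<lambda>z. _ * z"] cong: if_cong)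
      then show ?thesis by (simp add: right_diff_distrib sum_subtractf)
    qed
    also have "int (ds ! l) dvd \<dots>"
    proof (intro dvd_sum dvd_mult)
      fix i
      show "int (ds ! l) dvd unit_tuple ds i l - of_bool (l = i)" using l by (subst mod_eq_dvd_iff[symmetric]) (simp add: unit_tuple_def reduce_def)
    qed
    finally show "int (ds ! l) dvd (\<Sum>i<length ds. vec (length ds) x $ i * unit_tuple ds i l) - x l" .
  qed
  then show ?thesis using reduce_id[OF ds x] by simp
qed

lemma cyc_prod_hom_eqI:
  assumes ds: "pos_list ds" and K: "group K" and h: "h \<in> hom (cyc_prod ds) K" "g \<in> hom (cyc_prod ds) K"
    and eq: "\<And>i. i < length ds \<Longrightarrow> h (unit_tuple ds i) = g (unit_tuple ds i)" and x: "x \<in> cyc ds"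
  shows "h x = g x"
proof -
  let ?l = "lincomb ds (length ds) (unit_tuple ds)"
  have l: "?l \<in> hom (zvec (length ds)) (cyc_prod ds)" by (rule lincomb_hom[OF ds])
  have "(h \<circ> ?l) (vec (length ds) x) = (g \<circ> ?l) (vec (length ds) x)"
  proof (rule zvec_hom_eqI[OF K])
    show "h \<circ> ?l \<in> hom (zvec (length ds)) K" "g \<circ> ?l \<in> hom (zvec (length ds)) K" using l h by (auto intro: hom_compose)
    fix i assume "i < length ds"
    then show "(h \<circ> ?l) (unit_vec (length ds) i) = (g \<circ> ?l) (unit_vec (length ds) i)" using lincomb_unit[OF ds _ unit_tuple_carrier[OF ds]] eq by simp
  qed simp
  then show ?thesis using lincomb_unit_tuple[OF ds x] by simp
qed

lemma unit_tuple_pow: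
  assumes ds: "pos_list ds" and i: "i < length ds"
  shows "unit_tuple ds i [^]\<^bsub>cyc_prod ds\<^esub> (ds ! i) = cyc_one ds"
proof -
  have "reduce ds x [^]\<^bsub>cyc_prod ds\<^esub> (n::nat) = reduce ds (\<lambda>l. int n * x l)" for x n
  proof (induction n)
    case 0
    then show ?case by (simp add: one_eq_reduce)
  next
    case (Suc n)
    then show ?case by (simp add: reduce_mult algebra_simps)
  qed
  then show ?thesis unfolding unit_tuple_def reduce_eq_one_iff by (simp add: reduce_eq_one_iff)
qed

abbreviation pgrp :: "nat \<Rightarrow> nat list \<Rightarrow> (nat \<Rightarrow> int) monoid" where
  "pgrp p es \<equiv> cyc_prod (pows p es)"

lemma pos_list_pow: "p > 0 \<Longrightarrow> pos_list (pows p es)" by (simp add: pos_list_def)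

lemma pgrp_snoc: "p > 0 \<Longrightarrow> pgrp p es \<times>\<times> integer_mod_group (p ^ e) \<cong> pgrp p (es @ [e])"
  using cyc_prod_snoc_iso[of "p ^ e" "pows p es"] by (simp add: pos_list_pow)

text \<open>All exponents are at least 1, so each cyclic factor has exactly \<open>p\<close> maps to
  Z/p. This makes the length of the list an invariant of the group.\<close>

lemma card_homs_pgrp:
  assumes p: "p > 1" and es: "\<forall>e\<in>set es. e \<ge> 1"
  shows "card (homs (pgrp p es) (integer_mod_group p)) = p ^ length es"
proof -
  let ?r = "length es" and ?ds = "pows p es" and ?Z = "integer_mod_group p"
  let ?C = "cyc ?ds"
  interpret G: comm_group "cyc_prod ?ds" by (rule cyc_prod_group)
  have ds: "pos_list ?ds" using p by (intro pos_list_pow) simp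
  have cp: "carrier ?Z = {0..<int p}" using p by (simp add: carrier_integer_mod_group)
  have pd: "int p dvd int (?ds ! l)" if "l < ?r" for l using bspec[OF es nth_mem[OF that]] that by (simp add: dvd_power)
  define g where "g = (\<lambda>a x. (\<Sum>l<?r. a l * x l) mod int p :: int)"
  have g_cong: "g a x = g a y" if "\<And>l. l < ?r \<Longrightarrow> int (?ds ! l) dvd x l - y l" for a x y
  proof -
    have "int p dvd (\<Sum>l<?r. a l * (x l - y l))" by (intro dvd_sum dvd_mult dvd_trans[OF pd that]) auto
    then show ?thesis by (simp add: g_def mod_eq_dvd_iff right_diff_distrib sum_subtractf)
  qed
  have g_unit: "g a (unit_tuple ?ds i) = a i mod int p" if i: "i < ?r" for a i
  proof -
    have "g a (unit_tuple ?ds i) = g a (\<lambda>l. of_bool (l = i))" by (rule g_cong) (simp add: unit_tuple_def reduce_def flip: mod_eq_dvd_iff)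
    also have "(\<Sum>l<?r. a l * of_bool (l = i)) = (\<Sum>l<?r. if l = i then a l else 0)" by (intro sum.cong) auto
    then have "g a (\<lambda>l. of_bool (l = i)) = a i mod int p" using i by (simp add: g_def)
    finally show ?thesis .
  qed
  have g_hom: "g a \<in> hom (cyc_prod ?ds) ?Z" for a
  proof (rule homI)
    fix x y
    show "g a x \<in> carrier ?Z" using p by (simp add: g_def cp)
    have "g a (x \<otimes>\<^bsub>cyc_prod ?ds\<^esub> y) = g a (\<lambda>l. x l + y l)" by (rule g_cong) (simp add: cyc_prod_mult flip: mod_eq_dvd_iff)
    then show "g a (x \<otimes>\<^bsub>cyc_prod ?ds\<^esub> y) = g a x \<otimes>\<^bsub>?Z\<^esub> g a y" using p by (simp add: g_def distrib_left sum.distrib mod_add_eq)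
  qed
  have "bij_betw (\<lambda>a. \<lambda>x\<in>?C. g a x) ({..<?r} \<rightarrow>\<^sub>E {0..<int p}) (homs (cyc_prod ?ds) ?Z)"
  proof (rule bij_betw_byWitness[where f' = "\<lambda>h. \<lambda>i\<in>{..<?r}. h (unit_tuple ?ds i)"])
    show "\<forall>a\<in>{..<?r} \<rightarrow>\<^sub>E {0..<int p}. (\<lambda>i\<in>{..<?r}. (\<lambda>x\<in>?C. g a x) (unit_tuple ?ds i)) = a"
    proof
      fix a assume a: "a \<in> {..<?r} \<rightarrow>\<^sub>E {0..<int p}"
      have "a i mod int p = a i" if "i < ?r" for i using PiE_mem[OF a, of i] that by simp
      moreover have "a \<in> extensional {..<?r}" using a by (simp add: PiE_def)
      ultimately show "(\<lambda>i\<in>{..<?r}. (\<lambda>x\<in>?C. g a x) (unit_tuple ?ds i)) = a"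
        using unit_tuple_carrier[OF ds] g_unit by (intro extensionalityI[of _ "{..<?r}"]) auto
    qed
    show "\<forall>h\<in>homs (cyc_prod ?ds) ?Z. (\<lambda>x\<in>?C. g (\<lambda>i\<in>{..<?r}. h (unit_tuple ?ds i)) x) = h"
    proof
      fix h assume "h \<in> homs (cyc_prod ?ds) ?Z"
      then have h: "h \<in> hom (cyc_prod ?ds) ?Z" "h \<in> extensional ?C" by (auto simp: homs_def)
      have "g (\<lambda>i\<in>{..<?r}. h (unit_tuple ?ds i)) x = h x" if "x \<in> ?C" for x
      proof (rule cyc_prod_hom_eqI[OF ds group_integer_mod_group g_hom h(1) _ that])
        fix i assume "i < length ?ds"
        then show "g (\<lambda>i\<in>{..<?r}. h (unit_tuple ?ds i)) (unit_tuple ?ds i) = h (unit_tuple ?ds i)"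
          using g_unit[of i] hom_in_carrier[OF h(1) unit_tuple_carrier[OF ds]] cp by simp
      qed
      then show "(\<lambda>x\<in>?C. g (\<lambda>i\<in>{..<?r}. h (unit_tuple ?ds i)) x) = h" using h(2) by (intro extensionalityI[of _ ?C]) auto
    qed
    show "(\<lambda>a. \<lambda>x\<in>?C. g a x) ` ({..<?r} \<rightarrow>\<^sub>E {0..<int p}) \<subseteq> homs (cyc_prod ?ds) ?Z"
      using g_hom by (auto simp: homs_def hom_def)
    show "(\<lambda>h. \<lambda>i\<in>{..<?r}. h (unit_tuple ?ds i)) ` homs (cyc_prod ?ds) ?Z \<subseteq> {..<?r} \<rightarrow>\<^sub>E {0..<int p}"
    proof (rule image_subsetI)
      fix h assume "h \<in> homs (cyc_prod ?ds) ?Z"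
      then have "h \<in> hom (cyc_prod ?ds) ?Z" by (simp add: homs_def)
      from hom_in_carrier[OF this unit_tuple_carrier[OF ds]]
      show "(\<lambda>i\<in>{..<?r}. h (unit_tuple ?ds i)) \<in> {..<?r} \<rightarrow>\<^sub>E {0..<int p}" unfolding cp by (intro restrict_PiE_iff[THEN iffD2] ballI)
    qed
  qed
  from bij_betw_same_card[OF this] show ?thesis by (simp add: card_PiE)
qed

text \<open>Iterates \<open>card_epis_DirProd\<close>: \<open>R\<close> is the p-rank of
  \<open>U\<close>, and every new factor Z/p raises the rank of the target by one.\<close>

lemma card_epis_append_ones:
  assumes U: "comm_group U" "finite (carrier U)" and p: "Factorial_Ring.prime p"
    and R: "card (homs U (integer_mod_group p)) = p ^ R" and es: "\<forall>e\<in>set es. e \<ge> 1"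
  shows "real (card (epis U (pgrp p (es @ replicate i 1)))) =
     real (card (epis U (pgrp p es))) * (\<Prod>j<i. real p ^ R - real p ^ (length es + j))"
proof (induction i)
  case (Suc i)
  let ?fs = "es @ replicate i 1"
  have p1: "p > 1" using p prime_gt_1_nat by blast
  interpret U: comm_group U by (rule U)
  interpret E: comm_group "pgrp p ?fs" by (rule cyc_prod_group)
  interpret E': comm_group "pgrp p (?fs @ [1])" by (rule cyc_prod_group)
  have iso: "pgrp p ?fs \<times>\<times> integer_mod_group p \<cong> pgrp p (?fs @ [1])" using pgrp_snoc[of p ?fs 1] p1 by simp
  have "card (epis U (pgrp p (es @ replicate (Suc i) 1))) = card (epis U (pgrp p ?fs \<times>\<times> integer_mod_group p))"
    using card_epis_iso_cod[OF iso DirProd_group[OF E.is_group group_integer_mod_group] U.is_group] by (simp add: replicate_append_same)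
  moreover have "finite (carrier (pgrp p ?fs))" using p1 by (intro cyc_prod_finite pos_list_pow) simp
  moreover have "card (homs (pgrp p ?fs) (integer_mod_group p)) = p ^ (length es + i)"
  proof -
    have "\<forall>e\<in>set ?fs. e \<ge> 1" using es by (auto simp: set_replicate_conv_if split: if_splits)
    from card_homs_pgrp[OF p1 this] show ?thesis by simp
  qed
  ultimately show ?case using card_epis_DirProd[OF U E.comm_group_axioms _ p] Suc.IH R by simp
qed simp

section \<open>Cokernels modulo an integer\<close>

text \<open>For \<open>q = 0\<close> this is the image of \<open>A\<close> itself, so the integral
  cokernel and its reductions are treated alike, see \<open>cokernel_eq_mcok\<close>.\<close>

definition latt :: "nat \<Rightarrow> int mat \<Rightarrow> int vec set" where
  "latt q A = {A *\<^sub>v x + int q \<cdot>\<^sub>v y |x y. x \<in> carrier_vec (dim_col A) \<and> y \<in> carrier_vec (dim_row A)}"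

definition mcok :: "nat \<Rightarrow> int mat \<Rightarrow> int vec set monoid" where
  "mcok q A = zvec (dim_row A) Mod latt q A"

lemma lattI: "x \<in> carrier_vec (dim_col A) \<Longrightarrow> y \<in> carrier_vec (dim_row A) \<Longrightarrow> A *\<^sub>v x + int q \<cdot>\<^sub>v y \<in> latt q A"
  by (auto simp: latt_def)

lemma mat_vec_in: "A *\<^sub>v x \<in> carrier_vec (dim_row A)" by (rule carrier_vecI) simp

lemma latt_subset: "latt q A \<subseteq> carrier_vec (dim_row A)" by (auto simp: latt_def intro!: add_carrier_vec mat_vec_in)

lemma latt_image: "x \<in> carrier_vec (dim_col A) \<Longrightarrow> A *\<^sub>v x \<in> latt q A"
proof -
  assume x: "x \<in> carrier_vec (dim_col A)"
  have "A *\<^sub>v x + int q \<cdot>\<^sub>v 0\<^sub>v (dim_row A) = A *\<^sub>v x" by (intro eq_vecI) auto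
  then show ?thesis using lattI[OF x, of "0\<^sub>v (dim_row A)" q] by simp
qed

lemma latt_smult: "y \<in> carrier_vec (dim_row A) \<Longrightarrow> int q \<cdot>\<^sub>v y \<in> latt q A"
proof -
  assume y: "y \<in> carrier_vec (dim_row A)"
  have "A *\<^sub>v 0\<^sub>v (dim_col A) + int q \<cdot>\<^sub>v y = int q \<cdot>\<^sub>v y" using y by (intro eq_vecI) (auto simp: scalar_prod_def)
  then show ?thesis using lattI[OF _ y, of "0\<^sub>v (dim_col A)" q] by simp
qed

lemma smult_mat_vec: "x \<in> carrier_vec (dim_col A) \<Longrightarrow> A *\<^sub>v (c \<cdot>\<^sub>v x) = (c::int) \<cdot>\<^sub>v (A *\<^sub>v x)"
  by (intro eq_vecI) (auto simp: scalar_prod_def sum_distrib_left algebra_simps)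

lemma add_mat_vec: "x \<in> carrier_vec (dim_col A) \<Longrightarrow> y \<in> carrier_vec (dim_col A) \<Longrightarrow> A *\<^sub>v (x + y) = A *\<^sub>v x + A *\<^sub>v (y :: int vec)"
  by (rule mult_add_distrib_mat_vec[of A "dim_row A" "dim_col A"]) auto

lemma latt_add:
  assumes "v \<in> latt q A" "w \<in> latt q A"
  shows "v + w \<in> latt q A"
proof -
  obtain x y x' y' where xy: "x \<in> carrier_vec (dim_col A)" "y \<in> carrier_vec (dim_row A)" "x' \<in> carrier_vec (dim_col A)" "y' \<in> carrier_vec (dim_row A)"
    "v = A *\<^sub>v x + int q \<cdot>\<^sub>v y" "w = A *\<^sub>v x' + int q \<cdot>\<^sub>v y'" using assms by (auto simp: latt_def)
  have "v + w = A *\<^sub>v (x + x') + int q \<cdot>\<^sub>v (y + y')" unfolding xy(5,6) add_mat_vec[OF xy(1,3)] using xy by (intro eq_vecI) (auto simp: algebra_simps)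
  then show ?thesis using lattI[of "x + x'" A "y + y'" q] xy by simp
qed

lemma latt_smult_closed:
  assumes "v \<in> latt q A"
  shows "c \<cdot>\<^sub>v v \<in> latt q A"
proof -
  obtain x y where xy: "x \<in> carrier_vec (dim_col A)" "y \<in> carrier_vec (dim_row A)" "v = A *\<^sub>v x + int q \<cdot>\<^sub>v y"
    using assms by (auto simp: latt_def)
  have "c \<cdot>\<^sub>v v = A *\<^sub>v (c \<cdot>\<^sub>v x) + int q \<cdot>\<^sub>v (c \<cdot>\<^sub>v y)"
    unfolding xy(3) smult_mat_vec[OF xy(1)] using xy by (intro eq_vecI) (auto simp: algebra_simps)
  then show ?thesis using lattI[of "c \<cdot>\<^sub>v x" A "c \<cdot>\<^sub>v y" q] xy by simp
qed

lemma zvec_inv: "v \<in> carrier_vec m \<Longrightarrow> inv\<^bsub>zvec m\<^esub> v = (-1) \<cdot>\<^sub>v v"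
proof -
  assume v: "v \<in> carrier_vec m"
  interpret Z: comm_group "zvec m" by (rule zvec_group)
  have "((-1) \<cdot>\<^sub>v v) \<otimes>\<^bsub>zvec m\<^esub> v = \<one>\<^bsub>zvec m\<^esub>" using v by (intro eq_vecI) (auto simp: monoid_vec_simps)
  then show ?thesis using v by (intro Z.inv_equality) (auto simp: monoid_vec_simps)
qed

lemma latt_subgroup: "subgroup (latt q A) (zvec (dim_row A))"
proof -
  interpret Z: comm_group "zvec (dim_row A)" by (rule zvec_group)
  show ?thesis
  proof (rule Z.subgroupI)
    show "latt q A \<subseteq> carrier (zvec (dim_row A))" using latt_subset by (simp add: monoid_vec_simps)
    show "latt q A \<noteq> {}" using latt_image[of "0\<^sub>v (dim_col A)" A q] by auto
    show "inv\<^bsub>zvec (dim_row A)\<^esub> v \<in> latt q A" if "v \<in> latt q A" for v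
    proof -
      have "v \<in> carrier_vec (dim_row A)" using that latt_subset by blast
      then show ?thesis using latt_smult_closed[OF that, of "-1"] by (simp add: zvec_inv)
    qed
    show "v \<otimes>\<^bsub>zvec (dim_row A)\<^esub> w \<in> latt q A" if "v \<in> latt q A" "w \<in> latt q A" for v w
      using latt_add[OF that] by (simp add: monoid_vec_simps)
  qed
qed

lemma mcok_group: "comm_group (mcok q A)" unfolding mcok_def by (rule comm_group.quotient_hom(1)[OF zvec_group latt_subgroup])

lemma mcok_proj:
  shows "(\<lambda>v. latt q A #>\<^bsub>zvec (dim_row A)\<^esub> v) \<in> hom (zvec (dim_row A)) (mcok q A)"
    and "carrier (mcok q A) = (\<lambda>v. latt q A #>\<^bsub>zvec (dim_row A)\<^esub> v) ` carrier_vec (dim_row A)"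
    and "\<And>v. v \<in> carrier_vec (dim_row A) \<Longrightarrow> latt q A #>\<^bsub>zvec (dim_row A)\<^esub> v = \<one>\<^bsub>mcok q A\<^esub> \<longleftrightarrow> v \<in> latt q A"
  using comm_group.quotient_hom(2-)[OF zvec_group latt_subgroup[of q A]] by (simp_all add: mcok_def monoid_vec_simps)

lemma mcok_pow:
  assumes "y \<in> carrier (mcok q A)"
  shows "y [^]\<^bsub>mcok q A\<^esub> q = \<one>\<^bsub>mcok q A\<^esub>"
proof -
  interpret Z: comm_group "zvec (dim_row A)" by (rule zvec_group)
  interpret M: comm_group "mcok q A" by (rule mcok_group)
  interpret h: group_hom "zvec (dim_row A)" "mcok q A" "\<lambda>v. latt q A #>\<^bsub>zvec (dim_row A)\<^esub> v" by unfold_locales (rule mcok_proj(1))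
  obtain v where v: "v \<in> carrier_vec (dim_row A)" "y = latt q A #>\<^bsub>zvec (dim_row A)\<^esub> v" using assms mcok_proj(2)[of q A] by auto
  have "y [^]\<^bsub>mcok q A\<^esub> q = latt q A #>\<^bsub>zvec (dim_row A)\<^esub> (v [^]\<^bsub>zvec (dim_row A)\<^esub> q)"
    unfolding v(2) using h.hom_nat_pow[of v q] v(1) by (simp add: monoid_vec_simps)
  also have "v [^]\<^bsub>zvec (dim_row A)\<^esub> q = int q \<cdot>\<^sub>v v" by (rule zvec_pow[OF v(1)])
  finally show ?thesis using mcok_proj(3)[of "int q \<cdot>\<^sub>v v" A q] latt_smult[OF v(1)] v(1) by simp
qed

lemma mcok_finite:
  assumes "q > 0"
  shows "finite (carrier (mcok q A))"
proof -
  interpret Z: comm_group "zvec (dim_row A)" by (rule zvec_group)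
  let ?m = "dim_row A"
  let ?V = "(\<lambda>f. vec ?m f) ` ({..<?m} \<rightarrow>\<^sub>E {0..<int q})"
  have "carrier (mcok q A) \<subseteq> (\<lambda>v. latt q A #>\<^bsub>zvec ?m\<^esub> v) ` ?V"
  proof
    fix y assume "y \<in> carrier (mcok q A)"
    then obtain v where v: "v \<in> carrier_vec ?m" "y = latt q A #>\<^bsub>zvec ?m\<^esub> v" using mcok_proj(2)[of q A] by auto
    define w where "w = vec ?m (\<lambda>i\<in>{..<?m}. v $ i mod int q)"
    define z where "z = vec ?m (\<lambda>i. v $ i div int q)"
    have "w = (int q \<cdot>\<^sub>v ((-1) \<cdot>\<^sub>v z)) \<otimes>\<^bsub>zvec ?m\<^esub> v"
      using v by (intro eq_vecI) (auto simp: w_def z_def monoid_vec_simps minus_mult_div_eq_mod[symmetric])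
    moreover have "int q \<cdot>\<^sub>v ((-1) \<cdot>\<^sub>v z) \<in> latt q A" by (rule latt_smult) (simp add: z_def)
    ultimately have "w \<in> latt q A #>\<^bsub>zvec ?m\<^esub> v" unfolding r_coset_def by blast
    then have "latt q A #>\<^bsub>zvec ?m\<^esub> v = latt q A #>\<^bsub>zvec ?m\<^esub> w"
      by (rule Z.repr_independence) (use v latt_subgroup in \<open>simp_all add: monoid_vec_simps\<close>)
    moreover have "w \<in> ?V" unfolding w_def using assms by (intro imageI PiE_I) auto
    ultimately show "y \<in> (\<lambda>v. latt q A #>\<^bsub>zvec ?m\<^esub> v) ` ?V" using v(2) by blast
  qed
  moreover have "finite ?V" by (intro finite_imageI finite_PiE) auto
  ultimately show ?thesis using finite_subset finite_imageI by blast
qed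

lemma mcok_structure:
  assumes "Factorial_Ring.prime p"
  shows "\<exists>es. set es \<subseteq> {1..k} \<and> pgrp p es \<cong> mcok (p ^ k) A"
  using assms by (intro finite_abelian_p_group_structure mcok_group mcok_finite mcok_pow) (auto simp: prime_gt_0_nat)

lemma mat_vec_nth: "A \<in> carrier_mat r r' \<Longrightarrow> v \<in> carrier_vec r' \<Longrightarrow> i < r \<Longrightarrow> (A *\<^sub>v v) $ i = (\<Sum>j<r'. A $$ (i, j) * v $ j)"
  by (simp add: scalar_prod_def atLeast0LessThan)

text \<open>Multiples of \<open>q\<close> die because every modulus divides \<open>q\<close>; only
  the columns of \<open>A\<close> impose conditions.\<close>

lemma latt_killed_iff:
  assumes A: "A \<in> carrier_mat m m'" and q: "\<And>l. l < length ds \<Longrightarrow> ds ! l dvd q"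
  shows "(\<forall>x\<in>latt q A. lincomb ds m F x = cyc_one ds) \<longleftrightarrow>
      (\<forall>j<m'. \<forall>l<length ds. int (ds ! l) dvd (\<Sum>i<m. A $$ (i, j) * F i l))" (is "?L \<longleftrightarrow> ?R")
proof
  have dims: "dim_row A = m" "dim_col A = m'" using A by auto
  show ?R if L: ?L
  proof (intro allI impI)
    fix j l assume j: "j < m'" and l: "l < length ds"
    have "A *\<^sub>v unit_vec m' j \<in> latt q A" by (rule latt_image) (simp add: dims)
    then have "int (ds ! l) dvd (\<Sum>i<m. (A *\<^sub>v unit_vec m' j) $ i * F i l)" using L l by (simp add: lincomb_def reduce_eq_one_iff)
    moreover have "(A *\<^sub>v unit_vec m' j) $ i = A $$ (i, j)" if "i < m" for i using A that j by (simp add: row_def)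
    ultimately show "int (ds ! l) dvd (\<Sum>i<m. A $$ (i, j) * F i l)" by simp
  qed
  show ?L if R: ?R
  proof
    fix v assume "v \<in> latt q A"
    then obtain x y where xy: "x \<in> carrier_vec m'" "y \<in> carrier_vec m" "v = A *\<^sub>v x + int q \<cdot>\<^sub>v y" by (auto simp: latt_def dims)
    have "int (ds ! l) dvd (\<Sum>i<m. v $ i * F i l)" if l: "l < length ds" for l
    proof -
      have vi: "v $ i = (\<Sum>j<m'. A $$ (i, j) * x $ j) + int q * y $ i" if "i < m" for i unfolding xy(3) using that xy A mat_vec_nth[OF A xy(1) that] by simp
      have "(\<Sum>i<m. v $ i * F i l) = (\<Sum>i<m. (\<Sum>j<m'. A $$ (i, j) * x $ j) * F i l) + int q * (\<Sum>i<m. y $ i * F i l)"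
        by (simp add: vi distrib_right sum.distrib sum_distrib_left mult.assoc)
      also have "(\<Sum>i<m. (\<Sum>j<m'. A $$ (i, j) * x $ j) * F i l) = (\<Sum>j<m'. x $ j * (\<Sum>i<m. A $$ (i, j) * F i l))"
        unfolding sum_distrib_left sum_distrib_right by (subst sum.swap) (simp add: mult_ac)
      finally have eq: "(\<Sum>i<m. v $ i * F i l) = (\<Sum>j<m'. x $ j * (\<Sum>i<m. A $$ (i, j) * F i l)) + int q * (\<Sum>i<m. y $ i * F i l)" .
      have "int (ds ! l) dvd (\<Sum>j<m'. x $ j * (\<Sum>i<m. A $$ (i, j) * F i l))" by (rule dvd_sum, rule dvd_mult) (use R l in auto)
      then show ?thesis unfolding eq using q[OF l] by simp
    qed
    then show "lincomb ds m F v = cyc_one ds" by (simp add: lincomb_def reduce_eq_one_iff)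
  qed
qed

lemma card_epis_mcok:
  assumes ds: "pos_list ds" and A: "A \<in> carrier_mat m m'" and q: "\<And>l. l < length ds \<Longrightarrow> ds ! l dvd q"
  shows "card (epis (mcok q A) (cyc_prod ds)) =
     card {F \<in> {..<m} \<rightarrow>\<^sub>E cyc ds. generating ds m F \<and>
        (\<forall>j<m'. \<forall>l<length ds. int (ds ! l) dvd (\<Sum>i<m. A $$ (i, j) * F i l))}"
proof -
  have dims: "dim_row A = m" using A by auto
  have N: "subgroup (latt q A) (zvec m)" using latt_subgroup[of q A] dims by simp
  show ?thesis using card_epis_zvec_quotient[OF ds N, of "\<lambda>_. True"] latt_killed_iff[OF A q] by (simp add: mcok_def dims)
qed

text \<open>The injective surjections are the isomorphisms. The additional clause says that the
  kernel of the tuple is contained in the lattice, the other inclusion being the annihilation of the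
  columns.\<close>

lemma card_inj_epis_mcok:
  assumes ds: "pos_list ds" and A: "A \<in> carrier_mat m m'" and q: "\<And>l. l < length ds \<Longrightarrow> ds ! l dvd q"
  shows "card {h \<in> epis (mcok q A) (cyc_prod ds). inj_on h (carrier (mcok q A))} =
     card {F \<in> {..<m} \<rightarrow>\<^sub>E cyc ds. generating ds m F \<and>
        (\<forall>j<m'. \<forall>l<length ds. int (ds ! l) dvd (\<Sum>i<m. A $$ (i, j) * F i l)) \<and>
        (\<forall>v\<in>carrier_vec m. lincomb ds m F v = cyc_one ds \<longrightarrow> v \<in> latt q A)}"
proof -
  have dims: "dim_row A = m" using A by auto
  interpret G: comm_group "cyc_prod ds" by (rule cyc_prod_group)
  interpret M: comm_group "mcok q A" by (rule mcok_group)
  have N: "subgroup (latt q A) (zvec m)" using latt_subgroup[of q A] dims by simp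
  let ?P = "\<lambda>h. \<forall>v\<in>carrier_vec m. h v = cyc_one ds \<longrightarrow> v \<in> latt q A"
  have inj: "inj_on h (carrier (mcok q A)) \<longleftrightarrow> ?P (\<lambda>v\<in>carrier_vec m. h (latt q A #>\<^bsub>zvec m\<^esub> v))"
    if h: "h \<in> epis (mcok q A) (cyc_prod ds)" for h
  proof -
    have hh: "h \<in> hom (mcok q A) (cyc_prod ds)" using h by (simp add: epis_def)
    interpret h: group_hom "mcok q A" "cyc_prod ds" h by unfold_locales (rule hh)
    have "inj_on h (carrier (mcok q A)) \<longleftrightarrow> (\<forall>x\<in>carrier (mcok q A). h x = cyc_one ds \<longrightarrow> x = \<one>\<^bsub>mcok q A\<^esub>)"
      using h.inj_on_one_iff by blast
    also have "\<dots> \<longleftrightarrow> (\<forall>v\<in>carrier_vec m. h (latt q A #>\<^bsub>zvec m\<^esub> v) = cyc_one ds \<longrightarrow> latt q A #>\<^bsub>zvec m\<^esub> v = \<one>\<^bsub>mcok q A\<^esub>)"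
      using mcok_proj(2)[of q A] by (simp add: dims)
    also have "\<dots> \<longleftrightarrow> (\<forall>v\<in>carrier_vec m. h (latt q A #>\<^bsub>zvec m\<^esub> v) = cyc_one ds \<longrightarrow> v \<in> latt q A)"
      using mcok_proj(3)[of _ A q] by (simp add: dims)
    finally show ?thesis by simp
  qed
  have "{h \<in> epis (mcok q A) (cyc_prod ds). inj_on h (carrier (mcok q A))}
     = {h \<in> epis (zvec m Mod latt q A) (cyc_prod ds). ?P (\<lambda>v\<in>carrier_vec m. h (latt q A #>\<^bsub>zvec m\<^esub> v))}"
    using inj by (auto simp: mcok_def dims simp del: restrict_apply)
  then show ?thesis using card_epis_zvec_quotient[OF ds N, of ?P] latt_killed_iff[OF A q] by simp
qed

text \<open>\<open>sh\<close> shifts indices by one and puts the identity at the deleted vertex 0.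
  The harmonic equation at vertex \<open>Suc j\<close> is then the relation given by column
  \<open>j\<close> of the reduced Laplacian.\<close>

lemma card_epis_mcok_sandpile:
  assumes ds: "pos_list ds" and n: "n \<ge> 1" and E: "E \<subseteq> vertex_pairs n" and q: "\<And>l. l < length ds \<Longrightarrow> ds ! l dvd q"
  shows "card (epis (mcok q (reduced_laplacian n E)) (cyc_prod ds)) = card (harmonic_surj ds n E)"
proof -
  let ?m = "n - 1" let ?A = "reduced_laplacian n E" let ?o = "(cyc_one ds)"
  interpret G: comm_group "cyc_prod ds" by (rule cyc_prod_group)
  define sh where "sh = (\<lambda>F i. if i = 0 then ?o else if i < n then F (i - 1) else undefined :: nat \<Rightarrow> int)"
  have entry: "?A $$ (i, j) = (if i = j then int (vertex_degree E (Suc i)) else if {Suc i, Suc j} \<in> E then - 1 else 0)"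
    if "i < ?m" "j < ?m" for i j using that by (simp add: reduced_laplacian_def laplacian_def mat_delete_def)
  have lap: "(\<Sum>i | i < n \<and> {i, Suc j} \<in> E. sh F (Suc j) l - sh F i l) = (\<Sum>i<?m. ?A $$ (i, j) * F i l)"
    if j: "j < ?m" and l: "l < length ds" for F j l
  proof -
    have sj: "Suc j < n" using j by simp
    have noloop: "{Suc j, Suc j} \<notin> E" using E by (auto simp: vertex_pairs_def)
    have "(\<Sum>i | i < n \<and> {i, Suc j} \<in> E. sh F (Suc j) l - sh F i l)
       = int (vertex_degree E (Suc j)) * F j l - (\<Sum>i | i < n \<and> {i, Suc j} \<in> E. sh F i l)" using sj by (simp add: sum_subtractf card_incident[OF E] sh_def)
    also have "(\<Sum>i | i < n \<and> {i, Suc j} \<in> E. sh F i l) = (\<Sum>i<n. if {i, Suc j} \<in> E then sh F i l else 0)" by (simp add: sum.inter_filter[symmetric])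
    also have "\<dots> = (\<Sum>i<Suc ?m. if {i, Suc j} \<in> E then sh F i l else 0)" using n by simp
    also have "\<dots> = (\<Sum>i<?m. if {Suc i, Suc j} \<in> E then F i l else 0)"
      unfolding sum.lessThan_Suc_shift using l by (auto simp: sh_def cyc_prod_one intro!: sum.cong)
    also have "int (vertex_degree E (Suc j)) * F j l - (\<Sum>i<?m. if {Suc i, Suc j} \<in> E then F i l else 0)
       = (\<Sum>i<?m. (if i = j then int (vertex_degree E (Suc j)) * F j l else 0) - (if {Suc i, Suc j} \<in> E then F i l else 0))" using j by (simp add: sum_subtractf)
    also have "\<dots> = (\<Sum>i<?m. ?A $$ (i, j) * F i l)" using j noloop by (intro sum.cong) (auto simp: entry)
    finally show ?thesis .
  qed
  have ex: "\<exists>F. F' = sh F \<and> F \<in> {..<?m} \<rightarrow>\<^sub>E cyc ds" if "F' \<in> pinned ds n" for F'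
  proof -
    have F': "F' \<in> {..<n} \<rightarrow>\<^sub>E cyc ds" "F' 0 = ?o" using that by (auto simp: pinned_iff[OF n])
    let ?F = "\<lambda>i\<in>{..<?m}. F' (Suc i)"
    have "F' = sh ?F" using F'(2) PiE_arb[OF F'(1)] by (auto simp: sh_def fun_eq_iff)
    moreover have "?F \<in> {..<?m} \<rightarrow>\<^sub>E cyc ds" using PiE_mem[OF F'(1)] by auto
    ultimately show ?thesis by blast
  qed
  have shp: "sh F \<in> pinned ds n" if F: "F \<in> {..<?m} \<rightarrow>\<^sub>E cyc ds" for F
  proof -
    have "sh F \<in> {..<n} \<rightarrow>\<^sub>E cyc ds"
    proof (rule PiE_I)
      fix i assume "i \<in> {..<n}"
      then show "sh F i \<in> cyc ds" using PiE_mem[OF F, of "i - 1"] by (cases i) (auto simp: sh_def)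
    next
      fix i assume "i \<notin> {..<n}" then show "sh F i = undefined" using n by (auto simp: sh_def)
    qed
    then show ?thesis by (simp add: pinned_iff[OF n] sh_def)
  qed
  have shg: "generating ds n (sh F) \<longleftrightarrow> generating ds ?m F" if F: "F \<in> {..<?m} \<rightarrow>\<^sub>E cyc ds" for F
  proof -
    have FG: "F ` {..<?m} \<subseteq> cyc ds" using F by auto
    have "sh F ` {..<n} = sh F ` (insert 0 (Suc ` {..<?m}))"
    proof -
      have "{..<n} = insert 0 (Suc ` {..<?m})" using n by (cases n) (simp_all add: lessThan_Suc_eq_insert_0)
      then show ?thesis by simp
    qed
    also have "\<dots> = insert ?o (F ` {..<?m})"
      unfolding image_insert image_image by (rule arg_cong2[of _ _ _ _ insert], simp add: sh_def, rule image_cong) (auto simp: sh_def)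
    finally have 1: "sh F ` {..<n} = insert ?o (F ` {..<?m})" .
    have "generate (cyc_prod ds) (insert ?o (F ` {..<?m})) = generate (cyc_prod ds) (F ` {..<?m})"
    proof
      show "generate (cyc_prod ds) (F ` {..<?m}) \<subseteq> generate (cyc_prod ds) (insert ?o (F ` {..<?m}))" by (rule G.mono_generate) auto
      show "generate (cyc_prod ds) (insert ?o (F ` {..<?m})) \<subseteq> generate (cyc_prod ds) (F ` {..<?m})"
        by (rule G.generate_subgroup_incl[OF _ G.generate_is_subgroup[OF FG]]) (auto intro: generate.incl generate.one)
    qed
    then show ?thesis unfolding generating_def 1 by simp
  qed
  have "bij_betw sh {F \<in> {..<?m} \<rightarrow>\<^sub>E cyc ds. generating ds ?m F \<and>
        (\<forall>j<?m. \<forall>l<length ds. int (ds ! l) dvd (\<Sum>i<?m. ?A $$ (i, j) * F i l))} (harmonic_surj ds n E)"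
    (is "bij_betw sh ?L ?R") unfolding bij_betw_def
  proof
    show "inj_on sh ?L"
    proof (rule inj_onI)
      fix F F' assume F: "F \<in> ?L" "F' \<in> ?L" and eq: "sh F = sh F'"
      have "F i = F' i" if "i < ?m" for i
      proof -
        have "Suc i < n" using that by simp
        then show ?thesis using fun_cong[OF eq, of "Suc i"] by (simp add: sh_def)
      qed
      then show "F = F'" using F by (intro PiE_ext[of F "{..<?m}" "\<lambda>_. cyc ds"]) auto
    qed
    have harm: "harmonic ds n E (sh F) \<longleftrightarrow> (\<forall>j<?m. \<forall>l<length ds. int (ds ! l) dvd (\<Sum>i<?m. ?A $$ (i, j) * F i l))" for F
    proof -
      have "{1..<n} = Suc ` {..<?m}" using n by (simp add: lessThan_atLeast0 image_Suc_atLeastLessThan)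
      then show ?thesis unfolding harmonic_def by (simp add: lap) (simp add: Ball_def)
    qed
    show "sh ` ?L = ?R"
    proof
      show "sh ` ?L \<subseteq> ?R" using shp shg harm by (auto simp: harmonic_surj_def)
      show "?R \<subseteq> sh ` ?L"
      proof
        fix F' assume F': "F' \<in> ?R"
        then obtain F where F: "F' = sh F" "F \<in> {..<?m} \<rightarrow>\<^sub>E cyc ds" using ex by (auto simp: harmonic_surj_def)
        then have "F \<in> ?L" using F' shg[OF F(2)] harm[of F] by (simp add: harmonic_surj_def)
        then show "F' \<in> sh ` ?L" using F(1) by blast
      qed
    qed
  qed
  from bij_betw_same_card[OF this] show ?thesis using card_epis_mcok[OF ds reduced_laplacian_carrier q] by simp
qed

section \<open>The Sylow part of an integral cokernel\<close>

lemma smult_one_mult_vec: "v \<in> carrier_vec m \<Longrightarrow> (c \<cdot>\<^sub>m 1\<^sub>m m) *\<^sub>v v = (c :: int) \<cdot>\<^sub>v v"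
  by (intro eq_vecI) (auto simp: scalar_prod_def if_distrib[of "\<lambda>z. z * _"] if_distrib[of "\<lambda>z. _ * z"] cong: if_cong)

lemma latt_zero: "latt 0 A = (\<lambda>x. A *\<^sub>v x) ` carrier_vec (dim_col A)"
proof -
  have "A *\<^sub>v x + int 0 \<cdot>\<^sub>v y = A *\<^sub>v x" if "y \<in> carrier_vec (dim_row A)" for x y using that by (intro eq_vecI) auto
  note eq = this
  show ?thesis
  proof (intro equalityI subsetI)
    fix v assume "v \<in> latt 0 A"
    then obtain x y where xy: "x \<in> carrier_vec (dim_col A)" "y \<in> carrier_vec (dim_row A)" "v = A *\<^sub>v x + int 0 \<cdot>\<^sub>v y" unfolding latt_def by blast
    then show "v \<in> (\<lambda>x. A *\<^sub>v x) ` carrier_vec (dim_col A)" using eq by blast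
  next
    fix v assume "v \<in> (\<lambda>x. A *\<^sub>v x) ` carrier_vec (dim_col A)"
    then show "v \<in> latt 0 A" using latt_image[of _ A 0] by blast
  qed
qed

lemma cokernel_eq_mcok: "cokernel A = mcok 0 A" by (simp add: cokernel_def mcok_def latt_zero)

text \<open>By the adjugate identity the determinant annihilates the cokernel.\<close>

lemma det_smult_in_latt:
  fixes A :: "int mat"
  assumes A: "A \<in> carrier_mat m m" and v: "v \<in> carrier_vec m"
  shows "det A \<cdot>\<^sub>v v \<in> latt 0 A"
proof -
  have adj: "adj_mat A \<in> carrier_mat m m" "A * adj_mat A = det A \<cdot>\<^sub>m 1\<^sub>m m" using adj_mat[OF A] by auto
  have "A *\<^sub>v (adj_mat A *\<^sub>v v) = (A * adj_mat A) *\<^sub>v v" using assoc_mult_mat_vec[OF A adj(1) v] by simp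
  also have "\<dots> = det A \<cdot>\<^sub>v v" unfolding adj(2) by (rule smult_one_mult_vec[OF v])
  finally have "det A \<cdot>\<^sub>v v = A *\<^sub>v (adj_mat A *\<^sub>v v)" by simp
  moreover have "adj_mat A *\<^sub>v v \<in> carrier_vec (dim_col A)" using mult_mat_vec_carrier[OF adj(1) v] A by simp
  ultimately show ?thesis using latt_image by metis
qed

lemma iso_pow_eq_one:
  assumes iso: "G \<cong> K" and G: "group G" and K: "group K" and one: "\<And>x. x \<in> carrier K \<Longrightarrow> x [^]\<^bsub>K\<^esub> (n::nat) = \<one>\<^bsub>K\<^esub>"
    and x: "x \<in> carrier G"
  shows "x [^]\<^bsub>G\<^esub> n = \<one>\<^bsub>G\<^esub>"
proof -
  obtain h where h: "h \<in> iso G K" using iso by (auto simp: is_iso_def)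
  interpret G: group G by (rule G)
  interpret K: group K by (rule K)
  interpret h: group_hom G K h using h by unfold_locales (auto simp: iso_def)
  have "h (x [^]\<^bsub>G\<^esub> n) = h \<one>\<^bsub>G\<^esub>" using one[OF h.hom_closed[OF x]] h.hom_nat_pow[OF x] by simp
  moreover have "inj_on h (carrier G)" using h by (auto simp: iso_def bij_betw_def)
  ultimately show ?thesis using x by (meson G.nat_pow_closed G.one_closed inj_onD)
qed

locale sylow_setup =
  fixes A :: "int mat" and m p :: nat
  assumes A: "A \<in> carrier_mat m m" and det: "det A \<noteq> 0" and p: "Factorial_Ring.prime p"
begin

abbreviation "S \<equiv> mcok 0 A"
abbreviation "proj v \<equiv> latt 0 A #>\<^bsub>zvec m\<^esub> v"

lemma dims: "dim_row A = m" "dim_col A = m" using A by auto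

sublocale Z: comm_group "zvec m" by (rule zvec_group)
sublocale S: comm_group S by (rule mcok_group)
sublocale pr: group_hom "zvec m" S proj using mcok_proj(1)[of A 0] by unfold_locales (simp add: dims)

lemma proj_eq_one: "v \<in> carrier_vec m \<Longrightarrow> proj v = \<one>\<^bsub>S\<^esub> \<longleftrightarrow> v \<in> latt 0 A"
  using mcok_proj(3)[of v A 0] by (simp add: dims)

lemma carrier_S: "carrier S = proj ` carrier_vec m" using mcok_proj(2)[of 0 A] by (simp add: dims)

lemma proj_pow: "v \<in> carrier_vec m \<Longrightarrow> (proj v) [^]\<^bsub>S\<^esub> (n::nat) = proj (int n \<cdot>\<^sub>v v)"
  using pr.hom_nat_pow[of v n] zvec_pow[of v m n] by (simp add: monoid_vec_simps)

lemma proj_cong: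
  assumes "v \<in> carrier_vec m" "w \<in> carrier_vec m" "v - w \<in> latt 0 A"
  shows "proj v = proj w"
proof -
  have "v = (v - w) \<otimes>\<^bsub>zvec m\<^esub> w" using assms by (intro eq_vecI) (auto simp: monoid_vec_simps)
  then have "proj v = proj (v - w) \<otimes>\<^bsub>S\<^esub> proj w" using pr.hom_mult[of "v - w" w] assms by (simp add: monoid_vec_simps)
  also have "proj (v - w) = \<one>\<^bsub>S\<^esub>" using proj_eq_one[of "v - w"] assms by simp
  finally show ?thesis using pr.hom_closed[of w] assms by (simp add: monoid_vec_simps)
qed

lemma sylow_carrier: "carrier (sylow_part p S) = {x \<in> carrier S. \<exists>j. x [^]\<^bsub>S\<^esub> (p ^ j) = \<one>\<^bsub>S\<^esub>}"
proof -
  have "(\<exists>j. S.ord x = p ^ j) \<longleftrightarrow> (\<exists>j. x [^]\<^bsub>S\<^esub> (p ^ j) = \<one>\<^bsub>S\<^esub>)" if "x \<in> carrier S" for x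
  proof
    assume "\<exists>j. S.ord x = p ^ j"
    then show "\<exists>j. x [^]\<^bsub>S\<^esub> (p ^ j) = \<one>\<^bsub>S\<^esub>" using S.pow_ord_eq_1[OF that] by metis
  next
    assume "\<exists>j. x [^]\<^bsub>S\<^esub> (p ^ j) = \<one>\<^bsub>S\<^esub>"
    then obtain j where "S.ord x dvd p ^ j" using S.pow_eq_id[OF \<open>x \<in> carrier S\<close>] by blast
    then show "\<exists>j. S.ord x = p ^ j" using p by (auto simp: divides_primepow_nat)
  qed
  then show ?thesis by (auto simp: sylow_part_def)
qed

lemma decomposition:
  obtains e a u where "det A = int p ^ e * a" "\<And>j. coprime (int p ^ j) a"
proof -
  have "\<not> is_unit (int p)" using p prime_gt_1_nat by auto
  then obtain a where a: "det A = int p ^ multiplicity (int p) (det A) * a" "\<not> int p dvd a" using multiplicity_decompose'[OF det] by blast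
  have "coprime (int p ^ j) a" for j using a(2) p by (intro coprime_power_left_iff[THEN iffD2] disjI1 prime_imp_coprime) auto
  then show ?thesis using that a(1) by blast
qed

lemma sylow_group: "group (sylow_part p S)"
proof -
  let ?T = "carrier (sylow_part p S)"
  have "subgroup ?T S"
  proof (rule S.subgroupI)
    show "?T \<subseteq> carrier S" by (auto simp: sylow_carrier)
    have "\<one>\<^bsub>S\<^esub> \<in> ?T" by (simp add: sylow_carrier)
    then show "?T \<noteq> {}" by blast
    show "inv\<^bsub>S\<^esub> x \<in> ?T" if "x \<in> ?T" for x
    proof -
      obtain j where "x \<in> carrier S" "x [^]\<^bsub>S\<^esub> (p ^ j) = \<one>\<^bsub>S\<^esub>" using \<open>x \<in> ?T\<close> by (auto simp: sylow_carrier)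
      then show ?thesis using S.nat_pow_inv[of x "p ^ j"] by (auto simp: sylow_carrier)
    qed
    show "x \<otimes>\<^bsub>S\<^esub> y \<in> ?T" if "x \<in> ?T" "y \<in> ?T" for x y
    proof -
      obtain i j where xy: "x \<in> carrier S" "x [^]\<^bsub>S\<^esub> (p ^ i) = \<one>\<^bsub>S\<^esub>" "y \<in> carrier S" "y [^]\<^bsub>S\<^esub> (p ^ j) = \<one>\<^bsub>S\<^esub>"
        using \<open>x \<in> ?T\<close> \<open>y \<in> ?T\<close> by (auto simp: sylow_carrier)
      have "x [^]\<^bsub>S\<^esub> (p ^ (i + j)) = (x [^]\<^bsub>S\<^esub> (p ^ i)) [^]\<^bsub>S\<^esub> (p ^ j)" by (simp only: power_add S.nat_pow_pow[OF xy(1)])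
      moreover have "y [^]\<^bsub>S\<^esub> (p ^ (i + j)) = (y [^]\<^bsub>S\<^esub> (p ^ j)) [^]\<^bsub>S\<^esub> (p ^ i)" by (simp only: power_add S.nat_pow_pow[OF xy(3)] mult.commute)
      ultimately have "(x \<otimes>\<^bsub>S\<^esub> y) [^]\<^bsub>S\<^esub> (p ^ (i + j)) = \<one>\<^bsub>S\<^esub>" using xy by (simp add: S.nat_pow_distrib)
      then show ?thesis using xy by (auto simp: sylow_carrier)
    qed
  qed
  from S.subgroup_imp_group[OF this] show ?thesis by (simp add: sylow_part_def)
qed

text \<open>With \<open>det A = p ^ e * a\<close>, the integer \<open>u\<close> is 1 modulo
  \<open>p ^ M\<close> and 0 modulo \<open>a\<close>, so multiplication by \<open>u\<close> projects
  the cokernel onto its p-part. The assumption on exponents identifies the kernel of this projection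
  with \<open>latt (p ^ k) A\<close>.\<close>

lemma mcok_iso_sylow:
  assumes K: "\<And>x. x \<in> carrier (sylow_part p S) \<Longrightarrow> x [^]\<^bsub>S\<^esub> (p ^ k) = \<one>\<^bsub>S\<^esub>"
  shows "mcok (p ^ k) A \<cong> sylow_part p S"
proof -
  obtain e a where d: "det A = int p ^ e * a" and cop: "\<And>j. coprime (int p ^ j) a" using decomposition by metis
  \<comment> \<open>At least \<open>e\<close>, so that \<open>u\<close> acts as the identity on the
    p-part, and at least \<open>k\<close>, so that \<open>1 - u\<close> is a multiple of
    \<open>p ^ k\<close>.\<close>
  define M where "M = max e k"
  obtain \<alpha> \<beta> where ab: "\<alpha> * int p ^ M + \<beta> * a = 1" using bezout_int[of "int p ^ M" a] cop[of M] by (auto simp: coprime_iff_gcd_eq_1)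
  define u where "u = \<beta> * a"
  have u1: "1 - u = \<alpha> * int p ^ M" using ab by (simp add: u_def)
  define \<phi> where "\<phi> = (\<lambda>v. proj (u \<cdot>\<^sub>v v))"
  let ?T = "carrier (sylow_part p S)"
  have \<phi>hom: "\<phi> \<in> hom (zvec m) S"
  proof (rule homI)
    fix v w assume "v \<in> carrier (zvec m)" "w \<in> carrier (zvec m)"
    then have vw: "v \<in> carrier_vec m" "w \<in> carrier_vec m" by (simp_all add: monoid_vec_simps)
    show "\<phi> v \<in> carrier S" unfolding \<phi>_def using pr.hom_closed vw by (simp add: monoid_vec_simps)
    have "u \<cdot>\<^sub>v (v + w) = (u \<cdot>\<^sub>v v) \<otimes>\<^bsub>zvec m\<^esub> (u \<cdot>\<^sub>v w)" using vw by (intro eq_vecI) (auto simp: monoid_vec_simps algebra_simps)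
    then show "\<phi> (v \<otimes>\<^bsub>zvec m\<^esub> w) = \<phi> v \<otimes>\<^bsub>S\<^esub> \<phi> w"
      using pr.hom_mult[of "u \<cdot>\<^sub>v v" "u \<cdot>\<^sub>v w"] vw by (simp add: \<phi>_def monoid_vec_simps)
  qed
  have in_latt: "(det A * c) \<cdot>\<^sub>v v \<in> latt 0 A" if "v \<in> carrier_vec m" for c v
    using latt_smult_closed[OF det_smult_in_latt[OF A that], of c] by (simp add: smult_smult_assoc mult.commute)
  have \<phi>T: "\<phi> v \<in> ?T" if v: "v \<in> carrier_vec m" for v
  proof -
    have "(\<phi> v) [^]\<^bsub>S\<^esub> (p ^ e) = proj (int (p ^ e) \<cdot>\<^sub>v (u \<cdot>\<^sub>v v))" unfolding \<phi>_def using v by (simp add: proj_pow)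
    also have "int (p ^ e) \<cdot>\<^sub>v (u \<cdot>\<^sub>v v) = (det A * \<beta>) \<cdot>\<^sub>v v" by (simp add: smult_smult_assoc d u_def mult_ac)
    also have "proj \<dots> = \<one>\<^bsub>S\<^esub>" using proj_eq_one[of "(det A * \<beta>) \<cdot>\<^sub>v v"] in_latt[OF v] v by simp
    finally show ?thesis using hom_in_carrier[OF \<phi>hom, of v] v by (auto simp: sylow_carrier monoid_vec_simps)
  qed
  have surj: "\<phi> ` carrier_vec m = ?T"
  proof
    show "\<phi> ` carrier_vec m \<subseteq> ?T" using \<phi>T by blast
    show "?T \<subseteq> \<phi> ` carrier_vec m"
    proof
      fix x assume "x \<in> ?T"
      then obtain j where x: "x \<in> carrier S" "x [^]\<^bsub>S\<^esub> (p ^ j) = \<one>\<^bsub>S\<^esub>" by (auto simp: sylow_carrier)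
      then obtain v where v: "v \<in> carrier_vec m" "x = proj v" unfolding carrier_S by blast
      have pj: "int (p ^ j) \<cdot>\<^sub>v v \<in> latt 0 A" using x(2) v proj_pow[OF v(1)] proj_eq_one[of "int (p ^ j) \<cdot>\<^sub>v v"] by simp
      obtain \<gamma> \<delta> where gd: "\<gamma> * int p ^ j + \<delta> * a = 1" using bezout_int[of "int p ^ j" a] cop[of j] by (auto simp: coprime_iff_gcd_eq_1)
      \<comment> \<open>Bezout combines the power of \<open>p\<close> that kills \<open>v\<close>
        with the determinant, as \<open>a\<close> is prime to \<open>p\<close>: already
        \<open>p ^ e\<close> kills the p-part.\<close>
      have pe: "int p ^ e \<cdot>\<^sub>v v \<in> latt 0 A"
      proof -
        have "int p ^ e = int p ^ e * (\<gamma> * int p ^ j + \<delta> * a)" using gd by simp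
        also have "\<dots> = (int p ^ e * \<gamma>) * int (p ^ j) + det A * \<delta>" by (simp add: d algebra_simps)
        finally have eq: "int p ^ e = (int p ^ e * \<gamma>) * int (p ^ j) + det A * \<delta>" .
        have "((int p ^ e * \<gamma>) * int (p ^ j) + det A * \<delta>) \<cdot>\<^sub>v v = (int p ^ e * \<gamma>) \<cdot>\<^sub>v (int (p ^ j) \<cdot>\<^sub>v v) + (det A * \<delta>) \<cdot>\<^sub>v v"
          using v by (intro eq_vecI) (auto simp: algebra_simps)
        then have "int p ^ e \<cdot>\<^sub>v v = (int p ^ e * \<gamma>) \<cdot>\<^sub>v (int (p ^ j) \<cdot>\<^sub>v v) + (det A * \<delta>) \<cdot>\<^sub>v v"
          by (simp only: eq[symmetric])
        then show ?thesis using latt_add[OF latt_smult_closed[OF pj, of "int p ^ e * \<gamma>"] in_latt[OF v(1), of \<delta>]] by simp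
      qed
      have "(u \<cdot>\<^sub>v v) - v \<in> latt 0 A"
      proof -
        have "int p ^ M = int p ^ (M - e) * int p ^ e" by (simp add: M_def flip: power_add)
        then have "u - 1 = - (\<alpha> * int p ^ (M - e)) * int p ^ e" using u1 by (simp add: algebra_simps)
        then have "(u - 1) \<cdot>\<^sub>v v = (- (\<alpha> * int p ^ (M - e))) \<cdot>\<^sub>v (int p ^ e \<cdot>\<^sub>v v)" by (simp add: smult_smult_assoc)
        moreover have "(u \<cdot>\<^sub>v v) - v = (u - 1) \<cdot>\<^sub>v v" using v by (intro eq_vecI) (auto simp: algebra_simps)
        ultimately show ?thesis using latt_smult_closed[OF pe, of "- (\<alpha> * int p ^ (M - e))"] by (simp only:)
      qed
      then have "\<phi> v = x" unfolding \<phi>_def v(2) using v(1) by (intro proj_cong) auto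
      then show "x \<in> \<phi> ` carrier_vec m" using v(1) by blast
    qed
  qed
  interpret \<phi>: group_hom "zvec m" S \<phi> by unfold_locales (rule \<phi>hom)
  note grp = sylow_group
  have \<phi>h: "\<phi> \<in> hom (zvec m) (sylow_part p S)"
  proof (rule homI)
    fix v w assume vw: "v \<in> carrier (zvec m)" "w \<in> carrier (zvec m)"
    show "\<phi> v \<in> ?T" using vw \<phi>T by (simp add: monoid_vec_simps)
    show "\<phi> (v \<otimes>\<^bsub>zvec m\<^esub> w) = \<phi> v \<otimes>\<^bsub>sylow_part p S\<^esub> \<phi> w" using \<phi>.hom_mult[OF vw] by (simp add: sylow_part_def)
  qed
  interpret \<psi>: group_hom "zvec m" "sylow_part p S" \<phi> using grp \<phi>h by (simp add: group_hom_def group_hom_axioms_def Z.is_group)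
  have "kernel (zvec m) (sylow_part p S) \<phi> = latt (p ^ k) A"
  proof (intro equalityI subsetI)
    fix v assume "v \<in> kernel (zvec m) (sylow_part p S) \<phi>"
    then have v: "v \<in> carrier_vec m" "proj (u \<cdot>\<^sub>v v) = \<one>\<^bsub>S\<^esub>" by (auto simp: kernel_def sylow_part_def \<phi>_def monoid_vec_simps)
    then have "u \<cdot>\<^sub>v v \<in> latt 0 A" using proj_eq_one[of "u \<cdot>\<^sub>v v"] by simp
    then obtain x where x: "x \<in> carrier_vec m" "u \<cdot>\<^sub>v v = A *\<^sub>v x" by (auto simp: latt_zero dims)
    have "int p ^ M = int p ^ (M - k) * int p ^ k" by (simp add: M_def flip: power_add)
    then have "1 = u + int (p ^ k) * (\<alpha> * int p ^ (M - k))" using u1 by (simp add: algebra_simps)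
    then have "v = (u + int (p ^ k) * (\<alpha> * int p ^ (M - k))) \<cdot>\<^sub>v v" using v(1) by simp
    also have "\<dots> = u \<cdot>\<^sub>v v + int (p ^ k) \<cdot>\<^sub>v ((\<alpha> * int p ^ (M - k)) \<cdot>\<^sub>v v)" using v by (intro eq_vecI) (auto simp: algebra_simps)
    finally show "v \<in> latt (p ^ k) A" using lattI[of x A "(\<alpha> * int p ^ (M - k)) \<cdot>\<^sub>v v" "p ^ k"] x v by (simp add: dims)
  next
    fix v assume "v \<in> latt (p ^ k) A"
    then obtain x y where xy: "x \<in> carrier_vec m" "y \<in> carrier_vec m" "v = A *\<^sub>v x + int (p ^ k) \<cdot>\<^sub>v y" by (auto simp: latt_def dims)
    have Ax: "A *\<^sub>v x \<in> carrier_vec m" using mat_vec_in[of A x] dims by simp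
    have "\<phi> v = \<phi> (A *\<^sub>v x) \<otimes>\<^bsub>S\<^esub> \<phi> (int (p ^ k) \<cdot>\<^sub>v y)"
      using \<phi>.hom_mult[of "A *\<^sub>v x" "int (p ^ k) \<cdot>\<^sub>v y"] xy Ax by (simp add: monoid_vec_simps)
    also have "\<phi> (A *\<^sub>v x) = \<one>\<^bsub>S\<^esub>"
    proof -
      have "A *\<^sub>v x \<in> latt 0 A" using latt_image[of x A 0] xy by (simp add: dims)
      from latt_smult_closed[OF this, of u] show ?thesis unfolding \<phi>_def using proj_eq_one[of "u \<cdot>\<^sub>v (A *\<^sub>v x)"] Ax by simp
    qed
    also have "\<phi> (int (p ^ k) \<cdot>\<^sub>v y) = (\<phi> y) [^]\<^bsub>S\<^esub> (p ^ k)"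
      using \<phi>.hom_nat_pow[of y "p ^ k"] zvec_pow[OF xy(2), of "p ^ k"] xy by (simp add: monoid_vec_simps)
    also have "\<dots> = \<one>\<^bsub>S\<^esub>" by (rule K[OF \<phi>T[OF xy(2)]])
    finally have "\<phi> v = \<one>\<^bsub>S\<^esub>" by simp
    then show "v \<in> kernel (zvec m) (sylow_part p S) \<phi>" using xy Ax by (simp add: kernel_def sylow_part_def monoid_vec_simps)
  qed
  moreover have "\<phi> ` carrier (zvec m) = carrier (sylow_part p S)" using surj by (simp add: monoid_vec_simps)
  from \<psi>.FactGroup_iso[OF this] have "zvec m Mod kernel (zvec m) (sylow_part p S) \<phi> \<cong> sylow_part p S" .
  ultimately show "mcok (p ^ k) A \<cong> sylow_part p S" by (simp add: mcok_def dims)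
qed

text \<open>One power beyond the exponent of \<open>H\<close> is taken because modulo
  \<open>p ^ k\<close> a larger Sylow part could be cut down to \<open>H\<close>. If
  \<open>p ^ k\<close> kills the cokernel modulo \<open>p ^ Suc k\<close>, then it kills the Sylow
  part itself, by the iteration in the second half.\<close>

lemma sylow_iff_mcok:
  assumes H: "group H" "\<And>x. x \<in> carrier H \<Longrightarrow> x [^]\<^bsub>H\<^esub> (p ^ k) = \<one>\<^bsub>H\<^esub>"
  shows "sylow_part p (cokernel A) \<cong> H \<longleftrightarrow> mcok (p ^ Suc k) A \<cong> H"
proof -
  have mg: "group (mcok (p ^ Suc k) A)" by (rule comm_group.axioms(2)[OF mcok_group])
  have suc: "x [^]\<^bsub>S\<^esub> (p ^ Suc k) = \<one>\<^bsub>S\<^esub>" if "x \<in> carrier S" "x [^]\<^bsub>S\<^esub> (p ^ k) = \<one>\<^bsub>S\<^esub>" for x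
    using that S.nat_pow_pow[of x "p ^ k" p] by (simp add: mult.commute)
  have TS: "x \<in> carrier S" if "x \<in> carrier (sylow_part p S)" for x using that by (simp add: sylow_carrier)
  show ?thesis
  proof
    assume iso: "sylow_part p (cokernel A) \<cong> H"
    have "mcok (p ^ Suc k) A \<cong> sylow_part p S"
    proof (rule mcok_iso_sylow)
      fix x assume x: "x \<in> carrier (sylow_part p S)"
      have "x [^]\<^bsub>sylow_part p S\<^esub> (p ^ k) = \<one>\<^bsub>sylow_part p S\<^esub>" by (rule iso_pow_eq_one[OF iso[unfolded cokernel_eq_mcok] sylow_group H x])
      then have "x [^]\<^bsub>S\<^esub> (p ^ k) = \<one>\<^bsub>S\<^esub>" by (simp add: sylow_part_def nat_pow_def)
      then show "x [^]\<^bsub>S\<^esub> (p ^ Suc k) = \<one>\<^bsub>S\<^esub>" by (rule suc[OF TS[OF x]])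
    qed
    then show "mcok (p ^ Suc k) A \<cong> H" using iso_trans[OF _ iso[unfolded cokernel_eq_mcok]] by blast
  next
    assume iso: "mcok (p ^ Suc k) A \<cong> H"
    obtain e a where d: "det A = int p ^ e * a" and cop: "\<And>j. coprime (int p ^ j) a" using decomposition by metis
    have kill: "int (p ^ k) \<cdot>\<^sub>v v \<in> latt (p ^ Suc k) A" if v: "v \<in> carrier_vec m" for v
    proof -
      let ?q = "\<lambda>v. latt (p ^ Suc k) A #>\<^bsub>zvec m\<^esub> v"
      have qh: "?q \<in> hom (zvec m) (mcok (p ^ Suc k) A)" using mcok_proj(1)[of A "p ^ Suc k"] by (simp add: dims)
      interpret M: group "mcok (p ^ Suc k) A" by (rule mg)
      interpret qh: group_hom "zvec m" "mcok (p ^ Suc k) A" ?q by unfold_locales (rule qh)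
      have "?q (int (p ^ k) \<cdot>\<^sub>v v) = (?q v) [^]\<^bsub>mcok (p ^ Suc k) A\<^esub> (p ^ k)"
        using qh.hom_nat_pow[of v "p ^ k"] zvec_pow[OF v, of "p ^ k"] v by (simp add: monoid_vec_simps)
      also have "\<dots> = \<one>\<^bsub>mcok (p ^ Suc k) A\<^esub>" using qh.hom_closed[of v] v by (intro iso_pow_eq_one[OF iso mg H]) (auto simp: monoid_vec_simps)
      finally show ?thesis using mcok_proj(3)[of "int (p ^ k) \<cdot>\<^sub>v v" A "p ^ Suc k"] v by (simp add: dims)
    qed
    \<comment> \<open>Substituting the relation into its own remainder raises the power of
      \<open>p\<close> there without limit.\<close>
    have iter: "\<exists>n\<in>latt 0 A. \<exists>y\<in>carrier_vec m. int (p ^ k) \<cdot>\<^sub>v v = n + int (p ^ (k + j)) \<cdot>\<^sub>v y" if v: "v \<in> carrier_vec m" for v j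
    proof (induction j)
      case 0
      have "0\<^sub>v m = int 0 \<cdot>\<^sub>v 0\<^sub>v m" by (intro eq_vecI) auto
      then have "0\<^sub>v m \<in> latt 0 A" using latt_smult[of "0\<^sub>v m" A 0] by (metis dims(1) zero_carrier_vec)
      moreover have "int (p ^ k) \<cdot>\<^sub>v v = 0\<^sub>v m + int (p ^ (k + 0)) \<cdot>\<^sub>v v" using v by (intro eq_vecI) auto
      ultimately show ?case using v by blast
    next
      case (Suc j)
      then obtain n y where ny: "n \<in> latt 0 A" "y \<in> carrier_vec m" "int (p ^ k) \<cdot>\<^sub>v v = n + int (p ^ (k + j)) \<cdot>\<^sub>v y" by blast
      obtain x z where xz: "x \<in> carrier_vec m" "z \<in> carrier_vec m" "int (p ^ k) \<cdot>\<^sub>v y = A *\<^sub>v x + int (p ^ Suc k) \<cdot>\<^sub>v z"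
        using kill[OF ny(2)] by (auto simp: latt_def dims)
      have Ax: "A *\<^sub>v x \<in> latt 0 A" using latt_image[of x A 0] xz by (simp add: dims)
      have c: "n \<in> carrier_vec m" "A *\<^sub>v x \<in> carrier_vec m" using ny(1) Ax latt_subset[of 0 A] dims by auto
      have "int (p ^ (k + j)) \<cdot>\<^sub>v y = int (p ^ j) \<cdot>\<^sub>v (int (p ^ k) \<cdot>\<^sub>v y)" by (simp add: smult_smult_assoc power_add mult.commute)
      also have "\<dots> = int (p ^ j) \<cdot>\<^sub>v (A *\<^sub>v x) + int (p ^ (k + Suc j)) \<cdot>\<^sub>v z"
        unfolding xz(3) using xz(1,2) c by (intro eq_vecI) (auto simp: algebra_simps power_add dims)
      finally have eq: "int (p ^ (k + j)) \<cdot>\<^sub>v y = int (p ^ j) \<cdot>\<^sub>v (A *\<^sub>v x) + int (p ^ (k + Suc j)) \<cdot>\<^sub>v z" .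
      have "int (p ^ k) \<cdot>\<^sub>v v = (n + int (p ^ j) \<cdot>\<^sub>v (A *\<^sub>v x)) + int (p ^ (k + Suc j)) \<cdot>\<^sub>v z"
        unfolding ny(3) eq using c xz(1,2) by (intro eq_vecI) (auto simp: dims)
      moreover have "n + int (p ^ j) \<cdot>\<^sub>v (A *\<^sub>v x) \<in> latt 0 A" by (rule latt_add[OF ny(1) latt_smult_closed[OF Ax]])
      ultimately show ?case using xz(2) by blast
    qed
    have "mcok (p ^ Suc k) A \<cong> sylow_part p S"
    proof (rule mcok_iso_sylow)
      fix x assume x: "x \<in> carrier (sylow_part p S)"
      then obtain j where xj: "x \<in> carrier S" "x [^]\<^bsub>S\<^esub> (p ^ j) = \<one>\<^bsub>S\<^esub>" by (auto simp: sylow_carrier)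
      then obtain v where v: "v \<in> carrier_vec m" "x = proj v" unfolding carrier_S by blast
      have pj: "int (p ^ j) \<cdot>\<^sub>v v \<in> latt 0 A" using xj(2) v proj_pow[OF v(1)] proj_eq_one[of "int (p ^ j) \<cdot>\<^sub>v v"] by simp
      obtain \<gamma> \<delta> where gd: "\<gamma> * int p ^ j + \<delta> * a = 1" using bezout_int[of "int p ^ j" a] cop[of j] by (auto simp: coprime_iff_gcd_eq_1)
      \<comment> \<open>The remainder now carries the factor \<open>p ^ e\<close>, so multiplying by
        \<open>a\<close> makes it a multiple of the determinant, which lies in the lattice.\<close>
      obtain n y where ny: "n \<in> latt 0 A" "y \<in> carrier_vec m" "int (p ^ k) \<cdot>\<^sub>v v = n + int (p ^ (k + e)) \<cdot>\<^sub>v y" using iter[OF v(1), of e] by blast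
      have nc: "n \<in> carrier_vec m" using ny(1) latt_subset[of 0 A] dims by auto
      have "int (p ^ k) \<cdot>\<^sub>v v = (\<gamma> * int p ^ j + \<delta> * a) \<cdot>\<^sub>v (int (p ^ k) \<cdot>\<^sub>v v)" using gd v by simp
      also have "\<dots> = (\<gamma> * int (p ^ k)) \<cdot>\<^sub>v (int (p ^ j) \<cdot>\<^sub>v v) + (\<delta> * a) \<cdot>\<^sub>v (int (p ^ k) \<cdot>\<^sub>v v)"
        using v by (intro eq_vecI) (auto simp: algebra_simps)
      also have "(\<delta> * a) \<cdot>\<^sub>v (int (p ^ k) \<cdot>\<^sub>v v) = (\<delta> * a) \<cdot>\<^sub>v n + (\<delta> * int (p ^ k)) \<cdot>\<^sub>v (det A \<cdot>\<^sub>v y)"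
        unfolding ny(3) d using nc ny(2) by (intro eq_vecI) (auto simp: algebra_simps power_add)
      finally have "int (p ^ k) \<cdot>\<^sub>v v = (\<gamma> * int (p ^ k)) \<cdot>\<^sub>v (int (p ^ j) \<cdot>\<^sub>v v) + ((\<delta> * a) \<cdot>\<^sub>v n + (\<delta> * int (p ^ k)) \<cdot>\<^sub>v (det A \<cdot>\<^sub>v y))" .
      then have "int (p ^ k) \<cdot>\<^sub>v v \<in> latt 0 A"
        using latt_add[OF latt_smult_closed[OF pj] latt_add[OF latt_smult_closed[OF ny(1)] latt_smult_closed[OF det_smult_in_latt[OF A ny(2)]]]] by simp
      then have "x [^]\<^bsub>S\<^esub> (p ^ k) = \<one>\<^bsub>S\<^esub>" using v proj_pow[OF v(1)] proj_eq_one[of "int (p ^ k) \<cdot>\<^sub>v v"] by simp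
      then show "x [^]\<^bsub>S\<^esub> (p ^ Suc k) = \<one>\<^bsub>S\<^esub>" by (rule suc[OF xj(1)])
    qed
    then have "sylow_part p S \<cong> mcok (p ^ Suc k) A" by (rule group.iso_sym[OF mg])
    then show "sylow_part p (cokernel A) \<cong> H" using iso_trans[OF _ iso] by (simp add: cokernel_eq_mcok)
  qed
qed

end

section \<open>Fixed rank and triangular inversion\<close>

lemma set_erdos_renyi: "set_pmf (erdos_renyi n q) \<subseteq> Pow (vertex_pairs n)" by (auto simp: erdos_renyi_def)

lemma integrable_erdos_renyi: "integrable (measure_pmf (erdos_renyi n q)) (f :: _ \<Rightarrow> real)" by (rule integrable_measure_pmf_finite)
     (rule finite_subset[OF set_erdos_renyi], simp add: finite_vertex_pairs)

lemma erdos_renyi_expectation_mono: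
  fixes f g :: "nat set set \<Rightarrow> real"
  assumes "\<And>E. E \<subseteq> vertex_pairs n \<Longrightarrow> f E \<le> g E"
  shows "measure_pmf.expectation (erdos_renyi n q) f \<le> measure_pmf.expectation (erdos_renyi n q) g" using set_erdos_renyi[of n q]
  by (intro integral_mono_AE integrable_erdos_renyi AE_pmfI assms) auto

lemma erdos_renyi_expectation_cong:
  fixes f g :: "nat set set \<Rightarrow> real"
  assumes "\<And>E. E \<subseteq> vertex_pairs n \<Longrightarrow> f E = g E"
  shows "measure_pmf.expectation (erdos_renyi n q) f = measure_pmf.expectation (erdos_renyi n q) g" using assms by (intro antisym erdos_renyi_expectation_mono) auto

text \<open>No exchange of the limits in \<open>n\<close> and \<open>I\<close> is involved: one
  large even and one large odd \<open>I\<close> squeeze \<open>a n\<close> around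
  \<open>L\<close>.\<close>

lemma bonferroni_limit:
  fixes a :: "nat \<Rightarrow> real" and s :: "nat \<Rightarrow> nat \<Rightarrow> real"
  assumes up: "\<And>I. even I \<Longrightarrow> eventually (\<lambda>n. a n \<le> s I n) sequentially"
    and lo: "\<And>I. odd I \<Longrightarrow> eventually (\<lambda>n. s I n \<le> a n) sequentially"
    and lim: "\<And>I. s I \<longlonglongrightarrow> \<eta> I" and \<eta>: "\<eta> \<longlonglongrightarrow> L"
  shows "a \<longlonglongrightarrow> L"
proof (rule LIMSEQ_I)
  fix r :: real assume r: "r > 0"
  obtain N where N: "\<And>I. I \<ge> N \<Longrightarrow> \<bar>\<eta> I - L\<bar> < r / 2" using LIMSEQ_D[OF \<eta>, of "r/2"] r by auto
  have e: "eventually (\<lambda>n. \<bar>s I n - \<eta> I\<bar> < r / 2) sequentially" for I using tendstoD[OF lim[of I], of "r/2"] r by (simp add: dist_real_def)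
  have "eventually (\<lambda>n. norm (a n - L) < r) sequentially" using up[of "2 * N", simplified] lo[of "Suc (2 * N)", simplified] e[of "2 * N"] e[of "Suc (2 * N)"]
  proof eventually_elim
    case (elim n)
    then show ?case using N[of "2 * N"] N[of "Suc (2 * N)"] unfolding real_norm_def by linarith
  qed
  then show "\<exists>no. \<forall>n\<ge>no. norm (a n - L) < r" by (simp add: eventually_sequentially)
qed

text \<open>Induction from the largest size downwards: the equation for \<open>l\<close> contains
  only \<open>l\<close> and strictly larger indices, whose limits are already known.\<close>

lemma triangular_limit:
  fixes u :: "nat \<Rightarrow> 'a \<Rightarrow> real" and v :: "'a \<Rightarrow> real" and a :: "'a \<Rightarrow> 'a \<Rightarrow> real" and size :: "'a \<Rightarrow> nat"
  assumes fin: "finite T" and tri: "\<And>\<nu> l. \<nu> \<in> T \<Longrightarrow> l \<in> T \<Longrightarrow> a \<nu> l \<noteq> 0 \<Longrightarrow> \<nu> = l \<or> size l < size \<nu>"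
    and diag: "\<And>l. l \<in> T \<Longrightarrow> a l l \<noteq> 0" and bound: "\<And>l. l \<in> T \<Longrightarrow> size l \<le> B"
    and lim: "\<And>l. l \<in> T \<Longrightarrow> (\<lambda>n. \<Sum>\<nu>\<in>T. u n \<nu> * a \<nu> l) \<longlonglongrightarrow> (\<Sum>\<nu>\<in>T. v \<nu> * a \<nu> l)"
    and l: "l \<in> T"
  shows "(\<lambda>n. u n l) \<longlonglongrightarrow> v l" using l
proof (induction "B - size l" arbitrary: l rule: less_induct)
  case less
  let ?T = "T - {l}"
  have split: "(\<Sum>\<nu>\<in>T. w \<nu> * a \<nu> l) = w l * a l l + (\<Sum>\<nu>\<in>?T. w \<nu> * a \<nu> l)" for w using fin less.prems by (rule sum.remove)
  have "(\<lambda>n. \<Sum>\<nu>\<in>?T. u n \<nu> * a \<nu> l) \<longlonglongrightarrow> (\<Sum>\<nu>\<in>?T. v \<nu> * a \<nu> l)"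
  proof (rule tendsto_sum)
    fix \<nu> assume \<nu>: "\<nu> \<in> ?T"
    show "(\<lambda>n. u n \<nu> * a \<nu> l) \<longlonglongrightarrow> v \<nu> * a \<nu> l"
    proof (cases "a \<nu> l = 0")
      case False
      then have "size l < size \<nu>" using tri[of \<nu> l] \<nu> less.prems by auto
      then have "(\<lambda>n. u n \<nu>) \<longlonglongrightarrow> v \<nu>" using less.hyps[of \<nu>] \<nu> bound[of \<nu>] by auto
      then show ?thesis by (intro tendsto_intros)
    qed simp
  qed
  from tendsto_diff[OF lim[OF less.prems] this]
  have "(\<lambda>n. u n l * a l l) \<longlonglongrightarrow> v l * a l l" by (simp add: split)
  from tendsto_divide[OF this tendsto_const[of "a l l"] diag[OF less.prems]]
  show ?case using diag[OF less.prems] by simp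
qed

lemma alt_count_snoc:
  assumes "\<And>l. l < length ds \<Longrightarrow> p dvd ds ! l"
  shows "alt_count (ds @ [p]) = alt_count ds * p ^ length ds"
proof -
  have "alt_pairs (ds @ [p]) = alt_pairs ds \<union> (\<lambda>i. (i, length ds)) ` {..<length ds}" by (auto simp: alt_pairs_def less_Suc_eq image_iff)
  then have "alt_count (ds @ [p]) = (\<Prod>(i,j)\<in>alt_pairs ds. gcd ((ds @ [p]) ! i) ((ds @ [p]) ! j))
      * (\<Prod>(i,j)\<in>(\<lambda>i. (i, length ds)) ` {..<length ds}. gcd ((ds @ [p]) ! i) ((ds @ [p]) ! j))" unfolding alt_count_def using finite_alt_pairs[of ds]
    by (subst prod.union_disjoint[symmetric]) (auto simp: alt_pairs_def)
  also have "(\<Prod>(i,j)\<in>alt_pairs ds. gcd ((ds @ [p]) ! i) ((ds @ [p]) ! j)) = alt_count ds"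
    unfolding alt_count_def by (intro prod.cong refl) (auto simp: alt_pairs_def nth_append)
  also have "(\<Prod>(i,j)\<in>(\<lambda>i. (i, length ds)) ` {..<length ds}. gcd ((ds @ [p]) ! i) ((ds @ [p]) ! j)) = (\<Prod>i<length ds. p)"
    using assms by (subst prod.reindex) (auto simp: inj_on_def nth_append intro!: prod.cong)
  finally show ?thesis by simp
qed

lemma alt_count_append_ones:
  assumes es: "\<forall>e\<in>set es. e \<ge> 1"
  shows "alt_count (pows p (es @ replicate i 1)) = alt_count (pows p es) * (\<Prod>j<i. p ^ (length es + j))"
proof (induction i)
  case (Suc i)
  let ?fs = "pows p (es @ replicate i 1)"
  have dv: "p dvd ?fs ! l" if "l < length ?fs" for l
  proof -
    have "(es @ replicate i 1) ! l \<in> set (es @ replicate i 1)" using that by (intro nth_mem) simp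
    then have "(es @ replicate i 1) ! l \<ge> 1" using es by (auto simp: set_replicate_conv_if split: if_splits)
    moreover have "?fs ! l = p ^ ((es @ replicate i 1) ! l)" using that by (intro nth_map) (simp only: length_map)
    ultimately show ?thesis using dvd_power[of _ p] by simp
  qed
  have "pows p (es @ replicate (Suc i) 1) = ?fs @ [p]" by (simp add: replicate_append_same[symmetric])
  then have "alt_count (pows p (es @ replicate (Suc i) 1)) = alt_count ?fs * p ^ length ?fs" using alt_count_snoc[OF dv] by simp
  then show ?case using Suc.IH by simp
qed simp

text \<open>\<open>qc\<close> is phrased with \<open>q * (1 - q)\<close>, the rate from
  \<open>norm_bernoulli_factor_le\<close>. The \<open>c\<close> of this locale is smaller than the
  constant of the theorem, see \<open>er_range_bounds\<close>.\<close>

locale sandpile_prob =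
  fixes p k :: nat and q :: "nat \<Rightarrow> real" and c :: real
  assumes p: "Factorial_Ring.prime p" and c: "c > 1" and k: "k > 0"
    and qc: "eventually (\<lambda>n. c * ln n \<le> real n * (q n * (1 - q n))) sequentially"
    and q01: "eventually (\<lambda>n. 0 \<le> q n \<and> q n \<le> 1) sequentially"
begin

abbreviation "ex n f \<equiv> measure_pmf.expectation (erdos_renyi n (q n)) (f :: nat set set \<Rightarrow> real)"
abbreviation "Mc n E \<equiv> mcok (p ^ k) (reduced_laplacian n E)"
abbreviation "eta \<equiv> prodinf (\<lambda>i. 1 - real p powi (1 - 2 * int (Suc i)))"

lemma p1: "p > 1" using p prime_gt_1_nat by blast

text \<open>The choice is determined only up to the order of the list; its length is the rank, which
  \<open>length_tau_eq\<close> shows to be an invariant.\<close>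

definition tau :: "int mat \<Rightarrow> nat list" where
  "tau A = (SOME es. set es \<subseteq> {1..k} \<and> pgrp p es \<cong> mcok (p ^ k) A)"

lemma tau: "set (tau A) \<subseteq> {1..k}" "pgrp p (tau A) \<cong> mcok (p ^ k) A" using someI_ex[OF mcok_structure[OF p, of k A]] unfolding tau_def by auto

lemma pg: "group (pgrp p es)" "comm_group (pgrp p es)" using cyc_prod_group comm_group.axioms(2) by blast+

lemma mg: "group (mcok b A)" using mcok_group comm_group.axioms(2) by blast

lemma mfin: "finite (carrier (mcok (p ^ k) A))" using p1 by (intro mcok_finite) simp

lemma pfin: "finite (carrier (pgrp p es))" using p1 by (intro cyc_prod_finite pos_list_pow) simp

lemma card_homs_mcok: "card (homs (mcok (p ^ k) A) (integer_mod_group p)) = p ^ length (tau A)"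
proof -
  have "\<forall>e\<in>set (tau A). e \<ge> 1" using tau(1)[of A] by auto
  from card_homs_pgrp[OF p1 this] card_homs_iso[OF tau(2)[of A] pg(1) mg, of "integer_mod_group p"] show ?thesis by simp
qed

lemma length_tau_eq:
  assumes "set es \<subseteq> {1..k}" "pgrp p es \<cong> mcok (p ^ k) A"
  shows "length (tau A) = length es"
proof -
  have "\<forall>e\<in>set es. e \<ge> 1" using assms(1) by auto
  then have "p ^ length (tau A) = p ^ length es" using card_homs_pgrp[OF p1, of es] card_homs_iso[OF assms(2) pg(1) mg, of "integer_mod_group p"] card_homs_mcok by simp
  then show ?thesis using p1 by simp
qed

text \<open>Let R be the rank of the cokernel and r that of the target. Passing to the target times
  (Z/p)^i multiplies the number of surjections by the product of p^R - p^(r+j) over j < i; divided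
  by p^(ri) this is the Bonferroni product at d = R - r, so the alternating sum isolates R = r. In
  the limit \<open>alt_count\<close> gets multiplied by p^(ri) and the product of p^j, and what
  remains is the series for \<open>eta\<close>.\<close>

lemma rank_moment:
  assumes es: "set es \<subseteq> {1..k}"
  shows "(\<lambda>n. ex n (\<lambda>E. real (card (epis (Mc n E) (pgrp p es))) * of_bool (length (tau (reduced_laplacian n E)) = length es)))
    \<longlonglongrightarrow> real (alt_count (pows p es)) * eta"
proof -
  let ?r = "length es"
  let ?m = "real (alt_count (pows p es))"
  let ?A = "\<lambda>n E. reduced_laplacian n E"
  have es1: "\<forall>e\<in>set es. e \<ge> 1" using es by auto
  define fs where "fs = (\<lambda>i. es @ replicate i 1)"
  have fsk: "set (fs i) \<subseteq> {1..k}" for i using es k by (auto simp: fs_def set_replicate_conv_if)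
  define Y where "Y = (\<lambda>n E i. real (card (epis (Mc n E) (pgrp p (fs i)))))"
  define s where "s = (\<lambda>I n. \<Sum>i\<le>I. bonferroni_coeff p i / real p ^ (?r * i) * ex n (\<lambda>E. Y n E i))"
  have Yi: "Y n E i = Y n E 0 * (\<Prod>j<i. real p ^ length (tau (?A n E)) - real p ^ (?r + j))" for n E i
    unfolding Y_def fs_def using card_epis_append_ones[OF mcok_group mfin p card_homs_mcok es1] by simp
  \<comment> \<open>Surjections onto a group of larger rank are excluded by counting: the product
    formula for \<open>i = 1\<close> would give a negative number.\<close>
  have YR: "?r \<le> length (tau (?A n E))" if "Y n E 0 \<noteq> 0" for n E
  proof (rule ccontr)
    assume "\<not> ?r \<le> length (tau (?A n E))"
    then have lt: "real p ^ length (tau (?A n E)) < real p ^ ?r" using p1 by (intro power_strict_increasing) auto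
    have "Y n E 1 = Y n E 0 * (real p ^ length (tau (?A n E)) - real p ^ ?r)" using Yi[of n E 1] by simp
    moreover have "Y n E 0 > 0" using that by (simp add: Y_def)
    ultimately have "Y n E 1 < 0" using lt by (simp add: mult_pos_neg)
    then show False by (simp add: Y_def)
  qed
  have bon: "(\<Sum>i\<le>I. bonferroni_coeff p i / real p ^ (?r * i) * Y n E i)
      = Y n E 0 * (\<Sum>i\<le>I. bonferroni_coeff p i * (\<Prod>j<i. real p ^ (length (tau (?A n E)) - ?r) - real p ^ j))" for I n E
  proof (cases "Y n E 0 = 0")
    case False
    let ?R = "length (tau (?A n E))"
    have R: "?R = ?r + (?R - ?r)" using YR[OF False] by simp
    have "(\<Prod>j<i. real p ^ ?R - real p ^ (?r + j)) = real p ^ (?r * i) * (\<Prod>j<i. real p ^ (?R - ?r) - real p ^ j)" for i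
    proof -
      have "(\<Prod>j<i. real p ^ ?R - real p ^ (?r + j)) = (\<Prod>j<i. real p ^ ?r * (real p ^ (?R - ?r) - real p ^ j))"
        by (intro prod.cong refl) (subst R, simp add: power_add right_diff_distrib)
      then show ?thesis by (simp add: prod.distrib power_mult)
    qed
    then show ?thesis using p1 unfolding sum_distrib_left by (intro sum.cong refl) (subst Yi, simp)
  next
    case True
    then have "Y n E i = 0" for i by (subst Yi) simp
    then show ?thesis by simp
  qed
  have Y0: "real (card (epis (Mc n E) (pgrp p es))) = Y n E 0" for n E by (simp add: Y_def fs_def)
  have bool: "Y n E 0 * of_bool (length (tau (?A n E)) = ?r) = Y n E 0 * of_bool (length (tau (?A n E)) - ?r = 0)" for n E
  proof (cases "Y n E 0 = 0")
    case False
    then have "(length (tau (?A n E)) = ?r) = (length (tau (?A n E)) - ?r = 0)" using YR[OF False] by linarith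
    then show ?thesis by (simp only:)
  qed simp
  have exsum: "ex n (\<lambda>E. \<Sum>i\<le>I. bonferroni_coeff p i / real p ^ (?r * i) * Y n E i) = s I n" for I n
    unfolding s_def by (subst Bochner_Integration.integral_sum) (auto intro!: integrable_erdos_renyi)
  have Ynn: "Y n E 0 \<ge> 0" for n E by (simp add: Y_def)
  show ?thesis
  proof (rule bonferroni_limit)
    let ?a = "\<lambda>n. ex n (\<lambda>E. real (card (epis (Mc n E) (pgrp p es))) * of_bool (length (tau (?A n E)) = ?r))"
    have a: "?a n = ex n (\<lambda>E. Y n E 0 * of_bool (length (tau (?A n E)) - ?r = 0))" for n by (simp only: Y0 bool)
    show "eventually (\<lambda>n. ?a n \<le> s I n) sequentially" if "even I" for I unfolding a exsum[symmetric]
      by (intro always_eventually allI erdos_renyi_expectation_mono) (simp only: bon, intro mult_left_mono bonferroni_bounds(1)[OF p1 that] Ynn)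
    show "eventually (\<lambda>n. s I n \<le> ?a n) sequentially" if "odd I" for I unfolding a exsum[symmetric]
      by (intro always_eventually allI erdos_renyi_expectation_mono) (simp only: bon, intro mult_left_mono bonferroni_bounds(2)[OF p1 that] Ynn)
    show "s I \<longlonglongrightarrow> (\<Sum>i\<le>I. ?m * (bonferroni_coeff p i * (\<Prod>j<i. real p ^ j)))" for I unfolding s_def
    proof (rule tendsto_sum)
      fix i
      have pos: "pos_list (pows p (fs i))" using p1 by (intro pos_list_pow) simp
      have dv: "pows p (fs i) ! l dvd p ^ k" if l: "l < length (pows p (fs i))" for l
      proof -
        have "fs i ! l \<in> set (fs i)" using l by (intro nth_mem) simp
        then have "fs i ! l \<le> k" using fsk[of i] by auto
        then show ?thesis using l by (simp add: le_imp_power_dvd)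
      qed
      have "(\<lambda>n. ex n (\<lambda>E. real (card (harmonic_surj (pows p (fs i)) n E)))) \<longlonglongrightarrow> real (alt_count (pows p (fs i)))"
        by (rule harmonic_surj_moment[OF pos c qc q01])
      moreover have Yh: "Y n E i = real (card (harmonic_surj (pows p (fs i)) n E))"
        if "n \<ge> 1" "E \<subseteq> vertex_pairs n" for n E using card_epis_mcok_sandpile[OF pos that dv] by (simp add: Y_def)
      have "eventually (\<lambda>n. ex n (\<lambda>E. real (card (harmonic_surj (pows p (fs i)) n E))) = ex n (\<lambda>E. Y n E i)) sequentially"
        using eventually_ge_at_top[of 1] by eventually_elim (intro erdos_renyi_expectation_cong, simp only: Yh)
      ultimately have "(\<lambda>n. ex n (\<lambda>E. Y n E i)) \<longlonglongrightarrow> real (alt_count (pows p (fs i)))" by (rule Lim_transform_eventually)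
      from tendsto_mult_left[OF this, of "bonferroni_coeff p i / real p ^ (?r * i)"]
      have "(\<lambda>n. bonferroni_coeff p i / real p ^ (?r * i) * ex n (\<lambda>E. Y n E i)) \<longlonglongrightarrow> bonferroni_coeff p i / real p ^ (?r * i) * real (alt_count (pows p (fs i)))" .
      also have "real (alt_count (pows p (fs i))) = ?m * (real p ^ (?r * i) * (\<Prod>j<i. real p ^ j))"
        unfolding fs_def alt_count_append_ones[OF es1] by (simp add: power_add prod.distrib power_mult)
      also have "bonferroni_coeff p i / real p ^ (?r * i) * (?m * (real p ^ (?r * i) * (\<Prod>j<i. real p ^ j))) = ?m * (bonferroni_coeff p i * (\<Prod>j<i. real p ^ j))"
        using p1 by simp
      finally show "(\<lambda>n. bonferroni_coeff p i / real p ^ (?r * i) * ex n (\<lambda>E. Y n E i)) \<longlonglongrightarrow> ?m * (bonferroni_coeff p i * (\<Prod>j<i. real p ^ j))" .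
    qed
    show "(\<lambda>I. \<Sum>i\<le>I. ?m * (bonferroni_coeff p i * (\<Prod>j<i. real p ^ j))) \<longlonglongrightarrow> ?m * eta"
      using bonferroni_series[OF p1] unfolding sum_distrib_left[symmetric] sums_def_le by (intro tendsto_mult_left)
  qed
qed

end

section \<open>Surjections from the cokernel of a singular matrix\<close>

lemma generating_iff_lincomb:
  assumes ds: "pos_list ds" and F: "\<And>i. i < m \<Longrightarrow> F i \<in> cyc ds"
  shows "generating ds m F \<longleftrightarrow> (\<forall>w\<in>cyc ds. \<exists>v\<in>carrier_vec m. lincomb ds m F v = w)"
proof -
  interpret Z: comm_group "zvec m" by (rule zvec_group)
  interpret U: comm_group "cyc_prod ds" by (rule cyc_prod_group)
  interpret h: group_hom "zvec m" "cyc_prod ds" "lincomb ds m F" by unfold_locales (rule lincomb_hom[OF ds])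
  have "lincomb ds m F ` (unit_vec m ` {..<m}) = F ` {..<m}" using lincomb_unit[OF ds _ F] by (simp add: image_image)
  moreover have "generate (cyc_prod ds) (lincomb ds m F ` (unit_vec m ` {..<m})) = lincomb ds m F ` generate (zvec m) (unit_vec m ` {..<m})"
    by (rule h.generate_img) (auto simp: monoid_vec_def)
  ultimately have g: "generate (cyc_prod ds) (F ` {..<m}) = lincomb ds m F ` carrier_vec m" by (simp add: zvec_generate)
  have "lincomb ds m F ` carrier_vec m \<subseteq> cyc ds" using h.hom_closed by (auto simp: monoid_vec_def)
  then have "lincomb ds m F ` carrier_vec m = cyc ds \<longleftrightarrow> cyc ds \<subseteq> lincomb ds m F ` carrier_vec m" by (simp add: set_eq_subset)
  then show ?thesis unfolding generating_def g by (simp only: subset_eq image_iff) (simp only: eq_commute)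
qed

lemma generating_cyclic:
  assumes q: "q > 0" and F: "\<And>i. i < m \<Longrightarrow> F i \<in> cyc [q]" and i0: "i0 < m" "coprime (F i0 0) (int q)"
  shows "generating [q] m F"
proof (subst generating_iff_lincomb)
  show ds: "pos_list [q]" using q by (simp add: pos_list_def)
  obtain a b where ab: "a * F i0 0 + b * int q = 1" using bezout_int[of "F i0 0" "int q"] i0(2) by (auto simp: coprime_iff_gcd_eq_1)
  show "\<forall>w\<in>cyc [q]. \<exists>v\<in>carrier_vec m. lincomb [q] m F v = w"
  proof
    fix w assume w: "w \<in> cyc [q]"
    let ?x = "(a * w 0) \<cdot>\<^sub>v unit_vec m i0"
    have "lincomb [q] m F ?x = reduce [q] w" unfolding lincomb_def
    proof (rule reduce_cong)
      fix l assume "l < length [q]"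
      then have l: "l = 0" by simp
      have "(\<Sum>i<m. ?x $ i * F i l) = (\<Sum>i<m. if i = i0 then a * w 0 * F i l else 0)" by (intro sum.cong) (auto simp: unit_vec_def)
      also have "\<dots> = a * w 0 * F i0 l" using i0 by simp
      also have "\<dots> - w l = w 0 * (a * F i0 0 + b * int q - 1) - b * int q * w 0" unfolding l by (simp add: algebra_simps)
      also have "\<dots> = int q * (- b * w 0)" unfolding ab by simp
      finally show "int ([q] ! l) dvd (\<Sum>i<m. ?x $ i * F i l) - w l" using l by simp
    qed
    then show "\<exists>v\<in>carrier_vec m. lincomb [q] m F v = w" using reduce_id[OF ds w] by (intro bexI[of _ ?x]) auto
  qed
qed (rule F)

text \<open>A nonzero kernel vector with least sum of absolute values cannot have all entries
  divisible by \<open>p\<close>, since division by \<open>p\<close> would give a smaller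
  one.\<close>

lemma primitive_kernel_vector:
  fixes A :: "int mat"
  assumes A: "A \<in> carrier_mat m m" and det: "det A = 0" and p: "p > (1::nat)"
  obtains v :: "int vec" and i :: nat where "v \<in> carrier_vec m" "A *\<^sub>v v = 0\<^sub>v m" "i < m" "\<not> int p dvd v $ i"
proof -
  define K where "K = {v \<in> carrier_vec m. v \<noteq> 0\<^sub>v m \<and> A *\<^sub>v v = 0\<^sub>v m}"
  define f where "f = (\<lambda>v::int vec. \<Sum>i<m. nat \<bar>v $ i\<bar>)"
  have "\<exists>v. v \<in> K" using det_0_iff_vec_prod_zero[OF A] det by (auto simp: K_def)
  then obtain v where v: "v \<in> K" "\<And>w. w \<in> K \<Longrightarrow> f v \<le> f w" using ex_has_least_nat[of "\<lambda>v. v \<in> K" _ f] by blast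
  have "\<exists>i<m. \<not> int p dvd v $ i"
  proof (rule ccontr)
    assume "\<not> ?thesis"
    then have dv: "int p * (v $ i div int p) = v $ i" if "i < m" for i using that by auto
    define w where "w = vec m (\<lambda>i. v $ i div int p)"
    have vw: "v = int p \<cdot>\<^sub>v w" using v(1) dv by (intro eq_vecI) (auto simp: K_def w_def)
    have wc: "w \<in> carrier_vec m" by (simp add: w_def)
    have "int p \<cdot>\<^sub>v (A *\<^sub>v w) = 0\<^sub>v m" using v(1) smult_mat_vec[of w A "int p"] wc A vw by (simp add: K_def)
    then have "A *\<^sub>v w = 0\<^sub>v m"
    proof (intro eq_vecI)
      fix i assume eq: "int p \<cdot>\<^sub>v (A *\<^sub>v w) = 0\<^sub>v m" and i: "i < dim_vec (0\<^sub>v m :: int vec)"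
      have "(int p \<cdot>\<^sub>v (A *\<^sub>v w)) $ i = 0" using eq i by simp
      moreover have "(int p \<cdot>\<^sub>v (A *\<^sub>v w)) $ i = int p * (A *\<^sub>v w) $ i" using i A by (intro index_smult_vec) simp
      ultimately show "(A *\<^sub>v w) $ i = 0\<^sub>v m $ i" using p i by simp
    qed (use A in simp)
    moreover have "w \<noteq> 0\<^sub>v m" using v(1) vw by (auto simp: K_def)
    ultimately have "w \<in> K" using wc by (simp add: K_def)
    then have "f v \<le> f w" by (rule v(2))
    have "\<exists>i<m. v $ i \<noteq> 0"
    proof (rule ccontr)
      assume "\<not> ?thesis"
      then have "v = 0\<^sub>v m" using v(1) by (intro eq_vecI) (auto simp: K_def)
      then show False using v(1) by (simp add: K_def)
    qed
    then obtain i where i: "i < m" "v $ i \<noteq> 0" by blast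
    have le: "nat \<bar>w $ j\<bar> \<le> nat \<bar>v $ j\<bar>" if "j < m" for j
    proof -
      have "\<bar>v $ j\<bar> = int p * \<bar>w $ j\<bar>" using that wc by (subst vw) (simp add: abs_mult)
      moreover have "1 * \<bar>w $ j\<bar> \<le> int p * \<bar>w $ j\<bar>" using p by (intro mult_right_mono) auto
      ultimately show ?thesis by linarith
    qed
    have "nat \<bar>w $ i\<bar> < nat \<bar>v $ i\<bar>"
    proof -
      have e: "\<bar>v $ i\<bar> = int p * \<bar>w $ i\<bar>" using i wc by (subst vw) (simp add: abs_mult)
      then have "\<bar>w $ i\<bar> > 0" using i(2) by auto
      then have "1 * \<bar>w $ i\<bar> < int p * \<bar>w $ i\<bar>" using p by (intro mult_strict_right_mono) auto
      then show ?thesis using e by linarith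
    qed
    then have "f w < f v" unfolding f_def using le i(1) by (intro sum_strict_mono_ex1) auto
    then show False using \<open>f v \<le> f w\<close> by simp
  qed
  then show ?thesis using v(1) that by (auto simp: K_def)
qed

text \<open>Tuples pair with the columns of \<open>A\<close>, so a kernel vector of the transpose is
  a map from the cokernel, and an entry prime to \<open>p\<close> makes it onto Z/p^K. Multiplying
  it by the units 1 + pt gives p^(K-1) different surjections.\<close>

lemma card_epis_singular:
  fixes A :: "int mat"
  assumes A: "A \<in> carrier_mat m m" and det: "det A = 0" and p: "Factorial_Ring.prime p" and K: "K \<ge> 1"
  shows "card (epis (mcok (p ^ K) A) (cyc_prod [p ^ K])) \<ge> p ^ (K - 1)"
proof -
  let ?q = "p ^ K" let ?ds = "[p ^ K]"
  have p1: "p > 1" using p prime_gt_1_nat by blast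
  have ds: "pos_list ?ds" using p1 by (simp add: pos_list_def)
  have "det (A\<^sup>T) = 0" using det_transpose[OF A] det by simp
  then obtain v :: "int vec" and i0 :: nat where v: "v \<in> carrier_vec m" "A\<^sup>T *\<^sub>v v = 0\<^sub>v m" "i0 < m" "\<not> int p dvd v $ i0"
    using primitive_kernel_vector[of "A\<^sup>T" m p] A p1 by auto
  have ker: "(\<Sum>i<m. A $$ (i, j) * v $ i) = 0" if "j < m" for j
  proof -
    have "(A\<^sup>T *\<^sub>v v) $ j = (\<Sum>i<m. A $$ (i, j) * v $ i)" using that A v(1) by (simp add: scalar_prod_def atLeast0LessThan)
    then show ?thesis using v(2) that by simp
  qed
  have mq: "int ?q dvd x mod int ?q - x" for x by (subst mod_eq_dvd_iff[symmetric]) simp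
  define u where "u = (\<lambda>t::nat. 1 + int p * int t)"
  define F where "F = (\<lambda>t. \<lambda>i\<in>{..<m}. reduce ?ds (\<lambda>l. u t * v $ i))"
  have cop: "coprime x (int ?q)" if "\<not> int p dvd x" for x using that p prime_imp_coprime[of "int p" x] by (simp add: coprime_commute)
  have uc: "\<not> int p dvd u t" for t
  proof
    assume "int p dvd u t"
    then have "int p dvd 1" unfolding u_def by (metis dvd_add_left_iff dvd_triv_left)
    then show False using p1 by simp
  qed
  have Fl: "F t i 0 = (u t * v $ i) mod int ?q" if "i < m" for t i using that by (simp add: F_def reduce_def)
  have sub: "F ` {..<p ^ (K - 1)} \<subseteq> {F \<in> {..<m} \<rightarrow>\<^sub>E cyc ?ds. generating ?ds m F \<and>
        (\<forall>j<m. \<forall>l<length ?ds. int (?ds ! l) dvd (\<Sum>i<m. A $$ (i, j) * F i l))}" (is "_ \<subseteq> ?S")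
  proof (rule image_subsetI)
    fix t
    have Fc: "F t \<in> {..<m} \<rightarrow>\<^sub>E cyc ?ds" unfolding F_def by (intro restrict_PiE_iff[THEN iffD2] ballI reduce_carrier ds)
    have "generating ?ds m (F t)"
    proof (rule generating_cyclic[OF _ _ v(3)])
      show "coprime (F t i0 0) (int ?q)"
        unfolding Fl[OF v(3)] using cop[OF uc[of t]] cop[OF v(4)] p1 by (subst coprime_mod_left_iff) (simp_all only: coprime_mult_left_iff, simp)
    qed (use PiE_mem[OF Fc] p1 in auto)
    moreover have "int ?q dvd (\<Sum>i<m. A $$ (i, j) * F t i 0)" if j: "j < m" for j
    proof -
      have "(\<Sum>i<m. A $$ (i, j) * F t i 0) = (\<Sum>i<m. A $$ (i, j) * ((u t * v $ i) mod int ?q - u t * v $ i)) + u t * (\<Sum>i<m. A $$ (i, j) * v $ i)"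
        unfolding sum_distrib_left sum.distrib[symmetric] by (intro sum.cong refl) (simp add: Fl algebra_simps)
      moreover have "int ?q dvd (\<Sum>i<m. A $$ (i, j) * ((u t * v $ i) mod int ?q - u t * v $ i))" using mq by (intro dvd_sum dvd_mult)
      ultimately show ?thesis using ker[OF j] by simp
    qed
    ultimately show "F t \<in> ?S" using Fc by simp
  qed
  have inj: "inj_on F {..<p ^ (K - 1)}"
  proof (rule inj_onI)
    fix s t assume st: "s \<in> {..<p ^ (K - 1)}" "t \<in> {..<p ^ (K - 1)}" "F s = F t"
    have "(u s * v $ i0) mod int ?q = (u t * v $ i0) mod int ?q" using Fl[OF v(3), of s] Fl[OF v(3), of t] st(3) by simp
    then have "int ?q dvd (u s - u t) * v $ i0" by (simp add: mod_eq_dvd_iff left_diff_distrib)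
    then have "int ?q dvd u s - u t" by (rule coprime_dvd_mult_left_iff[THEN iffD1, OF coprime_commute[THEN iffD1, OF cop[OF v(4)]]])
    moreover have "int ?q = int p * int (p ^ (K - 1))" using K by (cases K) auto
    moreover have "u s - u t = int p * (int s - int t)" by (simp add: u_def right_diff_distrib)
    ultimately have dv: "int (p ^ (K - 1)) dvd int s - int t" using p1 by simp
    have "\<bar>int s - int t\<bar> < int (p ^ (K - 1))" using st(1,2) unfolding lessThan_iff by linarith
    then have "int s - int t = 0" using dv dvd_imp_le_int[of "int s - int t" "int (p ^ (K - 1))"] by linarith
    then show "s = t" by simp
  qed
  have fin: "finite ?S"
  proof (rule finite_subset[of _ "{..<m} \<rightarrow>\<^sub>E cyc ?ds"])
    show "finite ({..<m} \<rightarrow>\<^sub>E cyc ?ds)" by (intro finite_PiE cyc_prod_finite ds) simp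
  qed auto
  have "p ^ (K - 1) = card (F ` {..<p ^ (K - 1)})" using card_image[OF inj] by simp
  also have "\<dots> \<le> card ?S" by (intro card_mono fin sub)
  also have "\<dots> = card (epis (mcok (p ^ K) A) (cyc_prod [p ^ K]))" by (rule card_epis_mcok[OF ds A, symmetric]) simp
  finally show ?thesis .
qed

context sandpile_prob
begin

text \<open>Markov's inequality, with \<open>N\<close> chosen so that \<open>2 / r < p ^ N\<close>
  while the mean is eventually below 2.\<close>

lemma prob_singular_tendsto_0: "(\<lambda>n. ex n (\<lambda>E. of_bool (det (reduced_laplacian n E) = 0))) \<longlonglongrightarrow> 0"
proof (rule LIMSEQ_I)
  fix r :: real assume r: "r > 0"
  obtain N :: nat where N: "2 / r < real N" using reals_Archimedean2 by blast
  let ?ds = "[p ^ Suc N]"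
  have ds: "pos_list ?ds" using p1 by (simp add: pos_list_def)
  have "N < p ^ N" using p1 by (intro power_gt_expt) simp
  then have pN: "2 / r < real p ^ N" using N by (smt (verit) of_nat_less_iff of_nat_power)
  \<comment> \<open>A cyclic group carries only the zero alternating form, so its moment tends to
    1.\<close>
  have "alt_pairs ?ds = {}" by (auto simp: alt_pairs_def)
  then have "alt_count ?ds = 1" by (simp add: alt_count_def)
  then have "(\<lambda>n. ex n (\<lambda>E. real (card (harmonic_surj ?ds n E)))) \<longlonglongrightarrow> 1" using harmonic_surj_moment[OF ds c qc q01] by simp
  then have "eventually (\<lambda>n. ex n (\<lambda>E. real (card (harmonic_surj ?ds n E))) < 2) sequentially" by (rule order_tendstoD) simp
  then have "eventually (\<lambda>n. norm (ex n (\<lambda>E. of_bool (det (reduced_laplacian n E) = 0)) - 0) < r) sequentially" using eventually_ge_at_top[of 1]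
  proof eventually_elim
    case (elim n)
    let ?P = "ex n (\<lambda>E. of_bool (det (reduced_laplacian n E) = 0))"
    have "real p ^ N * of_bool (det (reduced_laplacian n E) = 0) \<le> real (card (harmonic_surj ?ds n E))"
      if E: "E \<subseteq> vertex_pairs n" for E
    proof (cases "det (reduced_laplacian n E) = 0")
      case True
      have "p ^ N \<le> card (epis (mcok (p ^ Suc N) (reduced_laplacian n E)) (cyc_prod ?ds))"
        using card_epis_singular[OF reduced_laplacian_carrier True p, of "Suc N"] by simp
      also have "\<dots> = card (harmonic_surj ?ds n E)" by (rule card_epis_mcok_sandpile[OF ds elim(2) E]) simp
      finally show ?thesis using True by (simp flip: of_nat_power)
    qed simp
    then have "ex n (\<lambda>E. real p ^ N * of_bool (det (reduced_laplacian n E) = 0)) \<le> ex n (\<lambda>E. real (card (harmonic_surj ?ds n E)))"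
      by (rule erdos_renyi_expectation_mono)
    then have "real p ^ N * ?P < 2" using elim(1) by simp
    moreover have "?P \<ge> 0" by (intro Bochner_Integration.integral_nonneg) simp
    moreover have "2 < real p ^ N * r" using pN r by (simp add: field_simps)
    ultimately have "real p ^ N * ?P < real p ^ N * r" by linarith
    then have "?P < r" using p1 by simp
    then show ?case using \<open>?P \<ge> 0\<close> by simp
  qed
  then show "\<exists>no. \<forall>n\<ge>no. norm (ex n (\<lambda>E. of_bool (det (reduced_laplacian n E) = 0)) - 0) < r" by (simp add: eventually_sequentially)
qed

text \<open>The model has to reproduce the moments for groups of one rank up to a common factor
  \<open>C\<close>. The limiting probabilities and \<open>eta / C\<close> times the counts in the
  model then solve the same triangular system.\<close>

lemma prob_limit_of_model:
  assumes fin: "finite \<M>" and Mr: "\<And>M. M \<in> \<M> \<Longrightarrow> length (tau M) = r" and C: "C > 0"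
    and model: "\<And>es. set es \<subseteq> {1..k} \<Longrightarrow> length es = r \<Longrightarrow>
      (\<Sum>M\<in>\<M>. real (card (epis (mcok (p ^ k) M) (pgrp p es)))) = C * real (alt_count (pows p es))"
    and es: "set es \<subseteq> {1..k}" "length es = r"
  shows "(\<lambda>n. ex n (\<lambda>E. of_bool (Mc n E \<cong> pgrp p es)))
    \<longlonglongrightarrow> eta / C * real (card {M \<in> \<M>. mcok (p ^ k) M \<cong> pgrp p es})"
proof -
  define L where "L = {es. set es \<subseteq> {1..k} \<and> length es = r}"
  \<comment> \<open>Permuted lists give isomorphic groups; without a representative for each class
    the system would contain repeated unknowns and lose its triangular shape.\<close>
  define cf where "cf = (\<lambda>es. SOME \<nu>. \<nu> \<in> L \<and> pgrp p \<nu> \<cong> pgrp p es)"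
  define T where "T = cf ` L"
  have finT: "finite T" unfolding T_def L_def by (intro finite_imageI finite_lists_length_eq) simp
  have cf: "cf l \<in> L" "pgrp p (cf l) \<cong> pgrp p l" if "l \<in> L" for l
  proof -
    have "\<exists>\<nu>. \<nu> \<in> L \<and> pgrp p \<nu> \<cong> pgrp p l" using that iso_refl by blast
    from someI_ex[OF this] show "cf l \<in> L" "pgrp p (cf l) \<cong> pgrp p l" by (auto simp: cf_def)
  qed
  have sym: "mcok b A \<cong> pgrp p \<nu> \<longleftrightarrow> pgrp p \<nu> \<cong> mcok b A" for b A \<nu> using group.iso_sym[OF pg(1)] group.iso_sym[OF mg] by blast
  have psym: "pgrp p \<mu> \<cong> pgrp p \<nu> \<Longrightarrow> pgrp p \<nu> \<cong> pgrp p \<mu>" for \<mu> \<nu> using group.iso_sym[OF pg(1)] by blast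
  have uniq: "\<mu> = \<nu>" if mn: "\<mu> \<in> T" "\<nu> \<in> T" "pgrp p \<mu> \<cong> pgrp p \<nu>" for \<mu> \<nu>
  proof -
    obtain a b where ab: "\<mu> = cf a" "\<nu> = cf b" "a \<in> L" "b \<in> L" using mn by (auto simp: T_def)
    have "pgrp p a \<cong> pgrp p b" using cf(2)[OF ab(3)] cf(2)[OF ab(4)] mn(3) ab(1,2) iso_trans psym by metis
    then have "(pgrp p \<kappa> \<cong> pgrp p a) = (pgrp p \<kappa> \<cong> pgrp p b)" for \<kappa> using iso_trans psym by blast
    then show ?thesis unfolding ab(1,2) cf_def by simp
  qed
  \<comment> \<open>Exactly one representative is isomorphic to the cokernel if the rank is
    \<open>r\<close>, and none otherwise.\<close>
  have ptw: "real (card (epis (mcok (p ^ k) A) (pgrp p l))) * of_bool (length (tau A) = r)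
     = (\<Sum>\<nu>\<in>T. of_bool (mcok (p ^ k) A \<cong> pgrp p \<nu>) * real (card (epis (pgrp p \<nu>) (pgrp p l))))" for A l
  proof (cases "length (tau A) = r")
    case True
    then have tL: "tau A \<in> L" using tau(1) by (simp add: L_def)
    let ?n = "cf (tau A)"
    have nT: "?n \<in> T" using tL by (simp add: T_def)
    have isoA: "mcok (p ^ k) A \<cong> pgrp p ?n" using cf(2)[OF tL] tau(2)[of A] iso_trans sym by blast
    have "mcok (p ^ k) A \<cong> pgrp p \<nu> \<longleftrightarrow> \<nu> = ?n" if "\<nu> \<in> T" for \<nu> using uniq[OF that nT] isoA iso_trans sym by blast
    then have "(\<Sum>\<nu>\<in>T. of_bool (mcok (p ^ k) A \<cong> pgrp p \<nu>) * real (card (epis (pgrp p \<nu>) (pgrp p l))))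
      = (\<Sum>\<nu>\<in>T. if \<nu> = ?n then real (card (epis (pgrp p \<nu>) (pgrp p l))) else 0)" by (intro sum.cong) auto
    also have "\<dots> = real (card (epis (pgrp p ?n) (pgrp p l)))" using finT nT by simp
    also have "card (epis (pgrp p ?n) (pgrp p l)) = card (epis (mcok (p ^ k) A) (pgrp p l))" by (rule card_epis_iso[OF isoA mg pg(1), symmetric])
    finally show ?thesis using True by simp
  next
    case False
    have "\<not> mcok (p ^ k) A \<cong> pgrp p \<nu>" if "\<nu> \<in> T" for \<nu>
    proof
      assume "mcok (p ^ k) A \<cong> pgrp p \<nu>"
      moreover have "\<nu> \<in> L" using that cf(1) by (auto simp: T_def)
      ultimately show False using length_tau_eq[of \<nu> A] sym False by (auto simp: L_def)
    qed
    then have "(\<Sum>\<nu>\<in>T. of_bool (mcok (p ^ k) A \<cong> pgrp p \<nu>) * real (card (epis (pgrp p \<nu>) (pgrp p l)))) = 0" by (intro sum.neutral) auto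
    then show ?thesis using False by simp
  qed
  define a where "a = (\<lambda>\<nu> l. real (card (epis (pgrp p \<nu>) (pgrp p l))))"
  define u where "u = (\<lambda>n \<nu>. ex n (\<lambda>E. of_bool (Mc n E \<cong> pgrp p \<nu>)))"
  define v where "v = (\<lambda>\<nu>. eta / C * (\<Sum>M\<in>\<M>. of_bool (mcok (p ^ k) M \<cong> pgrp p \<nu>)))"
  define sz where "sz = (\<lambda>\<nu>. card (carrier (pgrp p \<nu>)))"
  have main: "(\<lambda>n. u n l) \<longlonglongrightarrow> v l" if "l \<in> T" for l
  proof (rule triangular_limit[where a = a and size = sz and B = "Max (sz ` T)", OF finT _ _ _ _ that])
    fix \<nu> l assume nl: "\<nu> \<in> T" "l \<in> T" "a \<nu> l \<noteq> 0"
    then have ne: "epis (pgrp p \<nu>) (pgrp p l) \<noteq> {}" by (auto simp: a_def)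
    have "sz l \<le> sz \<nu>" unfolding sz_def by (rule epis_nonempty_card[OF pfin ne])
    moreover have "\<nu> = l" if "sz l = sz \<nu>"
    proof -
      obtain h where h: "h \<in> epis (pgrp p \<nu>) (pgrp p l)" using ne by blast
      have "h \<in> iso (pgrp p \<nu>) (pgrp p l)" using epis_iso[OF pfin h] that by (simp add: sz_def)
      then have "pgrp p \<nu> \<cong> pgrp p l" unfolding is_iso_def by blast
      then show ?thesis using uniq nl by blast
    qed
    ultimately show "\<nu> = l \<or> sz l < sz \<nu>" by linarith
  next
    fix l assume l: "l \<in> T"
    have "(\<lambda>x\<in>carrier (pgrp p l). x) \<in> epis (pgrp p l) (pgrp p l)" using group.is_monoid[OF pg(1)] by (auto simp: epis_def hom_def monoid.m_closed)
    then show "a l l \<noteq> 0" using finite_epis[OF pfin pfin] by (auto simp: a_def)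
    show "sz l \<le> Max (sz ` T)" using finT l by (intro Max_ge) auto
    have lL: "set l \<subseteq> {1..k}" "length l = r" using l cf(1) by (auto simp: T_def L_def)
    have "(\<Sum>\<nu>\<in>T. u n \<nu> * a \<nu> l) = ex n (\<lambda>E. \<Sum>\<nu>\<in>T. of_bool (Mc n E \<cong> pgrp p \<nu>) * a \<nu> l)" for n
      unfolding u_def by (subst Bochner_Integration.integral_sum) (auto intro!: integrable_erdos_renyi)
    then have 1: "(\<lambda>n. \<Sum>\<nu>\<in>T. u n \<nu> * a \<nu> l) = (\<lambda>n. ex n (\<lambda>E. real (card (epis (Mc n E) (pgrp p l))) * of_bool (length (tau (reduced_laplacian n E)) = length l)))"
      unfolding a_def ptw[symmetric] lL(2) by (intro ext) simp
    have "(\<Sum>\<nu>\<in>T. v \<nu> * a \<nu> l) = eta / C * (\<Sum>\<nu>\<in>T. \<Sum>M\<in>\<M>. of_bool (mcok (p ^ k) M \<cong> pgrp p \<nu>) * a \<nu> l)"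
      unfolding v_def sum_distrib_left sum_distrib_right by (simp add: mult.assoc)
    also have "(\<Sum>\<nu>\<in>T. \<Sum>M\<in>\<M>. of_bool (mcok (p ^ k) M \<cong> pgrp p \<nu>) * a \<nu> l) = (\<Sum>M\<in>\<M>. real (card (epis (mcok (p ^ k) M) (pgrp p l))))"
      unfolding a_def by (subst sum.swap, intro sum.cong refl, subst ptw[symmetric]) (simp add: Mr)
    also have "eta / C * \<dots> = real (alt_count (pows p l)) * eta" using model[OF lL] C by simp
    finally show "(\<lambda>n. \<Sum>\<nu>\<in>T. u n \<nu> * a \<nu> l) \<longlonglongrightarrow> (\<Sum>\<nu>\<in>T. v \<nu> * a \<nu> l)"
      unfolding 1 using rank_moment[OF lL(1)] by simp
  qed
  have eL: "es \<in> L" using es by (simp add: L_def)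
  have eq: "(mcok (p ^ k) A \<cong> pgrp p (cf es)) = (mcok (p ^ k) A \<cong> pgrp p es)" for A using cf(2)[OF eL] iso_trans psym by blast
  have "cf es \<in> T" using eL by (simp add: T_def)
  from main[OF this] show ?thesis unfolding u_def v_def eq using fin by (simp add: sum.If_cases of_bool_def Int_def)
qed

end

section \<open>A finite model: symmetric matrices modulo a prime power\<close>

lemma prod_dvd_diff:
  assumes "finite S" "\<And>i. i \<in> S \<Longrightarrow> (q::int) dvd f i - g i"
  shows "q dvd prod f S - prod g S" using assms
proof (induction S rule: finite_induct)
  case (insert x S)
  have "prod f (insert x S) - prod g (insert x S) = f x * (prod f S - prod g S) + (f x - g x) * prod g S" using insert.hyps by (simp add: algebra_simps)
  then show ?case using insert by simp
qed simp

lemma det_dvd_diff: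
  assumes A: "A \<in> carrier_mat n n" and B: "B \<in> carrier_mat n n"
    and eq: "\<And>i j. i < n \<Longrightarrow> j < n \<Longrightarrow> (q::int) dvd A $$ (i, j) - B $$ (i, j)"
  shows "q dvd det A - det B" unfolding det_def'[OF A] det_def'[OF B] sum_subtractf[symmetric] right_diff_distrib[symmetric]
proof (intro dvd_sum dvd_mult prod_dvd_diff eq)
  fix \<pi> i assume "\<pi> \<in> {\<pi>. \<pi> permutes {0..<n}}" "i \<in> {0..<n}"
  then show "i < n" "\<pi> i < n" using permutes_in_image[of \<pi> "{0..<n}" i] by auto
qed simp

lemma coprime_det_cong:
  assumes A: "A \<in> carrier_mat n n" and B: "B \<in> carrier_mat n n"
    and eq: "\<And>i j. i < n \<Longrightarrow> j < n \<Longrightarrow> (q::int) dvd A $$ (i, j) - B $$ (i, j)"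
  shows "coprime (det A) q \<longleftrightarrow> coprime (det B) q"
proof -
  have "det A mod q = det B mod q" using det_dvd_diff[OF assms] by (simp add: mod_eq_dvd_iff)
  then show ?thesis by (metis gcd_red_int coprime_iff_gcd_eq_1 gcd.commute)
qed

text \<open>The adjugate, scaled by an inverse of the determinant modulo \<open>q\<close>. Keeping
  the exact scalar \<open>1 + q * t\<close> allows all computations to stay in integer
  matrices.\<close>

lemma inverse_mod:
  fixes B :: "int mat"
  assumes B: "B \<in> carrier_mat r r" and cop: "coprime (det B) q"
  obtains B' t where "B' \<in> carrier_mat r r" "B * B' = (1 + q * t) \<cdot>\<^sub>m 1\<^sub>m r" "B' * B = (1 + q * t) \<cdot>\<^sub>m 1\<^sub>m r"
proof -
  obtain a b where ab: "a * det B + b * q = 1" using bezout_int[of "det B" q] cop by (auto simp: coprime_iff_gcd_eq_1)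
  have "a * det B = 1 + q * (- b)" using ab by (simp add: algebra_simps)
  moreover have "a \<cdot>\<^sub>m (det B \<cdot>\<^sub>m 1\<^sub>m r) = (a * det B) \<cdot>\<^sub>m 1\<^sub>m r" by (intro eq_matI) auto
  ultimately show ?thesis using adj_mat[OF B] B that[of "a \<cdot>\<^sub>m adj_mat B" "- b"]
    by (simp add: mult_smult_distrib[of B r r "adj_mat B" r] mult_smult_assoc_mat[of "adj_mat B" r r B r])
qed

text \<open>Solutions for all unit vectors form a right inverse modulo \<open>q\<close>; compare
  determinants.\<close>

lemma coprime_det_of_surj:
  fixes B :: "int mat"
  assumes B: "B \<in> carrier_mat r r"
    and sur: "\<And>j. j < r \<Longrightarrow> \<exists>x\<in>carrier_vec r. \<forall>i<r. q dvd (B *\<^sub>v x) $ i - of_bool (i = j)"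
  shows "coprime (det B) q"
proof -
  obtain x where x: "\<And>j. j < r \<Longrightarrow> x j \<in> carrier_vec r" "\<And>i j. i < r \<Longrightarrow> j < r \<Longrightarrow> q dvd (B *\<^sub>v x j) $ i - of_bool (i = j)"
    using sur by metis
  define Y where "Y = mat r r (\<lambda>(i, j). x j $ i)"
  have Y: "Y \<in> carrier_mat r r" by (simp add: Y_def)
  have "q dvd det (B * Y) - det (1\<^sub>m r)"
  proof (rule det_dvd_diff)
    fix i j assume ij: "i < r" "j < r"
    have "col Y j = x j" using ij x(1)[of j] by (intro eq_vecI) (auto simp: Y_def)
    then have "(B * Y) $$ (i, j) = (B *\<^sub>v x j) $ i" using ij B Y by simp
    then show "q dvd (B * Y) $$ (i, j) - 1\<^sub>m r $$ (i, j)" using x(2)[OF ij] ij by (simp add: of_bool_def)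
  qed (use B Y in auto)
  then have d: "q dvd det B * det Y - 1" using det_mult[OF B Y] by simp
  show ?thesis
  proof (rule coprimeI)
    fix c assume "c dvd det B" "c dvd q"
    then have "c dvd det B * det Y" "c dvd det B * det Y - 1" using d dvd_trans by auto
    from dvd_diff[OF this] show "is_unit c" by simp
  qed
qed

definition vcong :: "nat \<Rightarrow> int \<Rightarrow> int vec \<Rightarrow> int vec \<Rightarrow> bool" where
  "vcong r q u v \<longleftrightarrow> u \<in> carrier_vec r \<and> v \<in> carrier_vec r \<and> (\<forall>i<r. q dvd u $ i - v $ i)"

lemma vcong_sym: "vcong r q u v \<Longrightarrow> vcong r q v u" by (auto simp: vcong_def dvd_diff_commute)

lemma vcong_trans [trans]: "vcong r q u v \<Longrightarrow> vcong r q v w \<Longrightarrow> vcong r q u w"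
  unfolding vcong_def by (metis dvd_add diff_add_cancel add_diff_eq)

lemma vcong_mult:
  assumes "A \<in> carrier_mat r r" "A' \<in> carrier_mat r r" "\<And>i j. i < r \<Longrightarrow> j < r \<Longrightarrow> q dvd A $$ (i, j) - A' $$ (i, j)" "vcong r q u v"
  shows "vcong r q (A *\<^sub>v u) (A' *\<^sub>v v)"
proof -
  have uv: "u \<in> carrier_vec r" "v \<in> carrier_vec r" "\<And>i. i < r \<Longrightarrow> q dvd u $ i - v $ i" using assms(4) by (auto simp: vcong_def)
  have "q dvd (A *\<^sub>v u) $ i - (A' *\<^sub>v v) $ i" if i: "i < r" for i
  proof -
    have "(A *\<^sub>v u) $ i - (A' *\<^sub>v v) $ i = (\<Sum>j<r. A $$ (i, j) * (u $ j - v $ j) + (A $$ (i, j) - A' $$ (i, j)) * v $ j)"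
      unfolding mat_vec_nth[OF assms(1) uv(1) i] mat_vec_nth[OF assms(2) uv(2) i] sum_subtractf[symmetric] by (intro sum.cong refl) (simp add: algebra_simps)
    also have "q dvd \<dots>" using assms(3)[OF i] uv(3) by (intro dvd_sum dvd_add dvd_mult dvd_mult2) auto
    finally show ?thesis .
  qed
  then show ?thesis using assms(1,2) uv by (auto simp: vcong_def)
qed

lemma vcong_mult_left: "A \<in> carrier_mat r r \<Longrightarrow> vcong r q u v \<Longrightarrow> vcong r q (A *\<^sub>v u) (A *\<^sub>v v)" by (rule vcong_mult) auto

lemma vcong_inverse:
  fixes B :: "int mat"
  assumes "B \<in> carrier_mat r r" "B' \<in> carrier_mat r r" "B' * B = (1 + q * t) \<cdot>\<^sub>m 1\<^sub>m r" "v \<in> carrier_vec r"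
  shows "vcong r q (B' *\<^sub>v (B *\<^sub>v v)) v"
proof -
  have "B' *\<^sub>v (B *\<^sub>v v) = (B' * B) *\<^sub>v v" using assms by (intro assoc_mult_mat_vec[symmetric]) auto
  also have "\<dots> = (1 + q * t) \<cdot>\<^sub>v v" unfolding assms(3) by (rule smult_one_mult_vec[OF assms(4)])
  finally show ?thesis using assms by (auto simp: vcong_def algebra_simps)
qed

lemma latt_iff_vcong:
  assumes A: "A \<in> carrier_mat r r"
  shows "v \<in> latt q A \<longleftrightarrow> (\<exists>x\<in>carrier_vec r. vcong r (int q) v (A *\<^sub>v x))"
proof
  assume "v \<in> latt q A"
  then obtain x y where "x \<in> carrier_vec r" "y \<in> carrier_vec r" "v = A *\<^sub>v x + int q \<cdot>\<^sub>v y" using A by (auto simp: latt_def)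
  then show "\<exists>x\<in>carrier_vec r. vcong r (int q) v (A *\<^sub>v x)" using A by (intro bexI[of _ x]) (auto simp: vcong_def)
next
  assume "\<exists>x\<in>carrier_vec r. vcong r (int q) v (A *\<^sub>v x)"
  then obtain x where x: "x \<in> carrier_vec r" "vcong r (int q) v (A *\<^sub>v x)" by blast
  define y where "y = vec r (\<lambda>i. (v $ i - (A *\<^sub>v x) $ i) div int q)"
  have "v = A *\<^sub>v x + int q \<cdot>\<^sub>v y" using x(2) A by (intro eq_vecI) (auto simp: vcong_def y_def)
  then show "v \<in> latt q A" using lattI[of x A y q] x(1) A by (auto simp: y_def)
qed

text \<open>\<open>P\<close> depends only on residues modulo \<open>p\<close>, and each residue has
  \<open>n i\<close> lifts to the range of size \<open>p * n i\<close>.\<close>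

lemma card_PiE_mod:
  fixes n :: "'i \<Rightarrow> nat"
  assumes I: "finite I" and p: "p > 0"
    and P: "\<And>x y. (\<And>i. i \<in> I \<Longrightarrow> int p dvd x i - y i) \<Longrightarrow> P x \<longleftrightarrow> P y"
  shows "card {x \<in> (\<Pi>\<^sub>E i\<in>I. {0..<int (p * n i)}). P x} = (\<Prod>i\<in>I. n i) * card {x \<in> I \<rightarrow>\<^sub>E {0..<int p}. P x}"
proof -
  let ?S = "{x \<in> (\<Pi>\<^sub>E i\<in>I. {0..<int (p * n i)}). P x}" and ?R = "{x \<in> I \<rightarrow>\<^sub>E {0..<int p}. P x}" and ?T = "\<Pi>\<^sub>E i\<in>I. {0..<int (n i)}"
  have "bij_betw (\<lambda>(t, y). \<lambda>i\<in>I. int p * t i + y i) (?T \<times> ?R) ?S"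
  proof (rule bij_betw_byWitness[where f' = "\<lambda>x. (\<lambda>i\<in>I. x i div int p, \<lambda>i\<in>I. x i mod int p)"])
    show "\<forall>a\<in>?T \<times> ?R. (\<lambda>x. (\<lambda>i\<in>I. x i div int p, \<lambda>i\<in>I. x i mod int p)) ((\<lambda>(t, y). \<lambda>i\<in>I. int p * t i + y i) a) = a"
    proof
      fix a assume a: "a \<in> ?T \<times> ?R"
      obtain t y where ty: "a = (t, y)" by (cases a)
      have y: "y i div int p = 0" "y i mod int p = y i" if "i \<in> I" for i using a ty that by (auto simp: PiE_iff)
      have 1: "(\<lambda>i\<in>I. (\<lambda>i\<in>I. int p * t i + y i) i div int p) = t" using a ty y p by (intro ext) (auto simp: PiE_iff extensional_def)
      have 2: "(\<lambda>i\<in>I. (\<lambda>i\<in>I. int p * t i + y i) i mod int p) = y" using a ty y p by (intro ext) (auto simp: PiE_iff extensional_def)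
      show "(\<lambda>x. (\<lambda>i\<in>I. x i div int p, \<lambda>i\<in>I. x i mod int p)) ((\<lambda>(t, y). \<lambda>i\<in>I. int p * t i + y i) a) = a"
        unfolding ty prod.case 1 2 ..
    qed
    show "\<forall>x\<in>?S. (\<lambda>(t, y). \<lambda>i\<in>I. int p * t i + y i) (\<lambda>i\<in>I. x i div int p, \<lambda>i\<in>I. x i mod int p) = x"
      by (auto simp: PiE_iff extensional_def fun_eq_iff)
    show "(\<lambda>(t, y). \<lambda>i\<in>I. int p * t i + y i) ` (?T \<times> ?R) \<subseteq> ?S"
    proof (rule image_subsetI)
      fix a assume a: "a \<in> ?T \<times> ?R"
      obtain t y where ty: "a = (t, y)" by (cases a)
      have "int p * t i + y i \<in> {0..<int (p * n i)}" if i: "i \<in> I" for i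
      proof -
        have b: "0 \<le> t i" "t i + 1 \<le> int (n i)" "0 \<le> y i" "y i < int p" using a ty i by (auto simp: PiE_iff)
        have "int p * (t i + 1) \<le> int p * int (n i)" using b(2) by (intro mult_left_mono) auto
        then show ?thesis using b p by (simp add: algebra_simps)
      qed
      moreover have "P (\<lambda>i\<in>I. int p * t i + y i)" using a ty P[of "\<lambda>i\<in>I. int p * t i + y i" y] by simp
      ultimately show "(\<lambda>(t, y). \<lambda>i\<in>I. int p * t i + y i) a \<in> ?S" unfolding ty prod.case by simp
    qed
    show "(\<lambda>x. (\<lambda>i\<in>I. x i div int p, \<lambda>i\<in>I. x i mod int p)) ` ?S \<subseteq> ?T \<times> ?R"
    proof (rule image_subsetI)
      fix x assume x: "x \<in> ?S"
      have "x i div int p \<in> {0..<int (n i)}" if i: "i \<in> I" for i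
      proof -
        have "0 \<le> x i" "x i < int p * int (n i)" using x i by (auto simp: PiE_iff)
        moreover have "x i div int p < int (n i)"
        proof (rule ccontr)
          assume "\<not> ?thesis"
          then have "int p * int (n i) \<le> int p * (x i div int p)" by (intro mult_left_mono) auto
          also have "\<dots> \<le> x i" using mult_div_mod_eq[of "int p" "x i"] pos_mod_sign[of "int p" "x i"] p by linarith
          finally show False using \<open>x i < _\<close> by simp
        qed
        ultimately show ?thesis using p by (simp add: pos_imp_zdiv_nonneg_iff)
      qed
      moreover have "P (\<lambda>i\<in>I. x i mod int p)"
      proof -
        have "int p dvd x i - x i mod int p" for i by (simp add: minus_mod_eq_mult_div)
        then show ?thesis using x P[of x "\<lambda>i\<in>I. x i mod int p"] by simp
      qed
      ultimately show "(\<lambda>i\<in>I. x i div int p, \<lambda>i\<in>I. x i mod int p) \<in> ?T \<times> ?R" using p by simp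
    qed
  qed
  from bij_betw_same_card[OF this] show ?thesis using I by (simp add: card_cartesian_product card_PiE)
qed

definition upper_pairs :: "nat \<Rightarrow> (nat \<times> nat) set" where
  "upper_pairs r = {(i, j). i \<le> j \<and> j < r}"

lemma finite_upper_pairs: "finite (upper_pairs r)" by (rule finite_subset[of _ "{..<r} \<times> {..<r}"]) (auto simp: upper_pairs_def)

definition upair :: "nat \<Rightarrow> nat \<Rightarrow> nat \<times> nat" where "upair i j = (min i j, max i j)"

lemma upair_commute: "upair i j = upair j i" by (simp add: upair_def min.commute max.commute)

lemma upair_in: "i < r \<Longrightarrow> j < r \<Longrightarrow> upair i j \<in> upper_pairs r" by (auto simp: upair_def upper_pairs_def)

lemma mat_mult_nth:
  "A \<in> carrier_mat m n \<Longrightarrow> B \<in> carrier_mat n l \<Longrightarrow> i < m \<Longrightarrow> j < l \<Longrightarrow> (A * B) $$ (i, j) = (\<Sum>a<n. A $$ (i, a) * B $$ (a, j))"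
  by (simp add: scalar_prod_def atLeast0LessThan)

section \<open>Symmetric matrices modulo p^k under congruence\<close>

locale sym_model =
  fixes p k r :: nat
  assumes p: "Factorial_Ring.prime p" and k: "k > 0"
begin

text \<open>Divisibility of all entries by \<open>p\<close> makes the rank of the cokernel modulo
  \<open>p ^ k\<close> exactly \<open>r\<close>, see \<open>length_tau_model\<close>.\<close>

definition \<M> :: "int mat set" where
  "\<M> = {M \<in> carrier_mat r r. \<forall>i<r. \<forall>j<r. M $$ (i, j) = M $$ (j, i) \<and> M $$ (i, j) \<in> {0..<int (p ^ k)} \<and> int p dvd M $$ (i, j)}"

lemma MD: "M \<in> \<M> \<Longrightarrow> M \<in> carrier_mat r r"
  "M \<in> \<M> \<Longrightarrow> i < r \<Longrightarrow> j < r \<Longrightarrow> M $$ (i, j) = M $$ (j, i)"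
  "M \<in> \<M> \<Longrightarrow> i < r \<Longrightarrow> j < r \<Longrightarrow> M $$ (i, j) \<in> {0..<int (p ^ k)}"
  "M \<in> \<M> \<Longrightarrow> i < r \<Longrightarrow> j < r \<Longrightarrow> int p dvd M $$ (i, j)" by (auto simp: \<M>_def)

lemma p1: "p > 1" using p prime_gt_1_nat by blast

lemma finite_M: "finite \<M>"
proof -
  have "\<M> \<subseteq> (\<lambda>f. mat r r f) ` ({..<r} \<times> {..<r} \<rightarrow>\<^sub>E {0..<int (p ^ k)})"
  proof
    fix M assume M: "M \<in> \<M>"
    let ?f = "\<lambda>ij\<in>{..<r} \<times> {..<r}. M $$ ij"
    have "M = mat r r ?f" using MD(1)[OF M] by (intro eq_matI) auto
    moreover have "?f \<in> {..<r} \<times> {..<r} \<rightarrow>\<^sub>E {0..<int (p ^ k)}" using MD(3)[OF M] by (intro restrict_PiE_iff[THEN iffD2] ballI) auto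
    ultimately show "M \<in> (\<lambda>f. mat r r f) ` ({..<r} \<times> {..<r} \<rightarrow>\<^sub>E {0..<int (p ^ k)})" by (rule image_eqI)
  qed
  then show ?thesis by (rule finite_subset) (intro finite_imageI finite_PiE, auto)
qed

definition conj_mod :: "int mat \<Rightarrow> int mat \<Rightarrow> int mat" where
  "conj_mod B M = map_mat (\<lambda>x. x mod int (p ^ k)) (B\<^sup>T * (M * B))"

lemma conj_mod_nth:
  assumes B: "B \<in> carrier_mat r r" and M: "M \<in> carrier_mat r r" and ij: "i < r" "j < r"
  shows "conj_mod B M $$ (i, j) = (\<Sum>a<r. \<Sum>b<r. B $$ (a, i) * M $$ (a, b) * B $$ (b, j)) mod int (p ^ k)"
  using assms by (simp add: conj_mod_def scalar_prod_def atLeast0LessThan sum_distrib_left mult.assoc)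

lemma conj_mod_in:
  assumes B: "B \<in> carrier_mat r r" and M: "M \<in> \<M>"
  shows "conj_mod B M \<in> \<M>"
proof -
  note n = conj_mod_nth[OF B MD(1)[OF M]]
  have "conj_mod B M $$ (i, j) = conj_mod B M $$ (j, i)" if ij: "i < r" "j < r" for i j
  proof -
    have "(\<Sum>a<r. \<Sum>b<r. B $$ (a, i) * M $$ (a, b) * B $$ (b, j)) = (\<Sum>b<r. \<Sum>a<r. B $$ (b, j) * M $$ (b, a) * B $$ (a, i))"
      using MD(2)[OF M] by (subst sum.swap, intro sum.cong refl) (simp add: mult.commute mult.left_commute)
    then show ?thesis unfolding n[OF ij] n[OF ij(2,1)] by simp
  qed
  moreover have "int p dvd conj_mod B M $$ (i, j)" if ij: "i < r" "j < r" for i j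
  proof -
    have "int p dvd (\<Sum>a<r. \<Sum>b<r. B $$ (a, i) * M $$ (a, b) * B $$ (b, j))" using MD(4)[OF M] by (intro dvd_sum dvd_mult2 dvd_mult) auto
    moreover have "int p dvd int (p ^ k)" using k by simp
    ultimately show ?thesis unfolding n[OF ij] by (simp add: dvd_mod)
  qed
  moreover have "conj_mod B M $$ (i, j) \<in> {0..<int (p ^ k)}" if ij: "i < r" "j < r" for i j unfolding n[OF ij] using p1 by simp
  moreover have "conj_mod B M \<in> carrier_mat r r" using B MD(1)[OF M] by (simp add: conj_mod_def)
  ultimately show ?thesis by (auto simp: \<M>_def)
qed

lemma conj_mod_cong:
  assumes B: "B \<in> carrier_mat r r" and M: "M \<in> carrier_mat r r" and ij: "i < r" "j < r"
  shows "int (p ^ k) dvd (B\<^sup>T * (M * B)) $$ (i, j) - conj_mod B M $$ (i, j)" using assms by (simp add: conj_mod_def flip: mod_eq_dvd_iff)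

abbreviation "scal t \<equiv> (1 + int (p ^ k) * t) \<cdot>\<^sub>m 1\<^sub>m r"

lemma cop_pow: "coprime x (int p) \<Longrightarrow> coprime x (int (p ^ j))" by simp

lemma mat_inverse_mod:
  assumes B: "B \<in> carrier_mat r r" and cop: "coprime (det B) (int p)"
  obtains B' t where "B' \<in> carrier_mat r r" "B * B' = scal t" "B' * B = scal t"
    "B\<^sup>T * B'\<^sup>T = scal t" "B'\<^sup>T * B\<^sup>T = scal t"
proof -
  obtain B' t where *: "B' \<in> carrier_mat r r" "B * B' = scal t" "B' * B = scal t" using inverse_mod[OF B cop_pow[OF cop]] by blast
  have tr: "transpose_mat (c \<cdot>\<^sub>m 1\<^sub>m r) = c \<cdot>\<^sub>m 1\<^sub>m r" for c :: int by (intro eq_matI) auto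
  have "B\<^sup>T * B'\<^sup>T = scal t" using transpose_mult[OF *(1) B] *(3) tr by simp
  moreover have "B'\<^sup>T * B\<^sup>T = scal t" using transpose_mult[OF B *(1)] *(2) tr by simp
  ultimately show ?thesis using that * by blast
qed

text \<open>Stated for one column and any divisor \<open>d\<close> of \<open>p ^ k\<close>, because
  the columns are later tested modulo different powers of \<open>p\<close>.\<close>

lemma inverse_mod_cancel_left:
  fixes C :: "int mat"
  assumes B: "B \<in> carrier_mat r r" and B': "B' \<in> carrier_mat r r" and e: "B' * B = scal t"
    and C: "C \<in> carrier_mat r r" and d: "\<And>i. i < r \<Longrightarrow> d dvd (B * C) $$ (i, l)" and l: "l < r" "i < r" and dq: "d dvd int (p ^ k)"
  shows "d dvd C $$ (i, l)"
proof -
  have "(B' * (B * C)) $$ (i, l) = (\<Sum>a<r. B' $$ (i, a) * (B * C) $$ (a, l))" using B B' C l by (simp add: scalar_prod_def atLeast0LessThan)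
  also have "d dvd \<dots>" using d by (intro dvd_sum dvd_mult) auto
  finally have dd: "d dvd (B' * (B * C)) $$ (i, l)" .
  have "B' * (B * C) = (scal t) * C" using assoc_mult_mat[OF B' B C] e by simp
  also have "\<dots> = (1 + int (p ^ k) * t) \<cdot>\<^sub>m C" using C by (simp add: mult_smult_assoc_mat[of _ r r _ r])
  finally have "(B' * (B * C)) $$ (i, l) = C $$ (i, l) + int (p ^ k) * t * C $$ (i, l)" using C l by (simp add: algebra_simps)
  then show ?thesis using dd dq by (simp add: dvd_add_left_iff mult.assoc)
qed

text \<open>On a finite set injectivity suffices. Only cancellation on the left is available, so the
  difference of two matrices is transposed between the two cancellations.\<close>

lemma conj_mod_bij:
  assumes B: "B \<in> carrier_mat r r" and cop: "coprime (det B) (int p)"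
  shows "bij_betw (conj_mod B) \<M> \<M>"
proof -
  obtain B' t where B': "B' \<in> carrier_mat r r" "B * B' = scal t" "B' * B = scal t"
    "B\<^sup>T * B'\<^sup>T = scal t" "B'\<^sup>T * B\<^sup>T = scal t" using mat_inverse_mod[OF B cop] by blast
  have "inj_on (conj_mod B) \<M>"
  proof (rule inj_onI)
    fix M N assume MN: "M \<in> \<M>" "N \<in> \<M>" "conj_mod B M = conj_mod B N"
    note Mc = MD(1)[OF MN(1)] and Nc = MD(1)[OF MN(2)]
    let ?D = "M - N" let ?q = "int (p ^ k)"
    have D: "?D \<in> carrier_mat r r" by (rule minus_carrier_mat[OF Nc])
    have eq: "B\<^sup>T * (?D * B) = B\<^sup>T * (M * B) - B\<^sup>T * (N * B)"
      using B Mc Nc minus_mult_distrib_mat[of M r r N B r] mult_minus_distrib_mat[of "B\<^sup>T" r r "M * B" r "N * B"] by simp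
    have 1: "?q dvd (B\<^sup>T * (?D * B)) $$ (i, j)" if ij: "i < r" "j < r" for i j
    proof -
      have "?q dvd (B\<^sup>T * (M * B)) $$ (i, j) - (B\<^sup>T * (N * B)) $$ (i, j)" using dvd_diff[OF conj_mod_cong[OF B Mc ij] conj_mod_cong[OF B Nc ij]] MN(3) by simp
      then show ?thesis unfolding eq using B Nc ij by simp
    qed
    have 2: "?q dvd (?D * B) $$ (i, j)" if ij: "i < r" "j < r" for i j using B D by (intro inverse_mod_cancel_left[OF _ _ B'(5) _ 1 ij(2,1)]) (auto simp: B'(1) ij)
    have "?q dvd (B\<^sup>T * ?D\<^sup>T) $$ (i, j)" if ij: "i < r" "j < r" for i j
    proof -
      have "B\<^sup>T * ?D\<^sup>T = transpose_mat (?D * B)" using transpose_mult[OF D B] by simp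
      moreover have "transpose_mat (?D * B) $$ (i, j) = (?D * B) $$ (j, i)" using ij carrier_matD[OF mult_carrier_mat[OF D B]] by (intro index_transpose_mat) simp_all
      ultimately show ?thesis using 2[OF ij(2,1)] by (simp only:)
    qed
    then have 3: "?q dvd ?D\<^sup>T $$ (i, j)" if ij: "i < r" "j < r" for i j
      using B D ij(2) by (intro inverse_mod_cancel_left[OF _ _ B'(5) _ _ ij(2,1)]) (auto simp: B'(1))
    show "M = N"
    proof (rule eq_matI)
      fix i j assume "i < dim_row N" "j < dim_col N"
      then have ij: "i < r" "j < r" using Nc by auto
      have "?q dvd M $$ (i, j) - N $$ (i, j)" using 3[OF ij(2,1)] ij Mc Nc by simp
      then have "M $$ (i, j) mod ?q = N $$ (i, j) mod ?q" by (simp add: mod_eq_dvd_iff)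
      then show "M $$ (i, j) = N $$ (i, j)" using MD(3)[OF MN(1) ij] MD(3)[OF MN(2) ij] by simp
    qed (use Mc Nc in auto)
  qed
  moreover have "conj_mod B ` \<M> \<subseteq> \<M>" using conj_mod_in[OF B] by blast
  ultimately show ?thesis using finite_M endo_inj_surj unfolding bij_betw_def by blast
qed

text \<open>Modulo \<open>p\<close> the matrix vanishes, so every nonzero tuple is admissible. The
  number identifies the rank of the cokernel.\<close>

lemma card_epis_M_one:
  assumes M: "M \<in> \<M>"
  shows "card (epis (mcok (p ^ k) M) (cyc_prod [p])) = p ^ r - 1"
proof -
  have ds: "pos_list [p]" using p1 by (simp add: pos_list_def)
  let ?C = "cyc [p]"
  let ?o = "\<lambda>i\<in>{..<r}. (cyc_one [p])"
  have o: "cyc_one [p] \<in> ?C" by (rule one_in_carrier)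
  have gen: "generating [p] r F \<longleftrightarrow> F \<noteq> ?o" if F: "F \<in> {..<r} \<rightarrow>\<^sub>E ?C" for F
  proof
    assume "F \<noteq> ?o"
    moreover have "F = ?o" if "\<forall>i<r. F i = cyc_one [p]" using that by (intro PiE_ext[OF F]) (auto simp: o)
    ultimately obtain i0 where i0: "i0 < r" "F i0 \<noteq> (cyc_one [p])" by blast
    have Fi: "F i0 \<in> ?C" using F i0(1) by auto
    have "\<not> int p dvd F i0 0"
    proof
      assume "int p dvd F i0 0"
      then have "F i0 = cyc_one [p]" by (intro cyc_prod_eqI[OF ds Fi o]) (simp add: cyc_prod_one)
      then show False using i0(2) by simp
    qed
    then have "coprime (F i0 0) (int p)" using p prime_imp_coprime[of "int p" "F i0 0"] by (simp add: coprime_commute)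
    then show "generating [p] r F" using PiE_mem[OF F] p1 i0(1) by (intro generating_cyclic) auto
  next
    assume g: "generating [p] r F"
    show "F \<noteq> ?o"
    proof
      assume Fo: "F = ?o"
      let ?w = "reduce [p] (\<lambda>_. 1)"
      obtain v where "lincomb [p] r F v = ?w"
        using g[THEN generating_iff_lincomb[OF ds, THEN iffD1, rotated]] PiE_mem[OF F] reduce_carrier[OF ds, of "\<lambda>_. 1"] by blast
      moreover have "lincomb [p] r F v = reduce [p] (\<lambda>_. 0)" unfolding lincomb_def Fo by (rule reduce_cong) (simp add: cyc_prod_one)
      ultimately have "reduce [p] (\<lambda>_. 1) 0 = reduce [p] (\<lambda>_. 0) 0" by simp
      then show False using p1 by (simp add: reduce_def)
    qed
  qed
  have "card (epis (mcok (p ^ k) M) (cyc_prod [p])) = card {F \<in> {..<r} \<rightarrow>\<^sub>E ?C. generating [p] r F \<and>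
        (\<forall>j<r. \<forall>l<length [p]. int ([p] ! l) dvd (\<Sum>i<r. M $$ (i, j) * F i l))}" by (rule card_epis_mcok[OF ds MD(1)[OF M]]) (use k in simp)
  also have "{F \<in> {..<r} \<rightarrow>\<^sub>E ?C. generating [p] r F \<and> (\<forall>j<r. \<forall>l<length [p]. int ([p] ! l) dvd (\<Sum>i<r. M $$ (i, j) * F i l))}
     = ({..<r} \<rightarrow>\<^sub>E ?C) - {?o}"
  proof -
    have "int ([p] ! l) dvd (\<Sum>i<r. M $$ (i, j) * F i l)" if "j < r" "l < length [p]" for j l F using that MD(4)[OF M] by (intro dvd_sum) (simp add: dvd_mult2)
    then show ?thesis using gen by auto
  qed
  also have "card \<dots> = card ({..<r} \<rightarrow>\<^sub>E ?C) - 1" using o by (subst card_Diff_subset) auto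
  also have "card ({..<r} \<rightarrow>\<^sub>E ?C) = p ^ r" by (simp add: card_PiE cyc_prod_card[OF ds] cyc_order_def)
  finally show ?thesis .
qed

lemma card_epis_M_trivial:
  assumes M: "M \<in> \<M>"
  shows "card (epis (mcok (p ^ k) M) (cyc_prod [])) = 1"
proof -
  have ds: "pos_list []" by (simp add: pos_list_def)
  have gen: "generating [] r F" if "F \<in> {..<r} \<rightarrow>\<^sub>E cyc []" for F using that by (subst generating_iff_lincomb[OF ds])
      (auto simp: cyc_prod_carrier[OF ds] lincomb_def reduce_def intro!: exI[of _ "0\<^sub>v r"])
  have "card (epis (mcok (p ^ k) M) (cyc_prod [])) = card {F \<in> {..<r} \<rightarrow>\<^sub>E cyc []. generating [] r F \<and>
        (\<forall>j<r. \<forall>l<length ([]::nat list). int ([] ! l) dvd (\<Sum>i<r. M $$ (i, j) * F i l))}" by (rule card_epis_mcok[OF ds MD(1)[OF M]]) simp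
  also have "\<dots> = card ({..<r} \<rightarrow>\<^sub>E cyc [])" using gen by (intro arg_cong[where f = card]) auto
  also have "\<dots> = 1" by (simp add: card_PiE cyc_prod_carrier[OF ds])
  finally show ?thesis .
qed

end

text \<open>A symmetric matrix whose column \<open>l\<close> is divisible by \<open>p ^ (es ! l)\<close> for all \<open>l\<close> is the diagonal matrix of the
  \<open>p ^ (es ! i)\<close> times a matrix of this shape, and the transposes of these are the Gram matrices of symmetric pairings
  on \<open>pgrp p es\<close>. This is why \<open>theta\<close> counts both.\<close>

definition umat :: "nat \<Rightarrow> nat list \<Rightarrow> (nat \<times> nat \<Rightarrow> int) \<Rightarrow> int mat" where
  "umat p es u = mat (length es) (length es) (\<lambda>(i, j). int (p ^ (max (es ! i) (es ! j) - es ! i)) * u (upair i j))"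

definition theta :: "nat \<Rightarrow> nat list \<Rightarrow> nat" where
  "theta p es = card {w \<in> upper_pairs (length es) \<rightarrow>\<^sub>E {0..<int p}. coprime (det (umat p es w)) (int p)}"

lemma umat_coprime_cong:
  assumes "\<And>ij. ij \<in> upper_pairs (length es) \<Longrightarrow> int p dvd u ij - u' ij"
  shows "coprime (det (umat p es u)) (int p) \<longleftrightarrow> coprime (det (umat p es u')) (int p)"
proof (rule coprime_det_cong)
  fix i j assume ij: "i < length es" "j < length es"
  have "umat p es u $$ (i, j) - umat p es u' $$ (i, j) = int (p ^ (max (es ! i) (es ! j) - es ! i)) * (u (upair i j) - u' (upair i j))"
    using ij by (simp add: umat_def right_diff_distrib)
  then show "int p dvd umat p es u $$ (i, j) - umat p es u' $$ (i, j)" using assms[OF upair_in[OF ij]] by simp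
qed (auto simp: umat_def)

lemma card_theta:
  assumes "p > 0"
  shows "card {x \<in> (\<Pi>\<^sub>E ij\<in>upper_pairs (length es). {0..<int (p * n ij)}). coprime (det (umat p es x)) (int p)}
     = (\<Prod>ij\<in>upper_pairs (length es). n ij) * theta p es" unfolding theta_def using umat_coprime_cong by (intro card_PiE_mod finite_upper_pairs assms) blast

section \<open>Surjections from the model onto one group\<close>

locale sym_model_type = sym_model p k "length es" for p k :: nat and es :: "nat list" +
  assumes es: "set es \<subseteq> {1..k}"
begin

abbreviation "r \<equiv> length es"
abbreviation "ds \<equiv> pows p es"
abbreviation "tuples \<equiv> {..<r} \<rightarrow>\<^sub>E cyc ds"
abbreviation "cm F \<equiv> mat r r (\<lambda>(i, l). F i l :: int)"

lemma ds: "pos_list ds" using p1 by (intro pos_list_pow) simp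

lemma e_bounds: "i < r \<Longrightarrow> 1 \<le> es ! i" "i < r \<Longrightarrow> es ! i \<le> k" using subsetD[OF es nth_mem[of i es]] by simp_all

lemma ds_dvd: "l < length ds \<Longrightarrow> ds ! l dvd p ^ k" using e_bounds(2) by (simp add: le_imp_power_dvd)

lemma pe_dvd: "l < r \<Longrightarrow> int (p ^ (es ! l)) dvd int (p ^ k)" using ds_dvd[of l] by (simp only: of_nat_dvd_iff length_map nth_map)

lemma cm_transpose_nth:
  "v \<in> carrier_vec r \<Longrightarrow> l < r \<Longrightarrow> ((cm F)\<^sup>T *\<^sub>v v) $ l = (\<Sum>i<r. v $ i * F i l)"
  by (subst mat_vec_nth[of _ r r]) (auto simp: mult.commute intro!: sum.cong)

text \<open>The tuple has as many members as the rank of the group, so generation can be tested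
  modulo \<open>p\<close> on a square matrix.\<close>

lemma generating_iff_det:
  assumes F: "F \<in> tuples"
  shows "generating ds r F \<longleftrightarrow> coprime (det (cm F)) (int p)"
proof
  assume g: "generating ds r F"
  have "coprime (det ((cm F)\<^sup>T)) (int p)"
  proof (rule coprime_det_of_surj)
    fix j assume j: "j < r"
    let ?w = "\<lambda>l. of_bool (l = j) :: int"
    obtain v where v: "v \<in> carrier_vec r" "lincomb ds r F v = reduce ds ?w"
      using g[THEN generating_iff_lincomb[OF ds, THEN iffD1, rotated]] PiE_mem[OF F] reduce_carrier[OF ds, of ?w] by blast
    have "int p dvd ((cm F)\<^sup>T *\<^sub>v v) $ l - of_bool (l = j)" if l: "l < r" for l
    proof -
      have "reduce ds (\<lambda>l. \<Sum>i<r. v $ i * F i l) l = reduce ds ?w l" using v(2) by (simp add: lincomb_def)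
      then have "int (p ^ (es ! l)) dvd (\<Sum>i<r. v $ i * F i l) - ?w l" using l by (simp add: reduce_def mod_eq_dvd_iff)
      moreover have "int p dvd int (p ^ (es ! l))" using e_bounds(1)[OF l] by simp
      ultimately show ?thesis unfolding cm_transpose_nth[OF v(1) l] using dvd_trans by blast
    qed
    then show "\<exists>x\<in>carrier_vec r. \<forall>i<r. int p dvd ((cm F)\<^sup>T *\<^sub>v x) $ i - of_bool (i = j)" using v(1) by blast
  qed simp
  then show "coprime (det (cm F)) (int p)" using det_transpose[of "cm F" r] by simp
next
  assume c: "coprime (det (cm F)) (int p)"
  obtain B' t where B': "B' \<in> carrier_mat r r" "(cm F)\<^sup>T * B'\<^sup>T = scal t" using mat_inverse_mod[OF mat_carrier c] by blast
  have "\<exists>v\<in>carrier_vec r. lincomb ds r F v = w" if w: "w \<in> cyc ds" for w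
  proof -
    let ?v = "B'\<^sup>T *\<^sub>v vec r w"
    have v: "?v \<in> carrier_vec r" using B'(1) by simp
    have vc: "vcong r (int (p ^ k)) ((cm F)\<^sup>T *\<^sub>v ?v) (vec r w)" by (rule vcong_inverse[OF _ _ B'(2)]) (use B'(1) in auto)
    have "lincomb ds r F ?v = reduce ds w" unfolding lincomb_def
    proof (rule reduce_cong)
      fix l assume l: "l < length ds"
      then have l': "l < r" by simp
      then have "int (p ^ k) dvd ((cm F)\<^sup>T *\<^sub>v ?v) $ l - vec r w $ l" using vc unfolding vcong_def by blast
      then have "int (p ^ k) dvd (\<Sum>i<r. ?v $ i * F i l) - w l" unfolding cm_transpose_nth[OF v l'] index_vec[OF l'] .
      then show "int (ds ! l) dvd (\<Sum>i<r. ?v $ i * F i l) - w l" using ds_dvd[OF l] by (meson dvd_trans of_nat_dvd_iff)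
    qed
    then show ?thesis using v reduce_id[OF ds w] by (intro bexI[of _ ?v]) auto
  qed
  then show "generating ds r F" using F by (subst generating_iff_lincomb[OF ds]) auto
qed

text \<open>For symmetric \<open>N\<close>, \<open>kills\<close> and \<open>full\<close> say that
  the standard surjection, which reduces coordinate \<open>l\<close> modulo
  \<open>p ^ (es ! l)\<close>, factors through the cokernel of \<open>N\<close> modulo
  \<open>p ^ k\<close> and is injective there.\<close>

definition "kills N \<longleftrightarrow> (\<forall>i<r. \<forall>l<r. int (p ^ (es ! l)) dvd N $$ (i, l))"
definition "full N \<longleftrightarrow> (\<forall>w\<in>carrier_vec r. (\<forall>l<r. int (p ^ (es ! l)) dvd w $ l) \<longrightarrow> w \<in> latt (p ^ k) N)"

text \<open>The conditions say that column \<open>l\<close> of \<open>M * cm F\<close> is divisible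
  by \<open>p ^ (es ! l)\<close>; left multiplication by a matrix invertible modulo
  \<open>p ^ k\<close> does not change this.\<close>

lemma kills_conj_iff:
  assumes c: "coprime (det (cm F)) (int p)" and M: "M \<in> \<M>"
  shows "(\<forall>j<r. \<forall>l<length ds. int (ds ! l) dvd (\<Sum>i<r. M $$ (i, j) * F i l)) \<longleftrightarrow> kills (conj_mod (cm F) M)"
proof -
  let ?B = "cm F"
  have Bc: "?B \<in> carrier_mat r r" by simp
  note Mc = MD(1)[OF M]
  have MB: "M * ?B \<in> carrier_mat r r" using Mc by simp
  have 1: "(\<Sum>i<r. M $$ (i, j) * F i l) = (M * ?B) $$ (j, l)" if "j < r" "l < r" for j l
    using that Mc MD(2)[OF M] by (auto simp: scalar_prod_def atLeast0LessThan intro!: sum.cong)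
  have 2: "int (p ^ (es ! l)) dvd conj_mod ?B M $$ (i, l) \<longleftrightarrow> int (p ^ (es ! l)) dvd (?B\<^sup>T * (M * ?B)) $$ (i, l)"
    if il: "i < r" "l < r" for i l
  proof -
    have "int (p ^ (es ! l)) dvd (?B\<^sup>T * (M * ?B)) $$ (i, l) - conj_mod ?B M $$ (i, l)" using conj_mod_cong[OF Bc Mc il] pe_dvd[OF il(2)] dvd_trans by blast
    then show ?thesis by (metis diff_add_cancel dvd_add_right_iff)
  qed
  obtain B' t where B': "B' \<in> carrier_mat r r" "B'\<^sup>T * ?B\<^sup>T = scal t" using mat_inverse_mod[OF Bc c] by blast
  have "(\<forall>j<r. int (p ^ (es ! l)) dvd (M * ?B) $$ (j, l)) \<longleftrightarrow> (\<forall>i<r. int (p ^ (es ! l)) dvd (?B\<^sup>T * (M * ?B)) $$ (i, l))"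
    if l: "l < r" for l
  proof
    assume a: "\<forall>j<r. int (p ^ (es ! l)) dvd (M * ?B) $$ (j, l)"
    show "\<forall>i<r. int (p ^ (es ! l)) dvd (?B\<^sup>T * (M * ?B)) $$ (i, l)"
    proof (intro allI impI)
      fix i assume i: "i < r"
      have "(?B\<^sup>T * (M * ?B)) $$ (i, l) = (\<Sum>b<r. ?B\<^sup>T $$ (i, b) * (M * ?B) $$ (b, l))" using i l MB by (intro mat_mult_nth[of _ r r]) simp_all
      also have "int (p ^ (es ! l)) dvd \<dots>" using a by (intro dvd_sum dvd_mult) auto
      finally show "int (p ^ (es ! l)) dvd (?B\<^sup>T * (M * ?B)) $$ (i, l)" .
    qed
  next
    assume a: "\<forall>i<r. int (p ^ (es ! l)) dvd (?B\<^sup>T * (M * ?B)) $$ (i, l)"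
    show "\<forall>j<r. int (p ^ (es ! l)) dvd (M * ?B) $$ (j, l)"
      using a by (intro allI impI inverse_mod_cancel_left[OF _ _ B'(2) MB _ l _ pe_dvd[OF l]]) (auto simp: B'(1))
  qed
  then show ?thesis unfolding kills_def using 1 2 by auto
qed

text \<open>The transpose of \<open>cm F\<close> carries the kernel of the tuple to the kernel of
  the standard surjection and the lattice of \<open>M\<close> to that of the conjugate, and it is
  invertible modulo \<open>p ^ k\<close>.\<close>

lemma full_conj_iff:
  assumes c: "coprime (det (cm F)) (int p)" and M: "M \<in> \<M>"
  shows "(\<forall>v\<in>carrier_vec r. lincomb ds r F v = cyc_one ds \<longrightarrow> v \<in> latt (p ^ k) M) \<longleftrightarrow> full (conj_mod (cm F) M)"
proof -
  let ?B = "cm F" let ?q = "int (p ^ k)" let ?N = "conj_mod ?B M"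
  have Bc: "?B \<in> carrier_mat r r" "?B\<^sup>T \<in> carrier_mat r r" by simp_all
  note Mc = MD(1)[OF M]
  have Nc: "?N \<in> carrier_mat r r" using MD(1)[OF conj_mod_in[OF Bc(1) M]] .
  obtain B' t where B': "B' \<in> carrier_mat r r" "?B * B' = scal t" "B' * ?B = scal t"
    "?B\<^sup>T * B'\<^sup>T = scal t" "B'\<^sup>T * ?B\<^sup>T = scal t" using mat_inverse_mod[OF Bc(1) c] by blast
  have B't: "B'\<^sup>T \<in> carrier_mat r r" using B'(1) by simp
  have one: "lincomb ds r F v = cyc_one ds \<longleftrightarrow> (\<forall>l<r. int (p ^ (es ! l)) dvd (?B\<^sup>T *\<^sub>v v) $ l)"
    if "v \<in> carrier_vec r" for v unfolding lincomb_def reduce_eq_one_iff using cm_transpose_nth[OF that, of _ F] by simp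
  have Nx: "vcong r ?q (?N *\<^sub>v x) (?B\<^sup>T *\<^sub>v (M *\<^sub>v (?B *\<^sub>v x)))" if x: "x \<in> carrier_vec r" for x
  proof -
    have "vcong r ?q ((?B\<^sup>T * (M * ?B)) *\<^sub>v x) (?N *\<^sub>v x)" using conj_mod_cong[OF Bc(1) Mc] x by (intro vcong_mult) (auto simp: Nc Mc vcong_def)
    moreover have "(?B\<^sup>T * (M * ?B)) *\<^sub>v x = ?B\<^sup>T *\<^sub>v (M *\<^sub>v (?B *\<^sub>v x))" using x Mc Bc by (simp add: assoc_mult_mat_vec[of _ r r _ r])
    ultimately show ?thesis using vcong_sym by metis
  qed
  note li = latt_iff_vcong[OF Mc, of _ "p ^ k"] latt_iff_vcong[OF Nc, of _ "p ^ k"]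
  show ?thesis
  proof
    assume a: "\<forall>v\<in>carrier_vec r. lincomb ds r F v = cyc_one ds \<longrightarrow> v \<in> latt (p ^ k) M"
    show "full ?N" unfolding full_def
    proof (intro ballI impI)
      fix w assume w: "w \<in> carrier_vec r" "\<forall>l<r. int (p ^ (es ! l)) dvd w $ l"
      let ?v = "B'\<^sup>T *\<^sub>v w"
      have v: "?v \<in> carrier_vec r" by (rule mult_mat_vec_carrier[OF B't w(1)])
      have vw: "vcong r ?q (?B\<^sup>T *\<^sub>v ?v) w" by (rule vcong_inverse[OF B't Bc(2) B'(4) w(1)])
      have "int (p ^ (es ! l)) dvd (?B\<^sup>T *\<^sub>v ?v) $ l" if l: "l < r" for l
      proof -
        have "int (p ^ (es ! l)) dvd (?B\<^sup>T *\<^sub>v ?v) $ l - w $ l" using vw l pe_dvd[OF l] dvd_trans unfolding vcong_def by blast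
        then show ?thesis using w(2) l by (metis diff_add_cancel dvd_add)
      qed
      then have "?v \<in> latt (p ^ k) M" using a one[OF v] v by blast
      then obtain x where x: "x \<in> carrier_vec r" "vcong r ?q ?v (M *\<^sub>v x)" using li(1) by blast
      let ?x = "B' *\<^sub>v x"
      have xc: "?x \<in> carrier_vec r" by (rule mult_mat_vec_carrier[OF B'(1) x(1)])
      have "vcong r ?q w (?B\<^sup>T *\<^sub>v ?v)" by (rule vcong_sym[OF vw])
      also have "vcong r ?q (?B\<^sup>T *\<^sub>v ?v) (?B\<^sup>T *\<^sub>v (M *\<^sub>v x))" by (rule vcong_mult_left[OF Bc(2) x(2)])
      also have "vcong r ?q (?B\<^sup>T *\<^sub>v (M *\<^sub>v x)) (?B\<^sup>T *\<^sub>v (M *\<^sub>v (?B *\<^sub>v ?x)))"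
        by (intro vcong_mult_left[OF Bc(2)] vcong_mult_left[OF Mc] vcong_sym[OF vcong_inverse[OF B'(1) Bc(1) B'(2) x(1)]])
      also have "vcong r ?q (?B\<^sup>T *\<^sub>v (M *\<^sub>v (?B *\<^sub>v ?x))) (?N *\<^sub>v ?x)" by (rule vcong_sym[OF Nx[OF xc]])
      finally show "w \<in> latt (p ^ k) ?N" using li(2) xc by blast
    qed
  next
    assume a: "full ?N"
    show "\<forall>v\<in>carrier_vec r. lincomb ds r F v = cyc_one ds \<longrightarrow> v \<in> latt (p ^ k) M"
    proof (intro ballI impI)
      fix v assume v: "v \<in> carrier_vec r" "lincomb ds r F v = cyc_one ds"
      let ?w = "?B\<^sup>T *\<^sub>v v"
      have wc: "?w \<in> carrier_vec r" by (rule mult_mat_vec_carrier[OF Bc(2) v(1)])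
      have "?w \<in> latt (p ^ k) ?N" using a one[OF v(1)] v(2) wc unfolding full_def by blast
      then obtain x where x: "x \<in> carrier_vec r" "vcong r ?q ?w (?N *\<^sub>v x)" using li(2) by blast
      have Bx: "?B *\<^sub>v x \<in> carrier_vec r" "M *\<^sub>v (?B *\<^sub>v x) \<in> carrier_vec r"
        using mult_mat_vec_carrier[OF Bc(1) x(1)] mult_mat_vec_carrier[OF Mc] by blast+
      have "vcong r ?q v (B'\<^sup>T *\<^sub>v ?w)" by (rule vcong_sym[OF vcong_inverse[OF Bc(2) B't B'(5) v(1)]])
      also have "vcong r ?q (B'\<^sup>T *\<^sub>v ?w) (B'\<^sup>T *\<^sub>v (?N *\<^sub>v x))" by (rule vcong_mult_left[OF B't x(2)])
      also have "vcong r ?q (B'\<^sup>T *\<^sub>v (?N *\<^sub>v x)) (B'\<^sup>T *\<^sub>v (?B\<^sup>T *\<^sub>v (M *\<^sub>v (?B *\<^sub>v x))))"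
        by (rule vcong_mult_left[OF B't Nx[OF x(1)]])
      also have "vcong r ?q (B'\<^sup>T *\<^sub>v (?B\<^sup>T *\<^sub>v (M *\<^sub>v (?B *\<^sub>v x)))) (M *\<^sub>v (?B *\<^sub>v x))"
        by (rule vcong_inverse[OF Bc(2) B't B'(5) Bx(2)])
      finally show "v \<in> latt (p ^ k) M" using li(1) Bx(1) by blast
    qed
  qed
qed

definition "gens = {F \<in> tuples. coprime (det (cm F)) (int p)}"

lemma finite_tuples: "finite tuples" by (intro finite_PiE cyc_prod_finite ds) simp

text \<open>For fixed \<open>F\<close> conjugation permutes \<open>\<M>\<close>, so every generating
  tuple contributes the same number as the standard one.\<close>

lemma double_count:
  assumes R: "\<And>F M. coprime (det (cm F)) (int p) \<Longrightarrow> M \<in> \<M> \<Longrightarrow> R M F \<longleftrightarrow> R' (conj_mod (cm F) M)"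
  shows "(\<Sum>M\<in>\<M>. card {F \<in> tuples. generating ds r F \<and> R M F}) = card gens * card {N \<in> \<M>. R' N}"
proof -
  have fg: "finite gens" unfolding gens_def using finite_tuples by simp
  have "(\<Sum>M\<in>\<M>. card {F \<in> tuples. generating ds r F \<and> R M F}) = (\<Sum>M\<in>\<M>. card {F \<in> gens. R M F})"
    using generating_iff_det by (intro sum.cong refl arg_cong[where f = card]) (auto simp: gens_def)
  also have "\<dots> = (\<Sum>M\<in>\<M>. \<Sum>F\<in>gens. of_bool (R M F))" using fg by (simp add: sum.If_cases of_bool_def Int_def)
  also have "\<dots> = (\<Sum>F\<in>gens. \<Sum>M\<in>\<M>. of_bool (R M F))" by (rule sum.swap)
  also have "\<dots> = (\<Sum>F\<in>gens. card {N \<in> \<M>. R' N})"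
  proof (rule sum.cong[OF refl])
    fix F assume "F \<in> gens"
    then have c: "coprime (det (cm F)) (int p)" by (simp add: gens_def)
    have "(\<Sum>M\<in>\<M>. of_bool (R M F)) = (\<Sum>M\<in>\<M>. of_bool (R' (conj_mod (cm F) M)))" using R[OF c] by (intro sum.cong) auto
    also have "\<dots> = (\<Sum>N\<in>\<M>. of_bool (R' N))" by (rule sum.reindex_bij_betw[OF conj_mod_bij[OF _ c]]) simp
    also have "\<dots> = card {N \<in> \<M>. R' N}" using finite_M by (simp add: sum.If_cases of_bool_def Int_def)
    finally show "(\<Sum>M\<in>\<M>. of_bool (R M F)) = card {N \<in> \<M>. R' N}" .
  qed
  finally show ?thesis by simp
qed

definition "mx ij = max (es ! fst ij) (es ! snd ij)"
text \<open>By symmetry entry \<open>(i, j)\<close> is divisible by both \<open>p ^ (es ! i)\<close>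
  and \<open>p ^ (es ! j)\<close>; the free parameter is the quotient by the larger of the
  two.\<close>

definition "nmat u = mat r r (\<lambda>(i, j). int (p ^ max (es ! i) (es ! j)) * u (upair i j))"
definition "uspace = (\<Pi>\<^sub>E ij\<in>upper_pairs r. {0..<int (p ^ (k - mx ij))})"

lemma mx_upair: "mx (upair i j) = max (es ! i) (es ! j)" by (cases "i \<le> j") (auto simp: mx_def upair_def max_def min_def)

lemma mx_le: "ij \<in> upper_pairs r \<Longrightarrow> mx ij \<le> k" using e_bounds(2) by (auto simp: mx_def upper_pairs_def)

lemma nmat_in:
  assumes u: "u \<in> uspace"
  shows "nmat u \<in> \<M>" "kills (nmat u)"
proof -
  have n: "nmat u $$ (i, j) = int (p ^ max (es ! i) (es ! j)) * u (upair i j)" if "i < r" "j < r" for i j using that by (simp add: nmat_def)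
  have "nmat u $$ (i, j) = nmat u $$ (j, i)" if "i < r" "j < r" for i j using that by (simp add: n upair_commute max.commute)
  moreover have "nmat u $$ (i, j) \<in> {0..<int (p ^ k)}" if ij: "i < r" "j < r" for i j
  proof -
    let ?m = "max (es ! i) (es ! j)"
    have "u (upair i j) \<in> {0..<int (p ^ (k - ?m))}" using u upair_in[OF ij] mx_upair[of i j] by (fastforce simp: uspace_def PiE_iff)
    then have b: "0 \<le> u (upair i j)" "u (upair i j) < int (p ^ (k - ?m))" by auto
    have "?m \<le> k" using e_bounds(2) ij by simp
    then have pk: "p ^ k = p ^ ?m * p ^ (k - ?m)" by (simp flip: power_add)
    have "int (p ^ ?m) * u (upair i j) < int (p ^ ?m) * int (p ^ (k - ?m))" using b(2) p1 by (intro mult_strict_left_mono) auto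
    then show ?thesis using b(1) n[OF ij] unfolding pk by (simp add: of_nat_mult)
  qed
  moreover have "int p dvd nmat u $$ (i, j)" if ij: "i < r" "j < r" for i j
  proof -
    have "max (es ! i) (es ! j) > 0" using e_bounds(1)[OF ij(1)] by simp
    then have "int p dvd int (p ^ max (es ! i) (es ! j))" by (simp add: dvd_power)
    then show ?thesis unfolding n[OF ij] by (rule dvd_mult2)
  qed
  ultimately show "nmat u \<in> \<M>" by (auto simp: \<M>_def nmat_def)
  show "kills (nmat u)" unfolding kills_def
  proof (intro allI impI)
    fix i l assume il: "i < r" "l < r"
    have "p ^ (es ! l) dvd p ^ max (es ! i) (es ! l)" by (intro le_imp_power_dvd) simp
    then have "int (p ^ (es ! l)) dvd int (p ^ max (es ! i) (es ! l))" by (simp only: of_nat_dvd_iff)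
    then show "int (p ^ (es ! l)) dvd nmat u $$ (i, l)" unfolding n[OF il] by (rule dvd_mult2)
  qed
qed

lemma nmat_inj: "inj_on nmat uspace"
proof (rule inj_onI)
  fix u v assume uv: "u \<in> uspace" "v \<in> uspace" "nmat u = nmat v"
  show "u = v"
  proof (rule PiE_ext[OF uv(1)[unfolded uspace_def] uv(2)[unfolded uspace_def]])
    fix ij assume ij: "ij \<in> upper_pairs r"
    then have "fst ij < r" "snd ij < r" "upair (fst ij) (snd ij) = ij" by (auto simp: upper_pairs_def upair_def)
    moreover have "nmat u $$ ij = nmat v $$ ij" using uv(3) by simp
    ultimately show "u ij = v ij" using p1 by (cases ij) (simp add: nmat_def)
  qed
qed

lemma nmat_surj:
  assumes N: "N \<in> \<M>" "kills N"
  shows "\<exists>u\<in>uspace. N = nmat u"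
proof
  let ?u = "\<lambda>ij\<in>upper_pairs r. N $$ ij div int (p ^ mx ij)"
  have dv: "int (p ^ max (es ! i) (es ! j)) dvd N $$ (i, j)" if ij: "i < r" "j < r" for i j
  proof (cases "es ! i \<le> es ! j")
    case True
    then show ?thesis using N(2) ij by (simp add: kills_def max_def)
  next
    case False
    then have "int (p ^ max (es ! i) (es ! j)) dvd N $$ (j, i)" using N(2) ij by (simp add: kills_def max_def)
    then show ?thesis using MD(2)[OF N(1) ij] by simp
  qed
  show "N = nmat ?u"
  proof (rule eq_matI)
    fix i j assume "i < dim_row (nmat ?u)" "j < dim_col (nmat ?u)"
    then have ij: "i < r" "j < r" by (auto simp: nmat_def)
    have "N $$ upair i j = N $$ (i, j)" using MD(2)[OF N(1) ij] by (auto simp: upair_def min_def max_def)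
    then have "nmat ?u $$ (i, j) = int (p ^ max (es ! i) (es ! j)) * (N $$ (i, j) div int (p ^ max (es ! i) (es ! j)))"
      using ij upair_in[OF ij] by (simp add: nmat_def mx_upair)
    then show "N $$ (i, j) = nmat ?u $$ (i, j)" using dv[OF ij] by (simp only: dvd_mult_div_cancel)
  qed (use MD(1)[OF N(1)] in \<open>auto simp: nmat_def\<close>)
  have "N $$ ij div int (p ^ mx ij) \<in> {0..<int (p ^ (k - mx ij))}" if ij: "ij \<in> upper_pairs r" for ij
  proof -
    obtain i j where e: "ij = (i, j)" "i < r" "j < r" using ij by (auto simp: upper_pairs_def)
    have N': "0 \<le> N $$ ij" "N $$ ij < int (p ^ k)" using MD(3)[OF N(1) e(2,3)] e(1) by auto
    have mxe: "mx ij = max (es ! i) (es ! j)" by (simp add: mx_def e(1))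
    have d: "int (p ^ mx ij) * (N $$ ij div int (p ^ mx ij)) = N $$ ij" using dv[OF e(2,3)] unfolding mxe unfolding e(1) by (rule dvd_mult_div_cancel)
    have pk: "int (p ^ k) = int (p ^ mx ij) * int (p ^ (k - mx ij))" using mx_le[OF ij] by (simp flip: power_add)
    have pos: "int (p ^ mx ij) > 0" using p1 by simp
    have "int (p ^ mx ij) * (N $$ ij div int (p ^ mx ij)) < int (p ^ mx ij) * int (p ^ (k - mx ij))" using N'(2) unfolding d pk .
    then have "N $$ ij div int (p ^ mx ij) < int (p ^ (k - mx ij))" using pos by (simp only: mult_less_cancel_left_pos)
    moreover have "0 \<le> N $$ ij div int (p ^ mx ij)" using N'(1) pos by (simp only: pos_imp_zdiv_nonneg_iff)
    ultimately show ?thesis by simp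
  qed
  then show "?u \<in> uspace" unfolding uspace_def by (intro restrict_PiE_iff[THEN iffD2] ballI)
qed

lemma card_kills: "card {N \<in> \<M>. kills N \<and> Q N} = card {u \<in> uspace. Q (nmat u)}"
proof -
  have "{N \<in> \<M>. kills N \<and> Q N} = nmat ` {u \<in> uspace. Q (nmat u)}" using nmat_in nmat_surj by blast
  then show ?thesis using card_image[OF inj_on_subset[OF nmat_inj]] by (metis (no_types, lifting) Collect_subset mem_Collect_eq subsetI)
qed

lemma card_uspace: "card uspace = (\<Prod>ij\<in>upper_pairs r. p ^ (k - mx ij))" unfolding uspace_def by (subst card_PiE[OF finite_upper_pairs]) (simp flip: of_nat_power)

lemma nmat_mult_vec:
  assumes x: "x \<in> carrier_vec r" and i: "i < r"
  shows "(nmat u *\<^sub>v x) $ i = int (p ^ (es ! i)) * (umat p es u *\<^sub>v x) $ i"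
proof -
  have "(nmat u *\<^sub>v x) $ i = (\<Sum>j<r. nmat u $$ (i, j) * x $ j)" by (rule mat_vec_nth[OF _ x i]) (simp add: nmat_def)
  also have "\<dots> = (\<Sum>j<r. int (p ^ (es ! i)) * (umat p es u $$ (i, j) * x $ j))"
  proof (rule sum.cong[OF refl])
    fix j assume "j \<in> {..<r}"
    then have j: "j < r" by simp
    have "int p ^ max (es ! i) (es ! j) = int p ^ (es ! i) * int p ^ (max (es ! i) (es ! j) - es ! i)" by (simp flip: power_add)
    then show "nmat u $$ (i, j) * x $ j = int (p ^ (es ! i)) * (umat p es u $$ (i, j) * x $ j)" using i j by (simp add: nmat_def umat_def)
  qed
  also have "\<dots> = int (p ^ (es ! i)) * (umat p es u *\<^sub>v x) $ i" unfolding sum_distrib_left[symmetric] by (subst mat_vec_nth[OF _ x i]) (simp_all add: umat_def)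
  finally show ?thesis .
qed

text \<open>\<open>nmat u\<close> is the diagonal matrix of the \<open>p ^ (es ! i)\<close> times
  \<open>umat p es u\<close>, so fullness is surjectivity of \<open>umat p es u\<close> modulo the
  remaining powers \<open>p ^ (k - es ! i)\<close>. The strict bound on the exponents leaves at
  least one factor \<open>p\<close> to test.\<close>

lemma full_nmat_iff:
  assumes es': "\<And>i. i < r \<Longrightarrow> es ! i < k"
  shows "full (nmat u) \<longleftrightarrow> coprime (det (umat p es u)) (int p)"
proof -
  let ?U = "umat p es u"
  have U: "?U \<in> carrier_mat r r" by (simp add: umat_def)
  have N: "nmat u \<in> carrier_mat r r" by (simp add: nmat_def)
  have pk: "int (p ^ k) = int (p ^ (es ! i)) * int (p ^ (k - es ! i))" if "i < r" for i using es'[OF that] by (simp flip: power_add)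
  show ?thesis
  proof
    assume f: "full (nmat u)"
    show "coprime (det ?U) (int p)"
    proof (rule coprime_det_of_surj[OF U])
      fix j assume j: "j < r"
      let ?w = "vec r (\<lambda>i. int (p ^ (es ! i)) * of_bool (i = j))"
      have "?w \<in> latt (p ^ k) (nmat u)" using f unfolding full_def by simp
      then obtain x where x: "x \<in> carrier_vec r" "vcong r (int (p ^ k)) ?w (nmat u *\<^sub>v x)" using latt_iff_vcong[OF N] by blast
      have "int p dvd (?U *\<^sub>v x) $ i - of_bool (i = j)" if i: "i < r" for i
      proof -
        have "int (p ^ k) dvd ?w $ i - (nmat u *\<^sub>v x) $ i" using x(2) i unfolding vcong_def by blast
        moreover have "?w $ i - (nmat u *\<^sub>v x) $ i = int (p ^ (es ! i)) * (of_bool (i = j) - (?U *\<^sub>v x) $ i)"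
          unfolding nmat_mult_vec[OF x(1) i] using i by (simp add: right_diff_distrib)
        ultimately have "int (p ^ (k - es ! i)) dvd of_bool (i = j) - (?U *\<^sub>v x) $ i" unfolding pk[OF i] using p1 by simp
        moreover have "int p dvd int (p ^ (k - es ! i))" using es'[OF i] by (simp add: dvd_power)
        ultimately have "int p dvd of_bool (i = j) - (?U *\<^sub>v x) $ i" using dvd_trans by blast
        then show ?thesis by (simp only: dvd_diff_commute)
      qed
      then show "\<exists>x\<in>carrier_vec r. \<forall>i<r. int p dvd (?U *\<^sub>v x) $ i - of_bool (i = j)" using x(1) by blast
    qed
  next
    assume c: "coprime (det ?U) (int p)"
    obtain U' t where U': "U' \<in> carrier_mat r r" "?U * U' = scal t" using mat_inverse_mod[OF U c] by blast
    show "full (nmat u)" unfolding full_def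
    proof (intro ballI impI)
      fix w assume w: "w \<in> carrier_vec r" "\<forall>l<r. int (p ^ (es ! l)) dvd w $ l"
      define w0 where "w0 = vec r (\<lambda>l. w $ l div int (p ^ (es ! l)))"
      have w0: "w0 \<in> carrier_vec r" "\<And>l. l < r \<Longrightarrow> w $ l = int (p ^ (es ! l)) * w0 $ l" using w(2) by (simp_all add: w0_def)
      let ?x = "U' *\<^sub>v w0"
      have x: "?x \<in> carrier_vec r" by (rule mult_mat_vec_carrier[OF U'(1) w0(1)])
      have vc: "vcong r (int (p ^ k)) (?U *\<^sub>v ?x) w0" by (rule vcong_inverse[OF U'(1) U U'(2) w0(1)])
      have "int (p ^ k) dvd w $ i - (nmat u *\<^sub>v ?x) $ i" if i: "i < r" for i
      proof -
        have "w $ i - (nmat u *\<^sub>v ?x) $ i = int (p ^ (es ! i)) * (w0 $ i - (?U *\<^sub>v ?x) $ i)"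
          unfolding nmat_mult_vec[OF x i] w0(2)[OF i] by (simp add: right_diff_distrib)
        moreover have "int (p ^ k) dvd w0 $ i - (?U *\<^sub>v ?x) $ i" using vcong_sym[OF vc] i unfolding vcong_def by blast
        ultimately show ?thesis by simp
      qed
      then have "vcong r (int (p ^ k)) w (nmat u *\<^sub>v ?x)" using w(1) mult_mat_vec_carrier[OF N x] unfolding vcong_def by blast
      then show "w \<in> latt (p ^ k) (nmat u)" using latt_iff_vcong[OF N] x by blast
    qed
  qed
qed

text \<open>An entry has \<open>p ^ (k - mx ij - 1)\<close> lifts from its residue modulo
  \<open>p\<close>; the power of \<open>p\<close> on the left restores the missing factors without a
  division.\<close>

lemma card_full:
  assumes es': "\<And>i. i < r \<Longrightarrow> es ! i < k"
  shows "card {N \<in> \<M>. kills N \<and> full N} * p ^ card (upper_pairs r) = (\<Prod>ij\<in>upper_pairs r. p ^ (k - mx ij)) * theta p es"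
proof -
  have m: "p ^ (k - mx ij) = p * p ^ (k - mx ij - 1)" if "ij \<in> upper_pairs r" for ij
  proof -
    have "mx ij < k" using es' that by (auto simp: mx_def upper_pairs_def)
    then have "k - mx ij = Suc (k - mx ij - 1)" by simp
    then show ?thesis by (metis power_Suc)
  qed
  have us: "uspace = (\<Pi>\<^sub>E ij\<in>upper_pairs r. {0..<int (p * p ^ (k - mx ij - 1))})" unfolding uspace_def using m by (intro PiE_cong) simp
  have eq: "full (nmat u) \<longleftrightarrow> coprime (det (umat p es u)) (int p)" for u by (rule full_nmat_iff[OF es'])
  have "card {N \<in> \<M>. kills N \<and> full N} = card {u \<in> uspace. coprime (det (umat p es u)) (int p)}" unfolding card_kills eq ..
  also have "\<dots> = (\<Prod>ij\<in>upper_pairs r. p ^ (k - mx ij - 1)) * theta p es" unfolding us using p1 by (intro card_theta) simp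
  finally have "card {N \<in> \<M>. kills N \<and> full N} = (\<Prod>ij\<in>upper_pairs r. p ^ (k - mx ij - 1)) * theta p es" .
  moreover have "(\<Prod>ij\<in>upper_pairs r. p ^ (k - mx ij)) = (\<Prod>ij\<in>upper_pairs r. p) * (\<Prod>ij\<in>upper_pairs r. p ^ (k - mx ij - 1))"
    unfolding prod.distrib[symmetric] using m by (intro prod.cong) auto
  ultimately show ?thesis by simp
qed

lemma sum_card_epis: "(\<Sum>M\<in>\<M>. card (epis (mcok (p ^ k) M) (pgrp p es))) = card gens * (\<Prod>ij\<in>upper_pairs r. p ^ (k - mx ij))"
proof -
  have "(\<Sum>M\<in>\<M>. card (epis (mcok (p ^ k) M) (pgrp p es))) = (\<Sum>M\<in>\<M>. card {F \<in> tuples. generating ds r F \<and>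
        (\<forall>j<r. \<forall>l<length ds. int (ds ! l) dvd (\<Sum>i<r. M $$ (i, j) * F i l))})" by (rule sum.cong[OF refl]) (rule card_epis_mcok[OF ds MD(1) ds_dvd])
  also have "\<dots> = card gens * card {N \<in> \<M>. kills N}" by (rule double_count) (rule kills_conj_iff)
  finally show ?thesis using card_kills[of "\<lambda>_. True"] card_uspace by simp
qed

text \<open>Injective surjections are counted twice: a matrix whose cokernel has the right type
  admits as many as there are automorphisms, and \<open>double_count\<close> gives the
  total.\<close>

lemma sum_card_iso: "card {M \<in> \<M>. mcok (p ^ k) M \<cong> pgrp p es} * card (auto (pgrp p es)) = card gens * card {N \<in> \<M>. kills N \<and> full N}"
proof -
  let ?G = "pgrp p es"
  have pg: "group ?G" using cyc_prod_group comm_group.axioms(2) by blast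
  have mg: "group (mcok b A)" for b A using mcok_group comm_group.axioms(2) by blast
  have mfin: "finite (carrier (mcok (p ^ k) A))" for A using p1 by (intro mcok_finite) simp
  have pfin: "finite (carrier ?G)" by (intro cyc_prod_finite ds)
  have "card {h \<in> epis (mcok (p ^ k) M) ?G. inj_on h (carrier (mcok (p ^ k) M))} = of_bool (mcok (p ^ k) M \<cong> ?G) * card (auto ?G)" for M
  proof (cases "mcok (p ^ k) M \<cong> ?G")
    case True
    then obtain g where "g \<in> iso (mcok (p ^ k) M) ?G" unfolding is_iso_def by blast
    then have "bij_betw g (carrier (mcok (p ^ k) M)) (carrier ?G)" by (simp add: iso_def)
    then have cd: "card (carrier (mcok (p ^ k) M)) = card (carrier ?G)" by (rule bij_betw_same_card)
    have "inj_on h (carrier (mcok (p ^ k) M))" if "h \<in> epis (mcok (p ^ k) M) ?G" for h using epis_iso[OF mfin that cd] by (simp add: iso_def bij_betw_def)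
    then have "{h \<in> epis (mcok (p ^ k) M) ?G. inj_on h (carrier (mcok (p ^ k) M))} = epis (mcok (p ^ k) M) ?G" by blast
    then show ?thesis using True card_epis_iso[OF True mg pg, of ?G] epis_self[OF pfin] by simp
  next
    case False
    have "{h \<in> epis (mcok (p ^ k) M) ?G. inj_on h (carrier (mcok (p ^ k) M))} = {}"
    proof (rule ccontr)
      assume "\<not> ?thesis"
      then obtain h where h: "h \<in> epis (mcok (p ^ k) M) ?G" "inj_on h (carrier (mcok (p ^ k) M))" by blast
      then have "h \<in> iso (mcok (p ^ k) M) ?G" by (simp add: epis_def iso_def bij_betw_def)
      then show False using False unfolding is_iso_def by blast
    qed
    then show ?thesis using False by (simp only: card.empty of_bool_eq mult_zero_left)
  qed
  then have "(\<Sum>M\<in>\<M>. card {h \<in> epis (mcok (p ^ k) M) ?G. inj_on h (carrier (mcok (p ^ k) M))})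
    = card {M \<in> \<M>. mcok (p ^ k) M \<cong> pgrp p es} * card (auto (pgrp p es))"
    using finite_M by (simp flip: sum_distrib_right add: sum.If_cases of_bool_def Int_def)
  moreover have "(\<Sum>M\<in>\<M>. card {h \<in> epis (mcok (p ^ k) M) ?G. inj_on h (carrier (mcok (p ^ k) M))}) =
     (\<Sum>M\<in>\<M>. card {F \<in> tuples. generating ds r F \<and>
        ((\<forall>j<r. \<forall>l<length ds. int (ds ! l) dvd (\<Sum>i<r. M $$ (i, j) * F i l)) \<and>
        (\<forall>v\<in>carrier_vec r. lincomb ds r F v = cyc_one ds \<longrightarrow> v \<in> latt (p ^ k) M))})"
    by (rule sum.cong[OF refl]) (rule card_inj_epis_mcok[OF ds MD(1) ds_dvd])
  moreover have "\<dots> = card gens * card {N \<in> \<M>. kills N \<and> full N}" by (rule double_count) (simp only: kills_conj_iff full_conj_iff)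
  ultimately show ?thesis by simp
qed

end

text \<open>The order of GL_r over the field with p elements.\<close>

definition gl_count :: "nat \<Rightarrow> nat \<Rightarrow> nat" where
  "gl_count p r = card {x \<in> {..<r} \<times> {..<r} \<rightarrow>\<^sub>E {0..<int p}. coprime (det (mat r r x)) (int p)}"

lemma gl_count_pos:
  assumes "p > 1"
  shows "gl_count p r > 0"
proof -
  let ?S = "{x \<in> {..<r} \<times> {..<r} \<rightarrow>\<^sub>E {0..<int p}. coprime (det (mat r r x)) (int p)}"
  let ?x = "\<lambda>ij\<in>{..<r} \<times> {..<r}. of_bool (fst ij = snd ij) :: int"
  have "mat r r ?x = 1\<^sub>m r" by (intro eq_matI) auto
  then have "coprime (det (mat r r ?x)) (int p)" by simp
  moreover have "?x \<in> {..<r} \<times> {..<r} \<rightarrow>\<^sub>E {0..<int p}" using assms by (intro restrict_PiE_iff[THEN iffD2] ballI) auto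
  ultimately have "?x \<in> ?S" by simp
  moreover have "finite ?S" by (rule finite_subset[of _ "{..<r} \<times> {..<r} \<rightarrow>\<^sub>E {0..<int p}"]) (auto intro!: finite_PiE)
  ultimately show ?thesis unfolding gl_count_def by (intro card_gt_0_iff[THEN iffD2]) blast
qed

lemma prod_upper_pairs:
  "(\<Prod>ij\<in>upper_pairs (length ds). f ij) = (\<Prod>i<length ds. f (i, i)) * (\<Prod>ij\<in>alt_pairs ds. f ij)" for f :: "_ \<Rightarrow> nat"
proof -
  have "upper_pairs (length ds) = (\<lambda>i. (i, i)) ` {..<length ds} \<union> alt_pairs ds" by (auto simp: upper_pairs_def alt_pairs_def)
  moreover have "(\<lambda>i. (i, i)) ` {..<length ds} \<inter> alt_pairs ds = {}" by (auto simp: alt_pairs_def)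
  ultimately have "(\<Prod>ij\<in>upper_pairs (length ds). f ij) = (\<Prod>ij\<in>(\<lambda>i. (i, i)) ` {..<length ds}. f ij) * (\<Prod>ij\<in>alt_pairs ds. f ij)"
    by (simp add: prod.union_disjoint finite_alt_pairs)
  then show ?thesis by (simp add: prod.reindex inj_on_def)
qed

lemma gcd_pow: "gcd ((p::nat) ^ a) (p ^ b) = p ^ min a b" by (cases "a \<le> b") (auto simp: gcd_nat.absorb1 gcd_nat.absorb2 le_imp_power_dvd min_def)

lemma alt_count_pow:
  "alt_count (pows p es) = (\<Prod>(i, j)\<in>alt_pairs (pows p es). p ^ min (es ! i) (es ! j))"
  unfolding alt_count_def by (intro prod.cong refl) (auto simp: alt_pairs_def gcd_pow)

text \<open>Splits the square grid into the diagonal, the part above it, and the reflected part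
  below it.\<close>

lemma prod_square:
  fixes f :: "nat \<Rightarrow> nat"
  shows "(\<Prod>l<length ds. f l) ^ length ds = (\<Prod>i<length ds. f i) * (\<Prod>(i, j)\<in>alt_pairs ds. f i * f j)"
proof -
  let ?r = "length ds"
  let ?L = "(\<lambda>(i, j). (j, i)) ` alt_pairs ds"
  have "(\<Prod>l<?r. f l) ^ ?r = (\<Prod>i<?r. \<Prod>l<?r. f l)" by simp
  also have "\<dots> = (\<Prod>(i, l)\<in>{..<?r} \<times> {..<?r}. f l)" by (rule prod.cartesian_product)
  also have "{..<?r} \<times> {..<?r} = upper_pairs ?r \<union> ?L" by (auto simp: upper_pairs_def alt_pairs_def image_iff not_le)
  also have "(\<Prod>(i, l)\<in>upper_pairs ?r \<union> ?L. f l) = (\<Prod>(i, l)\<in>upper_pairs ?r. f l) * (\<Prod>(i, l)\<in>?L. f l)"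
    by (rule prod.union_disjoint) (simp add: finite_upper_pairs, simp add: finite_alt_pairs, auto simp: upper_pairs_def alt_pairs_def)
  also have "(\<Prod>(i, l)\<in>?L. f l) = (\<Prod>(i, j)\<in>alt_pairs ds. f i)" by (subst prod.reindex) (auto simp: inj_on_def intro!: prod.cong)
  also have "(\<Prod>(i, l)\<in>upper_pairs ?r. f l) = (\<Prod>i<?r. f i) * (\<Prod>(i, j)\<in>alt_pairs ds. f j)" by (simp add: prod_upper_pairs)
  finally have "(\<Prod>l<?r. f l) ^ ?r = (\<Prod>i<?r. f i) * (\<Prod>(i, j)\<in>alt_pairs ds. f j) * (\<Prod>(i, j)\<in>alt_pairs ds. f i)" .
  moreover have "(\<Prod>(i, j)\<in>alt_pairs ds. f i * f j) = (\<Prod>(i, j)\<in>alt_pairs ds. f i) * (\<Prod>(i, j)\<in>alt_pairs ds. f j)"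
    by (simp add: prod.distrib case_prod_unfold)
  ultimately show ?thesis by (simp only: mult_ac)
qed

context sym_model_type
begin

text \<open>Entry \<open>(i, l)\<close> ranges modulo \<open>p ^ (es ! l)\<close> and invertibility
  is a condition modulo \<open>p\<close>; the factor \<open>p ^ (r * r)\<close> clears the
  denominators.\<close>

lemma card_gens: "card gens * p ^ (r * r) = (\<Prod>l<r. p ^ (es ! l)) ^ r * gl_count p r"
proof -
  let ?I = "{..<r} \<times> {..<r}"
  let ?S = "{x \<in> (\<Pi>\<^sub>E il\<in>?I. {0..<int (p * p ^ (es ! snd il - 1))}). coprime (det (mat r r x)) (int p)}"
  have pe: "p * p ^ (es ! l - 1) = p ^ (es ! l)" if "l < r" for l using e_bounds(1)[OF that] by (cases "es ! l") auto
  have tup: "F \<in> tuples \<longleftrightarrow> F \<in> {..<r} \<rightarrow>\<^sub>E (\<Pi>\<^sub>E l\<in>{..<r}. {0..<int (p ^ (es ! l))})" for F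
    by (simp add: cyc_prod_carrier[OF ds] PiE_iff)
  have "bij_betw (\<lambda>x. \<lambda>i\<in>{..<r}. \<lambda>l\<in>{..<r}. x (i, l)) ?S gens"
  proof (rule bij_betw_byWitness[where f' = "\<lambda>F. \<lambda>il\<in>?I. F (fst il) (snd il)"])
    show "\<forall>x\<in>?S. (\<lambda>F. \<lambda>il\<in>?I. F (fst il) (snd il)) ((\<lambda>x. \<lambda>i\<in>{..<r}. \<lambda>l\<in>{..<r}. x (i, l)) x) = x"
    proof
      fix x assume "x \<in> ?S"
      then have "x \<in> extensional ?I" by (simp add: PiE_def)
      then show "(\<lambda>F. \<lambda>il\<in>?I. F (fst il) (snd il)) ((\<lambda>x. \<lambda>i\<in>{..<r}. \<lambda>l\<in>{..<r}. x (i, l)) x) = x"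
        by (intro extensionalityI[of _ ?I]) auto
    qed
    show "\<forall>F\<in>gens. (\<lambda>x. \<lambda>i\<in>{..<r}. \<lambda>l\<in>{..<r}. x (i, l)) ((\<lambda>F. \<lambda>il\<in>?I. F (fst il) (snd il)) F) = F"
    proof
      fix F assume "F \<in> gens"
      then have F: "F \<in> {..<r} \<rightarrow>\<^sub>E (\<Pi>\<^sub>E l\<in>{..<r}. {0..<int (p ^ (es ! l))})" using tup by (simp add: gens_def)
      have Fi: "F i \<in> extensional {..<r}" if "i < r" for i using F that by (auto simp: PiE_iff)
      show "(\<lambda>x. \<lambda>i\<in>{..<r}. \<lambda>l\<in>{..<r}. x (i, l)) ((\<lambda>F. \<lambda>il\<in>?I. F (fst il) (snd il)) F) = F"
      proof (rule extensionalityI[of _ "{..<r}"])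
        show "F \<in> extensional {..<r}" using F by (simp add: PiE_def)
        fix i assume "i \<in> {..<r}"
        then show "(\<lambda>i\<in>{..<r}. \<lambda>l\<in>{..<r}. (\<lambda>il\<in>?I. F (fst il) (snd il)) (i, l)) i = F i"
          using Fi[of i] by (intro extensionalityI[of _ "{..<r}"]) auto
      qed simp
    qed
    show "(\<lambda>x. \<lambda>i\<in>{..<r}. \<lambda>l\<in>{..<r}. x (i, l)) ` ?S \<subseteq> gens"
    proof (rule image_subsetI)
      fix x assume x: "x \<in> ?S"
      then have xP: "x \<in> (\<Pi>\<^sub>E il\<in>?I. {0..<int (p * p ^ (es ! snd il - 1))})" by simp
      let ?F = "\<lambda>i\<in>{..<r}. \<lambda>l\<in>{..<r}. x (i, l)"
      have cmx: "cm ?F = mat r r x" by (intro eq_matI) auto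
      have "x (i, l) \<in> {0..<int (p ^ (es ! l))}" if "i < r" "l < r" for i l using PiE_mem[OF xP, of "(i, l)"] that unfolding pe[OF that(2), symmetric] by simp
      then have "?F \<in> tuples" unfolding tup by (intro restrict_PiE_iff[THEN iffD2] ballI) auto
      moreover have "coprime (det (cm ?F)) (int p)" unfolding cmx using x by simp
      ultimately show "?F \<in> gens" unfolding gens_def by (intro CollectI conjI)
    qed
    show "(\<lambda>F. \<lambda>il\<in>?I. F (fst il) (snd il)) ` gens \<subseteq> ?S"
    proof (rule image_subsetI)
      fix F assume "F \<in> gens"
      then have F: "F \<in> {..<r} \<rightarrow>\<^sub>E (\<Pi>\<^sub>E l\<in>{..<r}. {0..<int (p ^ (es ! l))})" "coprime (det (cm F)) (int p)"
        using tup by (simp_all add: gens_def)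
      let ?x = "\<lambda>il\<in>?I. F (fst il) (snd il)"
      have xm: "mat r r ?x = cm F" by (intro eq_matI) auto
      have "F i l \<in> {0..<int (p * p ^ (es ! l - 1))}" if "i < r" "l < r" for i l unfolding pe[OF that(2)] using PiE_mem[OF PiE_mem[OF F(1), of i], of l] that by simp
      then have "?x \<in> (\<Pi>\<^sub>E il\<in>?I. {0..<int (p * p ^ (es ! snd il - 1))})" by (intro restrict_PiE_iff[THEN iffD2] ballI) auto
      moreover have "coprime (det (mat r r ?x)) (int p)" unfolding xm by (rule F(2))
      ultimately show "?x \<in> ?S" by (intro CollectI conjI)
    qed
  qed
  then have "card gens = card ?S" by (simp add: bij_betw_same_card)
  also have "\<dots> = (\<Prod>il\<in>?I. p ^ (es ! snd il - 1)) * gl_count p r" unfolding gl_count_def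
  proof (rule card_PiE_mod)
    fix x y :: "nat \<times> nat \<Rightarrow> int" assume xy: "\<And>i. i \<in> ?I \<Longrightarrow> int p dvd x i - y i"
    show "coprime (det (mat r r x)) (int p) = coprime (det (mat r r y)) (int p)" by (rule coprime_det_cong) (auto simp: xy)
  qed (use p1 in auto)
  also have "(\<Prod>il\<in>?I. p ^ (es ! snd il - 1)) = (\<Prod>l<r. p ^ (es ! l - 1)) ^ r"
    using prod.cartesian_product[of "\<lambda>i l. p ^ (es ! l - 1)" "{..<r}" "{..<r}"] by (simp add: case_prod_unfold)
  finally have "card gens * p ^ (r * r) = ((\<Prod>l<r. p) * (\<Prod>l<r. p ^ (es ! l - 1))) ^ r * gl_count p r" by (simp add: power_mult power_mult_distrib mult_ac)
  also have "(\<Prod>l<r. p) * (\<Prod>l<r. p ^ (es ! l - 1)) = (\<Prod>l<r. p ^ (es ! l))"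
    unfolding prod.distrib[symmetric] by (intro prod.cong refl) (simp only: pe lessThan_iff)
  finally show ?thesis .
qed

text \<open>Depends on \<open>es\<close> only through its length, so it can serve as the constant
  \<open>C\<close> of \<open>prob_limit_of_model\<close> for all groups of one rank.\<close>

definition "model_weight = real (gl_count p r) * real p ^ (k * card (upper_pairs r)) / real p ^ (r * r)"

lemma model_weight_pos: "model_weight > 0" using gl_count_pos[OF p1] p1 by (simp add: model_weight_def)

text \<open>For each pair the two prime powers have the product p^max * p^min. The minima make up
  \<open>alt_count\<close>, while the maxima, together with the diagonal, complete
  \<open>p ^ (k - mx ij)\<close> to \<open>p ^ k\<close>.\<close>

lemma model_total: "real (card gens * (\<Prod>ij\<in>upper_pairs r. p ^ (k - mx ij))) = model_weight * real (alt_count ds)"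
proof -
  let ?A = "alt_pairs ds"
  have "(\<Prod>l<r. p ^ (es ! l)) ^ r = (\<Prod>i<r. p ^ (es ! i)) * (\<Prod>(i, j)\<in>?A. p ^ (es ! i) * p ^ (es ! j))"
    using prod_square[of "\<lambda>l. p ^ (es ! l)" ds] by simp
  also have "(\<Prod>(i, j)\<in>?A. p ^ (es ! i) * p ^ (es ! j)) = (\<Prod>(i, j)\<in>?A. p ^ max (es ! i) (es ! j) * p ^ min (es ! i) (es ! j))"
    by (intro prod.cong refl) (auto simp: max_def min_def)
  also have "\<dots> = (\<Prod>ij\<in>?A. p ^ mx ij) * alt_count ds" unfolding alt_count_pow by (simp add: prod.distrib case_prod_unfold mx_def)
  also have "(\<Prod>i<r. p ^ (es ! i)) * ((\<Prod>ij\<in>?A. p ^ mx ij) * alt_count ds) = (\<Prod>ij\<in>upper_pairs r. p ^ mx ij) * alt_count ds"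
    using prod_upper_pairs[of "\<lambda>ij. p ^ mx ij" ds] by (simp add: mx_def)
  finally have sq: "(\<Prod>l<r. p ^ (es ! l)) ^ r = (\<Prod>ij\<in>upper_pairs r. p ^ mx ij) * alt_count ds" .
  have pk: "(\<Prod>ij\<in>upper_pairs r. p ^ (k - mx ij)) * (\<Prod>ij\<in>upper_pairs r. p ^ mx ij) = p ^ (k * card (upper_pairs r))"
  proof -
    have "(\<Prod>ij\<in>upper_pairs r. p ^ (k - mx ij)) * (\<Prod>ij\<in>upper_pairs r. p ^ mx ij) = (\<Prod>ij\<in>upper_pairs r. p ^ k)"
      unfolding prod.distrib[symmetric] using mx_le by (intro prod.cong refl) (simp flip: power_add)
    then show ?thesis by (simp add: power_mult)
  qed
  have "card gens * (\<Prod>ij\<in>upper_pairs r. p ^ (k - mx ij)) * p ^ (r * r)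
     = (\<Prod>ij\<in>upper_pairs r. p ^ (k - mx ij)) * (card gens * p ^ (r * r))" by (simp only: mult_ac)
  also have "\<dots> = (\<Prod>ij\<in>upper_pairs r. p ^ (k - mx ij)) * (\<Prod>ij\<in>upper_pairs r. p ^ mx ij) * (gl_count p r * alt_count ds)"
    unfolding card_gens sq by (simp only: mult_ac)
  also have "\<dots> = gl_count p r * p ^ (k * card (upper_pairs r)) * alt_count ds" unfolding pk by (simp only: mult_ac)
  finally have "real (card gens * (\<Prod>ij\<in>upper_pairs r. p ^ (k - mx ij))) * real p ^ (r * r)
     = real (gl_count p r) * real p ^ (k * card (upper_pairs r)) * real (alt_count ds)" by (simp only: flip: of_nat_mult of_nat_power)
  then show ?thesis using p1 by (simp add: model_weight_def field_simps)
qed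

lemma model_iso_count:
  assumes es': "\<And>i. i < r \<Longrightarrow> es ! i < k"
  shows "real (card {M \<in> \<M>. mcok (p ^ k) M \<cong> pgrp p es}) * real (card (auto (pgrp p es))) * real p ^ card (upper_pairs r)
    = model_weight * real (alt_count ds) * real (theta p es)"
proof -
  have "card {M \<in> \<M>. mcok (p ^ k) M \<cong> pgrp p es} * card (auto (pgrp p es)) * p ^ card (upper_pairs r)
     = card gens * (\<Prod>ij\<in>upper_pairs r. p ^ (k - mx ij)) * theta p es" unfolding sum_card_iso mult.assoc by (rule arg_cong[OF card_full]) (rule es')
  then have "real (card {M \<in> \<M>. mcok (p ^ k) M \<cong> pgrp p es}) * real (card (auto (pgrp p es))) * real p ^ card (upper_pairs r)
     = real (card gens * (\<Prod>ij\<in>upper_pairs r. p ^ (k - mx ij))) * real (theta p es)" by (simp only: flip: of_nat_mult of_nat_power)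
  then show ?thesis unfolding model_total .
qed

end

section \<open>Symmetric perfect pairings\<close>

lemma complex_units_group: "comm_group complex_units"
proof (rule comm_groupI)
  fix x assume "x \<in> carrier complex_units"
  then show "\<exists>y\<in>carrier complex_units. y \<otimes>\<^bsub>complex_units\<^esub> x = \<one>\<^bsub>complex_units\<^esub>"
    by (intro bexI[of _ "inverse x"]) (auto simp: complex_units_def)
qed (auto simp: complex_units_def)

lemma complex_units_simps:
  "carrier complex_units = UNIV - {0}" "x \<otimes>\<^bsub>complex_units\<^esub> y = x * y" "\<one>\<^bsub>complex_units\<^esub> = 1" by (simp_all add: complex_units_def)

lemma carrier_dual_group: "carrier (dual_group G) = homs G complex_units" by (auto simp: dual_group_def homs_def)

lemma root_of_unity_cis:
  assumes "n > 0" "z ^ n = (1::complex)"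
  shows "\<exists>a\<in>{0..<int n}. z = cis (2 * pi * (of_int a / of_nat n))"
proof -
  have "z \<in> (\<lambda>k. cis (2 * pi * real k / real n)) ` {..<n}" using Complex.bij_betw_roots_unity[OF assms(1)] assms(2) by (simp add: bij_betw_def)
  then obtain j where "j < n" "z = cis (2 * pi * real j / real n)" by auto
  then show ?thesis by (intro bexI[of _ "int j"]) auto
qed

lemma hom_power_root:
  assumes G: "group G" and h: "h \<in> hom G complex_units" and x: "x \<in> carrier G" "x [^]\<^bsub>G\<^esub> (n::nat) = \<one>\<^bsub>G\<^esub>"
  shows "h x ^ n = 1"
proof -
  interpret h: group_hom G complex_units h using G h comm_group.axioms(2)[OF complex_units_group] by (intro group_hom.intro group_hom_axioms.intro)
  have pw: "z [^]\<^bsub>complex_units\<^esub> n = z ^ n" for z :: complex by (induction n) (simp_all add: complex_units_simps nat_pow_def complex_units_def)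
  have "h (x [^]\<^bsub>G\<^esub> n) = h x [^]\<^bsub>complex_units\<^esub> n" using x(1) by (rule h.hom_nat_pow)
  then show ?thesis using x(2) h.hom_one pw by (simp add: complex_units_simps)
qed

lemma chi_hom:
  assumes ds: "pos_list ds"
  shows "(\<lambda>x. chi ds x a) \<in> hom (cyc_prod ds) complex_units"
proof (rule homI)
  fix x y
  show "chi ds x a \<in> carrier complex_units"
  proof -
    have "norm (chi ds x a) = 1" by simp
    then have "chi ds x a \<noteq> 0" by (metis norm_zero zero_neq_one)
    then show ?thesis by (simp add: complex_units_simps)
  qed
  have "x \<otimes>\<^bsub>cyc_prod ds\<^esub> y = reduce ds (\<lambda>l. x l + y l)" by (simp add: cyc_prod_mult reduce_def)
  then show "chi ds (x \<otimes>\<^bsub>cyc_prod ds\<^esub> y) a = chi ds x a \<otimes>\<^bsub>complex_units\<^esub> chi ds y a"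
    using ds by (simp add: chi_reduce chi_add complex_units_simps)
qed

lemma chi_unit_tuple:
  assumes ds: "pos_list ds" and i: "i < length ds"
  shows "chi ds (unit_tuple ds i) a = cis (2 * pi * (of_int (a i) / of_nat (ds ! i)))"
  unfolding unit_tuple_def chi_reduce[OF ds] using chi_single[OF i, of a] chi_sym[of ds] by metis

lemma cis_frac_eq_iff:
  assumes "d > (0::nat)"
  shows "cis (2 * pi * (of_int a / of_nat d)) = cis (2 * pi * (of_int b / of_nat d)) \<longleftrightarrow> int d dvd a - b"
proof -
  have "cis (2 * pi * (of_int (a - b) / of_nat d)) = cis (2 * pi * (of_int a / of_nat d)) / cis (2 * pi * (of_int b / of_nat d))"
    by (simp add: cis_divide diff_divide_distrib right_diff_distrib)
  then show ?thesis unfolding cis_frac_eq_1_iff[OF assms, symmetric] by simp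
qed

text \<open>A character is determined by its values on the unit tuples, which are roots of unity of
  order dividing the moduli, and \<open>chi\<close> realises all of these.\<close>

lemma bij_chi_dual:
  assumes ds: "pos_list ds"
  shows "bij_betw (\<lambda>a. \<lambda>x\<in>cyc ds. chi ds x a) (cyc ds) (homs (cyc_prod ds) complex_units)" unfolding bij_betw_def
proof
  let ?G = "cyc_prod ds"
  interpret G: comm_group ?G by (rule cyc_prod_group)
  have pos: "ds ! i > 0" if "i < length ds" for i using ds that by (simp add: pos_list_def)
  show "inj_on (\<lambda>a. \<lambda>x\<in>carrier ?G. chi ds x a) (carrier ?G)"
  proof (rule inj_onI)
    fix a b assume ab: "a \<in> carrier ?G" "b \<in> carrier ?G" "(\<lambda>x\<in>carrier ?G. chi ds x a) = (\<lambda>x\<in>carrier ?G. chi ds x b)"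
    show "a = b"
    proof (rule cyc_prod_eqI[OF ds ab(1,2)])
      fix l assume l: "l < length ds"
      have "chi ds (unit_tuple ds l) a = chi ds (unit_tuple ds l) b" using fun_cong[OF ab(3), of "unit_tuple ds l"] unit_tuple_carrier[OF ds] by simp
      then show "int (ds ! l) dvd a l - b l" using cis_frac_eq_iff[OF pos[OF l]] by (simp only: chi_unit_tuple[OF ds l])
    qed
  qed
  show "(\<lambda>a. \<lambda>x\<in>carrier ?G. chi ds x a) ` carrier ?G = homs ?G complex_units"
  proof
    show "(\<lambda>a. \<lambda>x\<in>carrier ?G. chi ds x a) ` carrier ?G \<subseteq> homs ?G complex_units"
    proof (rule image_subsetI)
      fix a
      have "(\<lambda>x\<in>carrier ?G. chi ds x a) \<in> hom ?G complex_units" using chi_hom[OF ds, of a] by (auto simp: hom_def)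
      then show "(\<lambda>x\<in>carrier ?G. chi ds x a) \<in> homs ?G complex_units" by (simp add: homs_def)
    qed
    show "homs ?G complex_units \<subseteq> (\<lambda>a. \<lambda>x\<in>carrier ?G. chi ds x a) ` carrier ?G"
    proof
      fix h assume "h \<in> homs ?G complex_units"
      then have h: "h \<in> hom ?G complex_units" "h \<in> extensional (carrier ?G)" by (auto simp: homs_def)
      have "\<exists>a\<in>{0..<int (ds ! i)}. h (unit_tuple ds i) = cis (2 * pi * (of_int a / of_nat (ds ! i)))" if i: "i < length ds" for i
        by (rule root_of_unity_cis[OF pos[OF i]], rule hom_power_root[OF _ h(1) unit_tuple_carrier[OF ds] unit_tuple_pow[OF ds i]]) unfold_locales
      then obtain a where a: "\<And>i. i < length ds \<Longrightarrow> a i \<in> {0..<int (ds ! i)}"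
        "\<And>i. i < length ds \<Longrightarrow> h (unit_tuple ds i) = cis (2 * pi * (of_int (a i) / of_nat (ds ! i)))" by metis
      let ?a = "reduce ds a"
      have "h x = chi ds x ?a" if "x \<in> carrier ?G" for x
      proof (rule cyc_prod_hom_eqI[OF ds comm_group.axioms(2)[OF complex_units_group] h(1) chi_hom[OF ds] _ that])
        fix i assume i: "i < length ds"
        show "h (unit_tuple ds i) = chi ds (unit_tuple ds i) ?a" unfolding chi_reduce_right[OF ds] chi_unit_tuple[OF ds i] by (rule a(2)[OF i])
      qed
      then have "h = (\<lambda>x\<in>carrier ?G. chi ds x ?a)" using h(2) by (intro extensionalityI[of _ "carrier ?G"]) auto
      then show "h \<in> (\<lambda>a. \<lambda>x\<in>carrier ?G. chi ds x a) ` carrier ?G" using reduce_carrier[OF ds] by blast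
    qed
  qed
qed

lemma pairing_hom_dual:
  assumes H: "group H" and b: "bilinear_pairing H \<phi>"
  shows "(\<lambda>y. \<lambda>x\<in>carrier H. \<phi> (x, y)) \<in> hom H (dual_group H)"
proof (rule homI)
  interpret H: group H by fact
  fix y assume y: "y \<in> carrier H"
  have "(\<lambda>x. \<phi> (x, y)) \<in> hom H complex_units" using b y by (simp add: bilinear_pairing_def)
  then have "(\<lambda>x\<in>carrier H. \<phi> (x, y)) \<in> hom H complex_units" by (auto simp: hom_def)
  then show "(\<lambda>x\<in>carrier H. \<phi> (x, y)) \<in> carrier (dual_group H)" by (simp add: carrier_dual_group homs_def)
  fix z assume z: "z \<in> carrier H"
  have "\<phi> (x, y \<otimes>\<^bsub>H\<^esub> z) = \<phi> (x, y) * \<phi> (x, z)" if "x \<in> carrier H" for x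
  proof -
    have "(\<lambda>y. \<phi> (x, y)) \<in> hom H complex_units" using b that by (simp add: bilinear_pairing_def)
    from hom_mult[OF this y z] show ?thesis by (simp add: complex_units_simps)
  qed
  then show "(\<lambda>x\<in>carrier H. \<phi> (x, y \<otimes>\<^bsub>H\<^esub> z)) = (\<lambda>x\<in>carrier H. \<phi> (x, y)) \<otimes>\<^bsub>dual_group H\<^esub> (\<lambda>x\<in>carrier H. \<phi> (x, z))"
    by (auto simp: dual_group_def)
qed

text \<open>Bilinearity supplies the homomorphism property and symmetry identifies the two adjoint
  maps, leaving one bijection to test.\<close>

lemma perfect_pairing_iff:
  assumes H: "group H" and b: "bilinear_pairing H \<phi>" and s: "symmetric_pairing H \<phi>"
  shows "perfect_pairing H \<phi> \<longleftrightarrow> bij_betw (\<lambda>y. \<lambda>x\<in>carrier H. \<phi> (x, y)) (carrier H) (homs H complex_units)"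
proof -
  interpret H: group H by fact
  let ?f = "\<lambda>y. \<lambda>x\<in>carrier H. \<phi> (x, y)" and ?g = "\<lambda>x. \<lambda>y\<in>carrier H. \<phi> (x, y)"
  have eq: "?g x = ?f x" if "x \<in> carrier H" for x using s that by (intro restrict_ext) (simp add: symmetric_pairing_def)
  have f: "?f \<in> hom H (dual_group H)" by (rule pairing_hom_dual[OF H b])
  have g: "?g \<in> hom H (dual_group H)"
  proof (rule homI)
    fix x assume x: "x \<in> carrier H"
    show "?g x \<in> carrier (dual_group H)" unfolding eq[OF x] using f x by (rule hom_in_carrier)
    fix y assume y: "y \<in> carrier H"
    show "?g (x \<otimes>\<^bsub>H\<^esub> y) = ?g x \<otimes>\<^bsub>dual_group H\<^esub> ?g y"
      unfolding eq[OF x] eq[OF y] eq[OF H.m_closed[OF x y]] by (rule hom_mult[OF f x y])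
  qed
  have "bij_betw ?g (carrier H) (homs H complex_units) \<longleftrightarrow> bij_betw ?f (carrier H) (homs H complex_units)" by (rule bij_betw_cong) (rule eq)
  then show ?thesis using f g unfolding perfect_pairing_def iso_def carrier_dual_group by simp
qed

context sym_model_type
begin

text \<open>The adjoint map of the pairing with Gram entries
  \<open>v (upair i j) / p ^ min (es ! i) (es ! j)\<close>. The power of \<open>p\<close> adapts
  these to the denominator \<open>p ^ (es ! i)\<close> that \<open>chi\<close> uses in coordinate
  \<open>i\<close>.\<close>

definition vpair :: "(nat \<times> nat \<Rightarrow> int) \<Rightarrow> (nat \<Rightarrow> int) \<Rightarrow> (nat \<Rightarrow> int)" where
  "vpair v y = (\<lambda>i. \<Sum>j<r. int (p ^ (es ! i - min (es ! i) (es ! j))) * v (upair i j) * y j)"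

lemma chi_vpair: "chi ds x (vpair v y) = cis (2 * pi * (\<Sum>i<r. \<Sum>j<r. of_int (x i * v (upair i j) * y j) / real p ^ min (es ! i) (es ! j)))"
proof -
  have "(\<Sum>l<length ds. of_int (x l * vpair v y l) / of_nat (ds ! l)) = (\<Sum>i<r. \<Sum>j<r. of_int (x i * v (upair i j) * y j) / real p ^ min (es ! i) (es ! j))"
    unfolding length_map
  proof (rule sum.cong[OF refl])
    fix i assume "i \<in> {..<r}"
    then have i: "i < r" by simp
    have "of_int (x i * vpair v y i) / of_nat (ds ! i) = (\<Sum>j<r. of_int (x i * (int (p ^ (es ! i - min (es ! i) (es ! j))) * v (upair i j) * y j)) / real p ^ (es ! i))"
      using i by (simp add: vpair_def sum_distrib_left sum_divide_distrib)
    also have "\<dots> = (\<Sum>j<r. of_int (x i * v (upair i j) * y j) / real p ^ min (es ! i) (es ! j))"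
    proof (rule sum.cong[OF refl])
      fix j
      have "real p ^ (es ! i) = real p ^ (es ! i - min (es ! i) (es ! j)) * real p ^ min (es ! i) (es ! j)" by (simp flip: power_add)
      then show "of_int (x i * (int (p ^ (es ! i - min (es ! i) (es ! j))) * v (upair i j) * y j)) / real p ^ (es ! i)
          = of_int (x i * v (upair i j) * y j) / real p ^ min (es ! i) (es ! j)" using p1 by simp
    qed
    finally show "of_int (x i * vpair v y i) / of_nat (ds ! i) = (\<Sum>j<r. of_int (x i * v (upair i j) * y j) / real p ^ min (es ! i) (es ! j))" .
  qed
  then show ?thesis unfolding chi_def by simp
qed

lemma chi_vpair_sym: "chi ds x (vpair v y) = chi ds y (vpair v x)"
proof -
  have "(\<Sum>i<r. \<Sum>j<r. of_int (x i * v (upair i j) * y j) / real p ^ min (es ! i) (es ! j))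
     = (\<Sum>i<r. \<Sum>j<r. of_int (y i * v (upair i j) * x j) / real p ^ min (es ! i) (es ! j))" by (subst sum.swap) (simp add: upair_commute min.commute mult_ac)
  then show ?thesis unfolding chi_vpair by simp
qed

definition "pairing_of v = (\<lambda>(x, y)\<in>cyc ds \<times> cyc ds. chi ds x (vpair v y))"

lemma pairing_of_apply: "x \<in> cyc ds \<Longrightarrow> y \<in> cyc ds \<Longrightarrow> pairing_of v (x, y) = chi ds x (vpair v y)" by (simp add: pairing_of_def)

lemma pairing_of_sym: "symmetric_pairing (cyc_prod ds) (pairing_of v)" unfolding symmetric_pairing_def using chi_vpair_sym by (simp add: pairing_of_apply)

lemma pairing_of_bilinear: "bilinear_pairing (cyc_prod ds) (pairing_of v)"
proof -
  let ?G = "cyc_prod ds"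
  interpret G: comm_group ?G by (rule cyc_prod_group)
  have 1: "(\<lambda>x. pairing_of v (x, y)) \<in> hom ?G complex_units" if y: "y \<in> carrier ?G" for y
  proof (rule homI)
    fix x x' assume x: "x \<in> carrier ?G"
    show "pairing_of v (x, y) \<in> carrier complex_units" unfolding pairing_of_apply[OF x y] using chi_hom[OF ds] x by (rule hom_in_carrier)
    assume x': "x' \<in> carrier ?G"
    show "pairing_of v (x \<otimes>\<^bsub>?G\<^esub> x', y) = pairing_of v (x, y) \<otimes>\<^bsub>complex_units\<^esub> pairing_of v (x', y)"
      unfolding pairing_of_apply[OF x y] pairing_of_apply[OF x' y] pairing_of_apply[OF G.m_closed[OF x x'] y] by (rule hom_mult[OF chi_hom[OF ds] x x'])
  qed
  have 2: "(\<lambda>y. pairing_of v (x, y)) \<in> hom ?G complex_units" if x: "x \<in> carrier ?G" for x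
  proof (rule homI)
    have e: "pairing_of v (x, y) = pairing_of v (y, x)" if "y \<in> carrier ?G" for y using pairing_of_sym that x by (simp add: symmetric_pairing_def)
    fix y y' assume y: "y \<in> carrier ?G"
    show "pairing_of v (x, y) \<in> carrier complex_units" unfolding e[OF y] by (rule hom_in_carrier[OF 1[OF x] y])
    assume y': "y' \<in> carrier ?G"
    show "pairing_of v (x, y \<otimes>\<^bsub>?G\<^esub> y') = pairing_of v (x, y) \<otimes>\<^bsub>complex_units\<^esub> pairing_of v (x, y')"
      unfolding e[OF y] e[OF y'] e[OF G.m_closed[OF y y']] by (rule hom_mult[OF 1[OF x] y y'])
  qed
  show ?thesis unfolding bilinear_pairing_def using 1 2 by blast
qed

text \<open>Through \<open>chi\<close> the adjoint map becomes the endomorphism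
  \<open>lincomb ds r F\<close>, where \<open>F\<close> lists the images of the unit tuples. By
  finiteness it is bijective iff \<open>F\<close> generates, iff the coordinate matrix is invertible
  modulo \<open>p\<close>; and this matrix agrees with \<open>umat p es v\<close> modulo
  \<open>p\<close>.\<close>

lemma pairing_of_perfect_iff:
  "perfect_pairing (cyc_prod ds) (pairing_of v) \<longleftrightarrow> coprime (det (umat p es v)) (int p)"
proof -
  let ?G = "cyc_prod ds" let ?C = "carrier ?G"
  have pg: "group ?G" using cyc_prod_group comm_group.axioms(2) by blast
  define F where "F = (\<lambda>j\<in>{..<r}. reduce ds (\<lambda>i. int (p ^ (es ! i - min (es ! i) (es ! j))) * v (upair i j)))"
  have F: "F \<in> tuples" unfolding F_def by (intro restrict_PiE_iff[THEN iffD2] ballI reduce_carrier ds)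
  have Fj: "int (p ^ (es ! l)) dvd F j l - int (p ^ (es ! l - min (es ! l) (es ! j))) * v (upair l j)" if "j < r" "l < r" for j l
    using that by (subst mod_eq_dvd_iff[symmetric]) (simp add: F_def reduce_def)
  have lin: "reduce ds (vpair v y) = lincomb ds r F (vec r y)" for y unfolding lincomb_def
  proof (rule reduce_cong)
    fix l assume "l < length ds"
    then have l: "l < r" by simp
    have "vpair v y l - (\<Sum>j<r. vec r y $ j * F j l) = - (\<Sum>j<r. y j * (F j l - int (p ^ (es ! l - min (es ! l) (es ! j))) * v (upair l j)))"
      unfolding vpair_def sum_subtractf[symmetric] sum_negf[symmetric] by (intro sum.cong refl) (simp add: algebra_simps)
    moreover have "int (ds ! l) dvd \<dots>" using l Fj by (subst dvd_minus_iff) (intro dvd_sum dvd_mult, simp)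
    ultimately show "int (ds ! l) dvd vpair v y l - (\<Sum>j<r. vec r y $ j * F j l)" by (simp only:)
  qed
  have chi_eq: "(\<lambda>x\<in>?C. pairing_of v (x, y)) = (\<lambda>a. \<lambda>x\<in>?C. chi ds x a) (lincomb ds r F (vec r y))" if y: "y \<in> ?C" for y
    unfolding lin[symmetric] using pairing_of_apply[OF _ y] by (intro restrict_ext) (simp add: chi_reduce_right[OF ds])
  have lc: "lincomb ds r F w \<in> ?C" for w unfolding lincomb_def by (rule reduce_carrier[OF ds])
  have "perfect_pairing ?G (pairing_of v) \<longleftrightarrow> bij_betw (\<lambda>y. \<lambda>x\<in>?C. pairing_of v (x, y)) ?C (homs ?G complex_units)"
    by (rule perfect_pairing_iff[OF pg pairing_of_bilinear pairing_of_sym])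
  also have "\<dots> \<longleftrightarrow> bij_betw ((\<lambda>a. \<lambda>x\<in>?C. chi ds x a) \<circ> (\<lambda>y. lincomb ds r F (vec r y))) ?C (homs ?G complex_units)"
    by (rule bij_betw_cong) (simp add: chi_eq)
  also have "\<dots> \<longleftrightarrow> bij_betw (\<lambda>y. lincomb ds r F (vec r y)) ?C ?C"
    by (rule bij_betw_comp_iff2[symmetric, OF bij_chi_dual[OF ds]]) (use lc in blast)
  also have "\<dots> \<longleftrightarrow> (\<lambda>y. lincomb ds r F (vec r y)) ` ?C = ?C"
  proof
    assume "(\<lambda>y. lincomb ds r F (vec r y)) ` ?C = ?C"
    then show "bij_betw (\<lambda>y. lincomb ds r F (vec r y)) ?C ?C"
      using eq_card_imp_inj_on[OF cyc_prod_finite[OF ds], of "\<lambda>y. lincomb ds r F (vec r y)"] by (simp add: bij_betw_def)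
  qed (simp add: bij_betw_def)
  also have "\<dots> \<longleftrightarrow> generating ds r F"
  proof -
    \<comment> \<open>Dependence on residues only: by symmetry of the pairing \<open>w\<close> can
      be moved into the first argument of \<open>chi\<close>, where nothing else counts.\<close>
    have red: "lincomb ds r F w = lincomb ds r F (vec r (reduce ds (\<lambda>i. w $ i)))" if w: "w \<in> carrier_vec r" for w
    proof -
      have "lincomb ds r F (vec r (reduce ds (\<lambda>i. w $ i))) = reduce ds (vpair v (reduce ds (\<lambda>i. w $ i)))" by (rule lin[symmetric])
      have "chi ds x (lincomb ds r F w) = chi ds x (lincomb ds r F (vec r (reduce ds (\<lambda>i. w $ i))))" for x
      proof -
        have "vec r (\<lambda>i. w $ i) = w" using w by auto
        then have "chi ds x (lincomb ds r F w) = chi ds (\<lambda>i. w $ i) (vpair v x)" using lin[of "\<lambda>i. w $ i"] chi_vpair_sym chi_reduce_right[OF ds] by metis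
        also have "\<dots> = chi ds (reduce ds (\<lambda>i. w $ i)) (vpair v x)" by (simp add: chi_reduce[OF ds])
        also have "\<dots> = chi ds x (lincomb ds r F (vec r (reduce ds (\<lambda>i. w $ i))))" using lin chi_vpair_sym chi_reduce_right[OF ds] by metis
        finally show ?thesis .
      qed
      then have "(\<lambda>a. \<lambda>x\<in>?C. chi ds x a) (lincomb ds r F w) = (\<lambda>a. \<lambda>x\<in>?C. chi ds x a) (lincomb ds r F (vec r (reduce ds (\<lambda>i. w $ i))))" by simp
      then show ?thesis using bij_chi_dual[OF ds] lc by (meson bij_betw_imp_inj_on inj_onD)
    qed
    have im: "(\<lambda>y. lincomb ds r F (vec r y)) ` ?C = lincomb ds r F ` carrier_vec r"
    proof
      show "(\<lambda>y. lincomb ds r F (vec r y)) ` ?C \<subseteq> lincomb ds r F ` carrier_vec r" by (rule image_subsetI) simp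
      show "lincomb ds r F ` carrier_vec r \<subseteq> (\<lambda>y. lincomb ds r F (vec r y)) ` ?C"
      proof (rule image_subsetI)
        fix w :: "int vec" assume w: "w \<in> carrier_vec r"
        show "lincomb ds r F w \<in> (\<lambda>y. lincomb ds r F (vec r y)) ` ?C"
          by (rule image_eqI[where x = "reduce ds (\<lambda>i. w $ i)"]) (rule red[OF w], rule reduce_carrier[OF ds])
      qed
    qed
    have sub: "lincomb ds r F ` carrier_vec r \<subseteq> ?C" using lc by blast
    have gen: "generating ds r F \<longleftrightarrow> ?C \<subseteq> lincomb ds r F ` carrier_vec r"
      using PiE_mem[OF F] by (subst generating_iff_lincomb[OF ds]) (auto simp: subset_eq image_iff)
    show ?thesis unfolding im gen set_eq_subset using sub by (simp only: simp_thms)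
  qed
  also have "\<dots> \<longleftrightarrow> coprime (det (cm F)) (int p)" by (rule generating_iff_det[OF F])
  also have "\<dots> \<longleftrightarrow> coprime (det (umat p es v)) (int p)"
  proof (rule coprime_det_cong)
    fix j l assume jl: "j < r" "l < r"
    have "es ! l - min (es ! l) (es ! j) = max (es ! j) (es ! l) - es ! j" by (auto simp: max_def min_def)
    then have "int (p ^ (es ! l)) dvd cm F $$ (j, l) - umat p es v $$ (j, l)" using Fj[OF jl] jl by (simp add: umat_def upair_commute)
    moreover have "int p dvd int (p ^ (es ! l))" using e_bounds(1)[OF jl(2)] by simp
    ultimately show "int p dvd cm F $$ (j, l) - umat p es v $$ (j, l)" using dvd_trans by blast
  qed (simp_all add: umat_def)
  finally show ?thesis .
qed

abbreviation "ut \<equiv> unit_tuple ds"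
definition "mn ij = min (es ! fst ij) (es ! snd ij)"
definition "vspace = (\<Pi>\<^sub>E ij\<in>upper_pairs r. {0..<int (p ^ mn ij)})"

lemma mn_upair: "mn (upair i j) = min (es ! i) (es ! j)" by (cases "i \<le> j") (auto simp: mn_def upair_def max_def min_def)

lemma ut_carrier: "ut i \<in> cyc ds" by (rule unit_tuple_carrier[OF ds])

lemma pairing_of_units:
  assumes ij: "i < r" "j < r"
  shows "pairing_of v (ut i, ut j) = cis (2 * pi * (of_int (v (upair i j)) / of_nat (p ^ mn (upair i j))))"
proof -
  \<comment> \<open>Every modulus exceeds 1, so the residue of 1 is 1.\<close>
  have ut: "ut j l = of_bool (l = j)" if l: "l < r" for l
  proof -
    have "p ^ (es ! l) > 1" using p1 e_bounds(1)[OF l] by (intro one_less_power) auto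
    then have "1 < int (p ^ (es ! l))" by linarith
    then show ?thesis using l unfolding unit_tuple_def reduce_def by (auto simp: of_bool_def)
  qed
  let ?m = "min (es ! i) (es ! j)"
  have "vpair v (ut j) i = (\<Sum>l<r. if l = j then int (p ^ (es ! i - min (es ! i) (es ! l))) * v (upair i l) else 0)"
    unfolding vpair_def by (intro sum.cong refl) (simp add: ut)
  also have "\<dots> = int (p ^ (es ! i - ?m)) * v (upair i j)" using ij by simp
  finally have vp: "vpair v (ut j) i = int (p ^ (es ! i - ?m)) * v (upair i j)" .
  have "real p ^ (es ! i) = real p ^ (es ! i - ?m) * real p ^ ?m" by (simp flip: power_add)
  then have "of_int (vpair v (ut j) i) / real p ^ (es ! i) = of_int (v (upair i j)) / real p ^ ?m" unfolding vp using p1 by simp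
  then show ?thesis using ij unfolding pairing_of_apply[OF ut_carrier ut_carrier] mn_upair by (subst chi_unit_tuple[OF ds]) (simp_all only: length_map nth_map of_nat_power)
qed

lemma pairing_eqI:
  assumes b: "bilinear_pairing (cyc_prod ds) \<phi>" "bilinear_pairing (cyc_prod ds) \<psi>"
    and eq: "\<And>i j. i < r \<Longrightarrow> j < r \<Longrightarrow> \<phi> (ut i, ut j) = \<psi> (ut i, ut j)"
    and xy: "x \<in> cyc ds" "y \<in> cyc ds"
  shows "\<phi> (x, y) = \<psi> (x, y)"
proof -
  note cg = comm_group.axioms(2)[OF complex_units_group]
  have h1: "(\<lambda>y. \<phi> (x, y)) \<in> hom (cyc_prod ds) complex_units" "(\<lambda>x. \<phi> (x, y)) \<in> hom (cyc_prod ds) complex_units"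
    "(\<lambda>y. \<psi> (x, y)) \<in> hom (cyc_prod ds) complex_units" "(\<lambda>x. \<psi> (x, y)) \<in> hom (cyc_prod ds) complex_units"
    if "x \<in> cyc ds" "y \<in> cyc ds" for x y using b that by (simp_all add: bilinear_pairing_def)
  have "\<phi> (ut i, y) = \<psi> (ut i, y)" if i: "i < length ds" for i
    by (rule cyc_prod_hom_eqI[OF ds cg h1(1)[OF ut_carrier xy(2)] h1(3)[OF ut_carrier xy(2)] _ xy(2)]) (use eq i in simp)
  then show ?thesis by (rule cyc_prod_hom_eqI[OF ds cg h1(2)[OF xy] h1(4)[OF xy] _ xy(1)])
qed

lemma pairing_of_in: "pairing_of v \<in> cyc ds \<times> cyc ds \<rightarrow>\<^sub>E carrier complex_units" unfolding pairing_of_def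
proof (intro restrict_PiE_iff[THEN iffD2] ballI)
  fix xy assume "xy \<in> cyc ds \<times> cyc ds"
  then show "(case xy of (x, y) \<Rightarrow> chi ds x (vpair v y)) \<in> carrier complex_units" using hom_in_carrier[OF chi_hom[OF ds]] by auto
qed

lemma pairing_of_inj: "inj_on pairing_of vspace"
proof (rule inj_onI)
  fix v w assume vw: "v \<in> vspace" "w \<in> vspace" "pairing_of v = pairing_of w"
  show "v = w"
  proof (rule PiE_ext[OF vw(1)[unfolded vspace_def] vw(2)[unfolded vspace_def]])
    fix ij assume ij: "ij \<in> upper_pairs r"
    obtain i j where e: "ij = (i, j)" "i < r" "j < r" "upair i j = ij" using ij by (auto simp: upper_pairs_def upair_def)
    have P: "p ^ mn ij > 0" using p1 by simp
    have "pairing_of v (ut i, ut j) = pairing_of w (ut i, ut j)" using vw(3) by simp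
    then have "int (p ^ mn ij) dvd v ij - w ij" unfolding pairing_of_units[OF e(2,3)] e(4) cis_frac_eq_iff[OF P] .
    then have "v ij mod int (p ^ mn ij) = w ij mod int (p ^ mn ij)" by (simp only: mod_eq_dvd_iff)
    moreover have "v ij \<in> {0..<int (p ^ mn ij)}" "w ij \<in> {0..<int (p ^ mn ij)}"
      using PiE_mem[OF vw(1)[unfolded vspace_def] ij] PiE_mem[OF vw(2)[unfolded vspace_def] ij] .
    ultimately show "v ij = w ij" by simp
  qed
qed

text \<open>The value at a pair of unit tuples is killed by the orders of both, hence is a root of
  unity of order dividing the smaller one. These values determine the pairing.\<close>

lemma pairing_of_surj:
  assumes \<phi>: "\<phi> \<in> cyc ds \<times> cyc ds \<rightarrow>\<^sub>E carrier complex_units"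
    and s: "symmetric_pairing (cyc_prod ds) \<phi>" and b: "bilinear_pairing (cyc_prod ds) \<phi>"
  shows "\<exists>v\<in>vspace. \<phi> = pairing_of v"
proof -
  have pg: "group (cyc_prod ds)" using cyc_prod_group comm_group.axioms(2) by blast
  have up: "ut i [^]\<^bsub>cyc_prod ds\<^esub> (p ^ (es ! i)) = cyc_one ds" if "i < r" for i using unit_tuple_pow[OF ds, of i] that by simp
  have "\<exists>a\<in>{0..<int (p ^ mn ij)}. \<phi> (ut (fst ij), ut (snd ij)) = cis (2 * pi * (of_int a / of_nat (p ^ mn ij)))" if ij: "ij \<in> upper_pairs r" for ij
  proof (rule root_of_unity_cis)
    show "p ^ mn ij > 0" using p1 by simp
    obtain i j where e: "ij = (i, j)" "i < r" "j < r" using ij by (auto simp: upper_pairs_def)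
    have 1: "\<phi> (ut i, ut j) ^ (p ^ (es ! i)) = 1" using b ut_carrier by (intro hom_power_root[OF pg _ ut_carrier up[OF e(2)]]) (simp add: bilinear_pairing_def)
    have 2: "\<phi> (ut i, ut j) ^ (p ^ (es ! j)) = 1" using b ut_carrier by (intro hom_power_root[OF pg _ ut_carrier up[OF e(3)]]) (simp add: bilinear_pairing_def)
    show "\<phi> (ut (fst ij), ut (snd ij)) ^ (p ^ mn ij) = 1" using 1 2 by (simp add: e(1) mn_def min_def)
  qed
  then obtain a where a: "\<And>ij. ij \<in> upper_pairs r \<Longrightarrow> a ij \<in> {0..<int (p ^ mn ij)}"
    "\<And>ij. ij \<in> upper_pairs r \<Longrightarrow> \<phi> (ut (fst ij), ut (snd ij)) = cis (2 * pi * (of_int (a ij) / of_nat (p ^ mn ij)))" by metis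
  let ?v = "restrict a (upper_pairs r)"
  have "\<phi> (x, y) = pairing_of ?v (x, y)" if xy: "x \<in> cyc ds" "y \<in> cyc ds" for x y
  proof (rule pairing_eqI[OF b pairing_of_bilinear _ xy])
    fix i j assume ij: "i < r" "j < r"
    have "\<phi> (ut i, ut j) = \<phi> (ut (fst (upair i j)), ut (snd (upair i j)))"
      using s ut_carrier by (cases "i \<le> j") (auto simp: upair_def symmetric_pairing_def min_def max_def)
    then show "\<phi> (ut i, ut j) = pairing_of ?v (ut i, ut j)" unfolding pairing_of_units[OF ij] using a(2)[OF upair_in[OF ij]] upair_in[OF ij] by simp
  qed
  then have "\<phi> = pairing_of ?v" by (intro PiE_ext[OF \<phi> pairing_of_in]) auto
  moreover have "?v \<in> vspace" unfolding vspace_def using a(1) by (intro restrict_PiE_iff[THEN iffD2] ballI)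
  ultimately show ?thesis by blast
qed

lemma sym_perfect_pairings_eq:
  "sym_perfect_pairings (cyc_prod ds) = pairing_of ` {v \<in> vspace. coprime (det (umat p es v)) (int p)}"
proof
  show "sym_perfect_pairings (cyc_prod ds) \<subseteq> pairing_of ` {v \<in> vspace. coprime (det (umat p es v)) (int p)}"
  proof
    fix \<phi> assume "\<phi> \<in> sym_perfect_pairings (cyc_prod ds)"
    then have \<phi>: "\<phi> \<in> cyc ds \<times> cyc ds \<rightarrow>\<^sub>E carrier complex_units" "symmetric_pairing (cyc_prod ds) \<phi>"
      "bilinear_pairing (cyc_prod ds) \<phi>" "perfect_pairing (cyc_prod ds) \<phi>" by (simp_all add: sym_perfect_pairings_def)
    then obtain v where "v \<in> vspace" "\<phi> = pairing_of v" using pairing_of_surj by blast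
    then show "\<phi> \<in> pairing_of ` {v \<in> vspace. coprime (det (umat p es v)) (int p)}" using \<phi>(4) pairing_of_perfect_iff by simp
  qed
  show "pairing_of ` {v \<in> vspace. coprime (det (umat p es v)) (int p)} \<subseteq> sym_perfect_pairings (cyc_prod ds)"
    using pairing_of_in pairing_of_sym pairing_of_bilinear pairing_of_perfect_iff by (auto simp: sym_perfect_pairings_def)
qed

lemma finite_sym_perfect_pairings: "finite (sym_perfect_pairings (cyc_prod ds))"
  unfolding sym_perfect_pairings_eq vspace_def by (intro finite_imageI finite_subset[OF Collect_subset] finite_PiE finite_upper_pairs) simp

text \<open>The parameters range modulo \<open>p ^ min (es ! i) (es ! j)\<close>: off the diagonal
  these moduli multiply to \<open>alt_count ds\<close>, on it to the group order, and perfectness is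
  the condition modulo \<open>p\<close> counted by \<open>theta\<close>.\<close>

lemma card_sym_perfect_pairings:
  "card (sym_perfect_pairings (cyc_prod ds)) * p ^ card (upper_pairs r) = alt_count ds * cyc_order ds * theta p es"
proof -
  have m: "p ^ mn ij = p * p ^ (mn ij - 1)" if "ij \<in> upper_pairs r" for ij
  proof -
    have "mn ij \<ge> 1" using that e_bounds(1) by (auto simp: mn_def upper_pairs_def)
    then show ?thesis by (cases "mn ij") auto
  qed
  have vs: "vspace = (\<Pi>\<^sub>E ij\<in>upper_pairs r. {0..<int (p * p ^ (mn ij - 1))})" unfolding vspace_def using m by (intro PiE_cong) simp
  have "card (sym_perfect_pairings (cyc_prod ds)) = card {v \<in> vspace. coprime (det (umat p es v)) (int p)}"
    unfolding sym_perfect_pairings_eq by (intro card_image inj_on_subset[OF pairing_of_inj]) blast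
  also have "\<dots> = (\<Prod>ij\<in>upper_pairs r. p ^ (mn ij - 1)) * theta p es" unfolding vs using p1 by (intro card_theta) simp
  finally have "card (sym_perfect_pairings (cyc_prod ds)) * p ^ card (upper_pairs r)
      = ((\<Prod>ij\<in>upper_pairs r. p) * (\<Prod>ij\<in>upper_pairs r. p ^ (mn ij - 1))) * theta p es" by simp
  also have "(\<Prod>ij\<in>upper_pairs r. p) * (\<Prod>ij\<in>upper_pairs r. p ^ (mn ij - 1)) = (\<Prod>ij\<in>upper_pairs r. p ^ mn ij)"
    unfolding prod.distrib[symmetric] using m by (intro prod.cong) auto
  also have "\<dots> = alt_count ds * cyc_order ds"
    using prod_upper_pairs[of "\<lambda>ij. p ^ mn ij" ds] by (simp add: mn_def alt_count_pow cyc_order_def case_prod_unfold)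
  finally show ?thesis .
qed

end

section \<open>Transport of pairings along isomorphisms\<close>

lemma sym_perfect_pairings_transport:
  assumes H: "group H" and G: "group G" and f: "f \<in> iso H G" and \<phi>: "\<phi> \<in> sym_perfect_pairings G"
  shows "(\<lambda>(x, y)\<in>carrier H \<times> carrier H. \<phi> (f x, f y)) \<in> sym_perfect_pairings H"
proof -
  interpret H: group H by fact
  interpret G: group G by fact
  have fh: "f \<in> hom H G" and fb: "bij_betw f (carrier H) (carrier G)" using f by (auto simp: iso_def)
  have fc: "f x \<in> carrier G" if "x \<in> carrier H" for x using fh that by (rule hom_in_carrier)
  have \<phi>1: "\<phi> \<in> carrier G \<times> carrier G \<rightarrow>\<^sub>E carrier complex_units" and \<phi>2: "symmetric_pairing G \<phi>"
    and \<phi>3: "bilinear_pairing G \<phi>" and \<phi>4: "perfect_pairing G \<phi>" using \<phi> by (simp_all add: sym_perfect_pairings_def)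
  let ?\<psi> = "\<lambda>(x, y)\<in>carrier H \<times> carrier H. \<phi> (f x, f y)"
  have ap: "?\<psi> (x, y) = \<phi> (f x, f y)" if "x \<in> carrier H" "y \<in> carrier H" for x y using that by simp
  have 1: "?\<psi> \<in> carrier H \<times> carrier H \<rightarrow>\<^sub>E carrier complex_units"
    using PiE_mem[OF \<phi>1] fc by (intro restrict_PiE_iff[THEN iffD2] ballI) auto
  have 2: "symmetric_pairing H ?\<psi>" using \<phi>2 fc by (simp add: symmetric_pairing_def)
  have comp: "(\<lambda>x. h (f x)) \<in> hom H complex_units" if "h \<in> hom G complex_units" for h using hom_compose[OF fh that] by (simp add: comp_def)
  have cong: "h \<in> hom H complex_units" if "h' \<in> hom H complex_units" "\<And>x. x \<in> carrier H \<Longrightarrow> h x = h' x" for h h'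
  proof (rule homI)
    fix x y assume x: "x \<in> carrier H"
    show "h x \<in> carrier complex_units" unfolding that(2)[OF x] by (rule hom_in_carrier[OF that(1) x])
    assume y: "y \<in> carrier H"
    show "h (x \<otimes>\<^bsub>H\<^esub> y) = h x \<otimes>\<^bsub>complex_units\<^esub> h y"
      unfolding that(2)[OF x] that(2)[OF y] that(2)[OF H.m_closed[OF x y]] by (rule hom_mult[OF that(1) x y])
  qed
  have 3: "bilinear_pairing H ?\<psi>" unfolding bilinear_pairing_def
  proof (intro conjI ballI)
    fix x assume x: "x \<in> carrier H"
    have "(\<lambda>y. \<phi> (f x, y)) \<in> hom G complex_units" using \<phi>3 fc[OF x] by (simp add: bilinear_pairing_def)
    from cong[OF comp[OF this] ap[OF x]] show "(\<lambda>y. ?\<psi> (x, y)) \<in> hom H complex_units" .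
    have "(\<lambda>y. \<phi> (y, f x)) \<in> hom G complex_units" using \<phi>3 fc[OF x] by (simp add: bilinear_pairing_def)
    from cong[OF comp[OF this] ap[OF _ x]] show "(\<lambda>y. ?\<psi> (y, x)) \<in> hom H complex_units" .
  qed
  let ?T = "\<lambda>k. \<lambda>x\<in>carrier H. k (f x)" and ?g = "\<lambda>y. \<lambda>x\<in>carrier G. \<phi> (x, y)"
  have "bij_betw ?g (carrier G) (homs G complex_units)" using perfect_pairing_iff[OF G \<phi>3 \<phi>2] \<phi>4 by blast
  from bij_betw_trans[OF bij_betw_trans[OF fb this] bij_precompose(1)[OF f H G]]
  have "bij_betw (?T \<circ> (?g \<circ> f)) (carrier H) (homs H complex_units)" .
  moreover have "(?T \<circ> (?g \<circ> f)) y = (\<lambda>x\<in>carrier H. ?\<psi> (x, y))" if y: "y \<in> carrier H" for y using fc y by (auto simp: fun_eq_iff)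
  ultimately have "bij_betw (\<lambda>y. \<lambda>x\<in>carrier H. ?\<psi> (x, y)) (carrier H) (homs H complex_units)"
    using bij_betw_cong[of "carrier H" "?T \<circ> (?g \<circ> f)" "\<lambda>y. \<lambda>x\<in>carrier H. ?\<psi> (x, y)"] by blast
  then have "perfect_pairing H ?\<psi>" using perfect_pairing_iff[OF H 3 2] by blast
  then show ?thesis unfolding sym_perfect_pairings_def using 1 2 3 by blast
qed

lemma sym_perfect_pairings_transport_inj:
  assumes f: "f \<in> iso H G"
  shows "inj_on (\<lambda>\<phi>. \<lambda>(x, y)\<in>carrier H \<times> carrier H. \<phi> (f x, f y)) (sym_perfect_pairings G)"
proof (rule inj_onI)
  fix \<phi> \<psi> assume a: "\<phi> \<in> sym_perfect_pairings G" "\<psi> \<in> sym_perfect_pairings G"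
    "(\<lambda>(x, y)\<in>carrier H \<times> carrier H. \<phi> (f x, f y)) = (\<lambda>(x, y)\<in>carrier H \<times> carrier H. \<psi> (f x, f y))"
  have P: "\<phi> \<in> carrier G \<times> carrier G \<rightarrow>\<^sub>E carrier complex_units" "\<psi> \<in> carrier G \<times> carrier G \<rightarrow>\<^sub>E carrier complex_units"
    using a(1,2) by (simp_all add: sym_perfect_pairings_def)
  show "\<phi> = \<psi>"
  proof (rule PiE_ext[OF P])
    fix ab assume ab: "ab \<in> carrier G \<times> carrier G"
    have sur: "f ` carrier H = carrier G" using f by (simp add: iso_def bij_betw_def)
    obtain x y where "x \<in> carrier H" "y \<in> carrier H" "ab = (f x, f y)" using ab unfolding sur[symmetric] by blast
    then show "\<phi> ab = \<psi> ab" using fun_cong[OF a(3), of "(x, y)"] by simp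
  qed
qed

lemma card_sym_perfect_pairings_iso:
  assumes H: "group H" and G: "group G" and iso: "H \<cong> G" and fin: "finite (sym_perfect_pairings G)"
  shows "card (sym_perfect_pairings H) = card (sym_perfect_pairings G)"
proof -
  obtain f where f: "f \<in> iso H G" using iso unfolding is_iso_def by blast
  obtain g where g: "g \<in> iso G H" using group.iso_sym[OF H iso] unfolding is_iso_def by blast
  let ?f = "\<lambda>\<phi>. \<lambda>(x, y)\<in>carrier H \<times> carrier H. \<phi> (f x, f y)" and ?g = "\<lambda>\<phi>. \<lambda>(x, y)\<in>carrier G \<times> carrier G. \<phi> (g x, g y)"
  note fi = sym_perfect_pairings_transport_inj[OF f] and gi = sym_perfect_pairings_transport_inj[OF g]
  have fs: "?f ` sym_perfect_pairings G \<subseteq> sym_perfect_pairings H" by (rule image_subsetI) (rule sym_perfect_pairings_transport[OF H G f])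
  have gs: "?g ` sym_perfect_pairings H \<subseteq> sym_perfect_pairings G" by (rule image_subsetI) (rule sym_perfect_pairings_transport[OF G H g])
  have "finite (sym_perfect_pairings H)" by (rule inj_on_finite[OF gi gs fin])
  then show ?thesis by (intro card_bij_eq[OF gi gs fi fs _ fin])
qed

section \<open>The limit law\<close>

lemma card_auto_iso:
  assumes H: "group H" and G: "group G" and iso: "H \<cong> G" and fin: "finite (carrier H)" "finite (carrier G)"
  shows "card (auto H) = card (auto G)"
proof -
  have "card (epis H H) = card (epis G H)" by (rule card_epis_iso[OF iso H G])
  also have "\<dots> = card (epis G G)" by (rule card_epis_iso_cod[OF iso H G])
  finally show ?thesis using epis_self fin by metis
qed

text \<open>Two counts of the surjections onto Z/p are compared: p^r - 1 from the matrix and p^R - 1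
  from the rank R.\<close>

lemma (in sandpile_prob) length_tau_model:
  assumes M: "M \<in> sym_model.\<M> p k r"
  shows "length (tau M) = r"
proof -
  interpret S: sym_model p k r by unfold_locales (rule p, rule k)
  have "real (card (epis (mcok (p ^ k) M) (pgrp p ([] @ replicate 1 1)))) =
     real (card (epis (mcok (p ^ k) M) (pgrp p []))) * (\<Prod>j<1. real p ^ length (tau M) - real p ^ (length ([] :: nat list) + j))"
    by (rule card_epis_append_ones[OF mcok_group mfin p card_homs_mcok]) simp
  then have "real (p ^ r - 1) = real p ^ length (tau M) - 1" using S.card_epis_M_one[OF M] S.card_epis_M_trivial[OF M] by simp
  then have "real (p ^ r) = real (p ^ length (tau M))" using p1 by (simp add: of_nat_diff)
  then show ?thesis using p1 by (simp only: of_nat_eq_iff power_inject_exp)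
qed

lemma (in sandpile_prob) prob_mcok_limit:
  assumes es: "set es \<subseteq> {1..<k}"
  shows "(\<lambda>n. ex n (\<lambda>E. of_bool (Mc n E \<cong> pgrp p es))) \<longlonglongrightarrow>
    real (card (sym_perfect_pairings (pgrp p es))) / (real (card (carrier (pgrp p es))) * real (card (auto (pgrp p es)))) * eta"
proof -
  let ?r = "length es" let ?ds = "pows p es"
  have es1: "set es \<subseteq> {1..k}" using es by auto
  interpret S: sym_model_type p k es by unfold_locales (rule p, rule k, rule es1)
  have lim: "(\<lambda>n. ex n (\<lambda>E. of_bool (Mc n E \<cong> pgrp p es))) \<longlonglongrightarrow> eta / S.model_weight * real (card {M \<in> S.\<M>. mcok (p ^ k) M \<cong> pgrp p es})"
  proof (rule prob_limit_of_model[OF S.finite_M _ S.model_weight_pos _ es1 refl])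
    show "length (tau M) = ?r" if "M \<in> S.\<M>" for M using length_tau_model[OF that] .
    fix es' assume es': "set es' \<subseteq> {1..k}" "length es' = ?r"
    interpret T: sym_model_type p k es' by unfold_locales (rule es'(1))
    have "T.model_weight = S.model_weight" unfolding T.model_weight_def S.model_weight_def es'(2) ..
    then show "(\<Sum>M\<in>S.\<M>. real (card (epis (mcok (p ^ k) M) (pgrp p es')))) = S.model_weight * real (alt_count (pows p es'))"
      using T.sum_card_epis T.model_total unfolding es'(2) by (simp flip: of_nat_sum)
  qed
  \<comment> \<open>Both counts below contain \<open>b * t\<close> and \<open>u\<close>:
    \<open>1\<close> for the model matrices with this cokernel, \<open>2\<close> for the perfect
    pairings. Eliminating them leaves \<open>I / w = s / (g * a)\<close>.\<close>
  define a where "a = real (card (auto (pgrp p es)))"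
  define u where "u = real p ^ card (upper_pairs ?r)"
  define w where "w = S.model_weight"
  define I where "I = real (card {M \<in> S.\<M>. mcok (p ^ k) M \<cong> pgrp p es})"
  define b where "b = real (alt_count ?ds)"
  define t where "t = real (theta p es)"
  define s where "s = real (card (sym_perfect_pairings (pgrp p es)))"
  define g where "g = real (cyc_order ?ds)"
  have up: "u > 0" using p1 by (simp add: u_def)
  have wp: "w > 0" using S.model_weight_pos by (simp add: w_def)
  have gp: "g > 0" using cyc_order_pos[OF S.ds] by (simp add: g_def)
  have "(\<lambda>x\<in>carrier (pgrp p es). x) \<in> epis (pgrp p es) (pgrp p es)" using group.is_monoid[OF pg(1)] by (auto simp: epis_def hom_def monoid.m_closed)
  then have "card (epis (pgrp p es) (pgrp p es)) > 0" using finite_epis[OF pfin pfin] by (auto simp: card_gt_0_iff)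
  then have ap: "a > 0" using epis_self[OF pfin] by (simp add: a_def)
  have "es ! i < k" if "i < ?r" for i using es nth_mem[OF that] by auto
  then have 1: "I * a * u = w * b * t" unfolding I_def a_def u_def w_def b_def t_def by (rule S.model_iso_count)
  have 2: "s * u = b * g * t" unfolding s_def u_def b_def g_def t_def using S.card_sym_perfect_pairings by (simp only: flip: of_nat_mult of_nat_power)
  have "I = w * (b * t) / (a * u)" using 1 ap up by (simp add: field_simps)
  moreover have "b * t = s * u / g" using 2 gp by (simp add: field_simps)
  ultimately have "eta / w * I = s / (g * a) * eta" using wp ap up gp by simp
  then show ?thesis using lim cyc_prod_card[OF S.ds] unfolding w_def I_def s_def g_def a_def by simp
qed

text \<open>\<open>x * (1 - x)\<close> is smallest at the ends of the interval, with value
  \<open>\<alpha> n * (1 - \<alpha> n)\<close>. As \<open>\<alpha>\<close> tends to 0, the factor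
  \<open>1 - \<alpha> n\<close> eventually exceeds \<open>(1 + c) / (2 * c)\<close>, and the
  constant \<open>(1 + c) / 2\<close>, still above 1, remains.\<close>

lemma er_range_bounds:
  fixes c :: real and \<alpha> \<beta> :: "nat \<Rightarrow> real"
  assumes c: "c > 1" and \<alpha>: "\<And>n. \<alpha> n = c * ln (real n) / real n"
    and \<beta>: "\<And>n. n \<ge> 1 \<Longrightarrow> \<alpha> n \<le> 1 / 2 \<Longrightarrow> \<beta> n \<in> {\<alpha> n .. 1 - \<alpha> n}"
  shows "eventually (\<lambda>n. (1 + c) / 2 * ln n \<le> real n * (\<beta> n * (1 - \<beta> n))) sequentially"
    and "eventually (\<lambda>n. 0 \<le> \<beta> n \<and> \<beta> n \<le> 1) sequentially"
proof -
  have "(\<lambda>n::nat. c * ln (real n) / real n) \<longlonglongrightarrow> 0" by real_asymp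
  moreover have "\<alpha> = (\<lambda>n. c * ln (real n) / real n)" using \<alpha> by (intro ext)
  ultimately have lim: "\<alpha> \<longlonglongrightarrow> 0" by (simp only:)
  have e1: "eventually (\<lambda>n. \<alpha> n < 1 / 2) sequentially" by (rule order_tendstoD(2)[OF lim]) simp
  have e2: "eventually (\<lambda>n. \<alpha> n < (c - 1) / (2 * c)) sequentially" by (rule order_tendstoD(2)[OF lim]) (use c in simp)
  show "eventually (\<lambda>n. 0 \<le> \<beta> n \<and> \<beta> n \<le> 1) sequentially" using e1 eventually_ge_at_top[of 1]
  proof eventually_elim
    case (elim n)
    have "\<alpha> n \<ge> 0" using elim c by (simp add: \<alpha>)
    then show ?case using \<beta>[of n] elim by auto
  qed
  show "eventually (\<lambda>n. (1 + c) / 2 * ln n \<le> real n * (\<beta> n * (1 - \<beta> n))) sequentially" using e1 e2 eventually_ge_at_top[of 1]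
  proof eventually_elim
    case (elim n)
    have b: "\<alpha> n \<le> \<beta> n" "\<beta> n \<le> 1 - \<alpha> n" using \<beta>[of n] elim by auto
    have "(\<beta> n - \<alpha> n) * (1 - \<alpha> n - \<beta> n) \<ge> 0" using b by (intro mult_nonneg_nonneg) auto
    then have 1: "\<alpha> n * (1 - \<alpha> n) \<le> \<beta> n * (1 - \<beta> n)" by (simp add: algebra_simps)
    have na: "real n * \<alpha> n = c * ln n" using elim by (simp add: \<alpha>)
    have "1 - \<alpha> n \<ge> (1 + c) / (2 * c)" using elim(2) c by (simp add: field_simps)
    then have "c * ln n * ((1 + c) / (2 * c)) \<le> c * ln n * (1 - \<alpha> n)" using elim c by (intro mult_left_mono) auto
    moreover have "c * ln n * ((1 + c) / (2 * c)) = (1 + c) / 2 * ln n" using c by (simp add: field_simps)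
    moreover have "c * ln n * (1 - \<alpha> n) = real n * (\<alpha> n * (1 - \<alpha> n))" unfolding na[symmetric] by simp
    moreover have "real n * (\<alpha> n * (1 - \<alpha> n)) \<le> real n * (\<beta> n * (1 - \<beta> n))" using 1 by (intro mult_left_mono) auto
    ultimately show ?case by linarith
  qed
qed

theorem theorem1p7:
  fixes p :: nat
    and c :: real
    and \<alpha> \<beta> :: "nat \<Rightarrow> real"
    and H :: "('h, 'm) monoid_scheme"
  assumes "Factorial_Ring.prime p"
    and "c > 1"
    and "\<And>n. \<alpha> n = c * ln (real n) / real n"
    and "\<And>n. n \<ge> 1 \<Longrightarrow> \<alpha> n \<le> 1 / 2 \<Longrightarrow> \<beta> n \<in> {\<alpha> n .. 1 - \<alpha> n}"
    and "finite_abelian_p_group p H"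
  shows "(\<lambda>n. measure_pmf.prob (erdos_renyi n (\<beta> n))
            {E. sylow_part p (sandpile_group n E) \<cong> H})
         \<longlonglongrightarrow>
         real (card (sym_perfect_pairings H)) / (real (Coset.order H) * real (card (auto H))) *
         prodinf (\<lambda>i. 1 - real p powi (1 - 2 * int (Suc i)))"
proof -
  obtain m where H: "comm_group H" "finite (carrier H)" "Coset.order H = p ^ m" using assms(5) by (auto simp: finite_abelian_p_group_def)
  interpret H: comm_group H by (rule H(1))
  have kill: "x [^]\<^bsub>H\<^esub> (p ^ m) = \<one>\<^bsub>H\<^esub>" if "x \<in> carrier H" for x using H.pow_order_eq_1[OF that] H(3) by simp
  obtain es where es: "set es \<subseteq> {1..m}" "pgrp p es \<cong> H" using finite_abelian_p_group_structure[OF H(1,2) assms(1)] kill by blast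
  let ?G = "pgrp p es"
  \<comment> \<open>\<open>Suc m\<close>, since both \<open>sylow_iff_mcok\<close> and the strict
    bound in \<open>prob_mcok_limit\<close> ask for one power of \<open>p\<close> beyond the bound
    \<open>p ^ m\<close> on the exponent of \<open>H\<close>.\<close>
  interpret P: sandpile_prob p "Suc m" \<beta> "(1 + c) / 2" using assms(1,2) er_range_bounds[OF assms(2-4)] by unfold_locales auto
  have HG: "H \<cong> ?G" by (rule group.iso_sym[OF P.pg(1) es(2)])
  have es': "set es \<subseteq> {1..<Suc m}" using es(1) by auto
  interpret S: sym_model_type p "Suc m" es using es(1) by unfold_locales (auto simp: assms(1))
  have order: "card (carrier ?G) = Coset.order H"
  proof -
    obtain f where "f \<in> iso ?G H" using es(2) unfolding is_iso_def by blast
    then show ?thesis unfolding Coset.order_def by (intro bij_betw_same_card[of f]) (simp add: iso_def)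
  qed
  have pairs: "card (sym_perfect_pairings H) = card (sym_perfect_pairings ?G)"
    by (rule card_sym_perfect_pairings_iso[OF H.is_group P.pg(1) HG S.finite_sym_perfect_pairings])
  have auts: "card (auto H) = card (auto ?G)" by (rule card_auto_iso[OF H.is_group P.pg(1) HG H(2) P.pfin])
  let ?L = "real (card (sym_perfect_pairings H)) / (real (Coset.order H) * real (card (auto H))) * P.eta"
  let ?a = "\<lambda>n E. of_bool (sylow_part p (sandpile_group n E) \<cong> H) :: real"
  let ?b = "\<lambda>n E. of_bool (P.Mc n E \<cong> ?G) :: real"
  let ?d = "\<lambda>n E. of_bool (det (reduced_laplacian n E) = 0) :: real"
  have lim: "(\<lambda>n. P.ex n (?b n)) \<longlonglongrightarrow> ?L" using P.prob_mcok_limit[OF es'] unfolding order pairs auts .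
  \<comment> \<open>Off the singular event the two indicators coincide; on it they differ by at most
    1. The error is thus bounded by a probability that tends to 0.\<close>
  have close: "\<bar>?a n E - ?b n E\<bar> \<le> ?d n E" for n E
  proof (cases "det (reduced_laplacian n E) = 0")
    case False
    interpret sylow_setup "reduced_laplacian n E" "n - 1" p by unfold_locales (rule reduced_laplacian_carrier, rule False, rule assms(1))
    have "sylow_part p (sandpile_group n E) \<cong> H \<longleftrightarrow> P.Mc n E \<cong> H" unfolding sandpile_group_def by (rule sylow_iff_mcok[OF H.is_group kill])
    also have "\<dots> \<longleftrightarrow> P.Mc n E \<cong> ?G" using iso_trans[OF _ HG] iso_trans[OF _ es(2)] by (intro iffI)
    finally show ?thesis by simp
  qed (auto simp: of_bool_def)
  have "(\<lambda>n. P.ex n (?a n) - P.ex n (?b n)) \<longlonglongrightarrow> 0"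
  proof (rule Lim_null_comparison[OF always_eventually P.prob_singular_tendsto_0], rule allI)
    fix n
    have "P.ex n (?a n) - P.ex n (?b n) = P.ex n (\<lambda>E. ?a n E - ?b n E)" by (rule Bochner_Integration.integral_diff[symmetric]) (rule integrable_erdos_renyi)+
    also have "norm \<dots> \<le> P.ex n (\<lambda>E. norm (?a n E - ?b n E))" by (rule integral_norm_bound)
    also have "\<dots> \<le> P.ex n (?d n)" by (rule erdos_renyi_expectation_mono) (simp only: real_norm_def close)
    finally show "norm (P.ex n (?a n) - P.ex n (?b n)) \<le> P.ex n (?d n)" .
  qed
  from tendsto_add[OF this lim] have "(\<lambda>n. P.ex n (?a n)) \<longlonglongrightarrow> ?L" by simp
  moreover have "P.ex n (?a n) = measure_pmf.prob (erdos_renyi n (\<beta> n)) {E. sylow_part p (sandpile_group n E) \<cong> H}" for n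
  proof -
    have "?a n = indicat_real {E. sylow_part p (sandpile_group n E) \<cong> H}" by (auto simp: indicator_def fun_eq_iff)
    then show ?thesis by simp
  qed
  ultimately show ?thesis by simp
qed

end
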